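(* Let $f$ be a non-degenerate, centered, normalized, continuous, stationary Gaussian field on $\mathbb{R}^2$ with covariance function $\kappa$. Suppose that $\kappa$ takes only non-negative values and that $f$ is invariant (in law) by $\frac{\pi}{2}$-rotation and by reflection through the horizontal axis. Suppose also that the Fourier transform of $\kappa$ takes only positive values, that $\kappa$ is $C^3$, and that there exist $\alpha>5$ and $C<+\infty$ such that for every $\beta\in\mathbb{N}^2$ with $\beta_1+\beta_2\leq 3$ and every $x$, $|\partial^\beta\kappa(x)|\leq C|x|^{-\alpha}$. Then, for each $\varepsilon\in\,]0,1]$, the critical threshold of the discrete percolation model on $\mathcal{T}^\varepsilon$ is $0$. More precisely: the probability that there is an unbounded black connected component (in the model with parameter $p\in\mathbb{R}$) is $1$ if $p>0$, and $0$ otherwise. Moreover, if it exists, such a component is a.s. unique. In particular, this result holds when $f$ is the Bargmann-Fock field (that is, $\kappa(x)=\exp(-\frac12|x|^2)$) or the centered Gaussian field with covariance given by $\kappa(x_1,x_2)=\Big(\frac{1}{(1+x_1^2)(1+x_2^2)}\Big)^n$ with $n\geq 3$ an integer.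
   Context: Field: non-degenerate means that for any pairwise distinct $x_1,\dots,x_k\in\mathbb{R}^2$ the covariance matrix of $(f(x_1),\dots,f(x_k))$ is invertible; normalized means $\mathrm{Var}(f(x))=1$ for every $x$. By stationarity, $\mathbb{E}[f(x)f(y)]=\kappa(x-y)$ for a function $\kappa:\mathbb{R}^2\to[-1,1]$ with $\kappa(0)=1$, called the covariance function. Lattice: $\mathcal{T}=(\mathcal{V},\mathcal{E})$ is the face-centered square lattice, i.e. the planar triangulation with vertex set $\mathcal{V}=\mathbb{Z}^2\cup(\mathbb{Z}^2+(\frac12,\frac12))$ whose edges are the straight segments joining nearest neighbours of $\mathbb{Z}^2$ and the segments joining the center of each unit square of the $\mathbb{Z}^2$-lattice to its four corners. $\mathcal{T}^\varepsilon=(\mathcal{V}^\varepsilon,\mathcal{E}^\varepsilon)$ is $\mathcal{T}$ scaled by $\varepsilon$. Discrete percolation model with parameter $p$: a point $x\in\mathbb{R}^2$ is colored black if either $x\in\mathcal{V}^\varepsilon$ and $f(x)\geq -p$, or $x$ belongs to an edge of $\mathcal{E}^\varepsilon$ whose two extremities $y_1,y_2$ satisfy $f(y_1)\geq -p$ and $f(y_2)\geq -p$. Otherwise $x$ is colored white. Black connected components are the connected components of the set of black points. *)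

theory Defs
  imports "HOL-Probability.Probability" "Jordan_Normal_Form.Matrix"
begin

no_notation vec_index (infixl "$" 100)

type_synonym 'w field = "real^2 \<Rightarrow> 'w \<Rightarrow> real"

text \<open>Degenerate (almost surely constant) Gaussian variables are allowed.\<close>

definition gaussian_variable :: "'w measure \<Rightarrow> ('w \<Rightarrow> real) \<Rightarrow> bool" where
  "gaussian_variable M X \<longleftrightarrow> X \<in> borel_measurable M \<and>
     ((\<exists>\<mu>. AE \<omega> in M. X \<omega> = \<mu>) \<or>
      (\<exists>\<mu> \<sigma>. \<sigma> > 0 \<and> distributed M lborel X (normal_density \<mu> \<sigma>)))"

definition covariance :: "'w measure \<Rightarrow> ('w \<Rightarrow> real) \<Rightarrow> ('w \<Rightarrow> real) \<Rightarrow> real" where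
  "covariance M X Y =
     (LINT \<omega>|M. (X \<omega> - (LINT \<omega>'|M. X \<omega>')) * (Y \<omega> - (LINT \<omega>'|M. Y \<omega>')))"

locale gaussian_field = prob_space M for M :: "'w measure" +
  fixes f :: "'w field"
  assumes gaussian_combination:
    "\<And>S a. finite S \<Longrightarrow> gaussian_variable M (\<lambda>\<omega>. \<Sum>x\<in>S. a x * f x \<omega>)"

definition centered :: "'w measure \<Rightarrow> 'w field \<Rightarrow> bool" where
  "centered M f \<longleftrightarrow> (\<forall>x. (LINT \<omega>|M. f x \<omega>) = 0)"

definition normalized :: "'w measure \<Rightarrow> 'w field \<Rightarrow> bool" where
  "normalized M f \<longleftrightarrow> (\<forall>x. prob_space.variance M (f x) = 1)"

definition nondegenerate :: "'w measure \<Rightarrow> 'w field \<Rightarrow> bool" where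
  "nondegenerate M f \<longleftrightarrow>
     (\<forall>xs. distinct xs \<longrightarrow>
        invertible_mat (Matrix.mat (length xs) (length xs)
          (\<lambda>(i, j). covariance M (f (xs ! i)) (f (xs ! j)))))"

definition continuous_field :: "'w measure \<Rightarrow> 'w field \<Rightarrow> bool" where
  "continuous_field M f \<longleftrightarrow> (AE \<omega> in M. continuous_on UNIV (\<lambda>x. f x \<omega>))"

definition field_law :: "'w measure \<Rightarrow> 'w field \<Rightarrow> (real^2 \<Rightarrow> real) measure" where
  "field_law M f = distr M (\<Pi>\<^sub>M x\<in>UNIV. borel) (\<lambda>\<omega> x. f x \<omega>)"

definition law_invariant :: "'w measure \<Rightarrow> 'w field \<Rightarrow> (real^2 \<Rightarrow> real^2) \<Rightarrow> bool" where
  "law_invariant M f T \<longleftrightarrow> field_law M (\<lambda>x. f (T x)) = field_law M f"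

definition stationary :: "'w measure \<Rightarrow> 'w field \<Rightarrow> bool" where
  "stationary M f \<longleftrightarrow> (\<forall>v. law_invariant M f (\<lambda>x. x + v))"

definition rotation_quarter :: "real^2 \<Rightarrow> real^2" where
  "rotation_quarter x = vector [- (x $ 2), x $ 1]"

definition reflection_horizontal :: "real^2 \<Rightarrow> real^2" where
  "reflection_horizontal x = vector [x $ 1, - (x $ 2)]"

definition covariance_function :: "'w measure \<Rightarrow> 'w field \<Rightarrow> (real^2 \<Rightarrow> real) \<Rightarrow> bool" where
  "covariance_function M f \<kappa> \<longleftrightarrow> (\<forall>x y. (LINT \<omega>|M. f x \<omega> * f y \<omega>) = \<kappa> (x - y))"

definition partial_deriv :: "2 \<Rightarrow> (real^2 \<Rightarrow> real) \<Rightarrow> real^2 \<Rightarrow> real" where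
  "partial_deriv i g x = deriv (\<lambda>t. g (x + t *\<^sub>R axis i 1)) 0"

primrec C_k :: "nat \<Rightarrow> (real^2 \<Rightarrow> real) \<Rightarrow> bool" where
  "C_k 0 g \<longleftrightarrow> continuous_on UNIV g"
| "C_k (Suc k) g \<longleftrightarrow> continuous_on UNIV g \<and>
     (\<forall>i x. (\<lambda>t::real. g (x + t *\<^sub>R axis i 1)) differentiable (at 0)) \<and>
     (\<forall>i. C_k k (partial_deriv i g))"

definition multi_deriv :: "nat \<Rightarrow> nat \<Rightarrow> (real^2 \<Rightarrow> real) \<Rightarrow> real^2 \<Rightarrow> real" where
  "multi_deriv \<beta>\<^sub>1 \<beta>\<^sub>2 g = (partial_deriv 1 ^^ \<beta>\<^sub>1) ((partial_deriv 2 ^^ \<beta>\<^sub>2) g)"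

text \<open>
  The origin is excluded because the bound is void there (its right-hand side is infinite),
  whereas \<open>0 powr a = 0\<close>.
\<close>

definition derivs_decay :: "(real^2 \<Rightarrow> real) \<Rightarrow> bool" where
  "derivs_decay \<kappa> \<longleftrightarrow>
     (\<exists>\<alpha> C. \<alpha> > 5 \<and>
        (\<forall>\<beta>\<^sub>1 \<beta>\<^sub>2 x. \<beta>\<^sub>1 + \<beta>\<^sub>2 \<le> 3 \<longrightarrow> x \<noteq> 0 \<longrightarrow>
           \<bar>multi_deriv \<beta>\<^sub>1 \<beta>\<^sub>2 \<kappa> x\<bar> \<le> C * norm x powr (- \<alpha>)))"

definition fourier_transform :: "(real^2 \<Rightarrow> real) \<Rightarrow> real^2 \<Rightarrow> complex" where
  "fourier_transform g \<xi> = (LINT x|lborel. cis (- (x \<bullet> \<xi>)) * complex_of_real (g x))"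

definition fourier_positive :: "(real^2 \<Rightarrow> real) \<Rightarrow> bool" where
  "fourier_positive g \<longleftrightarrow>
     (\<forall>\<xi>. \<exists>r. r > 0 \<and> fourier_transform g \<xi> = complex_of_real r)"

definition bargmann_fock_covariance :: "real^2 \<Rightarrow> real" where
  "bargmann_fock_covariance x = exp (- (norm x)\<^sup>2 / 2)"

definition rational_covariance :: "nat \<Rightarrow> real^2 \<Rightarrow> real" where
  "rational_covariance n x = (1 / ((1 + (x $ 1)\<^sup>2) * (1 + (x $ 2)\<^sup>2))) ^ n"

definition integer_points :: "(real^2) set" where
  "integer_points = {x. x $ 1 \<in> \<int> \<and> x $ 2 \<in> \<int>}"

definition lattice_vertices :: "(real^2) set" where
  "lattice_vertices = integer_points \<union> (\<lambda>z. z + vector [1/2, 1/2]) ` integer_points"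

text \<open>An edge is given by a pair of end points; each edge is listed in at least one direction.\<close>

definition lattice_edges :: "((real^2) \<times> (real^2)) set" where
  "lattice_edges =
     {(x, y). x \<in> integer_points \<and> y \<in> integer_points \<and> dist x y = 1} \<union>
     {(z + vector [1/2, 1/2], z + w) | z w. z \<in> integer_points \<and>
        w \<in> {vector [0, 0], vector [1, 0], vector [0, 1], vector [1, 1]}}"

definition scaled_vertices :: "real \<Rightarrow> (real^2) set" where
  "scaled_vertices \<epsilon> = (\<lambda>x. \<epsilon> *\<^sub>R x) ` lattice_vertices"

definition scaled_edges :: "real \<Rightarrow> ((real^2) \<times> (real^2)) set" where
  "scaled_edges \<epsilon> = (\<lambda>(x, y). (\<epsilon> *\<^sub>R x, \<epsilon> *\<^sub>R y)) ` lattice_edges"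

definition black_points :: "real \<Rightarrow> real \<Rightarrow> (real^2 \<Rightarrow> real) \<Rightarrow> (real^2) set" where
  "black_points \<epsilon> p g =
     {x \<in> scaled_vertices \<epsilon>. g x \<ge> - p} \<union>
     {x. \<exists>(y\<^sub>1, y\<^sub>2) \<in> scaled_edges \<epsilon>.
           x \<in> closed_segment y\<^sub>1 y\<^sub>2 \<and> g y\<^sub>1 \<ge> - p \<and> g y\<^sub>2 \<ge> - p}"

definition unbounded_black_components ::
    "real \<Rightarrow> real \<Rightarrow> (real^2 \<Rightarrow> real) \<Rightarrow> (real^2) set set" where
  "unbounded_black_components \<epsilon> p g = {C \<in> components (black_points \<epsilon> p g). \<not> bounded C}"

definition percolation_event :: "'w measure \<Rightarrow> 'w field \<Rightarrow> real \<Rightarrow> real \<Rightarrow> 'w set" where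
  "percolation_event M f \<epsilon> p =
     {\<omega> \<in> space M. unbounded_black_components \<epsilon> p (\<lambda>x. f x \<omega>) \<noteq> {}}"

definition critical_threshold :: "'w measure \<Rightarrow> 'w field \<Rightarrow> real \<Rightarrow> ereal" where
  "critical_threshold M f \<epsilon> =
     Sup {ereal p | p. measure M (percolation_event M f \<epsilon> p) = 0}"

text \<open>
  Measurability of the percolation event is part of the claim, since \<open>measure\<close> returns \<open>0\<close> on
  non-measurable sets.
\<close>

definition sharp_threshold_at_zero :: "'w measure \<Rightarrow> 'w field \<Rightarrow> real \<Rightarrow> bool" where
  "sharp_threshold_at_zero M f \<epsilon> \<longleftrightarrow>
     critical_threshold M f \<epsilon> = 0 \<and>
     (\<forall>p. percolation_event M f \<epsilon> p \<in> sets M \<and>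
          measure M (percolation_event M f \<epsilon> p) = (if p > 0 then 1 else 0)) \<and>
     (\<forall>p. AE \<omega> in M. \<forall>C \<in> unbounded_black_components \<epsilon> p (\<lambda>x. f x \<omega>).
                     \<forall>C' \<in> unbounded_black_components \<epsilon> p (\<lambda>x. f x \<omega>). C = C')"

end

theory Submission
  imports Defs
begin

text \<open>In coordinates rotated by 45 degrees the graph is the square lattice with some diagonals
  added, and by the symmetry of \<open>f\<close> under a change of sign it is self-dual at level \<open>0\<close>: squares are
  crossed with probability at least one half (Hex lemma). Interpolation along the Ornstein-Uhlenbeck
  semigroup expresses the covariance of two threshold events through their gradients. Since
  \<open>\<kappa> \<ge> 0\<close>, this yields positive association, and the decay of \<open>\<kappa>\<close> yields approximate independence
  of distant events. Positive association and the symmetries of the square are all that Tassion's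
  argument needs to cross long rectangles with probability bounded below, at infinitely many scales.
  White circuits at these scales block black arms, so arm probabilities tend to \<open>0\<close> and there is no
  percolation for \<open>p \<le> 0\<close>.

  Again because \<open>\<kappa> \<ge> 0\<close>, the interpolation gives a hypercontractive inequality; hence the variance of
  an increasing event is much smaller than its total influence when all influences are small. The
  influence of a vertex on a crossing is at most a white arm probability, so for every \<open>p > 0\<close> long
  rectangles are crossed with probability close to \<open>1\<close> at some scale. If a rectangle three times as
  large is not crossed, then neither are two distant strips of it; after a small increase of the
  level these failures are almost independent. Iterating, the failure probability decays
  geometrically along the powers of three, and the Borel-Cantelli lemma gives an infinite cluster
  and circuits in infinitely many annuli, which make it unique.\<close>

section \<open>Gaussian vectors and the Ornstein-Uhlenbeck semigroup\<close>

text \<open>The covariance formula needs gradients, but a threshold event has none. Its indicator is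
  therefore smoothed at a width \<eta>. The gradient is then as large as 1/\<eta>, yet its mean
  stays below 2, since each variable has a density at most 1. Hence the covariance of two events is
  at most 2/h times the sum of the covariances between their supports, where h is the width used for
  only one of the two. Two supports of order s^2 vertices at distance of order s contribute s^4 *
  s^(-5), which explains the exponent 5 in the decay: errors of order 1/s vanish at large scales.
  Replacing the smoothed event by the event itself costs an error proportional to the number of
  vertices. This is harmless when one support is fixed and the other goes to infinity. For two
  growing supports it is avoided by comparing the events at levels that differ by 2h, and these
  increments of the level can be made summable along the scales. All Gaussian identities are first
  checked on trigonometric polynomials, where both sides are finite sums of exponentials of the
  covariance form, so that the characteristic function is the only input.\<close>

definition lin :: "'i set => ('i => real) => ('i => real) => real" where
  "lin V a x = (\<Sum>i\<in>V. a i * x i)"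

definition bil :: "('i => 'i => real) => 'i set => ('i => real) => ('i => real) => real" where
  "bil S V a b = (\<Sum>i\<in>V. \<Sum>j\<in>V. a i * b j * S i j)"

text \<open>A list of pairs \<open>(c, a)\<close> stands for the trigonometric polynomial with terms \<open>c * exp (i * lin V a x)\<close>.\<close>

type_synonym 'i tpoly = "(complex \<times> ('i => real)) list"

text \<open>A linear functional on trigonometric polynomials is determined by its values
  \<open>g a\<close> at the characters. Evaluation, expectation and all the kernels below are of
  this form, so identities between them are checked for each frequency.\<close>

definition ls :: "(('i => real) => complex) => 'i tpoly => complex" where
  "ls g l = (\<Sum>p\<leftarrow>l. fst p * g (snd p))"

abbreviation ls2 :: "(('i => real) => ('i => real) => complex) => 'i tpoly => 'i tpoly => complex" where
  "ls2 h l l' \<equiv> ls (\<lambda>a. ls (h a) l') l"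

text \<open>Coefficients and frequencies are changed at the same time, since differentiation, shifts
  of the variable and the semigroup all act on characters in this way.\<close>

definition ltr :: "(('i => real) => complex) => (('i => real) => ('i => real)) => 'i tpoly => 'i tpoly" where
  "ltr \<phi> \<theta> l = map (\<lambda>p. (fst p * \<phi> (snd p), \<theta> (snd p))) l"

definition lmul :: "'i tpoly => 'i tpoly => 'i tpoly" where
  "lmul l l' = concat (map (\<lambda>p. map (\<lambda>q. (fst p * fst q, \<lambda>i. snd p i + snd q i)) l') l)"

definition ev :: "'i set => 'i tpoly => ('i => real) => complex" where
  "ev V l x = ls (\<lambda>a. cis (lin V a x)) l"

definition dd :: "'i => 'i tpoly => 'i tpoly" where
  "dd i = ltr (\<lambda>a. \<i> * of_real (a i)) (\<lambda>a. a)"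

lemma ls_Nil [simp]: "ls g [] = 0" and ls_Cons [simp]: "ls g (p # l) = fst p * g (snd p) + ls g l"
  and ls_append [simp]: "ls g (l @ l') = ls g l + ls g l'"
  by (simp_all add: ls_def)

lemma ls_ltr: "ls g (ltr \<phi> \<theta> l) = ls (\<lambda>a. \<phi> a * g (\<theta> a)) l"
  by (induction l) (auto simp: ltr_def algebra_simps)

lemma ls_cmult: "ls (\<lambda>a. c * g a) l = c * ls g l"
  by (induction l) (auto simp: algebra_simps)

lemma ls_add: "ls (\<lambda>a. g a + h a) l = ls g l + ls h l"
  by (induction l) (auto simp: algebra_simps)

lemma ls_diff: "ls (\<lambda>a. g a - h a) l = ls g l - ls h l"
  by (induction l) (auto simp: algebra_simps)

lemma ls_zero [simp]: "ls (\<lambda>a. 0) l = 0"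
  by (induction l) auto

lemma ls_sum: "ls (\<lambda>a. \<Sum>i\<in>I. g i a) l = (\<Sum>i\<in>I. ls (g i) l)"
  by (induction l) (auto simp: sum.distrib sum_distrib_left)

lemma ls_map_scale: "ls g (map (\<lambda>q. (c * fst q, \<lambda>i. a i + snd q i)) l) = c * ls (\<lambda>b. g (\<lambda>i. a i + b i)) l"
  by (induction l) (auto simp: algebra_simps)

lemma ls_lmul: "ls g (lmul l l') = ls2 (\<lambda>a b. g (\<lambda>i. a i + b i)) l l'"
  by (induction l) (auto simp: lmul_def ls_map_scale)

lemma ls2_swap: "ls2 h l l' = ls2 (\<lambda>a b. h b a) l' l"
proof (induction l)
  case (Cons p l) then show ?case by (simp add: ls_add ls_cmult)
qed simp

lemma ls_mult_ls: "ls g l * ls h l' = ls2 (\<lambda>a b. g a * h b) l l'"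
  by (induction l) (auto simp: algebra_simps ls_cmult)

lemma lin_add: "lin V (\<lambda>i. a i + b i) x = lin V a x + lin V b x"
  by (simp add: lin_def sum.distrib algebra_simps)

lemma bil_add_left: "bil S V (\<lambda>i. a i + b i) c = bil S V a c + bil S V b c"
  and bil_add_right: "bil S V c (\<lambda>i. a i + b i) = bil S V c a + bil S V c b"
  and bil_mult_left: "bil S V (\<lambda>i. r * a i) c = r * bil S V a c"
  and bil_mult_right: "bil S V c (\<lambda>i. r * a i) = r * bil S V c a"
  by (simp_all add: bil_def sum.distrib algebra_simps sum_distrib_left)

lemma ev_lmul: "ev V (lmul l l') x = ev V l x * ev V l' x"
  by (simp add: ev_def ls_lmul lin_add ls_mult_ls cis_mult)

lemma ev_append: "ev V (l @ l') x = ev V l x + ev V l' x"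
  by (simp add: ev_def)

lemma ls_has_vector_derivative:
  assumes "\<And>a. ((\<lambda>t. h t a) has_vector_derivative h' a) F"
  shows "((\<lambda>t. ls (h t) l) has_vector_derivative ls h' l) F"
  by (induction l) (auto intro!: derivative_eq_intros assms)

lemma ls_continuous:
  assumes "\<And>a. continuous_on A (\<lambda>t. h t a)"
  shows "continuous_on A (\<lambda>t. ls (h t) l)"
  by (induction l) (auto intro!: continuous_intros assms)

lemma ls_measurable [measurable]:
  assumes "\<And>a. (\<lambda>t. h t a) \<in> borel_measurable N"
  shows "(\<lambda>t. ls (h t) l) \<in> borel_measurable N"
  by (induction l) (auto intro!: borel_measurable_add borel_measurable_times assms)

lemma norm_ls_le: assumes "\<And>a. norm (g a) \<le> 1" shows "norm (ls g l) \<le> (\<Sum>p\<leftarrow>l. norm (fst p))"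
proof (induction l)
  case (Cons p l)
  have "norm (fst p * g (snd p)) \<le> norm (fst p)" using assms[of "snd p"] by (simp add: norm_mult mult_left_le)
  then show ?case using Cons norm_triangle_ineq[of "fst p * g (snd p)" "ls g l"] by simp
qed simp

text \<open>The law enters only through the characteristic functions of finite linear combinations.
  Repeated variables are thereby allowed, which \<open>gauss_reindex\<close> exploits.\<close>

locale gauss = prob_space M for M :: "'w measure" +
  fixes X :: "'i => 'w => real" and S :: "'i => 'i => real"
  assumes X_meas [measurable]: "\<And>i. X i \<in> borel_measurable M"
    and S_sym: "\<And>i j. S i j = S j i"
    and char_X: "\<And>V a. finite V ==>
      (LINT \<omega>|M. cis (lin V a (\<lambda>i. X i \<omega>))) = of_real (exp (- bil S V a a / 2))"
begin

lemma bil_sym: "bil S V a b = bil S V b a"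
  unfolding bil_def by (subst sum.swap) (simp add: S_sym mult.commute mult.left_commute)

lemma cis_meas [measurable]: "(\<lambda>\<omega>. cis (lin V a (\<lambda>i. X i \<omega>))) \<in> borel_measurable M"
  unfolding lin_def cis_conv_exp by measurable

lemma ev_meas: "(\<lambda>\<omega>. ev V l (\<lambda>i. c i + r * X i \<omega>)) \<in> borel_measurable M"
  unfolding ev_def lin_def cis_conv_exp by measurable

lemma integrable_cis_lin: "integrable M (\<lambda>\<omega>. cis (lin V a (\<lambda>i. X i \<omega>)))"
  by (rule integrable_const_bound[where B=1]) auto

text \<open>The modulus of a characteristic function is at most 1, which forces its exponent to be
  nonpositive.\<close>

lemma psd: assumes "finite V" shows "bil S V a a \<ge> 0"
proof -
  have "norm (LINT \<omega>|M. cis (lin V a (\<lambda>i. X i \<omega>))) \<le> (LINT \<omega>|M. norm (cis (lin V a (\<lambda>i. X i \<omega>))))"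
    by (rule integral_norm_bound)
  also have "\<dots> = 1" by (simp add: prob_space)
  finally show ?thesis using char_X[OF assms, of a] by simp
qed

lemma bil_sq_add:
  "bil S V (\<lambda>i. a i + b i) (\<lambda>i. a i + b i) = bil S V a a + 2 * bil S V a b + bil S V b b"
  using bil_sym[of V a b] by (simp add: bil_add_left bil_add_right)

definition mean :: "'i set => 'i tpoly => complex" where
  "mean V l = ls (\<lambda>a. of_real (exp (- bil S V a a / 2))) l"

text \<open>The action of the operator \<open>PP r\<close> below on coefficients.\<close>

definition lP :: "'i set => real => 'i tpoly => 'i tpoly" where
  "lP V r = ltr (\<lambda>a. of_real (exp (- ((1 - r\<^sup>2) * bil S V a a) / 2))) (\<lambda>a i. r * a i)"

lemma integral_ev: assumes "finite V"
  shows "integrable M (\<lambda>\<omega>. ev V l (\<lambda>i. X i \<omega>))" (is ?A)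
    and "(LINT \<omega>|M. ev V l (\<lambda>i. X i \<omega>)) = mean V l" (is ?B)
proof -
  have "?A \<and> ?B" unfolding ev_def mean_def
  proof (induction l)
    case (Cons p l)
    then show ?case using integrable_cis_lin[of V "snd p"] char_X[OF assms, of "snd p"]
      by simp
  qed simp
  then show ?A ?B by auto
qed

text \<open>Integrating out \<open>X\<close> multiplies the character of frequency
  \<open>r * a\<close> by the characteristic function at \<open>sqrt (1 - r\<^sup>2) * a\<close>,
  which is the factor in \<open>lP\<close>.\<close>

lemma integral_ev_affine: assumes "finite V" "0 \<le> r" "r \<le> 1"
  shows "(LINT \<omega>|M. ev V l (\<lambda>i. r * x i + sqrt (1 - r\<^sup>2) * X i \<omega>)) = ev V (lP V r l) x"
proof -
  let ?s = "sqrt (1 - r\<^sup>2)"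
  have r: "1 - r\<^sup>2 \<ge> 0" using assms by (simp add: power_le_one)
  have *: "ev V l (\<lambda>i. r * x i + ?s * X i \<omega>) = ev V (ltr (\<lambda>a. cis (r * lin V a x)) (\<lambda>a i. ?s * a i) l) (\<lambda>i. X i \<omega>)" for \<omega>
    unfolding ev_def ls_ltr cis_mult by (simp add: lin_def sum.distrib sum_distrib_left algebra_simps)
  show ?thesis unfolding * integral_ev(2)[OF assms(1)] unfolding mean_def lP_def ev_def ls_ltr
  proof (intro arg_cong[where f="\<lambda>g. ls g l"] ext, goal_cases)
    case (1 a)
    have "bil S V (\<lambda>i. ?s * a i) (\<lambda>i. ?s * a i) = (1 - r\<^sup>2) * bil S V a a"
      using r by (simp add: bil_mult_left bil_mult_right mult.assoc[symmetric])
    moreover have "lin V (\<lambda>i. r * a i) x = r * lin V a x" by (simp add: lin_def sum_distrib_left algebra_simps)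
    ultimately show ?case by (simp add: mult.commute)
  qed
qed

lemma mean_lmul: "mean V (lmul l l') = ls2 (\<lambda>a b. of_real (exp (- (bil S V a a + 2 * bil S V a b + bil S V b b) / 2))) l l'"
  unfolding mean_def ls_lmul bil_sq_add ..

text \<open>The cross term sees \<open>r\<close> and \<open>s\<close> only through their product.
  Reversibility and the semigroup law, as combined in \<open>EE_PP_PP\<close>, rest on this.\<close>

lemma mean_lmul_lP:
  "mean V (lmul (lP V r l) (lP V s l')) =
    ls2 (\<lambda>a b. of_real (exp (- (bil S V a a + 2 * (r * s) * bil S V a b + bil S V b b) / 2))) l l'"
  unfolding mean_lmul unfolding lP_def ls_ltr ls_cmult[symmetric]
  by (intro arg_cong[where f="\<lambda>g. ls g l"] arg_cong[where f="\<lambda>g. ls g l'"] ext)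
     (simp add: bil_mult_left bil_mult_right exp_add[symmetric] field_simps power2_eq_square
         flip: of_real_mult)

lemma lP_1 [simp]: "lP V 1 l = l"
  by (simp add: lP_def ltr_def)

lemma lP_lP: "lP V r (lP V s l) = lP V (r * s) l"
  unfolding lP_def ltr_def
  by (simp add: bil_mult_left bil_mult_right exp_add[symmetric] field_simps power2_eq_square
         flip: of_real_mult)

end

section \<open>Real trigonometric polynomials and their bounded limits\<close>

definition trig0 :: "'i set => (('i => real) => real) => bool" where
  "trig0 V F \<longleftrightarrow> (\<exists>l. \<forall>x. of_real (F x) = ev V l x)"

text \<open>Identities between Gaussian integrals pass from trigonometric polynomials to their bounded
  pointwise limits by dominated convergence.\<close>

definition tlim :: "'i set => (('i => real) => real) => bool" where
  "tlim V \<psi> \<longleftrightarrow> (\<exists>Fn C. (\<forall>n::nat. trig0 V (Fn n)) \<and> (\<forall>n x. \<bar>Fn n x\<bar> \<le> C) \<and> (\<forall>x. (\<lambda>n. Fn n x) \<longlonglongrightarrow> \<psi> x))"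

lemma trig0_bounded: assumes "trig0 V F" obtains C where "\<And>x. \<bar>F x\<bar> \<le> C"
proof -
  obtain l where l: "\<And>x. of_real (F x) = ev V l x" using assms by (auto simp: trig0_def)
  have "\<bar>F x\<bar> \<le> (\<Sum>p\<leftarrow>l. norm (fst p))" for x
  proof -
    have "\<bar>F x\<bar> = norm (ev V l x)" by (metis l norm_of_real real_norm_def)
    also have "\<dots> \<le> (\<Sum>p\<leftarrow>l. norm (fst p))" unfolding ev_def by (rule norm_ls_le) simp
    finally show ?thesis .
  qed
  then show ?thesis using that by blast
qed

lemma trig0_mult: "trig0 V F ==> trig0 V G ==> trig0 V (\<lambda>x. F x * G x)"
  unfolding trig0_def by (metis ev_lmul of_real_mult)

lemma trig0_add: "trig0 V F ==> trig0 V G ==> trig0 V (\<lambda>x. F x + G x)"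
  unfolding trig0_def by (metis ev_append of_real_add)

lemma trig0_const: "trig0 V (\<lambda>x. c)"
  unfolding trig0_def by (rule exI[of _ "[(of_real c, \<lambda>_. 0)]"]) (simp add: ev_def lin_def)

lemma trig0_cmult: "trig0 V F ==> trig0 V (\<lambda>x. c * F x)"
  using trig0_mult[OF trig0_const] by blast

lemma trig0_diff: "trig0 V F ==> trig0 V G ==> trig0 V (\<lambda>x. F x - G x)"
  using trig0_add[OF _ trig0_cmult[of V G "-1"]] by simp

lemma trig0_sum: "(\<And>i. i \<in> I ==> trig0 V (F i)) ==> trig0 V (\<lambda>x. \<Sum>i\<in>I. F i x)"
  by (induction I rule: infinite_finite_induct) (auto intro: trig0_const trig0_add)

lemma trig0_tlim: assumes "trig0 V F" shows "tlim V F"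
proof -
  obtain C where "\<And>x. \<bar>F x\<bar> \<le> C" using trig0_bounded[OF assms] by blast
  then show ?thesis unfolding tlim_def
    by (intro exI[of _ "\<lambda>_. F"] exI[of _ C]) (use assms in auto)
qed

lemma tlimE: assumes "tlim V \<psi>"
  obtains Fn C where "\<And>n::nat. trig0 V (Fn n)" "\<And>n x. \<bar>Fn n x\<bar> \<le> C" "\<And>x. (\<lambda>n. Fn n x) \<longlonglongrightarrow> \<psi> x"
    "\<And>x. \<bar>\<psi> x\<bar> \<le> C" "C \<ge> 0"
proof -
  obtain Fn C where *: "\<And>n::nat. trig0 V (Fn n)" "\<And>n x. \<bar>Fn n x\<bar> \<le> C" "\<And>x. (\<lambda>n. Fn n x) \<longlonglongrightarrow> \<psi> x"
    using assms by (auto simp: tlim_def)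
  have "\<bar>\<psi> x\<bar> \<le> C" for x
    by (rule LIMSEQ_le_const2[OF tendsto_rabs[OF *(3)]]) (use *(2) in auto)
  moreover have "C \<ge> 0" using *(2)[of 0 "\<lambda>_. 0"] by linarith
  ultimately show ?thesis using that * by blast
qed

lemma tlim_mult: assumes "tlim V F" "tlim V G" shows "tlim V (\<lambda>x. F x * G x)"
proof -
  obtain Fn C where F: "\<And>n::nat. trig0 V (Fn n)" "\<And>n x. \<bar>Fn n x\<bar> \<le> C" "\<And>x. (\<lambda>n. Fn n x) \<longlonglongrightarrow> F x" "C \<ge> 0"
    using tlimE[OF assms(1)] by metis
  obtain Gn D where G: "\<And>n::nat. trig0 V (Gn n)" "\<And>n x. \<bar>Gn n x\<bar> \<le> D" "\<And>x. (\<lambda>n. Gn n x) \<longlonglongrightarrow> G x" "D \<ge> 0"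
    using tlimE[OF assms(2)] by metis
  show ?thesis unfolding tlim_def
    by (intro exI[of _ "\<lambda>n x. Fn n x * Gn n x"] exI[of _ "C * D"])
       (auto intro!: trig0_mult tendsto_mult mult_mono F G simp: abs_mult)
qed

lemma tlim_add: assumes "tlim V F" "tlim V G" shows "tlim V (\<lambda>x. F x + G x)"
proof -
  obtain Fn C where F: "\<And>n::nat. trig0 V (Fn n)" "\<And>n x. \<bar>Fn n x\<bar> \<le> C" "\<And>x. (\<lambda>n. Fn n x) \<longlonglongrightarrow> F x" "C \<ge> 0"
    using tlimE[OF assms(1)] by metis
  obtain Gn D where G: "\<And>n::nat. trig0 V (Gn n)" "\<And>n x. \<bar>Gn n x\<bar> \<le> D" "\<And>x. (\<lambda>n. Gn n x) \<longlonglongrightarrow> G x" "D \<ge> 0"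
    using tlimE[OF assms(2)] by metis
  have "\<bar>Fn n x + Gn n x\<bar> \<le> C + D" for n x using F(2)[of n x] G(2)[of n x] by linarith
  then show ?thesis unfolding tlim_def
    by (intro exI[of _ "\<lambda>n x. Fn n x + Gn n x"] exI[of _ "C + D"])
       (auto intro!: trig0_add tendsto_add F G)
qed

lemma tlim_const: "tlim V (\<lambda>x. c)" by (intro trig0_tlim trig0_const)
lemma tlim_cmult: "tlim V F ==> tlim V (\<lambda>x. c * F x)" using tlim_mult[OF tlim_const] by blast
lemma tlim_diff: "tlim V F ==> tlim V G ==> tlim V (\<lambda>x. F x - G x)"
  using tlim_add[OF _ tlim_cmult[of V G "-1"]] by simp

section \<open>The Ornstein-Uhlenbeck semigroup on bounded limits\<close>

context gauss begin

text \<open>Mehler's formula: \<open>PP r\<close> is the Ornstein-Uhlenbeck semigroup at time \<open>- ln r\<close>.\<close>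

definition PP :: "real => (('i => real) => real) => ('i => real) => real" where
  "PP r \<psi> x = (LINT \<omega>|M. \<psi> (\<lambda>i. r * x i + sqrt (1 - r\<^sup>2) * X i \<omega>))"

definition EE :: "(('i => real) => real) => real" where
  "EE \<psi> = (LINT \<omega>|M. \<psi> (\<lambda>i. X i \<omega>))"

lemma trig0_meas: assumes "trig0 V F" shows "(\<lambda>\<omega>. F (\<lambda>i. c i + r * X i \<omega>)) \<in> borel_measurable M"
proof -
  obtain l where l: "\<And>x. of_real (F x) = ev V l x" using assms by (auto simp: trig0_def)
  have F: "F x = Re (ev V l x)" for x by (metis l Re_complex_of_real)
  show ?thesis unfolding F using ev_meas[of V l c r] by measurable
qed

lemma tlim_meas: assumes "tlim V F" shows "(\<lambda>\<omega>. F (\<lambda>i. c i + r * X i \<omega>)) \<in> borel_measurable M"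
proof -
  obtain Fn C where F: "\<And>n::nat. trig0 V (Fn n)" "\<And>x. (\<lambda>n. Fn n x) \<longlonglongrightarrow> F x" using tlimE[OF assms] by metis
  show ?thesis by (rule borel_measurable_LIMSEQ_real[OF F(2) trig0_meas[OF F(1)]])
qed

lemma tlim_meas0: "tlim V F ==> (\<lambda>\<omega>. F (\<lambda>i. X i \<omega>)) \<in> borel_measurable M"
  using tlim_meas[of V F "\<lambda>_. 0" 1] by simp

lemma tlim_bounded: assumes "tlim V F" obtains C where "\<And>x. \<bar>F x\<bar> \<le> C" by (rule tlimE[OF assms]) blast

lemma tlim_integrable: assumes "tlim V F" shows "integrable M (\<lambda>\<omega>. F (\<lambda>i. c i + r * X i \<omega>))"
proof -
  obtain C where C: "\<And>x. \<bar>F x\<bar> \<le> C" by (rule tlim_bounded[OF assms]) blast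
  show ?thesis by (rule integrable_const_bound[of _ C]) (use C tlim_meas[OF assms] in auto)
qed

lemma tlim_integrable0: "tlim V F ==> integrable M (\<lambda>\<omega>. F (\<lambda>i. X i \<omega>))"
  using tlim_integrable[of V F "\<lambda>_. 0" 1] by simp

lemma EE_add: "tlim V F ==> tlim V G ==> EE (\<lambda>x. F x + G x) = EE F + EE G"
  unfolding EE_def by (intro Bochner_Integration.integral_add tlim_integrable0)

lemma EE_diff: "tlim V F ==> tlim V G ==> EE (\<lambda>x. F x - G x) = EE F - EE G"
  unfolding EE_def by (intro Bochner_Integration.integral_diff tlim_integrable0)

lemma EE_cmult: "EE (\<lambda>x. c * F x) = c * EE F"
  unfolding EE_def by simp

lemma EE_const [simp]: "EE (\<lambda>x. c) = c" by (simp add: EE_def prob_space)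

lemma EE_mono: "tlim V F ==> tlim V G ==> (\<And>x. F x \<le> G x) ==> EE F \<le> EE G"
  unfolding EE_def by (intro integral_mono tlim_integrable0)

lemma EE_nonneg: "(\<And>x. F x \<ge> 0) ==> EE F \<ge> 0"
  unfolding EE_def by (rule Bochner_Integration.integral_nonneg) auto

lemma EE_lim: assumes "\<And>n::nat. tlim V (Fn n)" "\<And>n x. \<bar>Fn n x\<bar> \<le> C" "\<And>x. (\<lambda>n. Fn n x) \<longlonglongrightarrow> F x"
  shows "(\<lambda>n. EE (Fn n)) \<longlonglongrightarrow> EE F"
  unfolding EE_def
proof (rule integral_dominated_convergence[where w="\<lambda>_. C"])
  show "(\<lambda>\<omega>. F (\<lambda>i. X i \<omega>)) \<in> borel_measurable M"
    by (rule borel_measurable_LIMSEQ_real[OF assms(3) tlim_meas0[OF assms(1)]])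
qed (use assms tlim_meas0 in auto)

lemma PP_lim: assumes "\<And>n::nat. tlim V (Fn n)" "\<And>n x. \<bar>Fn n x\<bar> \<le> C" "\<And>x. (\<lambda>n. Fn n x) \<longlonglongrightarrow> F x"
  shows "(\<lambda>n. PP r (Fn n) x) \<longlonglongrightarrow> PP r F x"
  unfolding PP_def
proof (rule integral_dominated_convergence[where w="\<lambda>_. C"])
  show "(\<lambda>\<omega>. F (\<lambda>i. r * x i + sqrt (1 - r\<^sup>2) * X i \<omega>)) \<in> borel_measurable M"
    by (rule borel_measurable_LIMSEQ_real[OF assms(3) tlim_meas[OF assms(1)]])
qed (use assms tlim_meas in auto)

lemma abs_PP_le: assumes "tlim V F" "\<And>x. \<bar>F x\<bar> \<le> C" shows "\<bar>PP r F x\<bar> \<le> C"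
proof -
  have "\<bar>PP r F x\<bar> \<le> (LINT \<omega>|M. \<bar>F (\<lambda>i. r * x i + sqrt (1 - r\<^sup>2) * X i \<omega>)\<bar>)" unfolding PP_def by (rule integral_abs_bound)
  also have "\<dots> \<le> (LINT \<omega>|M. C)" by (intro integral_mono integrable_abs tlim_integrable[OF assms(1)]) (use assms in auto)
  finally show ?thesis by (simp add: prob_space)
qed

lemma PP_nonneg: "(\<And>x. F x \<ge> 0) ==> PP r F x \<ge> 0"
  unfolding PP_def by (rule Bochner_Integration.integral_nonneg) auto

lemma PP_1 [simp]: "PP 1 F = F"
  by (rule ext) (simp add: PP_def prob_space)

lemma PP_0: "PP 0 F x = EE F"
  by (simp add: PP_def EE_def)

context fixes V :: "'i set" assumes V: "finite V" begin

lemma EE_trig0: assumes "\<And>x. of_real (F x) = ev V l x" shows "of_real (EE F) = mean V l"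
  unfolding EE_def using integral_ev(2)[OF V, of l]
  by (simp flip: assms add: integral_complex_of_real)

lemma PP_trig0: assumes "\<And>x. of_real (F x) = ev V l x" "0 \<le> r" "r \<le> 1"
  shows "of_real (PP r F x) = ev V (lP V r l) x"
  unfolding PP_def using integral_ev_affine[OF V assms(2,3), of l x]
  by (simp flip: assms(1) add: integral_complex_of_real)

lemma trig0_PP: "trig0 V F ==> 0 \<le> r ==> r \<le> 1 ==> trig0 V (PP r F)"
  using PP_trig0 unfolding trig0_def by metis

lemma tlim_PP: assumes "tlim V F" "0 \<le> r" "r \<le> 1" shows "tlim V (PP r F)"
proof -
  obtain Fn C where F: "\<And>n::nat. trig0 V (Fn n)" "\<And>n x. \<bar>Fn n x\<bar> \<le> C" "\<And>x. (\<lambda>n. Fn n x) \<longlonglongrightarrow> F x"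
    using tlimE[OF assms(1)] by metis
  show ?thesis unfolding tlim_def
    by (intro exI[of _ "\<lambda>n. PP r (Fn n)"] exI[of _ C] conjI allI trig0_PP abs_PP_le[OF trig0_tlim[OF F(1)]]
        PP_lim[OF trig0_tlim[OF F(1)] F(2,3)] F assms)
qed

text \<open>For trigonometric polynomials both sides are given by the kernel of
  \<open>mean_lmul_lP\<close> with the same product \<open>r * s\<close>; the rest is dominated
  convergence.\<close>

lemma EE_PP_PP: assumes "tlim V F" "tlim V G" "0 \<le> r" "r \<le> 1" "0 \<le> s" "s \<le> 1"
  shows "EE (\<lambda>x. PP r F x * PP s G x) = EE (\<lambda>x. F x * PP (r * s) G x)"
proof -
  have rs: "0 \<le> r * s" "r * s \<le> 1" using assms by (auto intro: mult_le_one)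
  have *: "EE (\<lambda>x. PP r F x * PP s G x) = EE (\<lambda>x. F x * PP (r * s) G x)" if FG: "trig0 V F" "trig0 V G" for F G
  proof -
    obtain l where l: "\<And>x. of_real (F x) = ev V l x" using FG by (auto simp: trig0_def)
    obtain l' where l': "\<And>x. of_real (G x) = ev V l' x" using FG by (auto simp: trig0_def)
    have "complex_of_real (EE (\<lambda>x. PP r F x * PP s G x)) = mean V (lmul (lP V r l) (lP V s l'))"
      by (rule EE_trig0) (simp add: ev_lmul PP_trig0[OF l] PP_trig0[OF l'] assms)
    also have "\<dots> = mean V (lmul (lP V 1 l) (lP V (r * s) l'))" unfolding mean_lmul_lP by simp
    also have "\<dots> = complex_of_real (EE (\<lambda>x. F x * PP (r * s) G x))"
      by (rule EE_trig0[symmetric]) (simp add: ev_lmul l PP_trig0[OF l'] rs)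
    finally show ?thesis by simp
  qed
  obtain Fn C where F: "\<And>n::nat. trig0 V (Fn n)" "\<And>n x. \<bar>Fn n x\<bar> \<le> C" "\<And>x. (\<lambda>n. Fn n x) \<longlonglongrightarrow> F x" "C \<ge> 0"
    using tlimE[OF assms(1)] by metis
  obtain Gn D where G: "\<And>n::nat. trig0 V (Gn n)" "\<And>n x. \<bar>Gn n x\<bar> \<le> D" "\<And>x. (\<lambda>n. Gn n x) \<longlonglongrightarrow> G x" "D \<ge> 0"
    using tlimE[OF assms(2)] by metis
  have bF: "\<bar>PP r (Fn n) x\<bar> \<le> C" and bG: "\<bar>PP s (Gn n) x\<bar> \<le> D" "\<bar>PP (r * s) (Gn n) x\<bar> \<le> D" for n x r s
    by (intro abs_PP_le[where V=V] trig0_tlim F G)+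
  have "(\<lambda>n. EE (\<lambda>x. PP r (Fn n) x * PP s (Gn n) x)) \<longlonglongrightarrow> EE (\<lambda>x. PP r F x * PP s G x)"
    by (rule EE_lim[where C="C * D" and V=V])
       (use F G bF bG assms in \<open>auto intro!: trig0_tlim trig0_mult trig0_PP tendsto_mult PP_lim mult_mono simp: abs_mult\<close>)
  moreover have "(\<lambda>n. EE (\<lambda>x. Fn n x * PP (r * s) (Gn n) x)) \<longlonglongrightarrow> EE (\<lambda>x. F x * PP (r * s) G x)"
    by (rule EE_lim[where C="C * D" and V=V])
       (use F G bF bG assms rs in \<open>auto intro!: trig0_tlim trig0_mult trig0_PP tendsto_mult PP_lim mult_mono simp: abs_mult\<close>)
  ultimately show ?thesis using *[OF F(1) G(1)] LIMSEQ_unique by simp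
qed

lemma PP_PP: assumes "tlim V F" "0 \<le> r" "r \<le> 1" "0 \<le> s" "s \<le> 1"
  shows "PP r (PP s F) x = PP (r * s) F x"
proof -
  have rs: "0 \<le> r * s" "r * s \<le> 1" using assms by (auto intro: mult_le_one)
  have *: "PP r (PP s F) x = PP (r * s) F x" if F: "trig0 V F" for F
  proof -
    obtain l where l: "\<And>x. of_real (F x) = ev V l x" using F by (auto simp: trig0_def)
    have "complex_of_real (PP r (PP s F) x) = of_real (PP (r * s) F x)"
      using PP_trig0[OF PP_trig0[OF l assms(4,5)] assms(2,3)] PP_trig0[OF l rs] lP_lP by metis
    then show ?thesis by simp
  qed
  obtain Fn C where F: "\<And>n::nat. trig0 V (Fn n)" "\<And>n x. \<bar>Fn n x\<bar> \<le> C" "\<And>x. (\<lambda>n. Fn n x) \<longlonglongrightarrow> F x"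
    using tlimE[OF assms(1)] by metis
  have "(\<lambda>n. PP r (PP s (Fn n)) x) \<longlonglongrightarrow> PP r (PP s F) x"
    by (intro PP_lim[where V=V and C=C] abs_PP_le[where V=V] trig0_tlim trig0_PP F assms)
  moreover have "(\<lambda>n. PP (r * s) (Fn n) x) \<longlonglongrightarrow> PP (r * s) F x"
    by (intro PP_lim[where V=V and C=C] abs_PP_le[where V=V] trig0_tlim trig0_PP F assms)
  ultimately show ?thesis using *[OF F(1)] LIMSEQ_unique by simp
qed

lemma EE_PP: assumes "tlim V F" "0 \<le> r" "r \<le> 1" shows "EE (PP r F) = EE F"
  using EE_PP_PP[OF tlim_const[where c=1] assms(1) _ _ assms(2,3), of 0] PP_0[of F]
  by (simp add: PP_0)

lemma EE_mult_PP: assumes "tlim V F" "0 \<le> t" "t \<le> 1"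
  shows "EE (\<lambda>x. F x * PP t F x) = EE (\<lambda>x. (PP (sqrt t) F x)\<^sup>2)"
  using EE_PP_PP[OF assms(1) assms(1), of "sqrt t" "sqrt t"] assms by (simp add: power2_eq_square)

lemma PP_power2_le: assumes "tlim V F" shows "(PP r F x)\<^sup>2 \<le> PP r (\<lambda>x. (F x)\<^sup>2) x"
proof -
  let ?f = "\<lambda>\<omega>. F (\<lambda>i. r * x i + sqrt (1 - r\<^sup>2) * X i \<omega>)"
  have t2: "tlim V (\<lambda>x. (F x)\<^sup>2)" using tlim_mult[OF assms assms] by (simp add: power2_eq_square)
  note i = tlim_integrable[OF assms, of "\<lambda>i. r * x i" "sqrt (1 - r\<^sup>2)"] tlim_integrable[OF t2, of "\<lambda>i. r * x i" "sqrt (1 - r\<^sup>2)"]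
  show ?thesis using variance_eq[OF i] variance_positive[of ?f] unfolding PP_def by simp
qed

lemma EE_PP_power2_le: assumes "tlim V F" "0 \<le> r" "r \<le> 1"
  shows "EE (\<lambda>x. (PP r F x)\<^sup>2) \<le> EE (\<lambda>x. (F x)\<^sup>2)"
proof -
  have t2: "tlim V (\<lambda>x. (F x)\<^sup>2)" using tlim_mult[OF assms(1) assms(1)] by (simp add: power2_eq_square)
  have t3: "tlim V (\<lambda>x. (PP r F x)\<^sup>2)" using tlim_mult[OF tlim_PP tlim_PP, OF assms assms] by (simp add: power2_eq_square)
  have "EE (\<lambda>x. (PP r F x)\<^sup>2) \<le> EE (PP r (\<lambda>x. (F x)\<^sup>2))"
    by (rule EE_mono[OF t3 tlim_PP[OF t2 assms(2,3)]]) (rule PP_power2_le[OF assms(1)])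
  then show ?thesis using EE_PP[OF t2 assms(2,3)] by simp
qed

text \<open>The correlation at parameter \<open>t\<close> is the squared norm of
  \<open>PP (sqrt t) F\<close>, and \<open>PP\<close> contracts the L2 norm. The root of
  \<open>t / t'\<close> is the parameter that leads from \<open>sqrt t'\<close> to
  \<open>sqrt t\<close>.\<close>

lemma EE_mult_PP_mono: assumes "tlim V F" "0 \<le> t" "t \<le> t'" "t' \<le> 1"
  shows "EE (\<lambda>x. F x * PP t F x) \<le> EE (\<lambda>x. F x * PP t' F x)"
proof (cases "t' = 0")
  case False
  then have t': "t' > 0" using assms by simp
  let ?r = "sqrt (t / t')"
  have r: "0 \<le> ?r" "?r \<le> 1" using assms t' by auto
  have "?r * sqrt t' = sqrt t" using t' assms by (simp add: real_sqrt_divide)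
  then have "PP (sqrt t) F x = PP ?r (PP (sqrt t') F) x" for x
    using PP_PP[OF assms(1) r, of "sqrt t'" x] assms t' by simp
  then have "EE (\<lambda>x. (PP (sqrt t) F x)\<^sup>2) \<le> EE (\<lambda>x. (PP (sqrt t') F x)\<^sup>2)"
    using EE_PP_power2_le[OF tlim_PP[OF assms(1), of "sqrt t'"] r] assms t' by simp
  then show ?thesis using EE_mult_PP[OF assms(1)] assms t' by auto
qed (use assms in auto)

lemma EE_cauchy: assumes "tlim V F" "tlim V G"
  shows "(EE (\<lambda>x. F x * G x))\<^sup>2 \<le> EE (\<lambda>x. (F x)\<^sup>2) * EE (\<lambda>x. (G x)\<^sup>2)"
proof -
  have t: "tlim V (\<lambda>x. (F x)\<^sup>2)" "tlim V (\<lambda>x. (G x)\<^sup>2)" "tlim V (\<lambda>x. F x * G x)" using tlim_mult assms by (auto simp: power2_eq_square)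
  define a b c where "a = EE (\<lambda>x. (F x)\<^sup>2)" "b = EE (\<lambda>x. F x * G x)" "c = EE (\<lambda>x. (G x)\<^sup>2)"
  have *: "0 \<le> u\<^sup>2 * a - 2 * (u * v) * b + v\<^sup>2 * c" for u v
  proof -
    have "0 \<le> EE (\<lambda>x. (u * F x - v * G x)\<^sup>2)" by (rule EE_nonneg) simp
    also have "(\<lambda>x. (u * F x - v * G x)\<^sup>2) = (\<lambda>x. (u\<^sup>2 * (F x)\<^sup>2 - 2 * (u * v) * (F x * G x)) + v\<^sup>2 * (G x)\<^sup>2)"
      by (auto simp: power2_eq_square algebra_simps)
    also have "EE \<dots> = u\<^sup>2 * a - 2 * (u * v) * b + v\<^sup>2 * c"
      unfolding a_b_c_def
      by (subst EE_add[of V] EE_diff[of V], (intro tlim_cmult tlim_diff t)+)+ (simp add: EE_cmult)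
    finally show ?thesis .
  qed
  have "a \<ge> 0" "c \<ge> 0" unfolding a_b_c_def by (auto intro: EE_nonneg)
  have "b\<^sup>2 \<le> a * c"
  proof (cases "a = 0")
    case True
    show ?thesis
    proof (cases "c = 0")
      case True then show ?thesis using \<open>a = 0\<close> *[of 1 1] *[of 1 "-1"] by simp
    next
      case False then show ?thesis using \<open>a = 0\<close> *[of c b] \<open>c \<ge> 0\<close>
        by (simp add: power2_eq_square algebra_simps) (smt (verit) mult_nonneg_nonneg mult_pos_pos zero_le_square mult.assoc mult.commute zero_less_mult_iff)
    qed
  next
    case False
    then have "a > 0" using \<open>a \<ge> 0\<close> by simp
    have "0 \<le> a * (a * c - b\<^sup>2)" using *[of b a] by (simp add: power2_eq_square algebra_simps)
    then show ?thesis using \<open>a > 0\<close> by (simp add: zero_le_mult_iff)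
  qed
  then show ?thesis unfolding a_b_c_def .
qed

end
end

section \<open>Covariance formula and hypercontractivity\<close>

definition trig :: "'i set => (('i => real) => real) => ('i => ('i => real) => real) => bool" where
  "trig V F G \<longleftrightarrow> (\<exists>l. (\<forall>x. of_real (F x) = ev V l x) \<and> (\<forall>i\<in>V. \<forall>x. of_real (G i x) = ev V (dd i l) x))"

lemma trig_trig0: "trig V F G ==> trig0 V F"
  and trig_trig0_grad: "trig V F G ==> i \<in> V ==> trig0 V (G i)"
  unfolding trig_def trig0_def by auto

lemma ev_has_vector_derivative:
  assumes "finite V" "i \<in> V"
  shows "((\<lambda>t. ev V l (x(i := x i + t))) has_vector_derivative ev V (dd i l) x) (at 0)"
  unfolding ev_def dd_def ls_ltr
proof (rule ls_has_vector_derivative)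
  fix a :: "'a => real"
  have "lin V a (x(i := x i + t)) = lin V a x + t * a i" for t
    using assms by (simp add: lin_def sum.remove[of V i] algebra_simps)
  moreover have "((\<lambda>t::real. cis (lin V a x + t * a i)) has_vector_derivative (\<i> * of_real (a i) * cis (lin V a x))) (at 0)"
  proof -
    have "((\<lambda>z. exp (\<i> * (of_real (lin V a x) + z * of_real (a i)))) has_field_derivative
        (\<i> * of_real (a i) * exp (\<i> * of_real (lin V a x)))) (at (of_real 0))"
      by (auto intro!: derivative_eq_intros)
    from has_vector_derivative_real_field[OF this] show ?thesis by (simp add: cis_conv_exp algebra_simps)
  qed
  ultimately show "((\<lambda>t. cis (lin V a (x(i := x i + t)))) has_vector_derivative \<i> * of_real (a i) * cis (lin V a x)) (at 0)"
    by simp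
qed

text \<open>Single terms of the representing list are not real. The derivative is real all the same,
  because the imaginary part of \<open>ev V l\<close> vanishes identically and so does its
  derivative.\<close>

lemma trig0_trig: assumes "finite V" "trig0 V F" shows "\<exists>G. trig V F G"
proof -
  obtain l where l: "\<And>x. of_real (F x) = ev V l x" using assms by (auto simp: trig0_def)
  have "of_real (Re (ev V (dd i l) x)) = ev V (dd i l) x" if "i \<in> V" for i x
  proof -
    have "((\<lambda>t. Im (ev V l (x(i := x i + t)))) has_vector_derivative Im (ev V (dd i l) x)) (at 0)"
      using bounded_linear.has_vector_derivative[OF bounded_linear_Im ev_has_vector_derivative[OF assms(1) that]] .
    moreover have "Im (ev V l y) = 0" for y by (metis l Im_complex_of_real)
    ultimately have "((\<lambda>t::real. 0::real) has_vector_derivative Im (ev V (dd i l) x)) (at 0)" by simp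
    then have "Im (ev V (dd i l) x) = 0" using vector_derivative_unique_at has_vector_derivative_const by blast
    then show ?thesis by (simp add: complex_eq_iff)
  qed
  then show ?thesis unfolding trig_def using l
    by (intro exI[of _ "\<lambda>i x. Re (ev V (dd i l) x)"] exI[of _ l]) auto
qed

context gauss begin

text \<open>The kernel of the expectation of \<open>(PP a ((PP b F)\<^sup>2))\<^sup>2\<close> where \<open>b\<^sup>2 = 1 - 2 * y\<close> and \<open>a\<^sup>2 * b\<^sup>2 = y\<close>. This
  expectation decreases in \<open>y\<close>, from the square of the second moment of \<open>F\<close> at \<open>y = 0\<close> to the fourth
  moment of \<open>PP b F\<close> with \<open>b\<^sup>2 = 1/3\<close> at \<open>y = 1/3\<close>, which is the hypercontractive inequality.\<close>

definition K4 :: "'i set => real => ('i => real) => ('i => real) => ('i => real) => ('i => real) => real" where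
  "K4 V y p q r s = exp (- ((bil S V p p + bil S V q q + bil S V r r + bil S V s s) / 2
     + (1 - 2 * y) * (bil S V p q + bil S V r s)
     + y * (bil S V p r + bil S V p s + bil S V q r + bil S V q s)))"

abbreviation ls4 :: "(('i => real) => ('i => real) => ('i => real) => ('i => real) => complex) =>
    'i tpoly => 'i tpoly => 'i tpoly => 'i tpoly => complex" where
  "ls4 h l1 l2 l3 l4 \<equiv> ls (\<lambda>p. ls (\<lambda>q. ls (\<lambda>r. ls (h p q r) l4) l3) l2) l1"

lemma mean_four:
  assumes "b\<^sup>2 = 1 - 2 * y" "a\<^sup>2 * b\<^sup>2 = y"
  shows "mean V (lmul (lP V a (lmul (lP V b l1) (lP V b l2))) (lP V a (lmul (lP V b l3) (lP V b l4))))
    = ls4 (\<lambda>p q r s. of_real (K4 V y p q r s)) l1 l2 l3 l4"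
  unfolding mean_lmul_lP ls_lmul unfolding lP_def ls_ltr ls_cmult[symmetric]
proof (intro arg_cong[where f="\<lambda>g. ls g l1"] arg_cong[where f="\<lambda>g. ls g l2"] arg_cong[where f="\<lambda>g. ls g l3"] arg_cong[where f="\<lambda>g. ls g l4"] ext, goal_cases)
  case (1 p q r s)
  have K: "K4 V y p q r s = exp (- ((bil S V p p + bil S V q q + bil S V r r + bil S V s s) / 2
     + b\<^sup>2 * (bil S V p q + bil S V r s)
     + a\<^sup>2 * b\<^sup>2 * (bil S V p r + bil S V p s + bil S V q r + bil S V q s)))"
    unfolding K4_def by (simp only: assms(1) assms(2)[unfolded assms(1)])
  show ?case unfolding K
    by (simp add: bil_mult_left bil_mult_right bil_add_left bil_add_right flip: of_real_mult exp_add)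
       (simp add: power2_eq_square bil_sym[of V q p] bil_sym[of V s r] field_simps)
qed

text \<open>With four copies of one list the frequencies may be permuted. The three swaps reduce the
  six terms in the derivative of \<open>K4\<close> to two.\<close>

lemma ls4_swap_pairs: "ls4 h l l l l = ls4 (\<lambda>p q r s. h r s p q) l l l l"
proof -
  have "ls4 h l l l l = ls (\<lambda>p. ls (\<lambda>r. ls (\<lambda>q. ls (h p q r) l) l) l) l"
    by (intro arg_cong[where f="\<lambda>g. ls g l"] ext ls2_swap)
  also have "\<dots> = ls (\<lambda>r. ls (\<lambda>p. ls (\<lambda>q. ls (h p q r) l) l) l) l" by (rule ls2_swap)
  also have "\<dots> = ls (\<lambda>r. ls (\<lambda>p. ls (\<lambda>s. ls (\<lambda>q. h p q r s) l) l) l) l"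
    by (intro arg_cong[where f="\<lambda>g. ls g l"] ext ls2_swap)
  also have "\<dots> = ls (\<lambda>r. ls (\<lambda>s. ls (\<lambda>p. ls (\<lambda>q. h p q r s) l) l) l) l"
    by (intro arg_cong[where f="\<lambda>g. ls g l"] ext ls2_swap)
  finally show ?thesis .
qed

lemma ls4_swap12: "ls4 h l l l l = ls4 (\<lambda>p q r s. h q p r s) l l l l"
  by (rule ls2_swap)

lemma ls4_swap34: "ls4 h l l l l = ls4 (\<lambda>p q r s. h p q s r) l l l l"
  by (intro arg_cong[where f="\<lambda>g. ls g l"] ext ls2_swap)

lemma K4_sym: "K4 V y r s p q = K4 V y p q r s" "K4 V y q p r s = K4 V y p q r s" "K4 V y p q s r = K4 V y p q r s"
  unfolding K4_def by (simp_all add: bil_sym[of V r p] bil_sym[of V s p] bil_sym[of V r q] bil_sym[of V s q] bil_sym[of V q p] bil_sym[of V s r] algebra_simps)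

end

section \<open>The hypercontractive inequality for trigonometric polynomials\<close>

context gauss begin
context fixes V :: "'i set" assumes V: "finite V" begin

lemma tlim_sum: "(\<And>i. i \<in> I ==> tlim W (F i)) ==> tlim W (\<lambda>x. \<Sum>i\<in>I. F i x)"
  by (induction I rule: infinite_finite_induct) (auto intro: tlim_const tlim_add)

lemma PP_add: "tlim W F ==> tlim W G ==> PP r (\<lambda>x. F x + G x) x = PP r F x + PP r G x"
  unfolding PP_def by (intro Bochner_Integration.integral_add tlim_integrable)

lemma PP_cmult: "PP r (\<lambda>x. c * F x) x = c * PP r F x"
  unfolding PP_def by simp

lemma PP_sum: "(\<And>i. i \<in> I ==> tlim W (F i)) ==> PP r (\<lambda>x. \<Sum>i\<in>I. F i x) x = (\<Sum>i\<in>I. PP r (F i) x)"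
  unfolding PP_def by (intro Bochner_Integration.integral_sum tlim_integrable)

lemma PP_dsum: assumes "\<And>i j. i \<in> I ==> j \<in> J ==> tlim W (h i j)"
  shows "PP r (\<lambda>x. \<Sum>i\<in>I. \<Sum>j\<in>J. c i j * h i j x) x = (\<Sum>i\<in>I. \<Sum>j\<in>J. c i j * PP r (h i j) x)"
proof -
  have "PP r (\<lambda>x. \<Sum>i\<in>I. \<Sum>j\<in>J. c i j * h i j x) x = (\<Sum>i\<in>I. PP r (\<lambda>x. \<Sum>j\<in>J. c i j * h i j x) x)"
    by (rule PP_sum[of _ W]) (auto intro!: tlim_sum tlim_cmult assms)
  also have "\<dots> = (\<Sum>i\<in>I. \<Sum>j\<in>J. PP r (\<lambda>x. c i j * h i j x) x)"
    by (intro sum.cong refl PP_sum[of _ W]) (auto intro!: tlim_cmult assms)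
  finally show ?thesis by (simp add: PP_cmult)
qed

lemma EE_dsum: assumes "\<And>i j. i \<in> I ==> j \<in> J ==> tlim W (h i j)"
  shows "EE (\<lambda>x. \<Sum>i\<in>I. \<Sum>j\<in>J. c i j * h i j x) = (\<Sum>i\<in>I. \<Sum>j\<in>J. c i j * EE (h i j))"
  using PP_dsum[OF assms, where r=0] by (simp add: PP_0)

text \<open>Cauchy-Schwarz for the vector \<open>g\<close> and the scalar \<open>v\<close> under the
  averaging \<open>PP a\<close> at a fixed point, with vectors measured by the semidefinite form of
  \<open>S\<close>. It comes from the nonnegative mean of this form at
  \<open>u * g - w * v * e\<close>, where \<open>e\<close> is the mean of
  \<open>g * v\<close>.\<close>

lemma PP_gram:
  assumes g: "\<And>i. i \<in> V ==> tlim V (g i)" and v: "tlim V v"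
  shows "(\<Sum>i\<in>V. \<Sum>j\<in>V. S i j * (PP a (\<lambda>x. g i x * v x) x * PP a (\<lambda>x. g j x * v x) x))
    \<le> (\<Sum>i\<in>V. \<Sum>j\<in>V. S i j * PP a (\<lambda>x. g i x * g j x) x) * PP a (\<lambda>x. (v x)\<^sup>2) x" (is "?N \<le> ?G * ?A")
proof -
  define e where "e i = PP a (\<lambda>x. g i x * v x) x" for i
  have tgg: "tlim V (\<lambda>x. g i x * g j x)" and tgv: "tlim V (\<lambda>x. g i x * v x)" if "i \<in> V" "j \<in> V" for i j
    using that by (auto intro: tlim_mult g v)
  have tv: "tlim V (\<lambda>x. (v x)\<^sup>2)" using tlim_mult[OF v v] by (simp add: power2_eq_square)
  have N: "?N = bil S V e e" by (simp add: bil_def e_def algebra_simps)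
  have *: "0 \<le> u\<^sup>2 * ?G - 2 * (u * w) * ?N + w\<^sup>2 * ?N * ?A" for u w
  proof -
    have "0 \<le> PP a (\<lambda>y. bil S V (\<lambda>i. u * g i y + (- (w * v y)) * e i) (\<lambda>i. u * g i y + (- (w * v y)) * e i)) x"
      by (rule PP_nonneg) (rule psd[OF V])
    also have "(\<lambda>y. bil S V (\<lambda>i. u * g i y + (- (w * v y)) * e i) (\<lambda>i. u * g i y + (- (w * v y)) * e i))
      = (\<lambda>y. (\<Sum>i\<in>V. \<Sum>j\<in>V. u\<^sup>2 * S i j * (g i y * g j y)) + (\<Sum>i\<in>V. \<Sum>j\<in>V. (- 2 * (u * w) * S i j * e j) * (g i y * v y)) + (w\<^sup>2 * bil S V e e) * (v y)\<^sup>2)"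
      by (rule ext, subst bil_sq_add, simp only: bil_mult_left bil_mult_right)
         (simp add: bil_def sum_distrib_left sum_negf[symmetric] power2_eq_square algebra_simps)
    also have "PP a \<dots> x = (\<Sum>i\<in>V. \<Sum>j\<in>V. u\<^sup>2 * S i j * PP a (\<lambda>y. g i y * g j y) x) + (\<Sum>i\<in>V. \<Sum>j\<in>V. (- 2 * (u * w) * S i j * e j) * e i) + (w\<^sup>2 * bil S V e e) * ?A"
      by (subst PP_add[of V], (intro tlim_add tlim_sum tlim_cmult tgg tgv tv; assumption)+)+
         (simp only: PP_dsum[of V V V, OF tgg] PP_dsum[of V V V, OF tgv] PP_cmult e_def)
    also have "\<dots> = u\<^sup>2 * ?G - 2 * (u * w) * ?N + w\<^sup>2 * ?N * ?A" unfolding N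
      by (simp add: bil_def sum_distrib_left sum_negf algebra_simps)
    finally show ?thesis .
  qed
  have N0: "?N \<ge> 0" unfolding N by (rule psd[OF V])
  have A0: "?A \<ge> 0" by (rule PP_nonneg) simp
  show ?thesis
  proof (cases "?A = 0")
    case True
    have "0 \<le> ?G - 2 * w * ?N" for w using *[of 1 w] True by simp
    \<comment> \<open>For \<open>?N \<noteq> 0\<close> this choice of \<open>w\<close> would turn
      the right-hand side into -1.\<close>
    from this[of "(?G + 1) / (2 * ?N)"] have "?N = 0" by (cases "?N = 0") auto
    then show ?thesis using True by simp
  next
    case False
    then have "?A > 0" using A0 by simp
    moreover have "0 \<le> ?A * (?G * ?A - ?N)" using *[of ?A 1] by (simp add: power2_eq_square algebra_simps)
    ultimately show ?thesis by (simp add: zero_le_mult_iff)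
  qed
qed

text \<open>Differentiating \<open>K4\<close> in \<open>y\<close> brings down factors
  \<open>bil S V p q\<close>, which stand for derivatives of two of the four copies of
  \<open>F\<close>. By symmetry only two kinds of pairs remain, within a square and across the
  squares, and the derivative is -4 times the mean of the deficit in \<open>PP_gram\<close>, hence
  nonpositive.\<close>

lemma bonami_trig:
  assumes "trig0 V F"
  shows "EE (\<lambda>x. (PP (sqrt (1/3)) F x) ^ 4) \<le> (EE (\<lambda>x. (F x)\<^sup>2))\<^sup>2"
proof -
  obtain G where "trig V F G" using trig0_trig[OF V assms] by blast
  then obtain l where l: "\<And>x. of_real (F x) = ev V l x" and dl: "\<And>i x. i \<in> V ==> of_real (G i x) = ev V (dd i l) x"
    unfolding trig_def by blast
  note tG = trig_trig0_grad[OF \<open>trig V F G\<close>]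
  define \<phi> where "\<phi> y = Re (ls4 (\<lambda>p q r s. of_real (K4 V y p q r s)) l l l l)" for y
  have four: "complex_of_real (EE (\<lambda>x. PP a (\<lambda>x. PP b F1 x * PP b F2 x) x * PP a (\<lambda>x. PP b F3 x * PP b F4 x) x))
      = ls4 (\<lambda>p q r s. of_real (K4 V y p q r s)) l1 l2 l3 l4"
    if "\<And>x. of_real (F1 x) = ev V l1 x" "\<And>x. of_real (F2 x) = ev V l2 x" "\<And>x. of_real (F3 x) = ev V l3 x" "\<And>x. of_real (F4 x) = ev V l4 x"
      "0 \<le> a" "a \<le> 1" "0 \<le> b" "b \<le> 1" "b\<^sup>2 = 1 - 2 * y" "a\<^sup>2 * b\<^sup>2 = y" for F1 F2 F3 F4 l1 l2 l3 l4 a b y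
    unfolding mean_four[OF that(9,10), symmetric]
  proof (rule EE_trig0[OF V])
    fix x
    have 1: "complex_of_real (PP b F1 x * PP b F2 x) = ev V (lmul (lP V b l1) (lP V b l2)) x"
      "complex_of_real (PP b F3 x * PP b F4 x) = ev V (lmul (lP V b l3) (lP V b l4)) x" for x
      using that by (simp_all add: ev_lmul PP_trig0[OF V])
    show "complex_of_real (PP a (\<lambda>x. PP b F1 x * PP b F2 x) x * PP a (\<lambda>x. PP b F3 x * PP b F4 x) x) = ev V (lmul (lP V a (lmul (lP V b l1) (lP V b l2))) (lP V a (lmul (lP V b l3) (lP V b l4)))) x"
      using PP_trig0[OF V 1(1) that(5,6)] PP_trig0[OF V 1(2) that(5,6)] by (simp add: ev_lmul)
  qed
  define B where "B = bil S V"
  define D where "D y = 4 * Re (ls4 (\<lambda>p q r s. of_real (B p q * K4 V y p q r s)) l l l l) - 4 * Re (ls4 (\<lambda>p q r s. of_real (B p r * K4 V y p q r s)) l l l l)" for y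
  have der: "(\<phi> has_real_derivative D y) (at y)" for y
  proof -
    have "((\<lambda>y. K4 V y p q r s) has_vector_derivative (2 * B p q + 2 * B r s - B p r - B p s - B q r - B q s) * K4 V y p q r s) (at y)" for p q r s
      unfolding K4_def B_def has_real_derivative_iff_has_vector_derivative[symmetric]
      by (rule derivative_eq_intros refl | simp)+
    then have "((\<lambda>y. complex_of_real (K4 V y p q r s)) has_vector_derivative of_real ((2 * B p q + 2 * B r s - B p r - B p s - B q r - B q s) * K4 V y p q r s)) (at y)" for p q r s
      by (rule bounded_linear.has_vector_derivative[OF bounded_linear_of_real])
    then have "((\<lambda>y. ls4 (\<lambda>p q r s. of_real (K4 V y p q r s)) l l l l) has_vector_derivative
        ls4 (\<lambda>p q r s. of_real ((2 * B p q + 2 * B r s - B p r - B p s - B q r - B q s) * K4 V y p q r s)) l l l l) (at y)"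
      by (intro ls_has_vector_derivative)
    then have "(\<phi> has_real_derivative Re (ls4 (\<lambda>p q r s. of_real ((2 * B p q + 2 * B r s - B p r - B p s - B q r - B q s) * K4 V y p q r s)) l l l l)) (at y)"
      unfolding \<phi>_def has_real_derivative_iff_has_vector_derivative by (rule bounded_linear.has_vector_derivative[OF bounded_linear_Re])
    also have "ls4 (\<lambda>p q r s. of_real ((2 * B p q + 2 * B r s - B p r - B p s - B q r - B q s) * K4 V y p q r s)) l l l l
      = 2 * ls4 (\<lambda>p q r s. of_real (B p q * K4 V y p q r s)) l l l l + 2 * ls4 (\<lambda>p q r s. of_real (B r s * K4 V y p q r s)) l l l l
       - ls4 (\<lambda>p q r s. of_real (B p r * K4 V y p q r s)) l l l l - ls4 (\<lambda>p q r s. of_real (B p s * K4 V y p q r s)) l l l l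
       - ls4 (\<lambda>p q r s. of_real (B q r * K4 V y p q r s)) l l l l - ls4 (\<lambda>p q r s. of_real (B q s * K4 V y p q r s)) l l l l"
      unfolding ls_cmult[symmetric] ls_add[symmetric] ls_diff[symmetric]
      by (intro arg_cong[where f="\<lambda>g. ls g l"] ext) (simp add: algebra_simps)
    also have "ls4 (\<lambda>p q r s. of_real (B r s * K4 V y p q r s)) l l l l = ls4 (\<lambda>p q r s. of_real (B p q * K4 V y p q r s)) l l l l"
      by (subst ls4_swap_pairs) (simp add: K4_sym(1))
    also have "ls4 (\<lambda>p q r s. of_real (B p s * K4 V y p q r s)) l l l l = ls4 (\<lambda>p q r s. of_real (B p r * K4 V y p q r s)) l l l l"
      by (subst ls4_swap34) (simp add: K4_sym(3))
    also have "ls4 (\<lambda>p q r s. of_real (B q s * K4 V y p q r s)) l l l l = ls4 (\<lambda>p q r s. of_real (B q r * K4 V y p q r s)) l l l l"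
      by (subst ls4_swap34) (simp add: K4_sym(3))
    also have "ls4 (\<lambda>p q r s. of_real (B q r * K4 V y p q r s)) l l l l = ls4 (\<lambda>p q r s. of_real (B p r * K4 V y p q r s)) l l l l"
      by (subst ls4_swap12) (simp add: K4_sym(2))
    finally show ?thesis by (simp add: D_def)
  qed
  have D: "D y \<le> 0" if y: "0 \<le> y" "y \<le> 1/3" for y
  proof -
    \<comment> \<open>The bound \<open>a \<le> 1\<close> holds exactly up to \<open>y = 1/3\<close>,
      which is where the interpolation has to stop.\<close>
    define b a where "b = sqrt (1 - 2 * y)" and "a = sqrt (y / (1 - 2 * y))"
    have ab: "0 \<le> a" "a \<le> 1" "0 \<le> b" "b \<le> 1" "b\<^sup>2 = 1 - 2 * y" "a\<^sup>2 * b\<^sup>2 = y"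
      using y unfolding a_def b_def by (auto simp: field_simps)
    define g where "g i = PP b (G i)" for i
    define v where "v = PP b F"
    have tg: "tlim V (g i)" if "i \<in> V" for i unfolding g_def by (rule tlim_PP[OF V trig0_tlim[OF tG[OF that]] ab(3,4)])
    have tv: "tlim V v" unfolding v_def by (rule tlim_PP[OF V trig0_tlim[OF assms] ab(3,4)])
    have 1: "Re (ls4 (\<lambda>p q r s. of_real (B p q * K4 V y p q r s)) l l l l) = - EE (\<lambda>x. (\<Sum>i\<in>V. \<Sum>j\<in>V. S i j * PP a (\<lambda>x. g i x * g j x) x) * PP a (\<lambda>x. (v x)\<^sup>2) x)"
    proof -
      have "ls4 (\<lambda>p q r s. of_real (B p q * K4 V y p q r s)) l l l l
         = ls4 (\<lambda>p q r s. \<Sum>i\<in>V. \<Sum>j\<in>V. - of_real (S i j) * (\<i> * of_real (p i) * (\<i> * of_real (q j) * of_real (K4 V y p q r s)))) l l l l"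
        by (intro arg_cong[where f="\<lambda>g. ls g l"] ext) (simp add: B_def bil_def sum_distrib_right sum_distrib_left mult_ac)
      also have "\<dots> = (\<Sum>i\<in>V. \<Sum>j\<in>V. - of_real (S i j) * ls4 (\<lambda>p q r s. of_real (K4 V y p q r s)) (dd i l) (dd j l) l l)"
        unfolding ls_sum ls_cmult dd_def ls_ltr ..
      also have "\<dots> = (\<Sum>i\<in>V. \<Sum>j\<in>V. - of_real (S i j) * of_real (EE (\<lambda>x. PP a (\<lambda>x. g i x * g j x) x * PP a (\<lambda>x. v x * v x) x)))"
        unfolding g_def v_def by (intro sum.cong refl) (subst four[OF dl dl l l ab, symmetric], auto)
      finally have "Re (ls4 (\<lambda>p q r s. of_real (B p q * K4 V y p q r s)) l l l l) = - (\<Sum>i\<in>V. \<Sum>j\<in>V. S i j * EE (\<lambda>x. PP a (\<lambda>x. g i x * g j x) x * PP a (\<lambda>x. v x * v x) x))"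
        by (simp add: sum_negf)
      also have "\<dots> = - EE (\<lambda>x. \<Sum>i\<in>V. \<Sum>j\<in>V. S i j * (PP a (\<lambda>x. g i x * g j x) x * PP a (\<lambda>x. v x * v x) x))"
        by (subst EE_dsum[of V V V]) (intro tlim_sum tlim_cmult tlim_mult tlim_PP[OF V] tg tv ab refl; assumption)+
      finally show ?thesis by (simp add: sum_distrib_left sum_distrib_right algebra_simps power2_eq_square)
    qed
    have 2: "Re (ls4 (\<lambda>p q r s. of_real (B p r * K4 V y p q r s)) l l l l) = - EE (\<lambda>x. \<Sum>i\<in>V. \<Sum>j\<in>V. S i j * (PP a (\<lambda>x. g i x * v x) x * PP a (\<lambda>x. g j x * v x) x))"
    proof -
      have "ls4 (\<lambda>p q r s. of_real (B p r * K4 V y p q r s)) l l l l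
         = ls4 (\<lambda>p q r s. \<Sum>i\<in>V. \<Sum>j\<in>V. - of_real (S i j) * (\<i> * of_real (p i) * (\<i> * of_real (r j) * of_real (K4 V y p q r s)))) l l l l"
        by (intro arg_cong[where f="\<lambda>g. ls g l"] ext) (simp add: B_def bil_def sum_distrib_right sum_distrib_left mult_ac)
      also have "\<dots> = (\<Sum>i\<in>V. \<Sum>j\<in>V. - of_real (S i j) * ls4 (\<lambda>p q r s. of_real (K4 V y p q r s)) (dd i l) l (dd j l) l)"
        unfolding ls_sum ls_cmult dd_def ls_ltr ..
      also have "\<dots> = (\<Sum>i\<in>V. \<Sum>j\<in>V. - of_real (S i j) * of_real (EE (\<lambda>x. PP a (\<lambda>x. g i x * v x) x * PP a (\<lambda>x. g j x * v x) x)))"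
        unfolding g_def v_def by (intro sum.cong refl) (subst four[OF dl l dl l ab, symmetric], auto)
      finally have "Re (ls4 (\<lambda>p q r s. of_real (B p r * K4 V y p q r s)) l l l l) = - (\<Sum>i\<in>V. \<Sum>j\<in>V. S i j * EE (\<lambda>x. PP a (\<lambda>x. g i x * v x) x * PP a (\<lambda>x. g j x * v x) x))"
        by (simp add: sum_negf)
      also have "\<dots> = - EE (\<lambda>x. \<Sum>i\<in>V. \<Sum>j\<in>V. S i j * (PP a (\<lambda>x. g i x * v x) x * PP a (\<lambda>x. g j x * v x) x))"
        by (subst EE_dsum[of V V V]) (intro tlim_sum tlim_cmult tlim_mult tlim_PP[OF V] tg tv ab refl; assumption)+
      finally show ?thesis .
    qed
    have tvv: "tlim V (\<lambda>x. (v x)\<^sup>2)" using tlim_mult[OF tv tv] by (simp add: power2_eq_square)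
    have "EE (\<lambda>x. \<Sum>i\<in>V. \<Sum>j\<in>V. S i j * (PP a (\<lambda>x. g i x * v x) x * PP a (\<lambda>x. g j x * v x) x))
       \<le> EE (\<lambda>x. (\<Sum>i\<in>V. \<Sum>j\<in>V. S i j * PP a (\<lambda>x. g i x * g j x) x) * PP a (\<lambda>x. (v x)\<^sup>2) x)"
      by (rule EE_mono[of V]) (intro tlim_sum tlim_cmult tlim_mult tlim_PP[OF V] tg tv tvv ab PP_gram; assumption)+
    then show ?thesis unfolding D_def 1 2 by simp
  qed
  have "\<phi> (1/3) \<le> \<phi> 0"
    by (rule DERIV_nonpos_imp_nonincreasing) (use der D in auto)
  moreover have "\<phi> 0 = (EE (\<lambda>x. (F x)\<^sup>2))\<^sup>2"
    using four[OF l l l l, of 0 1 0] by (simp add: \<phi>_def PP_0 power2_eq_square flip: of_real_mult) (metis Re_complex_of_real)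
  moreover have "\<phi> (1/3) = EE (\<lambda>x. (PP (sqrt (1/3)) F x) ^ 4)"
    using four[OF l l l l, of 1 "sqrt (1/3)" "1/3"] by (simp add: \<phi>_def power4_eq_xxxx algebra_simps) (metis Re_complex_of_real)
  ultimately show ?thesis by simp
qed

end
end

section \<open>The covariance formula and its use for functions of small mean\<close>

definition glim :: "'i set => (('i => real) => real) => ('i => ('i => real) => real) => bool" where
  "glim V F DF \<longleftrightarrow> (\<exists>Fn DFn C. (\<forall>n::nat. trig V (Fn n) (DFn n)) \<and> (\<forall>n x. \<bar>Fn n x\<bar> \<le> C) \<and>
      (\<forall>n. \<forall>i\<in>V. \<forall>x. \<bar>DFn n i x\<bar> \<le> C) \<and> (\<forall>x. (\<lambda>n. Fn n x) \<longlonglongrightarrow> F x) \<and>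
      (\<forall>i\<in>V. \<forall>x. (\<lambda>n. DFn n i x) \<longlonglongrightarrow> DF i x))"

lemma glimE: assumes "glim V F DF"
  obtains Fn DFn C where "\<And>n::nat. trig V (Fn n) (DFn n)" "\<And>n x. \<bar>Fn n x\<bar> \<le> C"
      "\<And>n i x. i \<in> V ==> \<bar>DFn n i x\<bar> \<le> C" "\<And>x. (\<lambda>n. Fn n x) \<longlonglongrightarrow> F x"
      "\<And>i x. i \<in> V ==> (\<lambda>n. DFn n i x) \<longlonglongrightarrow> DF i x"
proof -
  from assms[unfolded glim_def] obtain Fn DFn C where "(\<forall>n::nat. trig V (Fn n) (DFn n)) \<and> (\<forall>n x. \<bar>Fn n x\<bar> \<le> C) \<and>
      (\<forall>n. \<forall>i\<in>V. \<forall>x. \<bar>DFn n i x\<bar> \<le> C) \<and> (\<forall>x. (\<lambda>n. Fn n x) \<longlonglongrightarrow> F x) \<and>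
      (\<forall>i\<in>V. \<forall>x. (\<lambda>n. DFn n i x) \<longlonglongrightarrow> DF i x)" by (elim exE)
  then show ?thesis by (intro that[of Fn DFn C]) auto
qed

lemma glim_tlim: "glim V F DF ==> tlim V F"
  by (erule glimE) (auto simp: tlim_def intro: trig_trig0)

lemma glim_tlim_grad: assumes "glim V F DF" "i \<in> V" shows "tlim V (DF i)"
proof (rule glimE[OF assms(1)], goal_cases)
  case (1 Fn DFn C)
  show ?thesis unfolding tlim_def
    by (intro exI[of _ "\<lambda>n. DFn n i"] exI[of _ C]) (use 1 trig_trig0_grad[OF 1(1) assms(2)] assms(2) in auto)
qed

context gauss begin
context fixes V :: "'i set" assumes V: "finite V" begin

definition covK :: "('i => ('i => real) => real) => ('i => ('i => real) => real) => real => real" where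
  "covK DF DG t = (\<Sum>i\<in>V. \<Sum>j\<in>V. S i j * EE (\<lambda>x. DF i x * PP t (DG j) x))"

text \<open>The mean of \<open>F * PP t G\<close> runs from the product of the means at
  \<open>t = 0\<close> to the mean of the product at \<open>t = 1\<close>. Its derivative pairs the
  two gradients, because the factor \<open>- a i * b j\<close> on characters is the product of two
  partial derivatives.\<close>

lemma cov_trig:
  assumes "trig V F DF" "trig V G DG"
  shows "(covK DF DG has_integral (EE (\<lambda>x. F x * G x) - EE F * EE G)) {0..1}"
    and "continuous_on {0..1} (covK DF DG)"
proof -
  obtain l where l: "\<And>x. of_real (F x) = ev V l x" and dl: "\<And>i x. i \<in> V ==> of_real (DF i x) = ev V (dd i l) x"
    using assms(1) unfolding trig_def by blast
  obtain m where m: "\<And>x. of_real (G x) = ev V m x" and dm: "\<And>i x. i \<in> V ==> of_real (DG i x) = ev V (dd i m) x"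
    using assms(2) unfolding trig_def by blast
  define K2 where "K2 t a b = exp (- (bil S V a a + 2 * t * bil S V a b + bil S V b b) / 2)" for t a b
  have EEQ: "complex_of_real (EE (\<lambda>x. F1 x * PP t F2 x)) = ls2 (\<lambda>a b. of_real (K2 t a b)) l1 l2"
    if "\<And>x. of_real (F1 x) = ev V l1 x" "\<And>x. of_real (F2 x) = ev V l2 x" "t \<in> {0..1}" for F1 F2 l1 l2 t
  proof -
    have "complex_of_real (EE (\<lambda>x. F1 x * PP t F2 x)) = mean V (lmul (lP V 1 l1) (lP V t l2))"
    proof (rule EE_trig0[OF V])
      fix x show "complex_of_real (F1 x * PP t F2 x) = ev V (lmul (lP V 1 l1) (lP V t l2)) x"
        using PP_trig0[OF V that(2), of t x] that(1)[of x] that(3) by (simp add: ev_lmul)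
    qed
    then show ?thesis unfolding mean_lmul_lP K2_def by simp
  qed
  define h where "h t = Re (ls2 (\<lambda>a b. of_real (K2 t a b)) l m)" for t
  define h' where "h' t = Re (ls2 (\<lambda>a b. of_real (- bil S V a b * K2 t a b)) l m)" for t
  have h': "covK DF DG t = h' t" if t: "t \<in> {0..1}" for t
  proof -
    have "ls2 (\<lambda>a b. of_real (- bil S V a b * K2 t a b)) l m =
      ls2 (\<lambda>a b. \<Sum>i\<in>V. \<Sum>j\<in>V. of_real (S i j) * (\<i> * of_real (a i) * (\<i> * of_real (b j) * of_real (K2 t a b)))) l m"
      by (intro arg_cong[where f="\<lambda>g. ls g l"] arg_cong[where f="\<lambda>g. ls g m"] ext)
         (simp add: bil_def sum_distrib_right sum_distrib_left mult_ac sum_negf)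
    also have "\<dots> = (\<Sum>i\<in>V. \<Sum>j\<in>V. of_real (S i j) * ls2 (\<lambda>a b. of_real (K2 t a b)) (dd i l) (dd j m))"
      unfolding ls_sum ls_cmult dd_def ls_ltr ..
    also have "\<dots> = (\<Sum>i\<in>V. \<Sum>j\<in>V. of_real (S i j) * of_real (EE (\<lambda>x. DF i x * PP t (DG j) x)))"
      by (intro sum.cong refl arg_cong2[where f=times] EEQ[symmetric] dl dm t)
    finally show ?thesis unfolding h'_def covK_def by simp
  qed
  have der: "(h has_vector_derivative h' t) (at t within A)" for t A
  proof -
    have "((\<lambda>t. K2 t a b) has_vector_derivative (- bil S V a b * K2 t a b)) (at t within A)" for a b
      unfolding K2_def has_real_derivative_iff_has_vector_derivative[symmetric]
      by (rule derivative_eq_intros refl | simp)+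
    then have "((\<lambda>t. complex_of_real (K2 t a b)) has_vector_derivative of_real (- bil S V a b * K2 t a b)) (at t within A)" for a b
      by (rule bounded_linear.has_vector_derivative[OF bounded_linear_of_real])
    then have "((\<lambda>t. ls2 (\<lambda>a b. of_real (K2 t a b)) l m) has_vector_derivative ls2 (\<lambda>a b. of_real (- bil S V a b * K2 t a b)) l m) (at t within A)"
      by (intro ls_has_vector_derivative)
    then show ?thesis unfolding h_def h'_def by (rule bounded_linear.has_vector_derivative[OF bounded_linear_Re])
  qed
  have "(h' has_integral h 1 - h 0) {0..1}"
    by (rule fundamental_theorem_of_calculus) (use der in auto)
  moreover have hE: "h t = EE (\<lambda>x. F x * PP t G x)" if "t \<in> {0..1}" for t
    unfolding h_def EEQ[OF l m that, symmetric] by simp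
  moreover have "h 1 = EE (\<lambda>x. F x * G x)" using hE[of 1] by simp
  moreover have "h 0 = EE F * EE G"
  proof -
    have "EE (\<lambda>x. F x * PP 0 G x) = EE F * EE G" unfolding PP_0 using EE_cmult[of "EE G" F] by (simp add: mult.commute)
    then show ?thesis using hE[of 0] by simp
  qed
  ultimately show "(covK DF DG has_integral (EE (\<lambda>x. F x * G x) - EE F * EE G)) {0..1}"
    using has_integral_cong[of "{0..1}" "covK DF DG" h', OF h'] by simp
  have "continuous_on {0..1} h'" unfolding h'_def K2_def
    by (intro continuous_intros ls_continuous) auto
  then show "continuous_on {0..1} (covK DF DG)" using continuous_on_cong[of "{0..1}" "{0..1}" "covK DF DG" h', OF refl h'] by simp
qed

lemma abs_EE_le: assumes "\<And>x. \<bar>F x\<bar> \<le> C" shows "\<bar>EE F\<bar> \<le> C"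
proof (cases "integrable M (\<lambda>\<omega>. F (\<lambda>i. X i \<omega>))")
  case True
  have "\<bar>EE F\<bar> \<le> (LINT \<omega>|M. \<bar>F (\<lambda>i. X i \<omega>)\<bar>)" unfolding EE_def by (rule integral_abs_bound)
  also have "\<dots> \<le> (LINT \<omega>|M. C)" by (intro integral_mono integrable_abs True) (use assms in auto)
  finally show ?thesis by (simp add: prob_space)
next
  \<comment> \<open>A function that is not integrable has integral 0, and the hypothesis at any one
    point gives \<open>C \<ge> 0\<close>.\<close>
  case False then show ?thesis using assms[of "\<lambda>_. 0"] by (simp add: EE_def not_integrable_integral_eq)
qed

theorem cov_formula:
  assumes "glim V F DF" "glim V G DG"
  shows "(covK DF DG has_integral (EE (\<lambda>x. F x * G x) - EE F * EE G)) {0..1}"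
proof -
  obtain Fn DFn C where F: "\<And>n::nat. trig V (Fn n) (DFn n)" "\<And>n x. \<bar>Fn n x\<bar> \<le> C"
      "\<And>n i x. i \<in> V ==> \<bar>DFn n i x\<bar> \<le> C" "\<And>x. (\<lambda>n. Fn n x) \<longlonglongrightarrow> F x"
      "\<And>i x. i \<in> V ==> (\<lambda>n. DFn n i x) \<longlonglongrightarrow> DF i x" by (rule glimE[OF assms(1)]) blast
  obtain Gn DGn D where G: "\<And>n::nat. trig V (Gn n) (DGn n)" "\<And>n x. \<bar>Gn n x\<bar> \<le> D"
      "\<And>n i x. i \<in> V ==> \<bar>DGn n i x\<bar> \<le> D" "\<And>x. (\<lambda>n. Gn n x) \<longlonglongrightarrow> G x"
      "\<And>i x. i \<in> V ==> (\<lambda>n. DGn n i x) \<longlonglongrightarrow> DG i x" by (rule glimE[OF assms(2)]) blast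
  have C: "0 \<le> C" "0 \<le> D" using F(2)[of 0 "\<lambda>_. 0"] G(2)[of 0 "\<lambda>_. 0"] by linarith+
  note tF = trig0_tlim[OF trig_trig0[OF F(1)]] and tG = trig0_tlim[OF trig_trig0[OF G(1)]]
  note tDF = trig0_tlim[OF trig_trig0_grad[OF F(1)]] and tDG = trig0_tlim[OF trig_trig0_grad[OF G(1)]]
  have bd: "\<bar>DFn n i x * PP t (DGn n j) x\<bar> \<le> C * D" if "i \<in> V" "j \<in> V" for n i j x t
    unfolding abs_mult by (intro mult_mono F(3) abs_PP_le[of V] tDG that G(3)) (use C in auto)
  let ?h = "\<lambda>_::real. \<Sum>i\<in>V. \<Sum>j\<in>V. \<bar>S i j\<bar> * (C * D)"
  have 1: "covK (DFn n) (DGn n) integrable_on {0..1}" for n using cov_trig(1)[OF F(1) G(1)] by (rule has_integral_integrable)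
  have 2: "?h integrable_on {0..1}" by auto
  have b: "\<bar>S i j * EE (\<lambda>x. DFn n i x * PP t (DGn n j) x)\<bar> \<le> \<bar>S i j\<bar> * (C * D)" if ij: "i \<in> V" "j \<in> V" for i j n t
    unfolding abs_mult[of "S i j"] by (intro mult_left_mono abs_EE_le bd ij) auto
  have 3: "norm (covK (DFn n) (DGn n) t) \<le> ?h t" if "t \<in> {0..1}" for n t
    unfolding covK_def real_norm_def
    by (rule order_trans[OF sum_abs], rule sum_mono, rule order_trans[OF sum_abs], rule sum_mono, rule b)
  have 4: "(\<lambda>n. covK (DFn n) (DGn n) t) \<longlonglongrightarrow> covK DF DG t" if t: "t \<in> {0..1}" for t
    unfolding covK_def
    proof (intro tendsto_sum tendsto_mult tendsto_const)
      fix i j assume ij: "i \<in> V" "j \<in> V"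
      show "(\<lambda>n. EE (\<lambda>x. DFn n i x * PP t (DGn n j) x)) \<longlonglongrightarrow> EE (\<lambda>x. DF i x * PP t (DG j) x)"
      proof (rule EE_lim[of V, OF _ bd[OF ij]])
        show "tlim V (\<lambda>x. DFn n i x * PP t (DGn n j) x)" for n
          using t by (intro tlim_mult tDF tDG tlim_PP[OF V] ij) auto
        show "(\<lambda>n. DFn n i x * PP t (DGn n j) x) \<longlonglongrightarrow> DF i x * PP t (DG j) x" for x
          by (intro tendsto_mult F(5) ij PP_lim[OF tDG[OF ij(2)] G(3)[OF ij(2)] G(5)[OF ij(2)]])
      qed
    qed
  note dc = dominated_convergence[OF 1 2 3 4]
  have "(\<lambda>n. integral {0..1} (covK (DFn n) (DGn n))) \<longlonglongrightarrow> EE (\<lambda>x. F x * G x) - EE F * EE G"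
  proof -
    have "(\<lambda>n. EE (\<lambda>x. Fn n x * Gn n x)) \<longlonglongrightarrow> EE (\<lambda>x. F x * G x)"
    proof (rule EE_lim[where C="C*D" and V=V])
      show "tlim V (\<lambda>x. Fn n x * Gn n x)" for n by (intro tlim_mult tF tG)
      show "\<bar>Fn n x * Gn n x\<bar> \<le> C * D" for n x unfolding abs_mult by (intro mult_mono F(2) G(2)) (use C in auto)
      show "(\<lambda>n. Fn n x * Gn n x) \<longlonglongrightarrow> F x * G x" for x by (intro tendsto_mult F(4) G(4))
    qed
    moreover have "(\<lambda>n. EE (Fn n)) \<longlonglongrightarrow> EE F" "(\<lambda>n. EE (Gn n)) \<longlonglongrightarrow> EE G"
      by (rule EE_lim[OF tF F(2,4)], rule EE_lim[OF tG G(2,4)])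
    ultimately have "(\<lambda>n. EE (\<lambda>x. Fn n x * Gn n x) - EE (Fn n) * EE (Gn n)) \<longlonglongrightarrow> EE (\<lambda>x. F x * G x) - EE F * EE G"
      by (intro tendsto_diff tendsto_mult)
    moreover have "integral {0..1} (covK (DFn n) (DGn n)) = EE (\<lambda>x. Fn n x * Gn n x) - EE (Fn n) * EE (Gn n)" for n
      using cov_trig(1)[OF F(1) G(1)] by (rule integral_unique)
    ultimately show ?thesis by simp
  qed
  then have "integral {0..1} (covK DF DG) = EE (\<lambda>x. F x * G x) - EE F * EE G"
    using LIMSEQ_unique[OF dc(2)] by simp
  then show ?thesis using has_integral_integrable_integral[of "covK DF DG"] dc(1) by blast
qed

lemma bonami:
  assumes "tlim V F"
  shows "EE (\<lambda>x. (PP (sqrt (1/3)) F x) ^ 4) \<le> (EE (\<lambda>x. (F x)\<^sup>2))\<^sup>2"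
proof -
  obtain Fn C where F: "\<And>n::nat. trig0 V (Fn n)" "\<And>n x. \<bar>Fn n x\<bar> \<le> C" "\<And>x. (\<lambda>n. Fn n x) \<longlonglongrightarrow> F x" "C \<ge> 0"
    using tlimE[OF assms] by metis
  have r: "0 \<le> sqrt (1/3)" "sqrt (1/3) \<le> 1" by auto
  note tF = trig0_tlim[OF F(1)]
  have t4: "tlim V (\<lambda>x. (PP (sqrt (1/3)) (Fn n) x) ^ 4)" and t2: "tlim V (\<lambda>x. (Fn n x)\<^sup>2)" for n
    using tlim_mult[OF tF tF, of n] tlim_PP[OF V tF[of n] r]
    by (auto simp: power4_eq_xxxx power2_eq_square intro!: tlim_mult)
  have b4: "\<bar>(PP (sqrt (1/3)) (Fn n) x) ^ 4\<bar> \<le> C ^ 4" and b2: "\<bar>(Fn n x)\<^sup>2\<bar> \<le> C\<^sup>2" for n x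
    unfolding power_abs by (rule power_mono, intro abs_PP_le[OF tF] F(2), simp)+
  have "(\<lambda>n. EE (\<lambda>x. (PP (sqrt (1/3)) (Fn n) x) ^ 4)) \<longlonglongrightarrow> EE (\<lambda>x. (PP (sqrt (1/3)) F x) ^ 4)"
    by (rule EE_lim[OF t4 b4]) (intro tendsto_power PP_lim[OF tF F(2,3)])
  moreover have "(\<lambda>n. (EE (\<lambda>x. (Fn n x)\<^sup>2))\<^sup>2) \<longlonglongrightarrow> (EE (\<lambda>x. (F x)\<^sup>2))\<^sup>2"
    by (intro tendsto_power EE_lim[OF t2 b2] F(3))
  ultimately show ?thesis by (rule LIMSEQ_le) (use bonami_trig[OF V F(1)] in auto)
qed

text \<open>Let \<open>Q\<close> be the left-hand side. Hypercontractivity bounds the fourth moment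
  of \<open>h = PP (1/3) \<phi>\<close> by \<open>Q\<^sup>2\<close>, and Young's inequality gives
  \<open>Q \<le> 3/4 * \<zeta> * EE \<phi> + B / (4 * \<zeta>^3) * Q\<^sup>2\<close>. The smallness
  of \<open>EE \<phi>\<close> makes the last term at most \<open>Q / 4\<close>.\<close>

lemma small_base:
  assumes \<phi>: "tlim V \<phi>" "\<And>x. 0 \<le> \<phi> x" "\<And>x. \<phi> x \<le> B" and B: "B \<ge> 1" and z: "\<zeta> > 0" and I: "EE \<phi> \<le> \<zeta> ^ 3 / B\<^sup>2"
  shows "EE (\<lambda>x. \<phi> x * PP (1/3) \<phi> x) \<le> \<zeta> * EE \<phi>"
proof -
  define h where "h = PP (1/3) \<phi>"
  define Q where "Q = EE (\<lambda>x. \<phi> x * h x)"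
  have th: "tlim V h" unfolding h_def by (rule tlim_PP[OF V \<phi>(1)]) auto
  have h0: "h x \<ge> 0" and hB: "h x \<le> B" for x unfolding h_def using PP_nonneg[of \<phi>] \<phi> abs_PP_le[OF \<phi>(1), of B "1/3" x] by (auto simp: abs_le_iff)
  have t4: "tlim V (\<lambda>x. h x ^ 4)" using th by (auto simp: power4_eq_xxxx intro!: tlim_mult)
  have h4: "EE (\<lambda>x. h x ^ 4) \<le> Q\<^sup>2"
  proof -
    have ts: "tlim V (PP (sqrt (1/3)) \<phi>)" by (rule tlim_PP[OF V \<phi>(1)]) auto
    have "h = PP (sqrt (1/3)) (PP (sqrt (1/3)) \<phi>)"
      by (rule ext) (subst PP_PP[OF V \<phi>(1)], auto simp: h_def)
    then have "EE (\<lambda>x. h x ^ 4) \<le> (EE (\<lambda>x. (PP (sqrt (1/3)) \<phi> x)\<^sup>2))\<^sup>2" using bonami[OF ts] by simp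
    also have "EE (\<lambda>x. (PP (sqrt (1/3)) \<phi> x)\<^sup>2) = Q" unfolding Q_def h_def by (rule EE_mult_PP[OF V \<phi>(1), symmetric]) auto
    finally show ?thesis .
  qed
  have pw: "\<phi> x * h x \<le> (3/4 * \<zeta>) * \<phi> x + (B / (4 * \<zeta>^3)) * h x ^ 4" for x
  proof -
    have "4 * \<zeta>^3 * h x \<le> 3 * \<zeta>^4 + h x ^ 4"
    proof -
      have "0 \<le> (h x - \<zeta>)\<^sup>2 * (2 * \<zeta>\<^sup>2 + (h x + \<zeta>)\<^sup>2)" by simp
      also have "\<dots> = h x ^ 4 + 3 * \<zeta> ^ 4 - 4 * \<zeta>^3 * h x" by (simp add: power2_eq_square power4_eq_xxxx power3_eq_cube algebra_simps)
      finally show ?thesis by simp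
    qed
    then have "h x \<le> 3/4 * \<zeta> + h x ^ 4 / (4 * \<zeta>^3)" using z by (simp add: field_simps power4_eq_xxxx power3_eq_cube)
    then have "\<phi> x * h x \<le> \<phi> x * (3/4 * \<zeta> + h x ^ 4 / (4 * \<zeta>^3))"
      by (rule mult_left_mono[OF _ \<phi>(2)])
    then have "\<phi> x * h x \<le> \<phi> x * (3/4 * \<zeta>) + \<phi> x * (h x ^ 4 / (4 * \<zeta>^3))"
      by (simp only: distrib_left)
    also have "\<phi> x * (h x ^ 4 / (4 * \<zeta>^3)) \<le> B * (h x ^ 4 / (4 * \<zeta>^3))"
      using z by (intro mult_right_mono \<phi>(3)) auto
    finally show ?thesis by (simp add: algebra_simps)
  qed
  have "Q \<le> EE (\<lambda>x. (3/4 * \<zeta>) * \<phi> x + (B / (4 * \<zeta>^3)) * h x ^ 4)" unfolding Q_def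
    by (intro EE_mono[of V] tlim_add tlim_cmult tlim_mult \<phi>(1) th t4 pw)
  also have "\<dots> = 3/4 * \<zeta> * EE \<phi> + B / (4 * \<zeta>^3) * EE (\<lambda>x. h x ^ 4)"
    by (subst EE_add[of V], (intro tlim_cmult \<phi>(1) t4)+) (simp only: EE_cmult)
  finally have A1: "Q \<le> 3/4 * \<zeta> * EE \<phi> + B / (4 * \<zeta>^3) * EE (\<lambda>x. h x ^ 4)" .
  have A2: "B / (4 * \<zeta>^3) * EE (\<lambda>x. h x ^ 4) \<le> B / (4 * \<zeta>^3) * Q\<^sup>2"
    using h4 B z by (intro mult_left_mono) auto
  have A3: "B / (4 * \<zeta>^3) * Q\<^sup>2 \<le> Q / 4"
  proof -
    have Q0: "Q \<ge> 0" unfolding Q_def using \<phi> h0 by (intro EE_nonneg) auto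
    have "Q \<le> EE (\<lambda>x. B * \<phi> x)" unfolding Q_def
      by (intro EE_mono[of V] tlim_mult[OF \<phi>(1) th] tlim_cmult \<phi>(1)) (rule order_trans[OF eq_refl[OF mult.commute] mult_right_mono[OF hB \<phi>(2)]])
    then have "Q \<le> B * EE \<phi>" by (simp add: EE_cmult)
    also have "\<dots> \<le> B * (\<zeta> ^ 3 / B\<^sup>2)" using I B by (intro mult_left_mono) auto
    also have "\<dots> = \<zeta>^3 / B" using B by (simp add: power2_eq_square)
    finally have "B * Q \<le> \<zeta>^3" using B by (simp add: field_simps)
    then have "B * Q * Q \<le> \<zeta>^3 * Q" using Q0 by (intro mult_right_mono) auto
    then show ?thesis using z by (simp add: field_simps power2_eq_square)
  qed
  have "Q \<le> \<zeta> * EE \<phi>" using A1 A2 A3 by linarith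
  then show ?thesis unfolding Q_def h_def .
qed

text \<open>Cauchy-Schwarz bounds the correlation at \<open>sqrt t\<close> by the norms of \<phi>
  and of \<open>PP (sqrt t) \<phi>\<close>; the square of the latter is the correlation at
  \<open>t\<close>. Smallness thus passes from \<open>t\<close> to \<open>sqrt t\<close>.\<close>

lemma small_step:
  assumes \<phi>: "tlim V \<phi>" "\<And>x. 0 \<le> \<phi> x" "\<And>x. \<phi> x \<le> B" and t: "0 \<le> t" "t \<le> 1"
    and le: "EE (\<lambda>x. \<phi> x * PP t \<phi> x) \<le> (\<zeta>\<^sup>2 / B) * EE \<phi>" and B: "B \<ge> 1" and z: "\<zeta> > 0"
  shows "EE (\<lambda>x. \<phi> x * PP (sqrt t) \<phi> x) \<le> \<zeta> * EE \<phi>"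
proof -
  have "(EE (\<lambda>x. \<phi> x * PP (sqrt t) \<phi> x))\<^sup>2 \<le> EE (\<lambda>x. (\<phi> x)\<^sup>2) * EE (\<lambda>x. (PP (sqrt t) \<phi> x)\<^sup>2)"
    by (rule EE_cauchy[OF V \<phi>(1) tlim_PP[OF V \<phi>(1)]]) (use t in auto)
  also have "EE (\<lambda>x. (PP (sqrt t) \<phi> x)\<^sup>2) = EE (\<lambda>x. \<phi> x * PP t \<phi> x)" using EE_mult_PP[OF V \<phi>(1) t] ..
  also have "EE (\<lambda>x. (\<phi> x)\<^sup>2) * EE (\<lambda>x. \<phi> x * PP t \<phi> x) \<le> (B * EE \<phi>) * ((\<zeta>\<^sup>2 / B) * EE \<phi>)"
  proof (intro mult_mono le)
    have "EE (\<lambda>x. (\<phi> x)\<^sup>2) \<le> EE (\<lambda>x. B * \<phi> x)" unfolding power2_eq_square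
      by (intro EE_mono[of V] tlim_mult tlim_cmult \<phi>(1)) (use \<phi> in \<open>simp add: mult_right_mono\<close>)
    then show "EE (\<lambda>x. (\<phi> x)\<^sup>2) \<le> B * EE \<phi>" by (simp add: EE_cmult)
  qed (use \<phi> B PP_nonneg[of \<phi>] EE_nonneg[of \<phi>] in \<open>auto intro!: EE_nonneg mult_nonneg_nonneg\<close>)
  also have "\<dots> = (\<zeta> * EE \<phi>)\<^sup>2" using B by (simp add: power2_eq_square)
  finally show ?thesis by (rule power2_le_imp_le) (use z EE_nonneg[of \<phi>] \<phi> in auto)
qed

end
end

text \<open>The parameters to which repeated use of \<open>small_step\<close> carries smallness from
  \<open>1/3\<close>; they tend to 1.\<close>

definition root_iter :: "nat => real" where
  "root_iter k = (sqrt ^^ k) (1/3)"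

lemma root_iter_bounds: "1/3 \<le> root_iter k" "root_iter k < 1" "1 - root_iter k \<le> (2/3) ^ k"
proof -
  have "1/3 \<le> root_iter k \<and> root_iter k < 1 \<and> 1 - root_iter k \<le> (2/3) ^ k"
  proof (induction k)
    case (Suc k)
    define t where "t = root_iter k"
    have t: "1/3 \<le> t" "t < 1" "1 - t \<le> (2/3)^k" using Suc by (auto simp: t_def)
    have st: "sqrt t < 1" "sqrt t \<ge> t" "sqrt t \<ge> 1/2" using t real_le_rsqrt[of "1/2" t] real_le_rsqrt[of t t]
      by (auto simp: power2_eq_square mult_left_le)
    have "1 - t = (1 - sqrt t) * (1 + sqrt t)" using t by (simp add: algebra_simps)
    moreover have "(1 - sqrt t) * (1 + sqrt t) \<ge> (1 - sqrt t) * (3/2)" using st by (intro mult_left_mono) auto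
    ultimately have "1 - sqrt t \<le> (2/3) * (1 - t)" by simp
    also have "\<dots> \<le> (2/3) * (2/3)^k" using t by simp
    finally have "1 - sqrt t \<le> (2/3)^(Suc k)" by simp
    then show ?case using st t by (simp add: root_iter_def t_def)
  qed (auto simp: root_iter_def)
  then show "1/3 \<le> root_iter k" "root_iter k < 1" "1 - root_iter k \<le> (2/3) ^ k" by auto
qed

lemma root_iter_near_1: assumes "\<epsilon> > 0" obtains k where "1 - root_iter k < \<epsilon>"
proof -
  obtain k where "(2/3::real) ^ k < \<epsilon>" using real_arch_pow_inv[of \<epsilon> "2/3"] assms by auto
  then show ?thesis using that[of k] root_iter_bounds(3)[of k] by linarith
qed

text \<open>The bound in \<open>PP_sD_le\<close> for \<open>PP s\<close> of a gradient component of
  a smoothed event. It is uniform in the smoothing width and integrable up to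
  \<open>s = 1\<close>.\<close>

definition tdens :: "real => real" where "tdens s = 2 / sqrt (1 - s\<^sup>2)"

lemma tdens_ge_1: "0 \<le> s ==> s < 1 ==> tdens s \<ge> 1"
proof -
  assume s: "0 \<le> s" "s < 1"
  have "0 < 1 - s\<^sup>2" using s by (simp add: power_less_one_iff abs_square_less_1)
  then have a: "0 < sqrt (1 - s\<^sup>2)" "sqrt (1 - s\<^sup>2) \<le> 1" by auto
  then have "sqrt (1 - s\<^sup>2) \<le> 2" by linarith
  then show ?thesis unfolding tdens_def using a(1) by (subst pos_le_divide_eq) auto
qed

lemma tdens_le: assumes "0 \<le> t" "t < 1" shows "tdens t \<le> 2 / sqrt (1 - t)"
proof -
  have "t\<^sup>2 \<le> t" using assms by (simp add: power2_eq_square mult_left_le)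
  then show ?thesis unfolding tdens_def using assms by (intro divide_left_mono) (auto simp: mult_pos_pos)
qed

lemma integral_inv_sqrt: assumes "\<tau> \<le> 1"
  shows "((\<lambda>t. 2 / sqrt (1 - t)) has_integral 4 * sqrt (1 - \<tau>)) {\<tau>..1}"
proof -
  have "((\<lambda>t. 2 / sqrt (1 - t)) has_integral (- 4 * sqrt (1 - 1) - (- 4 * sqrt (1 - \<tau>)))) {\<tau>..1}"
  proof (rule fundamental_theorem_of_calculus_interior[OF assms])
    show "continuous_on {\<tau>..1} (\<lambda>t. - 4 * sqrt (1 - t))" by (intro continuous_intros)
    fix x assume "x \<in> {\<tau><..<1}"
    then show "((\<lambda>t. - 4 * sqrt (1 - t)) has_vector_derivative 2 / sqrt (1 - x)) (at x)"
      unfolding has_real_derivative_iff_has_vector_derivative[symmetric]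
      by (auto intro!: derivative_eq_intros simp: field_simps)
  qed
  then show ?thesis by simp
qed

section \<open>Noise stability and the variance bound\<close>

context gauss begin

text \<open>Small-set expansion: correlations of \<open>\<phi>\<close> along the noise semigroup are negligible against
  the mean once the mean is small, at a rate that does not depend on the dimension.\<close>

lemma small_iter:
  assumes "B \<ge> 1"
  shows "\<forall>\<zeta>>0. \<exists>\<delta>>0. \<forall>V \<phi>. finite V --> tlim V \<phi> --> (\<forall>x. 0 \<le> \<phi> x \<and> \<phi> x \<le> B) --> EE \<phi> \<le> \<delta> -->
    EE (\<lambda>x. \<phi> x * PP (root_iter k) \<phi> x) \<le> \<zeta> * EE \<phi>"
proof (induction k)
  case 0
  show ?case
  proof (intro allI impI)
    fix \<zeta> :: real assume z: "\<zeta> > 0"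
    show "\<exists>\<delta>>0. \<forall>V \<phi>. finite V --> tlim V \<phi> --> (\<forall>x. 0 \<le> \<phi> x \<and> \<phi> x \<le> B) --> EE \<phi> \<le> \<delta> -->
      EE (\<lambda>x. \<phi> x * PP (root_iter 0) \<phi> x) \<le> \<zeta> * EE \<phi>"
      unfolding root_iter_def funpow_0
    proof (intro exI[of _ "\<zeta>^3 / B\<^sup>2"] conjI allI impI)
      fix V \<phi> assume a: "finite V" "tlim V \<phi>" "\<forall>x. 0 \<le> \<phi> x \<and> \<phi> x \<le> B" "EE \<phi> \<le> \<zeta>^3 / B\<^sup>2"
      show "EE (\<lambda>x. \<phi> x * PP (1/3) \<phi> x) \<le> \<zeta> * EE \<phi>"
        by (rule small_base[OF a(1,2) _ _ assms z a(4)]) (use a in auto)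
    qed (use assms z in auto)
  qed
next
  case (Suc k)
  show ?case
  proof (intro allI impI)
    fix \<zeta> :: real assume z: "\<zeta> > 0"
    then have "\<zeta>\<^sup>2 / B > 0" using assms by simp
    then obtain \<delta> where d: "\<delta> > 0" "\<And>V \<phi>. finite V ==> tlim V \<phi> ==> (\<And>x. 0 \<le> \<phi> x \<and> \<phi> x \<le> B) ==> EE \<phi> \<le> \<delta> ==>
      EE (\<lambda>x. \<phi> x * PP (root_iter k) \<phi> x) \<le> (\<zeta>\<^sup>2 / B) * EE \<phi>" using Suc by blast
    have r: "root_iter (Suc k) = sqrt (root_iter k)" by (simp add: root_iter_def)
    show "\<exists>\<delta>>0. \<forall>V \<phi>. finite V --> tlim V \<phi> --> (\<forall>x. 0 \<le> \<phi> x \<and> \<phi> x \<le> B) --> EE \<phi> \<le> \<delta> -->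
      EE (\<lambda>x. \<phi> x * PP (root_iter (Suc k)) \<phi> x) \<le> \<zeta> * EE \<phi>"
    proof (intro exI[of _ \<delta>] conjI allI impI d(1))
      fix V \<phi> assume a: "finite V" "tlim V \<phi>" "\<forall>x. 0 \<le> \<phi> x \<and> \<phi> x \<le> B" "EE \<phi> \<le> \<delta>"
      have 1: "EE (\<lambda>x. \<phi> x * PP (root_iter k) \<phi> x) \<le> (\<zeta>\<^sup>2 / B) * EE \<phi>" by (rule d(2)) (use a in auto)
      show "EE (\<lambda>x. \<phi> x * PP (root_iter (Suc k)) \<phi> x) \<le> \<zeta> * EE \<phi>"
        unfolding r by (rule small_step[OF a(1,2) _ _ _ _ 1 assms z]) (use a root_iter_bounds[of k] in auto)
    qed
  qed
qed

text \<open>No bound on \<psi> itself is uniform in the smoothing width, but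
  \<open>PP s \<psi>\<close> is bounded by \<open>tdens s\<close>, and \<open>small_iter\<close>
  applies to it. With \<open>s * s = r\<close>, the correlation of \<open>PP s \<psi>\<close> at
  parameter \<open>r\<close> is that of \<psi> at \<open>r\<^sup>2\<close>.\<close>

lemma small_energy:
  assumes z: "\<zeta> > 0"
  obtains \<tau> \<delta> where "0 \<le> \<tau>" "\<tau> < 1" "4 * sqrt (1 - \<tau>) \<le> \<zeta>" "\<delta> > 0"
    "\<And>V \<psi> t. finite V ==> tlim V \<psi> ==> (\<And>x. 0 \<le> \<psi> x) ==> (\<And>s x. 0 \<le> s ==> s < 1 ==> PP s \<psi> x \<le> tdens s) ==>
      EE \<psi> \<le> \<delta> ==> 0 \<le> t ==> t \<le> \<tau> ==> EE (\<lambda>x. \<psi> x * PP t \<psi> x) \<le> \<zeta> * EE \<psi>"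
proof -
  \<comment> \<open>For \<open>\<tau> = r\<^sup>2\<close> this gives
    \<open>1 - \<tau> \<le> 2 * (1 - r) \<le> \<zeta>\<^sup>2 / 16\<close>, hence
    \<open>4 * sqrt (1 - \<tau>) \<le> \<zeta>\<close>.\<close>
  obtain k where k: "1 - root_iter k < \<zeta>\<^sup>2 / 32" using root_iter_near_1[of "\<zeta>\<^sup>2/32"] z by auto
  define r where "r = root_iter k"
  define s where "s = sqrt r"
  have r: "1/3 \<le> r" "r < 1" unfolding r_def using root_iter_bounds by auto
  have s: "0 \<le> s" "s < 1" "s * s = r" unfolding s_def using r by auto
  define \<tau> where "\<tau> = s * (s * r)"
  have tau: "\<tau> = r\<^sup>2" unfolding \<tau>_def using s by (simp add: power2_eq_square mult.assoc[symmetric])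
  have t1: "\<tau> < 1" unfolding tau using r by (simp add: power_less_one_iff abs_square_less_1)
  obtain \<delta> where d: "\<delta> > 0" "\<And>V \<phi>. finite V ==> tlim V \<phi> ==> (\<And>x. 0 \<le> \<phi> x \<and> \<phi> x \<le> tdens s) ==> EE \<phi> \<le> \<delta> ==>
      EE (\<lambda>x. \<phi> x * PP r \<phi> x) \<le> \<zeta> * EE \<phi>"
    using small_iter[OF tdens_ge_1[OF s(1,2)], of k] z unfolding r_def by blast
  show ?thesis
  proof (rule that[of \<tau> \<delta>])
    have "1 - \<tau> = (1 - r) * (1 + r)" unfolding tau by (simp add: power2_eq_square algebra_simps)
    also have "\<dots> \<le> (1 - r) * 2" using r by (intro mult_left_mono) auto
    also have "\<dots> \<le> \<zeta>\<^sup>2 / 16" using k by (simp add: r_def)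
    finally have "sqrt (1 - \<tau>) \<le> sqrt ((\<zeta> / 4)\<^sup>2)" by (subst real_sqrt_le_iff) (simp add: power2_eq_square)
    then show "4 * sqrt (1 - \<tau>) \<le> \<zeta>" using z by simp
    fix V \<psi> t assume a: "finite V" "tlim V \<psi>" "\<And>x. 0 \<le> \<psi> x" "\<And>s x. 0 \<le> s ==> s < 1 ==> PP s \<psi> x \<le> tdens s"
      "EE \<psi> \<le> \<delta>" "0 \<le> t" "t \<le> \<tau>"
    have tP: "tlim V (PP s \<psi>)" using tlim_PP[OF a(1,2)] s by auto
    have e: "EE (PP s \<psi>) = EE \<psi>" using EE_PP[OF a(1,2)] s by auto
    have "EE (\<lambda>x. \<psi> x * PP t \<psi> x) \<le> EE (\<lambda>x. \<psi> x * PP \<tau> \<psi> x)"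
      by (rule EE_mult_PP_mono[OF a(1,2)]) (use a t1 in auto)
    also have "\<dots> = EE (\<lambda>x. PP s \<psi> x * PP (s * r) \<psi> x)" unfolding \<tau>_def
      by (rule EE_PP_PP[OF a(1,2,2), symmetric]) (use s r in \<open>auto intro: mult_le_one\<close>)
    also have "\<dots> = EE (\<lambda>x. PP s \<psi> x * PP r (PP s \<psi>) x)"
      by (subst PP_PP[OF a(1,2)]) (use s r in \<open>auto simp: mult.commute\<close>)
    also have "\<dots> \<le> \<zeta> * EE (PP s \<psi>)"
      by (rule d(2)[OF a(1) tP]) (use a s e PP_nonneg[of \<psi>] in auto)
    finally show "EE (\<lambda>x. \<psi> x * PP t \<psi> x) \<le> \<zeta> * EE \<psi>" using e by simp
  qed (use t1 d tau in auto)
qed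

text \<open>By \<open>cov_formula\<close> the variance is the integral of \<open>covK\<close>. Cross
  terms are reduced to diagonal ones by the arithmetic-geometric mean inequality, at the cost of the
  row sums \<open>K\<close>. Up to \<tau> the correlations are small. Beyond \<tau> the smoothing by
  \<open>PP t\<close> bounds them by \<open>tdens t\<close>, and the integral of
  \<open>2 / sqrt (1 - t)\<close> from \<tau> to 1 is \<open>4 * sqrt (1 - \<tau>)\<close>.\<close>

lemma variance_energy:
  fixes \<zeta> \<tau> K :: real
  assumes V: "finite V" and ne: "V \<noteq> {}" and F: "glim V F DF"
    and D0: "\<And>i x. i \<in> V ==> 0 \<le> DF i x"
    and DB: "\<And>i s x. i \<in> V ==> 0 \<le> s ==> s < 1 ==> PP s (DF i) x \<le> tdens s"
    and K: "\<And>i. i \<in> V ==> (\<Sum>j\<in>V. \<bar>S i j\<bar>) \<le> K"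
    and tau: "0 \<le> \<tau>" "\<tau> < 1" "4 * sqrt (1 - \<tau>) \<le> \<zeta>"
    and E: "\<And>i t. i \<in> V ==> 0 \<le> t ==> t \<le> \<tau> ==> EE (\<lambda>x. DF i x * PP t (DF i) x) \<le> \<zeta> * EE (DF i)"
  shows "EE (\<lambda>x. (F x)\<^sup>2) - (EE F)\<^sup>2 \<le> 2 * \<zeta> * K * (\<Sum>i\<in>V. EE (DF i))"
proof -
  note tD = glim_tlim_grad[OF F]
  define g where "g i t = EE (\<lambda>x. DF i x * PP t (DF i) x)" for i t
  define I where "I = (\<Sum>i\<in>V. EE (DF i))"
  have g0: "g i t \<ge> 0" if "i \<in> V" for i t unfolding g_def by (intro EE_nonneg mult_nonneg_nonneg D0 PP_nonneg that)
  have ED: "EE (DF i) \<ge> 0" if "i \<in> V" for i by (intro EE_nonneg D0 that)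
  have cross: "EE (\<lambda>x. DF i x * PP t (DF j) x) \<le> (g i t + g j t) / 2" if ij: "i \<in> V" "j \<in> V" and t: "0 \<le> t" "t \<le> 1" for i j t
  proof -
    have st: "0 \<le> sqrt t" "sqrt t \<le> 1" using t by auto
    define p q where "p = PP (sqrt t) (DF i)" and "q = PP (sqrt t) (DF j)"
    have tp: "tlim V p" and tq: "tlim V q" unfolding p_def q_def by (intro tlim_PP[OF V tD st] ij)+
    have t2: "tlim V (\<lambda>x. (p x)\<^sup>2)" "tlim V (\<lambda>x. (q x)\<^sup>2)" using tlim_mult[OF tp tp] tlim_mult[OF tq tq] by (auto simp: power2_eq_square)
    have "EE (\<lambda>x. DF i x * PP t (DF j) x) = EE (\<lambda>x. p x * q x)"
      using EE_PP_PP[OF V tD tD st st, OF ij] t by (simp add: p_def q_def)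
    also have "\<dots> \<le> EE (\<lambda>x. (1/2) * (p x)\<^sup>2 + (1/2) * (q x)\<^sup>2)"
    proof (rule EE_mono[OF tlim_mult[OF tp tq] tlim_add[OF tlim_cmult[OF t2(1)] tlim_cmult[OF t2(2)]]])
      fix x
      have "0 \<le> (p x - q x)\<^sup>2" by simp
      then show "p x * q x \<le> 1 / 2 * (p x)\<^sup>2 + 1 / 2 * (q x)\<^sup>2"
        by (simp add: power2_eq_square algebra_simps)
    qed
    also have "\<dots> = (1/2) * EE (\<lambda>x. (p x)\<^sup>2) + (1/2) * EE (\<lambda>x. (q x)\<^sup>2)"
      using EE_add[OF tlim_cmult[OF t2(1)] tlim_cmult[OF t2(2)], of "1/2" "1/2"] by (simp only: EE_cmult)
    also have "\<dots> = (g i t + g j t) / 2" unfolding g_def p_def q_def using EE_mult_PP[OF V tD t] ij by simp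
    finally show ?thesis .
  qed
  have covK_le: "covK V DF DF t \<le> K * (\<Sum>i\<in>V. g i t)" if t: "0 \<le> t" "t \<le> 1" for t
  proof -
    have "covK V DF DF t \<le> (\<Sum>i\<in>V. \<Sum>j\<in>V. \<bar>S i j\<bar> * ((g i t + g j t) / 2))"
      unfolding covK_def[OF V]
    proof (intro sum_mono)
      fix i j assume ij: "i \<in> V" "j \<in> V"
      have "0 \<le> EE (\<lambda>x. DF i x * PP t (DF j) x)" by (intro EE_nonneg mult_nonneg_nonneg D0 PP_nonneg ij)
      then have "S i j * EE (\<lambda>x. DF i x * PP t (DF j) x) \<le> \<bar>S i j\<bar> * EE (\<lambda>x. DF i x * PP t (DF j) x)"
        by (intro mult_right_mono) auto
      also have "\<dots> \<le> \<bar>S i j\<bar> * ((g i t + g j t) / 2)" by (intro mult_left_mono cross ij t) auto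
      finally show "S i j * EE (\<lambda>x. DF i x * PP t (DF j) x) \<le> \<bar>S i j\<bar> * ((g i t + g j t) / 2)" .
    qed
    also have "\<dots> = (\<Sum>i\<in>V. \<Sum>j\<in>V. \<bar>S i j\<bar> * g i t) / 2 + (\<Sum>i\<in>V. \<Sum>j\<in>V. \<bar>S i j\<bar> * g j t) / 2"
      by (simp add: sum.distrib[symmetric] sum_divide_distrib field_simps)
    also have "(\<Sum>i\<in>V. \<Sum>j\<in>V. \<bar>S i j\<bar> * g j t) = (\<Sum>i\<in>V. \<Sum>j\<in>V. \<bar>S i j\<bar> * g i t)"
      by (subst sum.swap) (simp add: S_sym)
    also have "(\<Sum>i\<in>V. \<Sum>j\<in>V. \<bar>S i j\<bar> * g i t) / 2 + (\<Sum>i\<in>V. \<Sum>j\<in>V. \<bar>S i j\<bar> * g i t) / 2 = (\<Sum>i\<in>V. (\<Sum>j\<in>V. \<bar>S i j\<bar>) * g i t)"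
      by (simp add: sum_distrib_right)
    also have "\<dots> \<le> (\<Sum>i\<in>V. K * g i t)" by (intro sum_mono mult_right_mono K g0)
    finally show ?thesis by (simp add: sum_distrib_left)
  qed
  have I0: "I \<ge> 0" unfolding I_def by (intro sum_nonneg ED)
  have K0: "K \<ge> 0"
  proof -
    obtain i where "i \<in> V" using ne by auto
    from order_trans[OF sum_nonneg K[OF this]] show ?thesis by simp
  qed
  have cov: "(covK V DF DF has_integral (EE (\<lambda>x. F x * F x) - EE F * EE F)) {0..1}" by (rule cov_formula[OF V F F])
  \<comment> \<open>At \<open>t = 1\<close> the weight \<open>w\<close> below is
    \<open>2 / sqrt 0 = 0\<close>, so the integrand is set to 0 at this point.\<close>
  have cov': "((\<lambda>t. if t = 1 then 0 else covK V DF DF t) has_integral (EE (\<lambda>x. F x * F x) - EE F * EE F)) {0..1}"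
    by (rule has_integral_spike_finite[OF _ _ cov, of "{1}"]) auto
  define w where "w t = (if t \<le> \<tau> then \<zeta> else 2 / sqrt (1 - t))" for t
  have w1: "(w has_integral (\<zeta> * \<tau>)) {0..\<tau>}"
  proof (rule has_integral_eq[of _ "\<lambda>_. \<zeta>"])
    show "((\<lambda>_. \<zeta>) has_integral \<zeta> * \<tau>) {0..\<tau>}" using has_integral_const_real[of \<zeta> 0 \<tau>] tau by (simp add: mult.commute)
  qed (simp add: w_def)
  have w2: "(w has_integral 4 * sqrt (1 - \<tau>)) {\<tau>..1}"
    by (rule has_integral_spike_finite[OF _ _ integral_inv_sqrt, of "{\<tau>}"]) (use tau in \<open>auto simp: w_def\<close>)
  have w: "(w has_integral (\<zeta> * \<tau> + 4 * sqrt (1 - \<tau>))) {0..1}"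
    by (rule has_integral_combine[OF _ _ w1 w2]) (use tau in auto)
  have "EE (\<lambda>x. F x * F x) - EE F * EE F \<le> (\<zeta> * \<tau> + 4 * sqrt (1 - \<tau>)) * (K * I)"
  proof (rule has_integral_le[OF cov' has_integral_mult_left[OF w]])
    fix t :: real assume t: "t \<in> {0..1}"
    show "(if t = 1 then 0 else covK V DF DF t) \<le> w t * (K * I)"
    proof (cases "t = 1")
      case True
      then show ?thesis using tau K0 I0 by (simp add: w_def)
    next
      case False
      then have t1: "0 \<le> t" "t < 1" using t by auto
      have "g i t \<le> w t * EE (DF i)" if i: "i \<in> V" for i
      proof (cases "t \<le> \<tau>")
        case True then show ?thesis using E[OF i t1(1)] unfolding g_def w_def by simp
      next
        case False
        have "g i t \<le> EE (\<lambda>x. tdens t * DF i x)" unfolding g_def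
        proof (rule EE_mono[OF tlim_mult[OF tD[OF i] tlim_PP[OF V tD[OF i]]] tlim_cmult[OF tD[OF i]]])
          show "DF i x * PP t (DF i) x \<le> tdens t * DF i x" for x
            by (subst mult.commute) (rule mult_right_mono[OF DB[OF i t1] D0[OF i]])
        qed (use t1 in auto)
        also have "\<dots> = tdens t * EE (DF i)" by (rule EE_cmult)
        also have "\<dots> \<le> w t * EE (DF i)" using tdens_le[OF t1] False ED[OF i] unfolding w_def by (intro mult_right_mono) auto
        finally show ?thesis .
      qed
      then have "K * (\<Sum>i\<in>V. g i t) \<le> K * (\<Sum>i\<in>V. w t * EE (DF i))" by (intro mult_left_mono sum_mono K0)
      then show ?thesis using covK_le[of t] t1 False unfolding I_def by (simp add: sum_distrib_left algebra_simps)
    qed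
  qed
  also have "\<dots> \<le> (2 * \<zeta>) * (K * I)"
  proof (intro mult_right_mono)
    have "0 \<le> 4 * sqrt (1 - \<tau>)" using tau by simp
    then have "\<zeta> \<ge> 0" using tau(3) by linarith
    then have "\<zeta> * \<tau> \<le> \<zeta>" using tau by (simp add: mult_left_le)
    then show "\<zeta> * \<tau> + 4 * sqrt (1 - \<tau>) \<le> 2 * \<zeta>" using tau by simp
  qed (use K0 I0 in auto)
  finally show ?thesis by (simp add: I_def power2_eq_square mult.assoc)
qed

end

section \<open>Threshold events\<close>

text \<open>A single variable is indexed by \<open>unit\<close>, so that the closure properties of
  \<open>trig0\<close> carry over.\<close>

definition trig1 :: "(real => real) => bool" where
  "trig1 w \<longleftrightarrow> trig0 (UNIV :: unit set) (\<lambda>x. w (x ()))"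

lemma trig1_trig0: assumes "trig1 w" "finite V" "i \<in> V" shows "trig0 V (\<lambda>x. w (x i))"
proof -
  obtain l where l: "\<And>x. of_real (w (x ())) = ev (UNIV :: unit set) l x" using assms by (auto simp: trig1_def trig0_def)
  let ?l = "map (\<lambda>p. (fst p, \<lambda>j. if j = i then snd p () else 0)) l"
  have m: "ls g ?l = ls (\<lambda>a. g (\<lambda>j. if j = i then a () else 0)) l" for g by (induction l) auto
  have "of_real (w (x i)) = ev V ?l x" for x
  proof -
    have "lin V (\<lambda>j. if j = i then a () else 0) x = lin UNIV a (\<lambda>_. x i)" for a :: "unit => real"
      using assms by (simp add: lin_def UNIV_unit if_distrib if_distribR cong: if_cong)
    then show ?thesis using l[of "\<lambda>_. x i"] by (simp add: ev_def m)
  qed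
  then show ?thesis unfolding trig0_def by blast
qed

lemma trig1_const: "trig1 (\<lambda>x. c)" by (simp add: trig1_def trig0_const)
lemma trig1_mult: "trig1 v ==> trig1 w ==> trig1 (\<lambda>x. v x * w x)" unfolding trig1_def by (rule trig0_mult)
lemma trig1_power: "trig1 w ==> trig1 (\<lambda>x. w x ^ k)" by (induction k) (auto intro: trig1_const trig1_mult)
lemma trig1_sum: "(\<And>i. i \<in> I ==> trig1 (w i)) ==> trig1 (\<lambda>x. \<Sum>i\<in>I. w i x)" unfolding trig1_def by (rule trig0_sum)

lemma trig1_sin: "trig1 (\<lambda>x. sin (b * x))"
  unfolding trig1_def trig0_def
  by (rule exI[of _ "[(- \<i> / 2, \<lambda>_. b), (\<i> / 2, \<lambda>_. - b)]"])
     (auto simp: ev_def lin_def UNIV_unit complex_eq_iff)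

lemma trig0_prod: "(\<And>i. i \<in> I ==> trig0 V (F i)) ==> trig0 V (\<lambda>x. \<Prod>i\<in>I. F i x)"
  by (induction I rule: infinite_finite_induct) (auto intro: trig0_const trig0_mult)

text \<open>Partial derivatives are unique, so a gradient computed by any means is the one attached
  to a representing list.\<close>

lemma trig_of_partial:
  assumes "finite V" "trig0 V F"
    and "\<And>i x. i \<in> V ==> ((\<lambda>t. F (x(i := x i + t))) has_real_derivative DF i x) (at 0)"
  shows "trig V F DF"
proof -
  obtain G where "trig V F G" using trig0_trig[OF assms(1,2)] by blast
  then obtain l where l: "\<And>x. of_real (F x) = ev V l x" and dl: "\<And>i x. i \<in> V ==> of_real (G i x) = ev V (dd i l) x"
    unfolding trig_def by blast
  have "G i x = DF i x" if i: "i \<in> V" for i x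
  proof -
    have "((\<lambda>t. complex_of_real (F (x(i := x i + t)))) has_vector_derivative of_real (G i x)) (at 0)"
      unfolding l dl[OF i] by (rule ev_has_vector_derivative[OF assms(1) i])
    from bounded_linear.has_vector_derivative[OF bounded_linear_Re this]
    have "((\<lambda>t. F (x(i := x i + t))) has_real_derivative G i x) (at 0)"
      by (simp add: has_real_derivative_iff_has_vector_derivative)
    then show ?thesis using assms(3)[OF i] DERIV_unique by blast
  qed
  then show ?thesis unfolding trig_def using l dl by (intro exI[of _ l]) auto
qed

definition step1 :: "(real => real) => (real => real) => bool" where
  "step1 U U' \<longleftrightarrow> (\<forall>x. (U has_real_derivative U' x) (at x)) \<and> continuous_on UNIV U' \<and>
    (\<exists>R. (\<forall>x. \<bar>x\<bar> \<ge> R --> U' x = 0) \<and> (\<forall>x\<le>-R. U x = 0))"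

lemma step1_shift: assumes "step1 U U'" shows "step1 (\<lambda>x. U (x + p)) (\<lambda>x. U' (x + p))"
proof -
  obtain R where R: "\<And>x. \<bar>x\<bar> \<ge> R ==> U' x = 0" "\<And>x. x \<le> -R ==> U x = 0" using assms by (auto simp: step1_def)
  show ?thesis unfolding step1_def
  proof (intro conjI allI exI[of _ "R + \<bar>p\<bar>"] impI)
    show "((\<lambda>x. U (x + p)) has_real_derivative U' (x + p)) (at x)" for x
      using assms by (intro iffD1[OF DERIV_shift]) (auto simp: step1_def)
    show "continuous_on UNIV (\<lambda>x. U' (x + p))"
      using assms by (auto simp: step1_def intro!: continuous_intros elim!: continuous_on_compose2)
  qed (auto intro!: R)
qed

lemma sin_lim: "(\<lambda>n. real (Suc n) * sin (x / real (Suc n))) \<longlonglongrightarrow> x"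
proof -
  have "((\<lambda>h. sin (x * h) / h) \<longlongrightarrow> x) (at 0)"
  proof -
    have "((\<lambda>h. sin (x * h)) has_real_derivative x) (at 0)" by (auto intro!: derivative_eq_intros)
    then show ?thesis by (simp add: has_field_derivative_iff)
  qed
  moreover have "filterlim (\<lambda>n. 1 / real (Suc n)) (at 0) sequentially"
    unfolding filterlim_at using LIMSEQ_inverse_real_of_nat by (auto simp: inverse_eq_divide)
  ultimately have "(\<lambda>n. sin (x * (1 / real (Suc n))) / (1 / real (Suc n))) \<longlonglongrightarrow> x"
    by (rule filterlim_compose)
  then show ?thesis by (simp add: field_simps)
qed

text \<open>\<open>N * sin (x / N)\<close> tends to \<open>x\<close>, and a polynomial in
  \<open>sin (x / N)\<close> is a trigonometric polynomial. Weierstrass approximation is applied to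
  the derivative and the result is integrated, so that function and derivative converge together. As
  the sine stays in \<open>{-1..1}\<close>, the bounds hold on the whole line.\<close>

lemma step1_approx:
  assumes "step1 U U'"
  obtains un un' C where "\<And>n::nat. trig1 (un n)" "\<And>n x. (un n has_real_derivative un' n x) (at x)"
    "\<And>n x. \<bar>un n x\<bar> \<le> C" "\<And>n x. \<bar>un' n x\<bar> \<le> C" "\<And>x. (\<lambda>n. un n x) \<longlonglongrightarrow> U x" "\<And>x. (\<lambda>n. un' n x) \<longlonglongrightarrow> U' x"
proof -
  obtain R0 where R0: "\<And>x. \<bar>x\<bar> \<ge> R0 ==> U' x = 0" "\<And>x. x \<le> -R0 ==> U x = 0" using assms by (auto simp: step1_def)
  obtain m :: nat where m: "real m > R0" using reals_Archimedean2 by blast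
  define R where "R = real m + 1"
  have R: "\<And>x. \<bar>x\<bar> \<ge> R ==> U' x = 0" "\<And>x. x \<le> -R ==> U x = 0" "R > 0" using m R0 by (auto simp: R_def)
  have dU: "\<And>x. (U has_real_derivative U' x) (at x)" and cU': "continuous_on UNIV U'" using assms by (auto simp: step1_def)
  have cU: "continuous_on UNIV U" using dU by (meson DERIV_isCont continuous_at_imp_continuous_on)
  obtain B where B: "\<And>x. \<bar>U' x\<bar> \<le> B" "B \<ge> 0"
  proof -
    have "bounded (U' ` {-R..R})" by (intro compact_imp_bounded compact_continuous_image continuous_on_subset[OF cU']) auto
    then obtain B where "\<forall>x\<in>{-R..R}. \<bar>U' x\<bar> \<le> B" by (auto simp: bounded_iff)
    then have "\<bar>U' x\<bar> \<le> max B 0" for x using R(1)[of x] by (cases "x \<in> {-R..R}") fastforce+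
    then show ?thesis using that by fastforce
  qed
  have Uconst: "U x = U R" if "x \<ge> R" for x
  proof (cases "x = R")
    case False
    then have "R < x" using that by simp
    then obtain z where "R < z" "U x - U R = (x - R) * U' z" using MVT2[of R x U U'] dU by auto
    then show ?thesis using R(1)[of z] by simp
  qed simp
  obtain D where D: "\<And>x. \<bar>U x\<bar> \<le> D"
  proof -
    have "bounded (U ` {-R..R})" by (intro compact_imp_bounded compact_continuous_image continuous_on_subset[OF cU]) auto
    then obtain D where "\<forall>x\<in>{-R..R}. \<bar>U x\<bar> \<le> D" by (auto simp: bounded_iff)
    then have D: "\<And>x. x \<in> {-R..R} ==> \<bar>U x\<bar> \<le> D" by blast
    have "\<bar>U x\<bar> \<le> D" for x using D[of x] D[of R] D[of "-R"] R(2)[of x] R(2)[of "-R"] Uconst[of x] R(3)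
      by (cases "x \<le> -R"; cases "x \<ge> R") auto
    then show ?thesis using that by blast
  qed
  \<comment> \<open>The offset \<open>m\<close> gives \<open>N n \<ge> R\<close> for every
    \<open>n\<close>, so that \<open>U\<close> vanishes at \<open>- N n\<close>, as the polynomial
    \<open>Q\<close> does at -1.\<close>
  define N where "N n = real (Suc (n + m))" for n
  have N: "N n \<ge> R" "N n \<ge> 1" "N n > 0" for n by (auto simp: N_def R_def)
  have "\<exists>q Q. (\<forall>y\<in>{-1..1}. \<bar>q y - N n * U' (N n * y)\<bar> \<le> 1 / N n) \<and> (\<forall>y. (Q has_real_derivative q y) (at y)) \<and>
      Q (-1) = 0 \<and> (\<exists>a k. Q = (\<lambda>y. \<Sum>i\<le>k. a i * y ^ i))" for n
  proof -
    have "continuous_on {-1..1} (\<lambda>y. N n * U' (N n * y))"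
      by (intro continuous_intros continuous_on_compose2[OF cU']) auto
    then obtain g where g: "real_polynomial_function g" "\<And>y. y \<in> {-1..1} ==> \<bar>N n * U' (N n * y) - g y\<bar> < 1 / N n"
      using Stone_Weierstrass_real_polynomial_function[of "{-1..1}" "\<lambda>y. N n * U' (N n * y)" "1 / N n"] N(3)[of n] by (auto simp: field_simps)
    then obtain a k where gk: "g = (\<lambda>y. \<Sum>i\<le>k. a i * y ^ i)" using real_polynomial_function_iff_sum by metis
    define Q0 where "Q0 y = (\<Sum>i\<le>k. a i / (real i + 1) * y ^ Suc i)" for y
    have Q0: "(Q0 has_real_derivative g y) (at y)" for y
      unfolding Q0_def gk
    proof (rule DERIV_sum)
      fix i
      have "((\<lambda>y. a i / (real i + 1) * y ^ Suc i) has_real_derivative a i / (real i + 1) * (real (Suc i) * y ^ (Suc i - Suc 0))) (at y)"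
        by (rule DERIV_cmult[OF DERIV_pow])
      moreover have "a i / (real i + 1) * (real (Suc i) * y ^ (Suc i - Suc 0)) = a i * y ^ i" by (simp add: field_simps)
      ultimately show "((\<lambda>y. a i / (real i + 1) * y ^ Suc i) has_real_derivative a i * y ^ i) (at y)" by simp
    qed
    define b where "b i = (case i of 0 => - Q0 (-1) | Suc j => a j / (real j + 1))" for i
    have Q: "Q0 y - Q0 (-1) = (\<Sum>i\<le>Suc k. b i * y ^ i)" for y
      unfolding sum.atMost_Suc_shift by (simp add: b_def Q0_def)
    have "((\<lambda>y. Q0 y - Q0 (-1)) has_real_derivative g y) (at y)" for y using Q0 by (auto intro!: derivative_eq_intros)
    then show ?thesis using g(2) Q
      by - (rule exI[of _ g], rule exI[of _ "\<lambda>y. Q0 y - Q0 (-1)"], auto simp: abs_minus_commute less_imp_le simp del: sum.atMost_Suc)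
  qed
  then have "\<forall>n. \<exists>p. (\<forall>y\<in>{-1..1}. \<bar>fst p y - N n * U' (N n * y)\<bar> \<le> 1 / N n) \<and> (\<forall>y. (snd p has_real_derivative fst p y) (at y)) \<and>
      snd p (-1) = 0 \<and> (\<exists>a k. snd p = (\<lambda>y. \<Sum>i\<le>k. a i * y ^ i))" by simp
  from choice[OF this] obtain p where p: "\<forall>n. (\<forall>y\<in>{-1..1}. \<bar>fst (p n) y - N n * U' (N n * y)\<bar> \<le> 1 / N n) \<and> (\<forall>y. (snd (p n) has_real_derivative fst (p n) y) (at y)) \<and>
      snd (p n) (-1) = 0 \<and> (\<exists>a k. snd (p n) = (\<lambda>y. \<Sum>i\<le>k. a i * y ^ i))" by (elim exE)
  define q Q where "q n = fst (p n)" and "Q n = snd (p n)" for n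
  have q: "\<bar>q n y - N n * U' (N n * y)\<bar> \<le> 1 / N n" if "y \<in> {-1..1}" for n y using p that by (simp add: q_def)
  have dQ: "(Q n has_real_derivative q n y) (at y)" for n y using p by (simp add: q_def Q_def)
  have Q1: "Q n (-1) = 0" for n using p by (simp add: Q_def)
  have Qp: "\<exists>a k. Q n = (\<lambda>y. \<Sum>i\<le>k. a i * y ^ i)" for n using p by (simp add: Q_def)
  have QU: "\<bar>Q n y - U (N n * y)\<bar> \<le> 2 / N n" if y: "y \<in> {-1..1}" for n y
  proof -
    have "\<bar>(Q n y - U (N n * y)) - (Q n (-1) - U (N n * (-1)))\<bar> \<le> 1 / N n * \<bar>y - (-1)\<bar>"
    proof -
      have "norm ((\<lambda>y. Q n y - U (N n * y)) y - (\<lambda>y. Q n y - U (N n * y)) (-1)) \<le> 1 / N n * norm (y - (-1))"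
      proof (rule field_differentiable_bound[of "{-1..1}"])
        fix z :: real assume z: "z \<in> {-1..1}"
        show "((\<lambda>y. Q n y - U (N n * y)) has_field_derivative (q n z - U' (N n * z) * N n)) (at z within {-1..1})"
          by (intro derivative_intros DERIV_chain'[where f="\<lambda>y. N n * y" and g=U] has_field_derivative_at_within[OF dQ] dU)
             (auto intro!: derivative_eq_intros DERIV_chain'[where f="\<lambda>y. N n * y" and g=U] dU)
        show "norm (q n z - U' (N n * z) * N n) \<le> 1 / N n" using q[OF z, of n] by (simp add: mult.commute)
      qed (use y in auto)
      then show ?thesis by simp
    qed
    moreover have "U (N n * (-1)) = 0" using R(2)[of "- N n"] N(1)[of n] by simp
    moreover have "1 / N n * \<bar>y - (-1)\<bar> \<le> 1 / N n * 2" using y N(3)[of n] by (intro mult_left_mono) auto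
    ultimately show ?thesis using Q1 by simp
  qed
  define un where "un n x = Q n (sin (x / N n))" for n x
  define un' where "un' n x = q n (sin (x / N n)) * cos (x / N n) / N n" for n x
  have sin1: "sin z \<in> {-1..1}" for z :: real by simp
  have limN: "(\<lambda>n. N n * sin (x / N n)) \<longlonglongrightarrow> x" for x
    using LIMSEQ_ignore_initial_segment[OF sin_lim, of m x] by (simp add: N_def)
  have lim1N: "(\<lambda>n. 1 / N n) \<longlonglongrightarrow> 0"
    using LIMSEQ_ignore_initial_segment[OF LIMSEQ_inverse_real_of_nat, of m] by (simp add: N_def inverse_eq_divide)
  have bound': "\<bar>un' n x - U' (N n * sin (x / N n)) * cos (x / N n)\<bar> \<le> 1 / N n" for n x
  proof -
    let ?s = "sin (x / N n)"
    have "un' n x - U' (N n * ?s) * cos (x / N n) = (q n ?s - N n * U' (N n * ?s)) * (cos (x / N n) / N n)"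
      using N(3)[of n] by (simp add: un'_def field_simps)
    also have "\<bar>\<dots>\<bar> \<le> (1 / N n) * 1"
      unfolding abs_mult
    proof (intro mult_mono q sin1)
      have "\<bar>cos (x / N n)\<bar> \<le> N n" using N(2)[of n] abs_cos_le_one[of "x / N n"] by linarith
      then show "\<bar>cos (x / N n) / N n\<bar> \<le> 1" using N(3)[of n] pos_divide_le_eq[OF N(3)[of n], of "\<bar>cos (x / N n)\<bar>" 1] by (simp add: abs_divide)
    qed (use N(3)[of n] in auto)
    finally show ?thesis by simp
  qed
  show ?thesis
  proof (rule that[of un un' "max (D + 2) (B + 1)"])
    fix n
    obtain a k where "Q n = (\<lambda>y. \<Sum>i\<le>k. a i * y ^ i)" using Qp by blast
    then show "trig1 (un n)" unfolding un_def
      using trig1_sin[of "1 / N n"] by (auto intro!: trig1_sum trig1_mult trig1_const trig1_power)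
    fix x
    show "(un n has_real_derivative un' n x) (at x)" unfolding un_def un'_def
      by (rule DERIV_chain2[OF dQ, THEN DERIV_cong]) (use N(3)[of n] in \<open>auto intro!: derivative_eq_intros\<close>)
    have "1 / N n \<le> 1" "2 / N n \<le> 2"
      using pos_divide_le_eq[OF N(3)[of n], of 1 1] pos_divide_le_eq[OF N(3)[of n], of 2 2] N(2)[of n] by simp_all
    then have "\<bar>un n x\<bar> \<le> D + 2" unfolding un_def using QU[OF sin1, of n "x / N n"] D[of "N n * sin (x / N n)"] by linarith
    then show "\<bar>un n x\<bar> \<le> max (D + 2) (B + 1)" by simp
    have "\<bar>U' (N n * sin (x / N n)) * cos (x / N n)\<bar> \<le> B * 1"
      unfolding abs_mult by (intro mult_mono B) auto
    then have "\<bar>un' n x\<bar> \<le> B + 1" using bound'[of n x] \<open>1 / N n \<le> 1\<close> by linarith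
    then show "\<bar>un' n x\<bar> \<le> max (D + 2) (B + 1)" by simp
  next
    fix x
    have "(\<lambda>n. U (N n * sin (x / N n))) \<longlonglongrightarrow> U x"
      using limN by (rule isCont_tendsto_compose[OF DERIV_isCont[OF dU]])
    moreover have "(\<lambda>n. un n x - U (N n * sin (x / N n))) \<longlonglongrightarrow> 0"
      by (rule Lim_null_comparison[OF _ tendsto_mult_right_zero[OF lim1N, of 2]]) (use QU[OF sin1] in \<open>auto simp: un_def\<close>)
    ultimately show "(\<lambda>n. un n x) \<longlonglongrightarrow> U x" using tendsto_add by fastforce
    have "(\<lambda>n. U' (N n * sin (x / N n))) \<longlonglongrightarrow> U' x"
      using limN cU' by (intro isCont_tendsto_compose[of _ U']) (auto simp: continuous_on_eq_continuous_at)
    moreover have "(\<lambda>n. cos (x / N n)) \<longlonglongrightarrow> cos 0"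
      using tendsto_mult_right_zero[OF lim1N, of x] by (intro tendsto_cos) simp
    ultimately have "(\<lambda>n. U' (N n * sin (x / N n)) * cos (x / N n)) \<longlonglongrightarrow> U' x * cos 0" by (rule tendsto_mult)
    moreover have "(\<lambda>n. un' n x - U' (N n * sin (x / N n)) * cos (x / N n)) \<longlonglongrightarrow> 0"
      by (rule Lim_null_comparison[OF _ lim1N]) (use bound' in auto)
    ultimately show "(\<lambda>n. un' n x) \<longlonglongrightarrow> U' x" using tendsto_add by fastforce
  qed
qed

text \<open>The multilinear extension of a set function. With smooth steps for \<open>u\<close>, it approximates the
  indicator of a threshold event by functions whose gradient is under control.\<close>

definition mext :: "'i set => ('i set => real) => ('i => real) => real" where
  "mext V A u = (\<Sum>S\<in>Pow V. A S * (\<Prod>i\<in>V. if i \<in> S then u i else 1 - u i))"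

lemma mext_insert: assumes "finite W" "i \<notin> W"
  shows "mext (insert i W) A u = u i * mext W (\<lambda>S. A (insert i S)) u + (1 - u i) * mext W A u"
proof -
  let ?w = "\<lambda>S. \<Prod>j\<in>insert i W. if j \<in> S then u j else 1 - u j"
  let ?v = "\<lambda>S. \<Prod>j\<in>W. if j \<in> S then u j else 1 - u j"
  have "mext (insert i W) A u = (\<Sum>S\<in>Pow W. A S * ?w S) + (\<Sum>S\<in>insert i ` Pow W. A S * ?w S)"
    unfolding mext_def Pow_insert using assms by (intro sum.union_disjoint) auto
  also have "(\<Sum>S\<in>insert i ` Pow W. A S * ?w S) = (\<Sum>S\<in>Pow W. A (insert i S) * ?w (insert i S))"
    using assms by (intro sum.reindex_cong[of "insert i"]) (auto simp: inj_on_def)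
  also have "(\<Sum>S\<in>Pow W. A (insert i S) * ?w (insert i S)) = (\<Sum>S\<in>Pow W. u i * (A (insert i S) * ?v S))"
  proof (intro sum.cong refl)
    fix S assume "S \<in> Pow W"
    have "(\<Prod>j\<in>W. if j \<in> insert i S then u j else 1 - u j) = ?v S" using assms(2) by (intro prod.cong) auto
    then have "?w (insert i S) = u i * ?v S" using assms by simp
    then show "A (insert i S) * ?w (insert i S) = u i * (A (insert i S) * ?v S)" by simp
  qed
  also have "(\<Sum>S\<in>Pow W. A S * ?w S) = (\<Sum>S\<in>Pow W. (1 - u i) * (A S * ?v S))"
  proof (intro sum.cong refl)
    fix S assume "S \<in> Pow W"
    then have "i \<notin> S" using assms(2) by auto
    then have "?w S = (1 - u i) * ?v S" using assms by simp
    then show "A S * ?w S = (1 - u i) * (A S * ?v S)" by simp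
  qed
  finally show ?thesis unfolding mext_def by (simp add: sum_distrib_left)
qed

lemma mext_empty [simp]: "mext {} A u = A {}" by (simp add: mext_def)

lemma mext_const: "finite V ==> mext V (\<lambda>_. c) u = c"
  by (induction V rule: finite_induct) (auto simp: mext_insert algebra_simps)

lemma mext_diff: "mext V (\<lambda>S. A S - B S) u = mext V A u - mext V B u"
  by (simp add: mext_def sum_subtractf algebra_simps)

lemma mext_cong: "(\<And>S. S \<subseteq> V ==> A S = B S) ==> (\<And>i. i \<in> V ==> u i = v i) ==> mext V A u = mext V B v"
  unfolding mext_def by (intro sum.cong refl arg_cong2[where f=times] prod.cong) auto

text \<open>Sets that miss an index with \<open>u i = 1\<close> or contain one with
  \<open>u i = 0\<close> have weight 0, so the sign of \<open>A\<close> matters only for the sets in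
  between. \<open>mext_sandwich\<close> and \<open>influence_bound\<close> rely on this.\<close>

lemma mext_nonneg:
  assumes "\<And>i. i \<in> V ==> 0 \<le> u i \<and> u i \<le> 1"
    and "\<And>S. S \<subseteq> V ==> {i\<in>V. u i = 1} \<subseteq> S ==> S \<subseteq> {i\<in>V. u i > 0} ==> 0 \<le> A S"
    and "finite V"
  shows "0 \<le> mext V A u"
  unfolding mext_def
proof (intro sum_nonneg)
  fix S assume S: "S \<in> Pow V"
  let ?w = "\<Prod>i\<in>V. if i \<in> S then u i else 1 - u i"
  have "?w \<ge> 0" using assms(1) by (intro prod_nonneg) auto
  show "0 \<le> A S * ?w"
  proof (cases "?w = 0")
    case False
    then have nz: "\<forall>i\<in>V. (if i \<in> S then u i else 1 - u i) \<noteq> 0" using assms(3) by (simp only: prod_zero_iff) blast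
    have 1: "u i > 0" if "i \<in> S" for i
    proof -
      have "i \<in> V" using that S by auto
      then show ?thesis using bspec[OF nz, of i] assms(1)[of i] that by simp
    qed
    have 2: "i \<in> S" if "i \<in> V" "u i = 1" for i
      using bspec[OF nz that(1)] that(2) by (cases "i \<in> S") simp_all
    have "0 \<le> A S" by (rule assms(2)) (use S 1 2 in blast)+
    then show ?thesis using \<open>?w \<ge> 0\<close> by simp
  qed simp
qed

lemma mext_mono:
  assumes "\<And>i. i \<in> V ==> 0 \<le> u i \<and> u i \<le> 1" "\<And>S. S \<subseteq> V ==> A S \<le> B S" "finite V"
  shows "mext V A u \<le> mext V B u"
  using mext_nonneg[OF assms(1), where A="\<lambda>S. B S - A S"] assms(2,3) by (simp add: mext_diff)

lemma mext_sandwich: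
  assumes "\<And>i. i \<in> V ==> 0 \<le> u i \<and> u i \<le> 1" "\<And>S T. S \<subseteq> T ==> T \<subseteq> V ==> A S \<le> A T" "finite V"
  shows "A {i\<in>V. u i = 1} \<le> mext V A u" "mext V A u \<le> A {i\<in>V. u i > 0}"
proof -
  have "0 \<le> mext V (\<lambda>S. A S - A {i\<in>V. u i = 1}) u"
    by (rule mext_nonneg[OF assms(1) _ assms(3)]) (auto intro: assms(2))
  then show "A {i\<in>V. u i = 1} \<le> mext V A u" by (simp add: mext_diff mext_const assms(3))
  have "0 \<le> mext V (\<lambda>S. A {i\<in>V. u i > 0} - A S) u"
    by (rule mext_nonneg[OF assms(1) _ assms(3)]) (auto intro: assms(2))
  then show "mext V A u \<le> A {i\<in>V. u i > 0}" by (simp add: mext_diff mext_const assms(3))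
qed

lemma mext_bound: assumes "\<And>i. i \<in> V ==> \<bar>u i\<bar> \<le> C" "C \<ge> 0"
  shows "\<bar>mext V A u\<bar> \<le> (\<Sum>S\<in>Pow V. \<bar>A S\<bar>) * (1 + C) ^ card V"
proof -
  have "\<bar>\<Prod>i\<in>V. if i \<in> S then u i else 1 - u i\<bar> \<le> (\<Prod>i\<in>V. 1 + C)" for S
    unfolding abs_prod
  proof (intro prod_mono conjI)
    fix i assume "i \<in> V"
    from assms(1)[OF this] assms(2) show "\<bar>if i \<in> S then u i else 1 - u i\<bar> \<le> 1 + C" by (cases "i \<in> S") simp_all
  qed simp
  then have "\<bar>mext V A u\<bar> \<le> (\<Sum>S\<in>Pow V. \<bar>A S\<bar> * (1 + C) ^ card V)"
    unfolding mext_def by (intro order_trans[OF sum_abs] sum_mono) (auto simp: abs_mult intro!: mult_left_mono)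
  then show ?thesis by (simp add: sum_distrib_right)
qed

lemma mext_tendsto: "(\<And>i. i \<in> V ==> ((\<lambda>n. u n i) \<longlongrightarrow> v i) F) ==> ((\<lambda>n. mext V A (u n)) \<longlongrightarrow> mext V A v) F"
  unfolding mext_def by (intro tendsto_sum tendsto_mult tendsto_const tendsto_prod) (auto intro!: tendsto_diff)

text \<open>For the indicator of an increasing event, this is the smoothed indicator that
  \<open>i\<close> is pivotal.\<close>

abbreviation mextd :: "'i set => ('i set => real) => 'i => ('i => real) => real" where
  "mextd V A i u \<equiv> mext (V - {i}) (\<lambda>S. A (insert i S) - A S) u"

lemma mext_partial:
  assumes "finite V" "i \<in> V" "(U i has_real_derivative D) (at (x i))"
  shows "((\<lambda>t. mext V A (\<lambda>j. U j ((x(i := x i + t)) j))) has_real_derivative D * mextd V A i (\<lambda>j. U j (x j))) (at 0)"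
proof -
  let ?u = "\<lambda>j. U j (x j)"
  have "mext V A (\<lambda>j. U j ((x(i := x i + t)) j)) = U i (x i + t) * mext (V - {i}) (\<lambda>S. A (insert i S)) ?u + (1 - U i (x i + t)) * mext (V - {i}) A ?u" for t
  proof -
    have e: "mext (V - {i}) B (\<lambda>j. U j ((x(i := x i + t)) j)) = mext (V - {i}) B ?u" for B by (rule mext_cong) auto
    have "V = insert i (V - {i})" using assms by auto
    then have "mext V A (\<lambda>j. U j ((x(i := x i + t)) j)) = mext (insert i (V - {i})) A (\<lambda>j. U j ((x(i := x i + t)) j))" by simp
    also have "\<dots> = U i (x i + t) * mext (V - {i}) (\<lambda>S. A (insert i S)) (\<lambda>j. U j ((x(i := x i + t)) j)) + (1 - U i (x i + t)) * mext (V - {i}) A (\<lambda>j. U j ((x(i := x i + t)) j))"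
      using assms by (subst mext_insert) auto
    finally show ?thesis by (simp only: e)
  qed
  then have f: "(\<lambda>t. mext V A (\<lambda>j. U j ((x(i := x i + t)) j))) = (\<lambda>t. U i (x i + t) * mext (V - {i}) (\<lambda>S. A (insert i S)) ?u + (1 - U i (x i + t)) * mext (V - {i}) A ?u)"
    by (rule ext)
  have "((\<lambda>t. U i (x i + t)) has_real_derivative D) (at 0)"
    using assms(3) DERIV_shift[of "U i" D 0 "x i"] by (simp add: add.commute)
  then have "((\<lambda>t. U i (x i + t) * mext (V - {i}) (\<lambda>S. A (insert i S)) ?u + (1 - U i (x i + t)) * mext (V - {i}) A ?u) has_real_derivative
     D * mext (V - {i}) (\<lambda>S. A (insert i S)) ?u + (0 - D) * mext (V - {i}) A ?u) (at 0)"
    by (intro DERIV_add DERIV_cmult_right DERIV_diff DERIV_const)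
  then show ?thesis unfolding f mext_diff by (simp add: algebra_simps)
qed

lemma glim_mext:
  assumes V: "finite V" and U: "\<And>i. i \<in> V ==> step1 (U i) (U' i)"
  shows "glim V (\<lambda>x. mext V A (\<lambda>i. U i (x i))) (\<lambda>i x. U' i (x i) * mextd V A i (\<lambda>i. U i (x i)))"
proof -
  have "\<forall>i\<in>V. \<exists>p. (\<forall>n. trig1 (fst p n)) \<and> (\<forall>n x. (fst p n has_real_derivative fst (snd p) n x) (at x)) \<and>
      (\<forall>n x. \<bar>fst p n x\<bar> \<le> snd (snd p)) \<and> (\<forall>n x. \<bar>fst (snd p) n x\<bar> \<le> snd (snd p)) \<and>
      (\<forall>x. (\<lambda>n. fst p n x) \<longlonglongrightarrow> U i x) \<and> (\<forall>x. (\<lambda>n. fst (snd p) n x) \<longlonglongrightarrow> U' i x)"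
  proof
    fix i assume "i \<in> V"
    from step1_approx[OF U[OF this]] obtain un un' C where *: "\<And>n::nat. trig1 (un n)" "\<And>n x. (un n has_real_derivative un' n x) (at x)"
    "\<And>n x. \<bar>un n x\<bar> \<le> C" "\<And>n x. \<bar>un' n x\<bar> \<le> C" "\<And>x. (\<lambda>n. un n x) \<longlonglongrightarrow> U i x" "\<And>x. (\<lambda>n. un' n x) \<longlonglongrightarrow> U' i x" by blast
    show "\<exists>p. (\<forall>n. trig1 (fst p n)) \<and> (\<forall>n x. (fst p n has_real_derivative fst (snd p) n x) (at x)) \<and>
      (\<forall>n x. \<bar>fst p n x\<bar> \<le> snd (snd p)) \<and> (\<forall>n x. \<bar>fst (snd p) n x\<bar> \<le> snd (snd p)) \<and>
      (\<forall>x. (\<lambda>n. fst p n x) \<longlonglongrightarrow> U i x) \<and> (\<forall>x. (\<lambda>n. fst (snd p) n x) \<longlonglongrightarrow> U' i x)"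
      by (rule exI[of _ "(un, un', C)"]) (simp add: *)
  qed
  from bchoice[OF this] obtain p where p: "\<forall>i\<in>V. (\<forall>n. trig1 (fst (p i) n)) \<and> (\<forall>n x. (fst (p i) n has_real_derivative fst (snd (p i)) n x) (at x)) \<and>
      (\<forall>n x. \<bar>fst (p i) n x\<bar> \<le> snd (snd (p i))) \<and> (\<forall>n x. \<bar>fst (snd (p i)) n x\<bar> \<le> snd (snd (p i))) \<and>
      (\<forall>x. (\<lambda>n. fst (p i) n x) \<longlonglongrightarrow> U i x) \<and> (\<forall>x. (\<lambda>n. fst (snd (p i)) n x) \<longlonglongrightarrow> U' i x)" by (elim exE)
  define un un' C where "un i = fst (p i)" and "un' i = fst (snd (p i))" and "C = (\<Sum>i\<in>V. \<bar>snd (snd (p i))\<bar>)" for i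
  have C: "\<bar>snd (snd (p i))\<bar> \<le> C" if "i \<in> V" for i unfolding C_def by (rule member_le_sum) (use V that in auto)
  have C0: "C \<ge> 0" unfolding C_def by (intro sum_nonneg) auto
  have u: "trig1 (un i n)" "(un i n has_real_derivative un' i n x) (at x)" "\<bar>un i n x\<bar> \<le> C" "\<bar>un' i n x\<bar> \<le> C"
    "(\<lambda>n. un i n x) \<longlonglongrightarrow> U i x" "(\<lambda>n. un' i n x) \<longlonglongrightarrow> U' i x" if "i \<in> V" for i n x
    using p C[OF that] that unfolding un_def un'_def
    by (auto intro: order_trans[OF _ order_trans[OF abs_ge_self C[OF that]]])
  define K0 where "K0 W B = (\<Sum>S\<in>Pow W. \<bar>B S\<bar>) * (1 + C) ^ card W" for W and B :: "'a set => real"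
  have K00: "K0 W B \<ge> 0" for W B unfolding K0_def using C0 by (auto intro!: mult_nonneg_nonneg sum_nonneg)
  define K where "K = K0 V A + (\<Sum>i\<in>V. C * K0 (V - {i}) (\<lambda>S. A (insert i S) - A S))"
  have Ki: "C * K0 (V - {i}) (\<lambda>S. A (insert i S) - A S) \<le> K" if "i \<in> V" for i
  proof -
    have "C * K0 (V - {i}) (\<lambda>S. A (insert i S) - A S) \<le> (\<Sum>i\<in>V. C * K0 (V - {i}) (\<lambda>S. A (insert i S) - A S))"
      by (rule member_le_sum[OF that]) (use V C0 K00 in auto)
    then show ?thesis unfolding K_def using K00[of V A] by linarith
  qed
  have KV: "K0 V A \<le> K" unfolding K_def using sum_nonneg[of V "\<lambda>i. C * K0 (V - {i}) (\<lambda>S. A (insert i S) - A S)"] C0 K00 by simp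
  show ?thesis unfolding glim_def
  proof (intro exI conjI allI ballI)
    fix n
    show "trig V (\<lambda>x. mext V A (\<lambda>i. un i n (x i))) (\<lambda>i x. un' i n (x i) * mextd V A i (\<lambda>i. un i n (x i)))"
    proof (rule trig_of_partial[OF V])
      show "trig0 V (\<lambda>x. mext V A (\<lambda>i. un i n (x i)))" unfolding mext_def
      proof (intro trig0_sum trig0_cmult trig0_prod)
        fix S i assume "i \<in> V"
        then have "trig0 V (\<lambda>x. un i n (x i))" using trig1_trig0[OF u(1) V] by blast
        then show "trig0 V (\<lambda>x. if i \<in> S then un i n (x i) else 1 - un i n (x i))"
          by (cases "i \<in> S") (auto intro!: trig0_diff trig0_const)
      qed
      show "((\<lambda>t. mext V A (\<lambda>j. un j n ((x(i := x i + t)) j))) has_real_derivative un' i n (x i) * mextd V A i (\<lambda>i. un i n (x i))) (at 0)" if "i \<in> V" for i x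
        by (rule mext_partial[OF V that, of "\<lambda>j. un j n", OF u(2)[OF that]])
    qed
    fix x
    show "\<bar>mext V A (\<lambda>i. un i n (x i))\<bar> \<le> K" using mext_bound[of V "\<lambda>i. un i n (x i)" C A] u(3) C0 KV unfolding K0_def by fastforce
    fix i assume i: "i \<in> V"
    have "\<bar>un' i n (x i) * mextd V A i (\<lambda>i. un i n (x i))\<bar> \<le> C * K0 (V - {i}) (\<lambda>S. A (insert i S) - A S)"
      unfolding abs_mult K0_def by (intro mult_mono u(4) i mext_bound u(3) C0) auto
    then show "\<bar>un' i n (x i) * mextd V A i (\<lambda>i. un i n (x i))\<bar> \<le> K" using Ki[OF i] by linarith
  next
    fix x show "(\<lambda>n. mext V A (\<lambda>i. un i n (x i))) \<longlonglongrightarrow> mext V A (\<lambda>i. U i (x i))"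
      by (rule mext_tendsto) (rule u(5))
  next
    fix x i assume i: "i \<in> V"
    show "(\<lambda>n. un' i n (x i) * mextd V A i (\<lambda>i. un i n (x i))) \<longlonglongrightarrow> U' i (x i) * mextd V A i (\<lambda>i. U i (x i))"
      by (intro tendsto_mult u(6) i mext_tendsto u(5)) auto
  qed
qed

section \<open>Smooth approximations of a threshold\<close>

definition is_step :: "real => (real => real) => (real => real) => bool" where
  "is_step \<eta> U U' \<longleftrightarrow> step1 U U' \<and> (\<forall>x. 0 \<le> U x \<and> U x \<le> 1) \<and> (\<forall>x\<le>-\<eta>. U x = 0) \<and> (\<forall>x\<ge>\<eta>. U x = 1) \<and>
     (\<forall>x. 0 \<le> U' x \<and> U' x \<le> 1 / \<eta>) \<and> (\<forall>x. \<bar>x\<bar> \<ge> \<eta> --> U' x = 0)"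

lemma is_step_exists: assumes "\<eta> > 0" shows "\<exists>U U'. is_step \<eta> U U'"
proof -
  \<comment> \<open>A tent with base \<open>2 * \<eta>\<close> and height \<open>1 / \<eta>\<close>,
    so that its integral is 1.\<close>
  define w where "w x = max 0 (1 - \<bar>x\<bar> / \<eta>) / \<eta>" for x
  define U where "U x = integral {-\<eta>..x} w" for x
  have cw: "continuous_on A w" for A unfolding w_def using assms by (intro continuous_intros) auto
  have w0: "w x = 0" if "\<bar>x\<bar> \<ge> \<eta>" for x
  proof -
    have "1 \<le> \<bar>x\<bar> / \<eta>" using that assms by (simp add: le_divide_eq)
    then show ?thesis unfolding w_def by simp
  qed
  have wge: "w x \<ge> 0" for x unfolding w_def using assms by auto
  have wle: "w x \<le> 1 / \<eta>" for x unfolding w_def using assms by (intro divide_right_mono) auto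
  have U0: "U x = 0" if "x \<le> -\<eta>" for x
    using that unfolding U_def by (cases "x = -\<eta>") auto
  have dU: "(U has_real_derivative w x) (at x)" for x
  proof (cases "x < -\<eta>")
    case True
    have "((\<lambda>_. 0) has_real_derivative w x) (at x)" using w0[of x] True by simp
    then show ?thesis
      by (rule has_field_derivative_transform_within_open[where S="{..<-\<eta>}"]) (use True U0 in auto)
  next
    case False
    \<comment> \<open>Starting the integral at \<open>- \<eta> - 1\<close> makes every
      \<open>x \<ge> - \<eta>\<close> an interior point, including
      \<open>x = - \<eta>\<close>.\<close>
    have e: "U y = integral {-\<eta>-1..y} w" if "y > -\<eta>-1" for y
    proof (cases "y < - \<eta>")
      case True
      have "integral {-\<eta>-1..y} w = integral {-\<eta>-1..y} (\<lambda>_. 0)" by (rule integral_cong) (use True w0 assms in auto)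
      then show ?thesis using U0[of y] True by simp
    next
      case False
      have "integral {-\<eta>-1..-\<eta>} w + integral {-\<eta>..y} w = integral {-\<eta>-1..y} w"
        using False by (intro Henstock_Kurzweil_Integration.integral_combine integrable_continuous_real cw) auto
      moreover have "integral {-\<eta>-1..-\<eta>} w = integral {-\<eta>-1..-\<eta>} (\<lambda>_. 0)" by (rule integral_cong) (use w0 assms in auto)
      ultimately show ?thesis unfolding U_def by simp
    qed
    have "((\<lambda>y. integral {-\<eta>-1..y} w) has_real_derivative w x) (at x within {-\<eta>-1..x+1})"
      by (rule integral_has_real_derivative[OF cw]) (use False in auto)
    then have "((\<lambda>y. integral {-\<eta>-1..y} w) has_real_derivative w x) (at x)"
      by (subst (asm) at_within_interior) (use False in auto)
    then show ?thesis
      by (rule has_field_derivative_transform_within_open[where S="{-\<eta>-1<..}"]) (use False e in auto)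
  qed
  have Umono: "U x \<le> U y" if "x \<le> y" for x y
    by (rule DERIV_nonneg_imp_nondecreasing[OF that]) (use dU wge in auto)
  have U1: "U \<eta> = 1"
  proof -
    have "((\<lambda>x. 1/\<eta> - (x + x)/(2 * \<eta> * \<eta>)) has_integral ((\<eta> / \<eta> - \<eta> * \<eta> / (2 * \<eta> * \<eta>)) - (0/\<eta> - 0 * 0 / (2 * \<eta> * \<eta>)))) {0..\<eta>}"
      by (rule fundamental_theorem_of_calculus)
         (use assms in \<open>auto intro!: derivative_eq_intros simp: has_real_derivative_iff_has_vector_derivative[symmetric] field_simps\<close>)
    then have "((\<lambda>x. 1/\<eta> - (x + x)/(2 * \<eta> * \<eta>)) has_integral 1/2) {0..\<eta>}" using assms by simp
    then have h1: "(w has_integral 1/2) {0..\<eta>}"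
      by (rule has_integral_eq[rotated]) (use assms in \<open>auto simp: w_def field_simps\<close>)
    then have "((\<lambda>x. w (- x)) has_integral 1/2) {-\<eta>..-0}" by (subst has_integral_reflect_real) simp
    moreover have "w (- x) = w x" for x by (simp add: w_def)
    ultimately have h2: "(w has_integral 1/2) {-\<eta>..0}" by simp
    have "(w has_integral (1/2 + 1/2)) {-\<eta>..\<eta>}" by (rule has_integral_combine[OF _ _ h2 h1]) (use assms in auto)
    then show ?thesis unfolding U_def by (simp add: integral_unique)
  qed
  have Uge: "U x = 1" if "x \<ge> \<eta>" for x
  proof (cases "x = \<eta>")
    case False
    then have "\<eta> < x" using that by simp
    then obtain z where "\<eta> < z" "U x - U \<eta> = (x - \<eta>) * w z" using MVT2[of \<eta> x U w] dU by auto
    then show ?thesis using w0[of z] U1 by simp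
  qed (simp add: U1)
  have U01: "0 \<le> U x \<and> U x \<le> 1" for x
    using Umono[of "-\<eta>" x] Umono[of x "-\<eta>"] U0[of x] U0[of "-\<eta>"] Umono[of x \<eta>] Uge[of x] U1 by (cases "x \<le> -\<eta>"; cases "x \<ge> \<eta>") auto
  have "is_step \<eta> U w" unfolding is_step_def step1_def
    using dU cw U0 Uge U01 wge wle w0 by (auto intro!: exI[of _ \<eta>])
  then show ?thesis by blast
qed

section \<open>Laws of threshold events\<close>

lemma tlim_law:
  assumes g: "gauss M X S" "gauss N Y T" and V: "finite V" and F: "tlim V F"
    and ST: "\<And>i j. i \<in> V ==> j \<in> V ==> S i j = T i j"
  shows "(LINT \<omega>|M. F (\<lambda>i. X i \<omega>)) = (LINT \<omega>|N. F (\<lambda>i. Y i \<omega>))"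
proof -
  interpret A: gauss M X S by fact
  interpret B: gauss N Y T by fact
  have bil: "bil S V a a = bil T V a a" for a unfolding bil_def by (intro sum.cong refl) (simp add: ST)
  obtain Fn C where F: "\<And>n::nat. trig0 V (Fn n)" "\<And>n x. \<bar>Fn n x\<bar> \<le> C" "\<And>x. (\<lambda>n. Fn n x) \<longlonglongrightarrow> F x"
    by (rule tlimE[OF F]) blast
  have "A.EE (Fn n) = B.EE (Fn n)" for n
  proof -
    obtain l where l: "\<And>x. of_real (Fn n x) = ev V l x" using F(1)[of n] by (auto simp: trig0_def)
    have "complex_of_real (A.EE (Fn n)) = of_real (B.EE (Fn n))"
      unfolding A.EE_trig0[OF V l] B.EE_trig0[OF V l] A.mean_def B.mean_def bil ..
    then show ?thesis by simp
  qed
  then have "(\<lambda>n. B.EE (Fn n)) \<longlonglongrightarrow> A.EE F"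
    using A.EE_lim[OF trig0_tlim[OF F(1)] F(2,3)] by simp
  then have "A.EE F = B.EE F" using B.EE_lim[OF trig0_tlim[OF F(1)] F(2,3)] by (rule LIMSEQ_unique)
  then show ?thesis unfolding A.EE_def B.EE_def .
qed

lemma mext_01: assumes "finite V" "\<And>i. i \<in> V ==> u i = (if P i then 1 else 0)"
  shows "mext V A u = A {i\<in>V. P i}"
proof -
  have "A {i\<in>V. P i} - mext V A u = 0"
  proof -
    have "0 \<le> mext V (\<lambda>S. A S - A {i\<in>V. P i}) u" "0 \<le> mext V (\<lambda>S. A {i\<in>V. P i} - A S) u"
    proof -
      have "{i\<in>V. u i = 1} = {i\<in>V. P i}" "{i\<in>V. u i > 0} = {i\<in>V. P i}"
        using assms(2) by (auto split: if_splits)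
      then have *: "S = {i\<in>V. P i}" if "S \<subseteq> V" "{i\<in>V. u i = 1} \<subseteq> S" "S \<subseteq> {i\<in>V. u i > 0}" for S
        using that by auto
      show "0 \<le> mext V (\<lambda>S. A S - A {i\<in>V. P i}) u"
      proof (rule mext_nonneg[OF _ _ assms(1)])
        show "0 \<le> u i \<and> u i \<le> 1" if "i \<in> V" for i using assms(2)[OF that] by simp
      qed (simp add: *[symmetric])
      show "0 \<le> mext V (\<lambda>S. A {i\<in>V. P i} - A S) u"
      proof (rule mext_nonneg[OF _ _ assms(1)])
        show "0 \<le> u i \<and> u i \<le> 1" if "i \<in> V" for i using assms(2)[OF that] by simp
      qed (simp add: *[symmetric])
    qed
    then show ?thesis by (simp add: mext_diff mext_const assms(1))
  qed
  then show ?thesis by simp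
qed

context gauss begin

definition sev :: "'i set => ('i => real) => ('i set => bool) => 'w set" where
  "sev V c E = {\<omega> \<in> space M. E {v\<in>V. X v \<omega> \<ge> c v}}"

lemma sev_meas [measurable]: assumes "finite V" shows "sev V c E \<in> sets M"
proof -
  have "sev V c E = (\<Union>S\<in>{S\<in>Pow V. E S}. {\<omega> \<in> space M. \<forall>v\<in>V. (X v \<omega> \<ge> c v) = (v \<in> S)})"
  proof (intro equalityI subsetI)
    fix \<omega> assume "\<omega> \<in> sev V c E"
    then show "\<omega> \<in> (\<Union>S\<in>{S\<in>Pow V. E S}. {\<omega> \<in> space M. \<forall>v\<in>V. (X v \<omega> \<ge> c v) = (v \<in> S)})"
      unfolding sev_def by (intro UN_I[of "{v\<in>V. X v \<omega> \<ge> c v}"]) auto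
  next
    fix \<omega> assume "\<omega> \<in> (\<Union>S\<in>{S\<in>Pow V. E S}. {\<omega> \<in> space M. \<forall>v\<in>V. (X v \<omega> \<ge> c v) = (v \<in> S)})"
    then obtain S where S: "S \<subseteq> V" "E S" "\<omega> \<in> space M" "\<forall>v\<in>V. (X v \<omega> \<ge> c v) = (v \<in> S)" by auto
    then have "{v\<in>V. X v \<omega> \<ge> c v} = S" by auto
    then show "\<omega> \<in> sev V c E" using S by (simp add: sev_def)
  qed
  also have "\<dots> \<in> sets M"
  proof (intro sets.finite_UN)
    show "finite {S \<in> Pow V. E S}" using assms by auto
    fix S
    have "{\<omega> \<in> space M. (X v \<omega> \<ge> c v) = (v \<in> S)} \<in> sets M" for v by measurable
    then show "{\<omega> \<in> space M. \<forall>v\<in>V. (X v \<omega> \<ge> c v) = (v \<in> S)} \<in> sets M"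
      using assms by (intro sets.sets_Collect_finite_All) auto
  qed
  finally show ?thesis .
qed

end

lemma sev_law:
  assumes g: "gauss M X S" "gauss N Y T" and V: "finite V"
    and ST: "\<And>i j. i \<in> V ==> j \<in> V ==> S i j = T i j"
  shows "measure M (gauss.sev M X V c E) = measure N (gauss.sev N Y V c E)"
proof -
  interpret A: gauss M X S by fact
  interpret B: gauss N Y T by fact
  have "\<forall>n. \<exists>p. is_step (1 / real (Suc n)) (fst p) (snd p)"
  proof
    fix n
    obtain U U' where "is_step (1 / real (Suc n)) U U'" using is_step_exists[of "1 / real (Suc n)"] by auto
    then show "\<exists>p. is_step (1 / real (Suc n)) (fst p) (snd p)" by (intro exI[of _ "(U, U')"]) simp
  qed
  from choice[OF this] obtain p where p: "\<And>n. is_step (1 / real (Suc n)) (fst (p n)) (snd (p n))" by blast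
  \<comment> \<open>The step is moved so that it has the value 1 from \<open>c i\<close> on. The
    limit is then the indicator of the closed half-line, also at its end point.\<close>
  define u where "u n i y = fst (p n) (y + (1 / real (Suc n) - c i))" for n i y
  define A where "A S = (of_bool (E S) :: real)" for S
  define Fn where "Fn n x = mext V A (\<lambda>i. u n i (x i))" for n x
  define F where "F x = A {i\<in>V. x i \<ge> c i}" for x
  have s: "step1 (u n i) (\<lambda>y. snd (p n) (y + (1 / real (Suc n) - c i)))" for n i
    unfolding u_def using p[of n] by (intro step1_shift) (simp add: is_step_def)
  have u01: "0 \<le> u n i y \<and> u n i y \<le> 1" for n i y using p[of n] by (simp add: u_def is_step_def)
  have t: "tlim V (Fn n)" for n unfolding Fn_def by (rule glim_tlim[OF glim_mext[OF V s]])
  have b: "\<bar>Fn n x\<bar> \<le> 1" for n x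
  proof -
    have "0 \<le> Fn n x" unfolding Fn_def by (rule mext_nonneg[OF _ _ V]) (use u01 in \<open>auto simp: A_def\<close>)
    moreover have "Fn n x \<le> mext V (\<lambda>_. 1) (\<lambda>i. u n i (x i))" unfolding Fn_def
      by (rule mext_mono[OF _ _ V]) (use u01 in \<open>auto simp: A_def\<close>)
    ultimately show ?thesis by (simp add: mext_const V)
  qed
  have l: "(\<lambda>n. Fn n x) \<longlonglongrightarrow> F x" for x
  proof -
    have "(\<lambda>n. u n i (x i)) \<longlonglongrightarrow> (if x i \<ge> c i then 1 else 0)" for i
    proof (cases "x i \<ge> c i")
      case True
      then have "u n i (x i) = 1" for n using p[of n] by (simp add: u_def is_step_def)
      then show ?thesis using True by simp
    next
      case False
      then obtain N where N: "2 / real (Suc N) < c i - x i" using reals_Archimedean[of "(c i - x i) / 2"] by (auto simp: field_simps)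
      have "u n i (x i) = 0" if "n \<ge> N" for n
      proof -
        have "2 / real (Suc n) \<le> 2 / real (Suc N)" using that by (intro divide_left_mono) auto
        then have "x i + (1 / real (Suc n) - c i) \<le> - (1 / real (Suc n))" using N by linarith
        then show ?thesis using p[of n] unfolding u_def is_step_def by blast
      qed
      then have "eventually (\<lambda>n. u n i (x i) = 0) sequentially" by (auto simp: eventually_sequentially)
      then show ?thesis using False by (simp add: tendsto_eventually)
    qed
    then have "(\<lambda>n. Fn n x) \<longlonglongrightarrow> mext V A (\<lambda>i. if x i \<ge> c i then 1 else 0)" unfolding Fn_def by (intro mext_tendsto)
    then show ?thesis by (simp add: F_def mext_01[OF V])
  qed
  have "A.EE (Fn n) = B.EE (Fn n)" for n unfolding A.EE_def B.EE_def by (rule tlim_law[OF g V t ST])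
  then have "A.EE F = B.EE F" using A.EE_lim[OF t b l] B.EE_lim[OF t b l] LIMSEQ_unique by simp
  moreover have "A.EE F = measure M (A.sev V c E)"
  proof -
    have "A.EE F = (LINT \<omega>|M. indicator (A.sev V c E) \<omega>)" unfolding A.EE_def
      by (intro Bochner_Integration.integral_cong refl) (auto simp: F_def A_def A.sev_def)
    then show ?thesis using A.sev_meas[OF V] by simp
  qed
  moreover have "B.EE F = measure N (B.sev V c E)"
  proof -
    have "B.EE F = (LINT \<omega>|N. indicator (B.sev V c E) \<omega>)" unfolding B.EE_def
      by (intro Bochner_Integration.integral_cong refl) (auto simp: F_def A_def B.sev_def)
    then show ?thesis using B.sev_meas[OF V] by simp
  qed
  ultimately show ?thesis by simp
qed

text \<open>The map \<sigma> need not be injective: coefficients of indices with the same image are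
  added up. This covers the symmetries of the lattice as well as several thresholds for one
  variable.\<close>

lemma gauss_reindex: assumes "gauss M X S" shows "gauss M (\<lambda>i. X (\<sigma> i)) (\<lambda>i j. S (\<sigma> i) (\<sigma> j))"
proof -
  interpret gauss M X S by fact
  show ?thesis
  proof
    fix V :: "'c set" and a :: "'c => real" assume V: "finite V"
    define b where "b w = (\<Sum>i\<in>{i\<in>V. \<sigma> i = w}. a i)" for w
    have e: "(\<Sum>w\<in>\<sigma> ` V. b w * h w) = (\<Sum>i\<in>V. a i * h (\<sigma> i))" for h
    proof -
      have "(\<Sum>i\<in>V. a i * h (\<sigma> i)) = (\<Sum>w\<in>\<sigma> ` V. \<Sum>i\<in>{i\<in>V. \<sigma> i = w}. a i * h (\<sigma> i))"
        using V by (subst sum.image_gen[of V _ \<sigma>]) auto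
      also have "\<dots> = (\<Sum>w\<in>\<sigma> ` V. b w * h w)" unfolding b_def sum_distrib_right
        by (intro sum.cong refl) auto
      finally show ?thesis ..
    qed
    have "bil S (\<sigma> ` V) b b = (\<Sum>w\<in>\<sigma> ` V. b w * (\<Sum>w'\<in>\<sigma> ` V. b w' * S w w'))"
      by (simp add: bil_def sum_distrib_left mult_ac)
    also have "\<dots> = bil (\<lambda>i j. S (\<sigma> i) (\<sigma> j)) V a a"
      unfolding e by (simp add: bil_def sum_distrib_left mult_ac)
    finally have "bil S (\<sigma> ` V) b b = bil (\<lambda>i j. S (\<sigma> i) (\<sigma> j)) V a a" .
    moreover have "lin (\<sigma> ` V) b (\<lambda>i. X i \<omega>) = lin V a (\<lambda>i. X (\<sigma> i) \<omega>)" for \<omega>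
      unfolding lin_def e ..
    ultimately show "(LINT \<omega>|M. cis (lin V a (\<lambda>i. X (\<sigma> i) \<omega>))) = of_real (exp (- bil (\<lambda>i j. S (\<sigma> i) (\<sigma> j)) V a a / 2))"
      using char_X[of "\<sigma> ` V" b] V by simp
  qed (auto intro: S_sym)
qed

lemma gauss_uminus: assumes "gauss M X S" shows "gauss M (\<lambda>i \<omega>. - X i \<omega>) S"
proof -
  interpret gauss M X S by fact
  show ?thesis
  proof
    fix V :: "'b set" and a :: "'b => real" assume V: "finite V"
    have "lin V a (\<lambda>i. - X i \<omega>) = lin V (\<lambda>i. -1 * a i) (\<lambda>i. X i \<omega>)" for \<omega> by (simp add: lin_def)
    moreover have "bil S V (\<lambda>i. -1 * a i) (\<lambda>i. -1 * a i) = bil S V a a" by (simp add: bil_def)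
    ultimately show "(LINT \<omega>|M. cis (lin V a (\<lambda>i. - X i \<omega>))) = of_real (exp (- bil S V a a / 2))"
      using char_X[OF V, of "\<lambda>i. -1 * a i"] by simp
  qed (auto intro: S_sym)
qed

locale gauss1 = gauss M X S for M :: "'w measure" and X :: "'i => 'w => real" and S +
  assumes S_nonneg: "\<And>i j. S i j \<ge> 0"
    and dens: "\<And>i a b. a \<le> b ==> prob {\<omega> \<in> space M. a \<le> X i \<omega> \<and> X i \<omega> \<le> b} \<le> b - a"
begin

section \<open>Smoothed events, their gradients and covariances\<close>

definition sF :: "'i set => ('i => real => real) => ('i => real) => ('i set => bool) => ('i => real) => real" where
  "sF V U c E x = mext V (\<lambda>S. of_bool (E S)) (\<lambda>i. U i (x i - c i))"

definition sD :: "'i set => ('i => real => real) => ('i => real => real) => ('i => real) => ('i set => bool) => 'i => ('i => real) => real" where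
  "sD V U U' c E i x = U' i (x i - c i) * mextd V (\<lambda>S. of_bool (E S)) i (\<lambda>i. U i (x i - c i))"

definition incr :: "'i set => ('i set => bool) => bool" where
  "incr V E \<longleftrightarrow> (\<forall>S T. S \<subseteq> T --> T \<subseteq> V --> E S --> E T)"

lemma incrD: "incr V E ==> Q \<subseteq> R ==> R \<subseteq> V ==> E Q ==> E R" by (auto simp: incr_def)

context
  fixes V :: "'i set" and U U' :: "'i => real => real" and \<eta> :: "'i => real" and c :: "'i => real"
  assumes V: "finite V" and step: "\<And>i. i \<in> V ==> is_step (\<eta> i) (U i) (U' i)" and eta: "\<And>i. i \<in> V ==> \<eta> i > 0"
begin

lemma sF_glim: "glim V (sF V U c E) (sD V U U' c E)"
proof -
  have s: "step1 (\<lambda>y. U i (y - c i)) (\<lambda>y. U' i (y - c i))" if "i \<in> V" for i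
    using step1_shift[of "U i" "U' i" "- c i"] step[OF that] by (simp add: is_step_def)
  from glim_mext[OF V s, of "\<lambda>i. i" "\<lambda>S. of_bool (E S)"] show ?thesis
    unfolding sF_def[abs_def] sD_def[abs_def] by simp
qed

lemma U01: "i \<in> V ==> 0 \<le> U i y \<and> U i y \<le> 1" and U'0: "i \<in> V ==> 0 \<le> U' i y"
  and U'le: "i \<in> V ==> U' i y \<le> 1 / \<eta> i" and U'out: "i \<in> V ==> \<bar>y\<bar> \<ge> \<eta> i ==> U' i y = 0"
  and Uhi: "i \<in> V ==> y \<ge> \<eta> i ==> U i y = 1" and Ulo: "i \<in> V ==> y \<le> - \<eta> i ==> U i y = 0"
  using step[of i] by (auto simp: is_step_def)

lemma sF_01: "0 \<le> sF V U c E x" "sF V U c E x \<le> 1"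
proof -
  show "0 \<le> sF V U c E x" unfolding sF_def by (rule mext_nonneg[OF _ _ V]) (use U01 in auto)
  have "sF V U c E x \<le> mext V (\<lambda>_. 1) (\<lambda>i. U i (x i - c i))" unfolding sF_def by (rule mext_mono[OF _ _ V]) (use U01 in auto)
  then show "sF V U c E x \<le> 1" by (simp add: mext_const V)
qed

lemma mextd_01: assumes "incr V E" "i \<in> V"
  shows "0 \<le> mextd V (\<lambda>S. of_bool (E S)) i (\<lambda>i. U i (x i - c i))" "mextd V (\<lambda>S. of_bool (E S)) i (\<lambda>i. U i (x i - c i)) \<le> 1"
proof -
  have *: "0 \<le> (of_bool (E (insert i S)) - of_bool (E S) :: real)" if "S \<subseteq> V - {i}" for S
    using incrD[OF assms(1), of S "insert i S"] that assms(2) by (auto simp: of_bool_def)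
  show "0 \<le> mextd V (\<lambda>S. of_bool (E S)) i (\<lambda>i. U i (x i - c i))"
    by (rule mext_nonneg) (use U01 V * in auto)
  have "mextd V (\<lambda>S. of_bool (E S)) i (\<lambda>i. U i (x i - c i)) \<le> mext (V - {i}) (\<lambda>_. 1) (\<lambda>i. U i (x i - c i))"
    by (rule mext_mono) (use U01 V in auto)
  then show "mextd V (\<lambda>S. of_bool (E S)) i (\<lambda>i. U i (x i - c i)) \<le> 1" using V by (simp add: mext_const)
qed

lemma sD_nonneg: "incr V E ==> i \<in> V ==> 0 \<le> sD V U U' c E i x"
  unfolding sD_def by (intro mult_nonneg_nonneg U'0 mextd_01)

lemma sD_le: assumes "incr V E" "i \<in> V" shows "sD V U U' c E i x \<le> 1 / \<eta> i * indicator {-\<eta> i..\<eta> i} (x i - c i)"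
proof -
  have "sD V U U' c E i x \<le> U' i (x i - c i) * 1" unfolding sD_def
    by (intro mult_left_mono mextd_01 assms U'0)
  also have "\<dots> \<le> 1 / \<eta> i * indicator {-\<eta> i..\<eta> i} (x i - c i)"
    using U'le[OF assms(2), of "x i - c i"] U'out[OF assms(2), of "x i - c i"] eta[OF assms(2)]
    by (auto simp: indicator_def abs_if split: if_splits)
  finally show ?thesis .
qed

lemma sD_le': assumes "incr V E" "i \<in> V" shows "sD V U U' c E i x \<le> 1 / \<eta> i"
proof -
  have "1 / \<eta> i * indicator {-\<eta> i..\<eta> i} (x i - c i) \<le> 1 / \<eta> i * 1"
    using eta[OF assms(2)] by (intro mult_left_mono) (auto simp: indicator_def)
  then show ?thesis using sD_le[OF assms, of x] by simp
qed

text \<open>The gradient is a bump of height at most \<open>1 / \<eta> i\<close> on an interval of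
  length \<open>2 * \<eta> i\<close>. It is averaged over a translate of
  \<open>\<sigma> * X i\<close>, whose density is at most \<open>1 / \<sigma>\<close>, so the width
  cancels.\<close>

lemma PP_sD_le: assumes "incr V E" "i \<in> V" "0 \<le> s" "s < 1" shows "PP s (sD V U U' c E i) x \<le> tdens s"
proof -
  define \<sigma> where "\<sigma> = sqrt (1 - s\<^sup>2)"
  have \<sigma>: "\<sigma> > 0" unfolding \<sigma>_def using assms by (simp add: power_less_one_iff abs_square_less_1)
  define a where "a = (c i - \<eta> i - s * x i) / \<sigma>"
  define b where "b = (c i + \<eta> i - s * x i) / \<sigma>"
  note e = eta[OF assms(2)]
  have ab: "b - a = 2 * \<eta> i / \<sigma>" unfolding a_def b_def using \<sigma> by (simp add: field_simps)
  have "PP s (sD V U U' c E i) x \<le> (LINT \<omega>|M. 1 / \<eta> i * indicator {\<omega> \<in> space M. a \<le> X i \<omega> \<and> X i \<omega> \<le> b} \<omega>)"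
    unfolding PP_def \<sigma>_def[symmetric]
  proof (rule integral_mono)
    show "integrable M (\<lambda>\<omega>. sD V U U' c E i (\<lambda>i. s * x i + \<sigma> * X i \<omega>))"
      by (rule tlim_integrable[OF glim_tlim_grad[OF sF_glim assms(2)]])
    show "integrable M (\<lambda>\<omega>. 1 / \<eta> i * indicator {\<omega> \<in> space M. a \<le> X i \<omega> \<and> X i \<omega> \<le> b} \<omega>)"
      by (intro integrable_mult_right integrable_real_indicator) (auto simp: emeasure_eq_measure)
    fix \<omega> assume w: "\<omega> \<in> space M"
    have ind: "indicator {-\<eta> i..\<eta> i} (s * x i + \<sigma> * X i \<omega> - c i) \<le> (indicator {\<omega> \<in> space M. a \<le> X i \<omega> \<and> X i \<omega> \<le> b} \<omega> :: real)"
    proof (cases "s * x i + \<sigma> * X i \<omega> - c i \<in> {-\<eta> i..\<eta> i}")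
      case True
      then have "a \<le> X i \<omega>" "X i \<omega> \<le> b" unfolding a_def b_def
        using pos_divide_le_eq[OF \<sigma>] pos_le_divide_eq[OF \<sigma>] by (auto simp: mult.commute)
      then show ?thesis using w by simp
    qed simp
    then show "sD V U U' c E i (\<lambda>i. s * x i + \<sigma> * X i \<omega>) \<le> 1 / \<eta> i * indicator {\<omega> \<in> space M. a \<le> X i \<omega> \<and> X i \<omega> \<le> b} \<omega>"
      by (intro order_trans[OF sD_le[OF assms(1,2), of "\<lambda>i. s * x i + \<sigma> * X i \<omega>"]] mult_left_mono) (use e in simp_all)
  qed
  also have "\<dots> = 1 / \<eta> i * prob {\<omega> \<in> space M. a \<le> X i \<omega> \<and> X i \<omega> \<le> b}" by simp
  also have "\<dots> \<le> 1 / \<eta> i * (b - a)"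
  proof (intro mult_left_mono dens)
    have "b - a \<ge> 0" unfolding ab using e \<sigma> by simp
    then show "a \<le> b" by simp
  qed (use e in auto)
  also have "\<dots> = tdens s" unfolding ab tdens_def \<sigma>_def[symmetric] using e by simp
  finally show ?thesis .
qed

lemma EE_sD_le: assumes "incr V E" "i \<in> V" shows "EE (sD V U U' c E i) \<le> 2"
  using PP_sD_le[OF assms, of 0 undefined] by (simp add: PP_0 tdens_def)

definition bad :: "'w set" where "bad = {\<omega> \<in> space M. \<exists>i\<in>V. \<bar>X i \<omega> - c i\<bar> \<le> \<eta> i}"

lemma bad_meas: "bad \<in> sets M"
  unfolding bad_def by (intro sets.sets_Collect_finite_Ex V) measurable

lemma prob_bad: "prob bad \<le> 2 * (\<Sum>i\<in>V. \<eta> i)"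
proof -
  have "bad = (\<Union>i\<in>V. {\<omega> \<in> space M. c i - \<eta> i \<le> X i \<omega> \<and> X i \<omega> \<le> c i + \<eta> i})"
  proof -
    have "\<bar>y - d\<bar> \<le> h \<longleftrightarrow> d - h \<le> y \<and> y \<le> d + h" for y d h :: real by auto
    then show ?thesis unfolding bad_def by auto
  qed
  then have "prob bad \<le> (\<Sum>i\<in>V. prob {\<omega> \<in> space M. c i - \<eta> i \<le> X i \<omega> \<and> X i \<omega> \<le> c i + \<eta> i})"
    by (simp only:) (rule finite_measure_subadditive_finite[OF V], auto)
  also have "\<dots> \<le> (\<Sum>i\<in>V. (c i + \<eta> i) - (c i - \<eta> i))" using eta by (intro sum_mono dens) (auto simp: less_imp_le add_increasing2)
  also have "\<dots> = 2 * (\<Sum>i\<in>V. \<eta> i)" by (simp add: sum_distrib_left)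
  finally show ?thesis .
qed

lemma sF_good:
  assumes "\<omega> \<in> space M" "\<omega> \<notin> bad" shows "sF V U c E (\<lambda>i. X i \<omega>) = of_bool (E {v\<in>V. X v \<omega> \<ge> c v})"
  unfolding sF_def
proof (rule mext_01[OF V])
  fix i assume i: "i \<in> V"
  then have "\<not> \<bar>X i \<omega> - c i\<bar> \<le> \<eta> i" using assms unfolding bad_def by auto
  then show "U i (X i \<omega> - c i) = (if c i \<le> X i \<omega> then 1 else 0)"
    using Uhi[OF i, of "X i \<omega> - c i"] Ulo[OF i, of "X i \<omega> - c i"] eta[OF i] by (auto simp: abs_if split: if_splits)
qed

text \<open>Off \<open>bad\<close> the smoothed quantity is the indicator, and everywhere it lies
  between 0 and 1, so the error is at most the probability of \<open>bad\<close>.\<close>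

lemma EE_approx:
  assumes \<Phi>: "tlim V \<Phi>" "\<And>x. 0 \<le> \<Phi> x" "\<And>x. \<Phi> x \<le> 1"
    and good: "\<And>\<omega>. \<omega> \<in> space M ==> \<omega> \<notin> bad ==> \<Phi> (\<lambda>i. X i \<omega>) = of_bool (E {v\<in>V. X v \<omega> \<ge> c v})"
  shows "\<bar>EE \<Phi> - prob (sev V c E)\<bar> \<le> 2 * (\<Sum>i\<in>V. \<eta> i)"
proof -
  have i1: "integrable M (\<lambda>\<omega>. \<Phi> (\<lambda>i. X i \<omega>))" by (rule tlim_integrable0[OF \<Phi>(1)])
  have i2: "integrable M (indicator (sev V c E) :: _ => real)" using sev_meas[OF V] by (intro integrable_real_indicator) (auto simp: emeasure_eq_measure)
  have i3: "integrable M (indicator bad :: _ => real)" using bad_meas by (intro integrable_real_indicator) (auto simp: emeasure_eq_measure)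
  have "EE \<Phi> - prob (sev V c E) = (LINT \<omega>|M. \<Phi> (\<lambda>i. X i \<omega>) - indicator (sev V c E) \<omega>)"
    unfolding EE_def using i1 i2 sev_meas[OF V] by simp
  also have "\<bar>\<dots>\<bar> \<le> (LINT \<omega>|M. \<bar>\<Phi> (\<lambda>i. X i \<omega>) - indicator (sev V c E) \<omega>\<bar>)" by (rule integral_abs_bound)
  also have "\<dots> \<le> (LINT \<omega>|M. indicator bad \<omega>)"
  proof (rule integral_mono)
    fix \<omega> assume w: "\<omega> \<in> space M"
    show "\<bar>\<Phi> (\<lambda>i. X i \<omega>) - indicator (sev V c E) \<omega>\<bar> \<le> (indicator bad \<omega> :: real)"
      using good[OF w] \<Phi>(2)[of "\<lambda>i. X i \<omega>"] \<Phi>(3)[of "\<lambda>i. X i \<omega>"] w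
      by (cases "\<omega> \<in> bad") (auto simp: indicator_def sev_def)
  qed (use i1 i2 i3 in auto)
  also have "\<dots> = prob bad" using bad_meas by simp
  also have "\<dots> \<le> 2 * (\<Sum>i\<in>V. \<eta> i)" by (rule prob_bad)
  finally show ?thesis .
qed

lemma sF_sandwich:
  assumes "incr V E"
  shows "prob (sev V (\<lambda>i. c i + \<eta> i) E) \<le> EE (sF V U c E)" "EE (sF V U c E) \<le> prob (sev V (\<lambda>i. c i - \<eta> i) E)"
proof -
  have t: "tlim V (sF V U c E)" by (rule glim_tlim[OF sF_glim])
  have i: "integrable M (indicator (sev V d E) :: _ => real)" for d using sev_meas[OF V] by (intro integrable_real_indicator) (auto simp: emeasure_eq_measure)
  have m: "of_bool (E S) \<le> (of_bool (E T) :: real)" if "S \<subseteq> T" "T \<subseteq> V" for S T using incrD[OF assms that] by auto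
  have 1: "of_bool (E {v\<in>V. U v (x v - c v) = 1}) \<le> sF V U c E x" "sF V U c E x \<le> of_bool (E {v\<in>V. U v (x v - c v) > 0})" for x
    unfolding sF_def using mext_sandwich[of V "\<lambda>i. U i (x i - c i)" "\<lambda>S. of_bool (E S)", OF U01 m V] by auto
  have "prob (sev V (\<lambda>i. c i + \<eta> i) E) = (LINT \<omega>|M. indicator (sev V (\<lambda>i. c i + \<eta> i) E) \<omega>)" using sev_meas[OF V] by simp
  also have "\<dots> \<le> EE (sF V U c E)" unfolding EE_def
  proof (rule integral_mono[OF i tlim_integrable0[OF t]])
    fix \<omega> assume "\<omega> \<in> space M"
    have "{v\<in>V. X v \<omega> \<ge> c v + \<eta> v} \<subseteq> {v\<in>V. U v (X v \<omega> - c v) = 1}" by (auto intro!: Uhi)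
    then have "indicator (sev V (\<lambda>i. c i + \<eta> i) E) \<omega> \<le> (of_bool (E {v\<in>V. U v (X v \<omega> - c v) = 1}) :: real)"
      using incrD[OF assms, of "{v\<in>V. X v \<omega> \<ge> c v + \<eta> v}" "{v\<in>V. U v (X v \<omega> - c v) = 1}"] by (auto simp: indicator_def sev_def)
    then show "indicator (sev V (\<lambda>i. c i + \<eta> i) E) \<omega> \<le> sF V U c E (\<lambda>i. X i \<omega>)" by (rule order_trans[OF _ 1(1)])
  qed
  finally show "prob (sev V (\<lambda>i. c i + \<eta> i) E) \<le> EE (sF V U c E)" .
  have "EE (sF V U c E) \<le> (LINT \<omega>|M. indicator (sev V (\<lambda>i. c i - \<eta> i) E) \<omega>)" unfolding EE_def
  proof (rule integral_mono[OF tlim_integrable0[OF t] i])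
    fix \<omega> assume w: "\<omega> \<in> space M"
    have "{v\<in>V. U v (X v \<omega> - c v) > 0} \<subseteq> {v\<in>V. X v \<omega> \<ge> c v - \<eta> v}"
    proof
      fix v assume "v \<in> {v\<in>V. U v (X v \<omega> - c v) > 0}"
      then have v: "v \<in> V" "U v (X v \<omega> - c v) > 0" by auto
      then have "\<not> X v \<omega> - c v \<le> - \<eta> v" using Ulo[OF v(1), of "X v \<omega> - c v"] by auto
      then show "v \<in> {v\<in>V. X v \<omega> \<ge> c v - \<eta> v}" using v by simp
    qed
    then have "(of_bool (E {v\<in>V. U v (X v \<omega> - c v) > 0}) :: real) \<le> indicator (sev V (\<lambda>i. c i - \<eta> i) E) \<omega>"
      using incrD[OF assms, of "{v\<in>V. U v (X v \<omega> - c v) > 0}" "{v\<in>V. X v \<omega> \<ge> c v - \<eta> v}"] w by (auto simp: indicator_def sev_def)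
    then show "sF V U c E (\<lambda>i. X i \<omega>) \<le> indicator (sev V (\<lambda>i. c i - \<eta> i) E) \<omega>" by (rule order_trans[OF 1(2)])
  qed
  also have "\<dots> = prob (sev V (\<lambda>i. c i - \<eta> i) E)" using sev_meas[OF V] by simp
  finally show "EE (sF V U c E) \<le> prob (sev V (\<lambda>i. c i - \<eta> i) E)" .
qed

text \<open>Increasing events have nonnegative smoothed gradients, so with \<open>S \<ge> 0\<close>
  the integrand of the covariance formula is nonnegative. For the upper bound, one gradient is
  bounded pointwise by \<open>1 / h\<close> and the other in mean by 2; gradients vanish outside the
  supports \<open>VA\<close> and \<open>VB\<close>.\<close>

lemma cov_sF:
  assumes A: "incr V A" and B: "incr V B"
    and VA: "VA \<subseteq> V" "\<And>S. S \<subseteq> V ==> A S = A (S \<inter> VA)" and VB: "VB \<subseteq> V" "\<And>S. S \<subseteq> V ==> B S = B (S \<inter> VB)"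
    and h: "\<And>i. i \<in> VA ==> \<eta> i = h"
  shows "0 \<le> EE (\<lambda>x. sF V U c A x * sF V U c B x) - EE (sF V U c A) * EE (sF V U c B)"
    and "EE (\<lambda>x. sF V U c A x * sF V U c B x) - EE (sF V U c A) * EE (sF V U c B) \<le> 2 / h * (\<Sum>i\<in>VA. \<Sum>j\<in>VB. S i j)"
proof -
  let ?DA = "sD V U U' c A" and ?DB = "sD V U U' c B"
  note cov = cov_formula[OF V sF_glim sF_glim, of A B]
  have z: "sD V U U' c E i x = 0" if "i \<notin> W" "\<And>S. S \<subseteq> V ==> E S = E (S \<inter> W)" "i \<in> V" for E i W x
  proof -
    have "mextd V (\<lambda>S. of_bool (E S)) i (\<lambda>i. U i (x i - c i)) = mext (V - {i}) (\<lambda>_. 0) (\<lambda>i. U i (x i - c i))"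
    proof (rule mext_cong)
      fix S assume S: "S \<subseteq> V - {i}"
      have "E (insert i S) = E (insert i S \<inter> W)" by (rule that(2)) (use S that in auto)
      also have "insert i S \<inter> W = S \<inter> W" using that by auto
      also have "E (S \<inter> W) = E S" by (rule that(2)[symmetric]) (use S in auto)
      finally show "of_bool (E (insert i S)) - of_bool (E S) = (0::real)" by simp
    qed simp
    then show ?thesis unfolding sD_def using V by (simp add: mext_const)
  qed
  have K0: "0 \<le> covK V ?DA ?DB t" for t
    unfolding covK_def[OF V] by (intro sum_nonneg mult_nonneg_nonneg S_nonneg EE_nonneg sD_nonneg A B PP_nonneg)
  show "0 \<le> EE (\<lambda>x. sF V U c A x * sF V U c B x) - EE (sF V U c A) * EE (sF V U c B)"
    by (rule has_integral_nonneg[OF cov]) (rule K0)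
  have K1: "covK V ?DA ?DB t \<le> 2 / h * (\<Sum>i\<in>VA. \<Sum>j\<in>VB. S i j)" if t: "t \<in> {0..1}" for t
  proof -
    have fin: "finite VA" "finite VB" using finite_subset[OF VA(1) V] finite_subset[OF VB(1) V] by auto
    have "covK V ?DA ?DB t = (\<Sum>i\<in>VA. \<Sum>j\<in>VB. S i j * EE (\<lambda>x. ?DA i x * PP t (?DB j) x))"
    proof -
      have zB: "?DB j = (\<lambda>_. 0)" if "j \<in> V - VB" for j using z[of j VB B, OF _ VB(2)] that by auto
      have zA: "?DA i = (\<lambda>_. 0)" if "i \<in> V - VA" for i using z[of i VA A, OF _ VA(2)] that by auto
      have "(\<Sum>j\<in>V. S i j * EE (\<lambda>x. ?DA i x * PP t (?DB j) x)) = (\<Sum>j\<in>VB. S i j * EE (\<lambda>x. ?DA i x * PP t (?DB j) x))" for i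
        by (rule sum.mono_neutral_right[OF V VB(1)]) (simp add: zB PP_def)
      moreover have "(\<Sum>i\<in>V. \<Sum>j\<in>VB. S i j * EE (\<lambda>x. ?DA i x * PP t (?DB j) x)) = (\<Sum>i\<in>VA. \<Sum>j\<in>VB. S i j * EE (\<lambda>x. ?DA i x * PP t (?DB j) x))"
        by (rule sum.mono_neutral_right[OF V VA(1)]) (simp add: zA)
      ultimately show ?thesis unfolding covK_def[OF V] by simp
    qed
    also have "\<dots> \<le> (\<Sum>i\<in>VA. \<Sum>j\<in>VB. S i j * (2 / h))"
    proof (intro sum_mono mult_left_mono S_nonneg)
      fix i j assume ij: "i \<in> VA" "j \<in> VB"
      then have iV: "i \<in> V" and jV: "j \<in> V" using VA VB by auto
      have h0: "h > 0" using eta[OF iV] h[OF ij(1)] by simp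
      have tD: "tlim V (?DB j)" by (rule glim_tlim_grad[OF sF_glim jV])
      have "EE (\<lambda>x. ?DA i x * PP t (?DB j) x) \<le> EE (\<lambda>x. (1 / h) * PP t (?DB j) x)"
      proof (rule EE_mono[OF tlim_mult[OF glim_tlim_grad[OF sF_glim iV] tlim_PP[OF V tD]] tlim_cmult[OF tlim_PP[OF V tD]]])
        show "?DA i x * PP t (?DB j) x \<le> 1 / h * PP t (?DB j) x" for x
          using sD_le'[OF A iV, of x] h[OF ij(1)] by (intro mult_right_mono PP_nonneg sD_nonneg B jV) auto
      qed (use t in auto)
      also have "\<dots> = (1 / h) * EE (?DB j)" using EE_PP[OF V tD, of t] t EE_cmult[of "1 / h" "PP t (?DB j)"] by simp
      also have "\<dots> \<le> (1 / h) * 2" using h0 by (intro mult_left_mono EE_sD_le B jV) auto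
      finally show "EE (\<lambda>x. ?DA i x * PP t (?DB j) x) \<le> 2 / h" by simp
    qed
    finally show ?thesis by (simp add: sum_distrib_right sum_distrib_left sum_divide_distrib mult.commute)
  qed
  show "EE (\<lambda>x. sF V U c A x * sF V U c B x) - EE (sF V U c A) * EE (sF V U c B) \<le> 2 / h * (\<Sum>i\<in>VA. \<Sum>j\<in>VB. S i j)"
    using has_integral_le[OF cov has_integral_const_real[of "2 / h * (\<Sum>i\<in>VA. \<Sum>j\<in>VB. S i j)" 0 1]] K1 by simp
qed

end
end

section \<open>Positive association and decoupling\<close>

context gauss1 begin

lemma step_family: assumes "\<And>i. \<eta> i > 0" obtains U U' where "\<And>i::'i. is_step (\<eta> i) (U i) (U' i)"
proof -
  have "\<forall>i. \<exists>p. is_step (\<eta> i) (fst p) (snd p)"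
  proof
    fix i obtain U U' where "is_step (\<eta> i) U U'" using is_step_exists[OF assms] by blast
    then show "\<exists>p. is_step (\<eta> i) (fst p) (snd p)" by (intro exI[of _ "(U, U')"]) simp
  qed
  from choice[OF this] obtain p where "\<forall>i. is_step (\<eta> i) (fst (p i)) (snd (p i))" by blast
  then show ?thesis using that[of "\<lambda>i. fst (p i)" "\<lambda>i. snd (p i)"] by blast
qed

lemma incr_restrict: assumes "incr W A" shows "incr V (\<lambda>R. A (R \<inter> W))"
  unfolding incr_def
proof (intro allI impI)
  fix Q R assume "Q \<subseteq> R" "R \<subseteq> V" "A (Q \<inter> W)"
  then show "A (R \<inter> W)" using incrD[OF assms, of "Q \<inter> W" "R \<inter> W"] by auto
qed

lemma sF_prod_approx:
  assumes V: "finite V" and st: "\<And>i. i \<in> V ==> is_step (\<eta> i) (U i) (U' i)" "\<And>i. i \<in> V ==> \<eta> i > 0"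
  shows "\<bar>EE (\<lambda>x. sF V U c A x * sF V U c B x) - prob (sev V c (\<lambda>R. A R \<and> B R))\<bar> \<le> 2 * (\<Sum>i\<in>V. \<eta> i)"
    and "\<bar>EE (sF V U c A) - prob (sev V c A)\<bar> \<le> 2 * (\<Sum>i\<in>V. \<eta> i)"
proof -
  note t = glim_tlim[OF sF_glim[OF V st]]
  show "\<bar>EE (\<lambda>x. sF V U c A x * sF V U c B x) - prob (sev V c (\<lambda>R. A R \<and> B R))\<bar> \<le> 2 * (\<Sum>i\<in>V. \<eta> i)"
  proof (rule EE_approx[OF V st tlim_mult[OF t t]])
    fix \<omega> assume w: "\<omega> \<in> space M" "\<omega> \<notin> bad V \<eta> c"
    have g: "sF V U c E (\<lambda>i. X i \<omega>) = of_bool (E {v\<in>V. X v \<omega> \<ge> c v})" for E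
      by (rule sF_good[OF V]) (use st w in auto)
    show "sF V U c A (\<lambda>i. X i \<omega>) * sF V U c B (\<lambda>i. X i \<omega>) = of_bool (A {v\<in>V. X v \<omega> \<ge> c v} \<and> B {v\<in>V. X v \<omega> \<ge> c v})"
      unfolding g by simp
  qed (use sF_01[OF V st] in \<open>auto intro: mult_le_one mult_nonneg_nonneg\<close>)
  show "\<bar>EE (sF V U c A) - prob (sev V c A)\<bar> \<le> 2 * (\<Sum>i\<in>V. \<eta> i)"
    by (rule EE_approx[OF V st t]) (use sF_01[OF V st] sF_good[OF V st] in auto)
qed

lemma EE_sF_bounds: assumes "finite V" "\<And>i. i \<in> V ==> is_step (\<eta> i) (U i) (U' i)" "\<And>i. i \<in> V ==> \<eta> i > 0"
  shows "0 \<le> EE (sF V U c A)" "EE (sF V U c A) \<le> 1"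
proof -
  have *: "0 \<le> sF V U c A x \<and> sF V U c A x \<le> 1" for x using sF_01[OF assms(1)] assms(2,3) by metis
  then show "0 \<le> EE (sF V U c A)" by (intro EE_nonneg) auto
  have "\<bar>EE (sF V U c A)\<bar> \<le> 1" by (rule abs_EE_le[OF assms(1)]) (use * in \<open>auto simp: abs_le_iff intro: order_trans[of _ 0]\<close>)
  then show "EE (sF V U c A) \<le> 1" by simp
qed

text \<open>Pitt's inequality. The smoothed events are positively correlated by
  \<open>cov_sF\<close>, and since \<open>V\<close> is fixed, the smoothing width \<open>h\<close>
  can be taken arbitrarily small.\<close>

theorem fkg:
  assumes V: "finite V" and A: "incr V A" and B: "incr V B"
  shows "prob (sev V c A) * prob (sev V c B) \<le> prob (sev V c (\<lambda>R. A R \<and> B R))"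
proof (rule field_le_epsilon)
  fix e :: real assume e: "e > 0"
  \<comment> \<open>Three smoothing errors \<open>2 * card V * h\<close> occur, one for each event
    and one for their conjunction, hence the 6.\<close>
  define h where "h = e / (6 * (real (card V) + 1))"
  have h: "h > 0" unfolding h_def using e by simp
  have hV: "6 * (real (card V) * h) \<le> e" unfolding h_def using e by (simp add: field_simps)
  obtain U U' where U: "\<And>i::'i. is_step h (U i) (U' i)" using step_family[of "\<lambda>_. h"] h by metis
  note ap = sF_prod_approx[where U=U and U'=U' and \<eta>="\<lambda>_. h", OF V U h, where c=c]
  let ?a = "EE (sF V U c A)" and ?b = "EE (sF V U c B)"
  have s: "(\<Sum>i\<in>V. h) = real (card V) * h" by simp
  have 1: "?a * ?b \<le> EE (\<lambda>x. sF V U c A x * sF V U c B x)"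
    using cov_sF(1)[where U=U and U'=U' and \<eta>="\<lambda>_. h", OF V U h A B, where VA=V and VB=V and c=c and h=h] by (simp add: Int_absorb2)
  have 2: "\<bar>?a - prob (sev V c A)\<bar> \<le> 2 * (real (card V) * h)" "\<bar>?b - prob (sev V c B)\<bar> \<le> 2 * (real (card V) * h)"
    using ap(2) s by auto
  have 3: "\<bar>EE (\<lambda>x. sF V U c A x * sF V U c B x) - prob (sev V c (\<lambda>R. A R \<and> B R))\<bar> \<le> 2 * (real (card V) * h)" using ap(1) s by auto
  have "prob (sev V c A) * prob (sev V c B) - ?a * ?b = (prob (sev V c A) - ?a) * prob (sev V c B) + ?a * (prob (sev V c B) - ?b)"
    by (simp add: algebra_simps)
  also have "\<dots> \<le> \<bar>prob (sev V c A) - ?a\<bar> * 1 + 1 * \<bar>prob (sev V c B) - ?b\<bar>"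
  proof (intro add_mono)
    show "(prob (sev V c A) - ?a) * prob (sev V c B) \<le> \<bar>prob (sev V c A) - ?a\<bar> * 1"
      by (rule order_trans[OF mult_right_mono[OF abs_ge_self]]) (auto intro!: mult_left_le)
    note a01 = EE_sF_bounds[where U=U and U'=U' and \<eta>="\<lambda>_. h", OF V U h, where c=c and A=A]
    show "?a * (prob (sev V c B) - ?b) \<le> 1 * \<bar>prob (sev V c B) - ?b\<bar>"
      by (rule order_trans[OF mult_left_mono[OF abs_ge_self]]) (use a01 in \<open>auto intro!: mult_left_le_one_le\<close>)
  qed
  also have "\<dots> \<le> 4 * (real (card V) * h)" using 2 by (simp add: abs_minus_commute)
  finally have 4: "prob (sev V c A) * prob (sev V c B) - ?a * ?b \<le> 4 * (real (card V) * h)" .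
  have "EE (\<lambda>x. sF V U c A x * sF V U c B x) \<le> prob (sev V c (\<lambda>R. A R \<and> B R)) + 2 * (real (card V) * h)"
    using 3 by (simp add: abs_le_iff)
  then show "prob (sev V c A) * prob (sev V c B) \<le> prob (sev V c (\<lambda>R. A R \<and> B R)) + e"
    using 1 4 hV by linarith
qed

text \<open>Only the width on \<open>VA\<close> enters the covariance bound of
  \<open>cov_sF\<close>. It is kept at \<open>h\<close>, while the width \<open>k\<close> on
  \<open>VB\<close> is arbitrarily small, so that the smoothing error counts the vertices of
  \<open>VA\<close> alone and \<open>VB\<close> may be much larger.\<close>

theorem mixing:
  assumes VA: "finite VA" and VB: "finite VB" "VA \<inter> VB = {}" and A: "incr VA A" and B: "incr VB B" and h: "h > 0"
  shows "prob (sev (VA \<union> VB) c (\<lambda>R. A (R \<inter> VA) \<and> B (R \<inter> VB))) \<le> prob (sev VA c A) * prob (sev VB c B)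
     + 2 / h * (\<Sum>i\<in>VA. \<Sum>j\<in>VB. S i j) + 6 * (real (card VA) * h)"
proof (rule field_le_epsilon)
  fix e :: real assume e: "e > 0"
  define k where "k = e / (6 * (real (card VB) + 1))"
  have k: "k > 0" unfolding k_def using e by simp
  have kV: "6 * (real (card VB) * k) \<le> e" unfolding k_def using e by (simp add: field_simps)
  let ?V = "VA \<union> VB"
  define \<eta> where "\<eta> i = (if i \<in> VA then h else k)" for i
  have eta: "\<eta> i > 0" for i using h k by (simp add: \<eta>_def)
  obtain U U' where U: "\<And>i::'i. is_step (\<eta> i) (U i) (U' i)" using step_family[of \<eta>] eta by metis
  have V: "finite ?V" using VA VB by simp
  let ?A = "\<lambda>R. A (R \<inter> VA)" and ?B = "\<lambda>R. B (R \<inter> VB)"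
  have iA: "incr ?V ?A" and iB: "incr ?V ?B"
    using A B by (auto intro: incr_restrict)
  have s: "(\<Sum>i\<in>?V. \<eta> i) = real (card VA) * h + real (card VB) * k"
  proof -
    have "(\<Sum>i\<in>?V. \<eta> i) = (\<Sum>i\<in>VA. \<eta> i) + (\<Sum>i\<in>VB. \<eta> i)" using VA VB by (intro sum.union_disjoint)
    also have "(\<Sum>i\<in>VA. \<eta> i) = (\<Sum>i\<in>VA. h)" by (intro sum.cong) (auto simp: \<eta>_def)
    also have "(\<Sum>i\<in>VB. \<eta> i) = (\<Sum>i\<in>VB. k)" using VB(2) by (intro sum.cong) (auto simp: \<eta>_def)
    finally show ?thesis by simp
  qed
  note ap = sF_prod_approx[where U=U and U'=U' and \<eta>=\<eta>, OF V U eta, where c=c]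
  let ?a = "EE (sF ?V U c ?A)" and ?b = "EE (sF ?V U c ?B)"
  have 1: "EE (\<lambda>x. sF ?V U c ?A x * sF ?V U c ?B x) \<le> ?a * ?b + 2 / h * (\<Sum>i\<in>VA. \<Sum>j\<in>VB. S i j)"
    using cov_sF(2)[where U=U and U'=U' and \<eta>=\<eta>, OF V U eta iA iB, where VA=VA and VB=VB and c=c and h=h] by (simp add: \<eta>_def Int_absorb1 Int_assoc)
  have eS: "{v \<in> ?V. P v} \<inter> VA = {v \<in> VA. P v}" "{v \<in> ?V. P v} \<inter> VB = {v \<in> VB. P v}" for P by auto
  have eA: "sev ?V c ?A = sev VA c A" and eB: "sev ?V c ?B = sev VB c B"
    by (simp_all only: sev_def eS)
  define \<delta> where "\<delta> = 2 * (real (card VA) * h + real (card VB) * k)"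
  have 2: "\<bar>?a - prob (sev VA c A)\<bar> \<le> \<delta>" "\<bar>?b - prob (sev VB c B)\<bar> \<le> \<delta>"
    using ap(2)[of ?A] ap(2)[of ?B] s eA eB by (auto simp: \<delta>_def)
  have 3: "\<bar>EE (\<lambda>x. sF ?V U c ?A x * sF ?V U c ?B x) - prob (sev ?V c (\<lambda>R. ?A R \<and> ?B R))\<bar> \<le> \<delta>" using ap(1)[of ?A ?B] s by (auto simp: \<delta>_def)
  note bA = EE_sF_bounds[where U=U and U'=U' and \<eta>=\<eta>, OF V U eta, where c=c and A="?A"] and bB = EE_sF_bounds[where U=U and U'=U' and \<eta>=\<eta>, OF V U eta, where c=c and A="?B"]
  have "?a * ?b - prob (sev VA c A) * prob (sev VB c B) = (?a - prob (sev VA c A)) * ?b + prob (sev VA c A) * (?b - prob (sev VB c B))"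
    by (simp add: algebra_simps)
  also have "\<dots> \<le> \<bar>?a - prob (sev VA c A)\<bar> * 1 + 1 * \<bar>?b - prob (sev VB c B)\<bar>"
  proof (intro add_mono)
    show "(?a - prob (sev VA c A)) * ?b \<le> \<bar>?a - prob (sev VA c A)\<bar> * 1"
      by (rule order_trans[OF mult_right_mono[OF abs_ge_self]]) (use bB in \<open>auto intro!: mult_left_le\<close>)
    show "prob (sev VA c A) * (?b - prob (sev VB c B)) \<le> 1 * \<bar>?b - prob (sev VB c B)\<bar>"
      by (rule order_trans[OF mult_left_mono[OF abs_ge_self]]) (auto intro!: mult_left_le_one_le)
  qed
  also have "\<dots> \<le> 2 * \<delta>" using 2 by simp
  finally have 4: "?a * ?b \<le> prob (sev VA c A) * prob (sev VB c B) + 2 * \<delta>" by simp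
  have "prob (sev ?V c (\<lambda>R. ?A R \<and> ?B R)) \<le> EE (\<lambda>x. sF ?V U c ?A x * sF ?V U c ?B x) + \<delta>" using 3 by (simp add: abs_le_iff)
  with 4 show "prob (sev ?V c (\<lambda>R. ?A R \<and> ?B R)) \<le> prob (sev VA c A) * prob (sev VB c B)
     + 2 / h * (\<Sum>i\<in>VA. \<Sum>j\<in>VB. S i j) + 6 * (real (card VA) * h) + e"
    using 1 kV unfolding \<delta>_def by (simp add: algebra_simps)
qed

text \<open>By monotonicity the smoothed events lie between the events at the thresholds
  \<open>a - h\<close> and \<open>a + h\<close>. This comparison replaces an estimate of the
  smoothing error, so the supports enter only through their covariances.\<close>

theorem sprinkled_decoupling:
  assumes VA: "finite VA" and VB: "finite VB" and A: "incr VA A" and B: "incr VB B" and h: "h > 0"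
  shows "prob (sev (VA \<union> VB) (\<lambda>_. a - h) (\<lambda>R. \<not> A (R \<inter> VA) \<and> \<not> B (R \<inter> VB))) \<le>
     prob (sev VA (\<lambda>_. a + h) (\<lambda>R. \<not> A R)) * prob (sev VB (\<lambda>_. a + h) (\<lambda>R. \<not> B R)) + 2 / h * (\<Sum>i\<in>VA. \<Sum>j\<in>VB. S i j)"
proof -
  obtain U U' where U: "\<And>i::'i. is_step h (U i) (U' i)" using step_family[of "\<lambda>_. h"] h by metis
  let ?V = "VA \<union> VB"
  have V: "finite ?V" using VA VB by simp
  let ?A = "\<lambda>R. A (R \<inter> VA)" and ?B = "\<lambda>R. B (R \<inter> VB)"
  have iA: "incr ?V ?A" and iB: "incr ?V ?B"
    using A B by (auto intro: incr_restrict)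
  have eS: "{v \<in> ?V. P v} \<inter> VA = {v \<in> VA. P v}" "{v \<in> ?V. P v} \<inter> VB = {v \<in> VB. P v}" for P by auto
  have eA: "sev ?V c (\<lambda>R. \<not> ?A R) = sev VA c (\<lambda>R. \<not> A R)" and eB: "sev ?V c (\<lambda>R. \<not> ?B R) = sev VB c (\<lambda>R. \<not> B R)" for c
    by (simp_all only: sev_def eS)
  let ?F = "sF ?V U (\<lambda>_. a) ?A" and ?G = "sF ?V U (\<lambda>_. a) ?B"
  note tF = glim_tlim[OF sF_glim[where U=U and U'=U' and \<eta>="\<lambda>_. h", OF V U h, where c="\<lambda>_. a" and E="?A"]] and tG = glim_tlim[OF sF_glim[where U=U and U'=U' and \<eta>="\<lambda>_. h", OF V U h, where c="\<lambda>_. a" and E="?B"]]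
  have neg: "prob (sev ?V c (\<lambda>R. \<not> E R)) = 1 - prob (sev ?V c E)" for c E
  proof -
    have "sev ?V c (\<lambda>R. \<not> E R) = space M - sev ?V c E" by (auto simp: sev_def)
    then show ?thesis using prob_compl[OF sev_meas[OF V]] by simp
  qed
  have cov: "EE (\<lambda>x. ?F x * ?G x) - EE ?F * EE ?G \<le> 2 / h * (\<Sum>i\<in>VA. \<Sum>j\<in>VB. S i j)"
    using cov_sF(2)[where U=U and U'=U' and \<eta>="\<lambda>_. h", OF V U h iA iB, where VA=VA and VB=VB and c="\<lambda>_. a" and h=h] by (simp add: Int_absorb1 Int_assoc)
  note sA = sF_sandwich[where U=U and U'=U' and \<eta>="\<lambda>_. h", OF V U h iA, where c="\<lambda>_. a"] and sB = sF_sandwich[where U=U and U'=U' and \<eta>="\<lambda>_. h", OF V U h iB, where c="\<lambda>_. a"]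
  have i: "integrable M (indicator (sev ?V d E) :: _ => real)" for d E using sev_meas[OF V] by (intro integrable_real_indicator) (auto simp: emeasure_eq_measure)
  have "prob (sev ?V (\<lambda>_. a - h) (\<lambda>R. \<not> ?A R \<and> \<not> ?B R)) \<le> EE (\<lambda>x. (1 - ?F x) * (1 - ?G x))"
  proof -
    have t: "tlim ?V (\<lambda>x. (1 - ?F x) * (1 - ?G x))" by (intro tlim_mult tlim_diff tlim_const tF tG)
    have "(LINT \<omega>|M. indicator (sev ?V (\<lambda>_. a - h) (\<lambda>R. \<not> ?A R \<and> \<not> ?B R)) \<omega>) \<le> EE (\<lambda>x. (1 - ?F x) * (1 - ?G x))"
      unfolding EE_def
    proof (rule integral_mono[OF i tlim_integrable0[OF t]])
      fix \<omega> assume w: "\<omega> \<in> space M"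
      have z: "sF ?V U (\<lambda>_. a) E (\<lambda>i. X i \<omega>) = 0" if E: "incr ?V E" "\<not> E {v\<in>?V. X v \<omega> \<ge> a - h}" for E
      proof -
        have m: "of_bool (E R) \<le> (of_bool (E T) :: real)" if "R \<subseteq> T" "T \<subseteq> ?V" for R T using incrD[OF E(1) that] by auto
        have "sF ?V U (\<lambda>_. a) E (\<lambda>i. X i \<omega>) \<le> of_bool (E {v\<in>?V. U v (X v \<omega> - a) > 0})"
          unfolding sF_def using mext_sandwich(2)[of ?V "\<lambda>i. U i (X i \<omega> - a)" "\<lambda>S. of_bool (E S) :: real", OF _ m V] U01[where U=U and U'=U' and \<eta>="\<lambda>_. h", OF V U h] by blast
        moreover have "{v\<in>?V. U v (X v \<omega> - a) > 0} \<subseteq> {v\<in>?V. X v \<omega> \<ge> a - h}"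
        proof
          fix v assume "v \<in> {v\<in>?V. U v (X v \<omega> - a) > 0}"
          then have v: "v \<in> ?V" "U v (X v \<omega> - a) > 0" by auto
          then have "\<not> X v \<omega> - a \<le> - h" using Ulo[where U=U and U'=U' and \<eta>="\<lambda>_. h", OF V U h v(1), of "X v \<omega> - a"] by auto
          then show "v \<in> {v\<in>?V. X v \<omega> \<ge> a - h}" using v by simp
        qed
        then have "\<not> E {v\<in>?V. U v (X v \<omega> - a) > 0}" using incrD[OF E(1)] E(2) by blast
        ultimately show ?thesis using sF_01(1)[where U=U and U'=U' and \<eta>="\<lambda>_. h", OF V U h, where c="\<lambda>_. a" and E=E and x="\<lambda>i. X i \<omega>"] by simp
      qed
      show "indicator (sev ?V (\<lambda>_. a - h) (\<lambda>R. \<not> ?A R \<and> \<not> ?B R)) \<omega> \<le> (1 - ?F (\<lambda>i. X i \<omega>)) * (1 - ?G (\<lambda>i. X i \<omega>))"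
      proof (cases "\<omega> \<in> sev ?V (\<lambda>_. a - h) (\<lambda>R. \<not> ?A R \<and> \<not> ?B R)")
        case True
        then have "\<not> ?A {v\<in>?V. X v \<omega> \<ge> a - h}" "\<not> ?B {v\<in>?V. X v \<omega> \<ge> a - h}" unfolding sev_def by auto
        then show ?thesis using z[OF iA] z[OF iB] by (simp add: indicator_def)
      next
        case False
        then show ?thesis using sF_01[where U=U and U'=U' and \<eta>="\<lambda>_. h", OF V U h, where c="\<lambda>_. a" and x="\<lambda>i. X i \<omega>"] by simp
      qed
    qed
    then show ?thesis using sev_meas[OF V] by simp
  qed
  also have "\<dots> = 1 - EE ?F - EE ?G + EE (\<lambda>x. ?F x * ?G x)"
  proof -
    have "(\<lambda>x. (1 - ?F x) * (1 - ?G x)) = (\<lambda>x. ((1 - ?F x) - ?G x) + ?F x * ?G x)" by (rule ext) (simp add: algebra_simps)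
    then show ?thesis
      using EE_add[OF tlim_diff[OF tlim_diff[OF tlim_const[of _ 1] tF] tG] tlim_mult[OF tF tG]]
        EE_diff[OF tlim_diff[OF tlim_const[of _ 1] tF] tG] EE_diff[OF tlim_const[of _ 1] tF] by simp
  qed
  also have "\<dots> \<le> (1 - EE ?F) * (1 - EE ?G) + 2 / h * (\<Sum>i\<in>VA. \<Sum>j\<in>VB. S i j)" using cov by (simp add: algebra_simps)
  also have "(1 - EE ?F) * (1 - EE ?G) \<le> prob (sev ?V (\<lambda>_. a + h) (\<lambda>R. \<not> ?A R)) * prob (sev ?V (\<lambda>_. a + h) (\<lambda>R. \<not> ?B R))"
    unfolding neg using sA sB EE_sF_bounds[where U=U and U'=U' and \<eta>="\<lambda>_. h", OF V U h] by (intro mult_mono) auto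
  finally show ?thesis unfolding eA eB by simp
qed

end

section \<open>Sharp threshold\<close>

context gauss begin

lemma shift_trig:
  assumes V: "finite V" and F: "trig V F DF" and ab: "a \<le> b"
  shows "((\<lambda>p. \<Sum>i\<in>V. EE (\<lambda>x. DF i (\<lambda>j. x j + p))) has_integral (EE (\<lambda>x. F (\<lambda>j. x j + b)) - EE (\<lambda>x. F (\<lambda>j. x j + a)))) {a..b}"
proof -
  obtain l where l: "\<And>x. of_real (F x) = ev V l x" and dl: "\<And>i x. i \<in> V ==> of_real (DF i x) = ev V (dd i l) x"
    using F unfolding trig_def by blast
  define s where "s a = (\<Sum>i\<in>V. a i)" for a :: "'i => real"
  have shift: "complex_of_real (EE (\<lambda>x. G (\<lambda>j. x j + p))) = ls (\<lambda>a. cis (p * s a) * of_real (exp (- bil S V a a / 2))) m"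
    if G: "\<And>x. of_real (G x) = ev V m x" for G m p
  proof -
    have "complex_of_real (EE (\<lambda>x. G (\<lambda>j. x j + p))) = mean V (ltr (\<lambda>a. cis (p * s a)) (\<lambda>a. a) m)"
    proof (rule EE_trig0[OF V])
      fix x
      have "lin V a (\<lambda>j. x j + p) = p * s a + lin V a x" for a by (simp add: lin_def s_def sum.distrib sum_distrib_left algebra_simps)
      then show "complex_of_real (G (\<lambda>j. x j + p)) = ev V (ltr (\<lambda>a. cis (p * s a)) (\<lambda>a. a) m) x"
        unfolding G ev_def ls_ltr by (simp add: cis_mult)
    qed
    then show ?thesis unfolding mean_def ls_ltr .
  qed
  define h where "h p = Re (ls (\<lambda>a. cis (p * s a) * of_real (exp (- bil S V a a / 2))) l)" for p
  have hE: "h p = EE (\<lambda>x. F (\<lambda>j. x j + p))" for p unfolding h_def shift[OF l, symmetric] by simp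
  define h' where "h' p = Re (ls (\<lambda>a. (\<i> * of_real (s a) * cis (p * s a)) * of_real (exp (- bil S V a a / 2))) l)" for p
  have h'E: "h' p = (\<Sum>i\<in>V. EE (\<lambda>x. DF i (\<lambda>j. x j + p)))" for p
  proof -
    have "ls (\<lambda>a. (\<i> * of_real (s a) * cis (p * s a)) * of_real (exp (- bil S V a a / 2))) l
      = ls (\<lambda>a. \<Sum>i\<in>V. \<i> * of_real (a i) * (cis (p * s a) * of_real (exp (- bil S V a a / 2)))) l"
      by (intro arg_cong[where f="\<lambda>g. ls g l"] ext) (simp add: s_def sum_distrib_left sum_distrib_right mult_ac)
    also have "\<dots> = (\<Sum>i\<in>V. ls (\<lambda>a. cis (p * s a) * of_real (exp (- bil S V a a / 2))) (dd i l))"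
      unfolding ls_sum dd_def ls_ltr ..
    also have "\<dots> = (\<Sum>i\<in>V. complex_of_real (EE (\<lambda>x. DF i (\<lambda>j. x j + p))))"
      by (intro sum.cong refl shift[symmetric] dl)
    finally show ?thesis unfolding h'_def by simp
  qed
  have cd: "((\<lambda>p::real. cis (p * c)) has_vector_derivative (\<i> * of_real c * cis (p * c))) (at p within A)" for c p A
  proof -
    have "((\<lambda>z. exp (\<i> * (z * of_real c))) has_field_derivative (\<i> * of_real c * exp (\<i> * (of_real p * of_real c)))) (at (of_real p))"
      by (auto intro!: derivative_eq_intros)
    from has_vector_derivative_real_field[OF this] show ?thesis by (simp add: cis_conv_exp)
  qed
  have der: "(h has_vector_derivative h' p) (at p within A)" for p A
    unfolding h_def h'_def
    by (intro bounded_linear.has_vector_derivative[OF bounded_linear_Re] ls_has_vector_derivative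
        bounded_linear.has_vector_derivative[OF bounded_linear_mult_left] cd)
  have "(h' has_integral h b - h a) {a..b}" by (rule fundamental_theorem_of_calculus[OF ab der])
  then show ?thesis unfolding h'E hE .
qed

text \<open>The analogue of Russo's formula: raising the level shifts all variables by the same
  amount, and the derivative is the sum of the mean partial derivatives, that is, of the
  influences.\<close>

theorem shift_formula:
  assumes V: "finite V" and F: "glim V F DF" and ab: "a \<le> b"
  shows "((\<lambda>p. \<Sum>i\<in>V. EE (\<lambda>x. DF i (\<lambda>j. x j + p))) has_integral (EE (\<lambda>x. F (\<lambda>j. x j + b)) - EE (\<lambda>x. F (\<lambda>j. x j + a)))) {a..b}"
proof -
  obtain Fn DFn C where F: "\<And>n::nat. trig V (Fn n) (DFn n)" "\<And>n x. \<bar>Fn n x\<bar> \<le> C"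
      "\<And>n i x. i \<in> V ==> \<bar>DFn n i x\<bar> \<le> C" "\<And>x. (\<lambda>n. Fn n x) \<longlonglongrightarrow> F x"
      "\<And>i x. i \<in> V ==> (\<lambda>n. DFn n i x) \<longlonglongrightarrow> DF i x" by (rule glimE[OF F]) blast
  have EE_lim_shift: "(\<lambda>n. EE (\<lambda>x. Gn n (\<lambda>j. x j + p))) \<longlonglongrightarrow> EE (\<lambda>x. G (\<lambda>j. x j + p))"
    if "\<And>n. trig0 V (Gn n)" "\<And>n x. \<bar>Gn n x\<bar> \<le> C" "\<And>x. (\<lambda>n. Gn n x) \<longlonglongrightarrow> G x" for Gn G and p :: real
    unfolding EE_def
  proof (rule integral_dominated_convergence[where w="\<lambda>_. C"])
    have m: "(\<lambda>\<omega>. Gn n (\<lambda>i. X i \<omega> + p)) \<in> borel_measurable M" for n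
      using trig0_meas[OF that(1), of n "\<lambda>_. p" 1] by (simp add: add.commute)
    show "(\<lambda>\<omega>. Gn n (\<lambda>i. X i \<omega> + p)) \<in> borel_measurable M" for n by (rule m)
    show "(\<lambda>\<omega>. G (\<lambda>i. X i \<omega> + p)) \<in> borel_measurable M" by (rule borel_measurable_LIMSEQ_real[OF that(3) m])
  qed (use that in auto)
  let ?k = "\<lambda>n p. \<Sum>i\<in>V. EE (\<lambda>x. DFn n i (\<lambda>j. x j + p))"
  let ?g = "\<lambda>p. \<Sum>i\<in>V. EE (\<lambda>x. DF i (\<lambda>j. x j + p))"
  note st = shift_trig[OF V F(1) ab]
  have 1: "?k n integrable_on {a..b}" for n using st by (rule has_integral_integrable)
  have 2: "(\<lambda>_::real. real (card V) * C) integrable_on {a..b}" by auto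
  have 3: "norm (?k n p) \<le> real (card V) * C" if "p \<in> {a..b}" for n p
  proof -
    have "norm (?k n p) \<le> (\<Sum>i\<in>V. C)" unfolding real_norm_def
      by (rule order_trans[OF sum_abs], rule sum_mono, rule abs_EE_le[OF V], rule F(3))
    then show ?thesis by simp
  qed
  have 4: "(\<lambda>n. ?k n p) \<longlonglongrightarrow> ?g p" if "p \<in> {a..b}" for p
    by (rule tendsto_sum, rule EE_lim_shift) (use F trig_trig0_grad[OF F(1)] in auto)
  note dc = dominated_convergence[OF 1 2 3 4]
  have "(\<lambda>n. integral {a..b} (?k n)) \<longlonglongrightarrow> EE (\<lambda>x. F (\<lambda>j. x j + b)) - EE (\<lambda>x. F (\<lambda>j. x j + a))"
    unfolding integral_unique[OF st]
    by (rule tendsto_diff; rule EE_lim_shift) (use F trig_trig0[OF F(1)] in auto)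
  then have "integral {a..b} ?g = EE (\<lambda>x. F (\<lambda>j. x j + b)) - EE (\<lambda>x. F (\<lambda>j. x j + a))"
    using LIMSEQ_unique[OF dc(2)] by simp
  then show ?thesis using has_integral_integrable_integral[of ?g] dc(1) by blast
qed

end

section \<open>Conditioning on one variable and the size of influences\<close>

lemma pattern_meas:
  assumes "finite V" "\<And>v. v \<in> V ==> {\<omega> \<in> space M. P v \<omega>} \<in> sets M"
  shows "{\<omega> \<in> space M. E {v\<in>V. P v \<omega>}} \<in> sets M"
proof -
  have "{\<omega> \<in> space M. E {v\<in>V. P v \<omega>}} = (\<Union>R\<in>{R\<in>Pow V. E R}. {\<omega> \<in> space M. \<forall>v\<in>V. P v \<omega> = (v \<in> R)})"
  proof (intro equalityI subsetI)
    fix \<omega> assume "\<omega> \<in> {\<omega> \<in> space M. E {v\<in>V. P v \<omega>}}"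
    then show "\<omega> \<in> (\<Union>R\<in>{R\<in>Pow V. E R}. {\<omega> \<in> space M. \<forall>v\<in>V. P v \<omega> = (v \<in> R)})"
      by (intro UN_I[of "{v\<in>V. P v \<omega>}"]) auto
  next
    fix \<omega> assume "\<omega> \<in> (\<Union>R\<in>{R\<in>Pow V. E R}. {\<omega> \<in> space M. \<forall>v\<in>V. P v \<omega> = (v \<in> R)})"
    then obtain R where R: "R \<subseteq> V" "E R" "\<omega> \<in> space M" "\<forall>v\<in>V. P v \<omega> = (v \<in> R)" by auto
    then have "{v\<in>V. P v \<omega>} = R" by auto
    then show "\<omega> \<in> {\<omega> \<in> space M. E {v\<in>V. P v \<omega>}}" using R by simp
  qed
  also have "\<dots> \<in> sets M"
  proof (intro sets.finite_UN)
    show "finite {R \<in> Pow V. E R}" using assms by auto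
    fix R
    have "{\<omega> \<in> space M. P v \<omega> = (v \<in> R)} \<in> sets M" if "v \<in> V" for v
      using assms(2)[OF that] by (cases "v \<in> R") (auto intro: sets.sets_Collect_neg)
    then show "{\<omega> \<in> space M. \<forall>v\<in>V. P v \<omega> = (v \<in> R)} \<in> sets M"
      using assms by (intro sets.sets_Collect_finite_All) auto
  qed
  finally show ?thesis .
qed

locale gauss2 = gauss1 M X S for M :: "'w measure" and X :: "'i => 'w => real" and S +
  assumes S_diag: "\<And>i. S i i = 1"
    and tail: "\<And>a. \<exists>q>0. \<forall>i. q \<le> prob {\<omega> \<in> space M. X i \<omega> \<le> a}"
begin

text \<open>Regression on \<open>X i\<close>: replacing \<open>X i\<close> by an independent copy while keeping the residuals
  \<open>X v - S i v * X i\<close> does not change the law.\<close>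

lemma gauss_regress:
  "gauss (M \<Otimes>\<^sub>M M) (\<lambda>v z. S i v * X i (fst z) + (X v (snd z) - S i v * X i (snd z))) S"
proof -
  interpret P: pair_prob_space M M ..
  show ?thesis
  proof
    show "(\<lambda>z. S i v * X i (fst z) + (X v (snd z) - S i v * X i (snd z))) \<in> borel_measurable (M \<Otimes>\<^sub>M M)" for v by measurable
    fix V :: "'i set" and a :: "'i => real" assume V: "finite V"
    define s where "s = (\<Sum>v\<in>V. a v * S i v)"
    define a' where "a' v = (if v \<in> V then a v else 0)" for v
    \<comment> \<open>What remains of \<open>a\<close> when the part along \<open>X i\<close> is
      split off: the combination is \<open>s * X i\<close> in the first copy plus
      \<open>lin ?W b\<close> in the second, with variances \<open>s\<^sup>2\<close> and
      \<open>bil S V a a - s\<^sup>2\<close>.\<close>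
    define b where "b v = a' v + (if v = i then - s else 0)" for v
    let ?W = "insert i V"
    have W: "finite ?W" using V by simp
    have a': "(\<Sum>v\<in>?W. a' v * h v) = (\<Sum>v\<in>V. a v * h v)" for h
      by (rule sum.mono_neutral_cong_right) (use V in \<open>auto simp: a'_def\<close>)
    have b: "(\<Sum>v\<in>?W. b v * h v) = (\<Sum>v\<in>V. a v * h v) - s * h i" for h
      unfolding b_def by (simp add: distrib_right sum.distrib a'[symmetric] if_distrib[of "\<lambda>x. x * _"] sum.delta[OF W] cong: if_cong)
    have bb: "bil S ?W b b = bil S V a a - s\<^sup>2"
    proof -
      have "bil S ?W b b = (\<Sum>v\<in>?W. b v * (\<Sum>w\<in>?W. b w * S v w))" by (simp add: bil_def sum_distrib_left mult_ac)
      also have "\<dots> = (\<Sum>v\<in>V. a v * ((\<Sum>w\<in>V. a w * S v w) - s * S v i)) - s * ((\<Sum>w\<in>V. a w * S i w) - s * S i i)"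
        unfolding b ..
      also have "\<dots> = bil S V a a - s * (\<Sum>v\<in>V. a v * S v i)"
        using S_diag by (simp add: s_def[symmetric] bil_def sum_subtractf sum_distrib_left algebra_simps)
      also have "(\<Sum>v\<in>V. a v * S v i) = s" unfolding s_def by (intro sum.cong refl) (simp add: S_sym[of _ i])
      finally show ?thesis by (simp add: power2_eq_square)
    qed
    have l: "lin V a (\<lambda>v. S i v * X i (fst z) + (X v (snd z) - S i v * X i (snd z))) = lin {i} (\<lambda>_. s) (\<lambda>v. X v (fst z)) + lin ?W b (\<lambda>v. X v (snd z))" for z
      unfolding lin_def b by (simp add: s_def sum.distrib sum_subtractf sum_distrib_left sum_distrib_right algebra_simps)
    have m1: "(\<lambda>\<omega>. cis (lin {i} (\<lambda>_. s) (\<lambda>v. X v \<omega>))) \<in> borel_measurable M" and m2: "(\<lambda>\<omega>. cis (lin ?W b (\<lambda>v. X v \<omega>))) \<in> borel_measurable M" by measurable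
    have int: "integrable (M \<Otimes>\<^sub>M M) (\<lambda>z. cis (lin {i} (\<lambda>_. s) (\<lambda>v. X v (fst z))) * cis (lin ?W b (\<lambda>v. X v (snd z))))"
      by (rule P.integrable_const_bound[where B=1]) (use m1 m2 in \<open>auto simp: norm_mult\<close>)
    have "(LINT z|(M \<Otimes>\<^sub>M M). cis (lin V a (\<lambda>v. S i v * X i (fst z) + (X v (snd z) - S i v * X i (snd z)))))
       = (LINT z|(M \<Otimes>\<^sub>M M). cis (lin {i} (\<lambda>_. s) (\<lambda>v. X v (fst z))) * cis (lin ?W b (\<lambda>v. X v (snd z))))"
      unfolding l by (simp add: cis_mult)
    also have "\<dots> = (LINT \<omega>|M. LINT \<omega>'|M. cis (lin {i} (\<lambda>_. s) (\<lambda>v. X v \<omega>)) * cis (lin ?W b (\<lambda>v. X v \<omega>')))"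
      using P.integral_fst'[OF int] by simp
    also have "\<dots> = of_real (exp (- bil S {i} (\<lambda>_. s) (\<lambda>_. s) / 2)) * of_real (exp (- bil S ?W b b / 2))"
      using char_X[OF W, of b] char_X[of "{i}" "\<lambda>_. s"] by simp
    also have "\<dots> = of_real (exp (- bil S V a a / 2))"
      unfolding bb using S_diag by (simp add: bil_def power2_eq_square field_simps flip: of_real_mult exp_add)
    finally show "(LINT z|(M \<Otimes>\<^sub>M M). cis (lin V a (\<lambda>v. S i v * X i (fst z) + (X v (snd z) - S i v * X i (snd z)))))
       = of_real (exp (- bil S V a a / 2))" .
  qed (rule S_sym)
qed

lemma measure_Times: assumes "A \<in> sets M" "B \<in> sets M" shows "measure (M \<Otimes>\<^sub>M M) (A \<times> B) = prob A * prob B"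
proof -
  interpret P: pair_prob_space M M ..
  show ?thesis using emeasure_pair_measure_Times[OF assms] by (simp add: measure_def enn2real_mult)
qed

text \<open>By \<open>gauss_regress\<close> the variable \<open>X i\<close> may be redrawn
  independently of the residuals. Let \<open>Q\<close> be the event \<open>W\<close> with the value
  \<open>lo\<close> put at \<open>i\<close>. As covariances are nonnegative and \<open>W\<close> is
  decreasing, \<open>W\<close> implies \<open>Q\<close> when the value is at least
  \<open>lo\<close>, and \<open>Q\<close> implies \<open>W\<close> when it is at most
  \<open>lo\<close>. Since \<open>Q\<close> does not depend on the redrawn variable, probabilities
  factorize in both cases.\<close>

lemma conditional_decreasing:
  assumes V: "finite V" and W: "incr V (\<lambda>R. \<not> W R)" and lh: "lo \<le> hi"
  shows "prob {\<omega> \<in> space M. lo \<le> X i \<omega> \<and> X i \<omega> < hi \<and> W {v\<in>V. X v \<omega> \<ge> 0}} * prob {\<omega> \<in> space M. X i \<omega> \<le> lo}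
    \<le> (hi - lo) * prob (sev V (\<lambda>_. 0) W)"
proof -
  interpret P: pair_prob_space M M ..
  let ?N = "M \<Otimes>\<^sub>M M"
  define Y where "Y v z = S i v * X i (fst z) + (X v (snd z) - S i v * X i (snd z))" for v z
  have Yi: "Y i z = X i (fst z)" for z unfolding Y_def using S_diag by simp
  have gY: "gauss ?N Y S" using gauss_regress[of i] unfolding Y_def[abs_def] .
  have gX: "gauss M X S" ..
  interpret B: gauss ?N Y S by (rule gY)
  \<comment> \<open>Two extra copies of \<open>i\<close> express \<open>lo \<le> X i\<close> and
    \<open>X i < hi\<close> as threshold conditions, so that \<open>sev_law\<close> covers
    them.\<close>
  define \<sigma> :: "'i + bool => 'i" where "\<sigma> k = (case k of Inl v => v | Inr _ => i)" for k
  define c :: "'i + bool => real" where "c k = (case k of Inl v => 0 | Inr b => (if b then lo else hi))" for k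
  define J where "J = Inl ` V \<union> {Inr True, Inr False}"
  have J: "finite J" unfolding J_def using V by simp
  define E where "E R \<longleftrightarrow> Inr True \<in> R \<and> Inr False \<notin> R \<and> W {v. Inl v \<in> R}" for R :: "('i + bool) set"
  have JV: "{v. Inl v \<in> J \<and> P v} = {v\<in>V. P v}" for P unfolding J_def by auto
  have law: "measure M (gauss.sev M (\<lambda>k. X (\<sigma> k)) J c E) = measure ?N (gauss.sev ?N (\<lambda>k. Y (\<sigma> k)) J c E)"
    by (rule sev_law[OF gauss_reindex[OF gX] gauss_reindex[OF gY] J]) simp
  have E1: "gauss.sev M (\<lambda>k. X (\<sigma> k)) J c E = {\<omega> \<in> space M. lo \<le> X i \<omega> \<and> X i \<omega> < hi \<and> W {v\<in>V. X v \<omega> \<ge> 0}}"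
    unfolding gauss.sev_def[OF gauss_reindex[OF gX]] E_def by (auto simp: JV \<sigma>_def c_def) (auto simp: J_def)
  have E2: "gauss.sev ?N (\<lambda>k. Y (\<sigma> k)) J c E = {z \<in> space ?N. lo \<le> Y i z \<and> Y i z < hi \<and> W {v\<in>V. Y v z \<ge> 0}}"
    unfolding gauss.sev_def[OF gauss_reindex[OF gY]] E_def by (auto simp: JV \<sigma>_def c_def) (auto simp: J_def)
  define Q where "Q = {\<omega> \<in> space M. W {v\<in>V. S i v * lo + (X v \<omega> - S i v * X i \<omega>) \<ge> 0}}"
  have Qm: "Q \<in> sets M" unfolding Q_def by (rule pattern_meas[OF V]) measurable
  have Wd: "W R'" if "R' \<subseteq> R" "R \<subseteq> V" "W R" for R R' using incrD[OF W that(1,2)] that(3) by blast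
  have "prob {\<omega> \<in> space M. lo \<le> X i \<omega> \<and> X i \<omega> < hi \<and> W {v\<in>V. X v \<omega> \<ge> 0}} \<le> (hi - lo) * prob Q"
  proof -
    have "prob {\<omega> \<in> space M. lo \<le> X i \<omega> \<and> X i \<omega> < hi \<and> W {v\<in>V. X v \<omega> \<ge> 0}} = measure ?N {z \<in> space ?N. lo \<le> Y i z \<and> Y i z < hi \<and> W {v\<in>V. Y v z \<ge> 0}}"
      using law unfolding E1 E2 .
    also have "\<dots> \<le> measure ?N ({\<omega> \<in> space M. lo \<le> X i \<omega> \<and> X i \<omega> \<le> hi} \<times> Q)"
    proof (rule P.finite_measure_mono)
      show "{z \<in> space ?N. lo \<le> Y i z \<and> Y i z < hi \<and> W {v\<in>V. Y v z \<ge> 0}} \<subseteq> {\<omega> \<in> space M. lo \<le> X i \<omega> \<and> X i \<omega> \<le> hi} \<times> Q"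
      proof
        fix z assume z: "z \<in> {z \<in> space ?N. lo \<le> Y i z \<and> Y i z < hi \<and> W {v\<in>V. Y v z \<ge> 0}}"
        have "S i v * lo \<le> S i v * X i (fst z)" for v using z unfolding Yi by (intro mult_left_mono S_nonneg) auto
        then have "{v\<in>V. S i v * lo + (X v (snd z) - S i v * X i (snd z)) \<ge> 0} \<subseteq> {v\<in>V. Y v z \<ge> 0}"
          unfolding Y_def by (auto intro: order_trans)
        from Wd[OF this] z show "z \<in> {\<omega> \<in> space M. lo \<le> X i \<omega> \<and> X i \<omega> \<le> hi} \<times> Q"
          unfolding Q_def Yi by (cases z) (auto simp: space_pair_measure)
      qed
      show "{\<omega> \<in> space M. lo \<le> X i \<omega> \<and> X i \<omega> \<le> hi} \<times> Q \<in> sets ?N" using Qm by (intro pair_measureI) measurable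
    qed
    also have "\<dots> = prob {\<omega> \<in> space M. lo \<le> X i \<omega> \<and> X i \<omega> \<le> hi} * prob Q" using Qm by (intro measure_Times) measurable
    also have "\<dots> \<le> (hi - lo) * prob Q" by (intro mult_right_mono dens lh) simp
    finally show ?thesis .
  qed
  moreover have "prob {\<omega> \<in> space M. X i \<omega> \<le> lo} * prob Q \<le> prob (sev V (\<lambda>_. 0) W)"
  proof -
    have "prob {\<omega> \<in> space M. X i \<omega> \<le> lo} * prob Q = measure ?N ({\<omega> \<in> space M. X i \<omega> \<le> lo} \<times> Q)"
      using Qm by (intro measure_Times[symmetric]) measurable
    also have "\<dots> \<le> measure ?N (B.sev V (\<lambda>_. 0) W)"
    proof (rule P.finite_measure_mono[OF _ B.sev_meas[OF V]])
      show "{\<omega> \<in> space M. X i \<omega> \<le> lo} \<times> Q \<subseteq> B.sev V (\<lambda>_. 0) W"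
      proof
        fix z assume z: "z \<in> {\<omega> \<in> space M. X i \<omega> \<le> lo} \<times> Q"
        have "S i v * X i (fst z) \<le> S i v * lo" for v using z by (intro mult_left_mono S_nonneg) auto
        then have "{v\<in>V. Y v z \<ge> 0} \<subseteq> {v\<in>V. S i v * lo + (X v (snd z) - S i v * X i (snd z)) \<ge> 0}"
          unfolding Y_def by (auto intro: order_trans)
        from Wd[OF this] z show "z \<in> B.sev V (\<lambda>_. 0) W"
          unfolding Q_def B.sev_def by (cases z) (auto simp: space_pair_measure)
      qed
    qed
    also have "\<dots> = prob (sev V (\<lambda>_. 0) W)" by (rule sev_law[OF gY gX V, symmetric, THEN sym]) simp
    finally show ?thesis .
  qed
  ultimately have "prob {\<omega> \<in> space M. lo \<le> X i \<omega> \<and> X i \<omega> < hi \<and> W {v\<in>V. X v \<omega> \<ge> 0}} * prob {\<omega> \<in> space M. X i \<omega> \<le> lo}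
     \<le> ((hi - lo) * prob Q) * prob {\<omega> \<in> space M. X i \<omega> \<le> lo}" by (intro mult_right_mono) auto
  also have "\<dots> = (hi - lo) * (prob {\<omega> \<in> space M. X i \<omega> \<le> lo} * prob Q)" by simp
  also have "\<dots> \<le> (hi - lo) * prob (sev V (\<lambda>_. 0) W)"
    using lh \<open>prob {\<omega> \<in> space M. X i \<omega> \<le> lo} * prob Q \<le> prob (sev V (\<lambda>_. 0) W)\<close> by (intro mult_left_mono) auto
  finally show ?thesis .
qed

end

context gauss2 begin

text \<open>The gradient in \<open>i\<close> vanishes unless \<open>X i\<close> is within \<eta> of
  \<open>- p\<close>. There it is at most 1/\<eta>, and it needs a configuration containing all
  vertices with \<open>X v \<ge> 0\<close> in which \<open>i\<close> is pivotal; being decreasing,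
  \<open>W\<close> then holds for these vertices alone. \<open>conditional_decreasing\<close> bounds
  the probability by \<open>2 * \<eta> * \<delta> / q\<close>, so that \<eta> cancels.\<close>

lemma influence_bound:
  assumes V: "finite V" and i: "i \<in> V" and st: "\<And>i. i \<in> V ==> is_step \<eta> (U i) (U' i)" and h: "\<eta> > 0"
    and W: "incr (V - {i}) (\<lambda>R. \<not> W R)" and piv: "\<And>R. R \<subseteq> V - {i} ==> A (insert i R) ==> \<not> A R ==> W R"
    and A: "incr V A" and p: "\<eta> \<le> p" "p + \<eta> \<le> p0"
    and q: "q > 0" "q \<le> prob {\<omega> \<in> space M. X i \<omega> \<le> - p0}"
    and d: "prob (sev (V - {i}) (\<lambda>_. 0) W) \<le> \<delta>"
  shows "EE (sD V U U' (\<lambda>_. - p) A i) \<le> 2 * \<delta> / q"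
proof -
  let ?c = "\<lambda>_::'i. - p"
  let ?E = "{\<omega> \<in> space M. - p - \<eta> \<le> X i \<omega> \<and> X i \<omega> < - p + \<eta> \<and> W {v\<in>V - {i}. X v \<omega> \<ge> 0}}"
  have Vi: "finite (V - {i})" using V by simp
  have m: "?E \<in> sets M"
  proof -
    have "{\<omega> \<in> space M. W {v\<in>V - {i}. X v \<omega> \<ge> 0}} \<in> sets M" by (rule pattern_meas[OF Vi]) measurable
    moreover have "?E = {\<omega> \<in> space M. - p - \<eta> \<le> X i \<omega> \<and> X i \<omega> < - p + \<eta>} \<inter> {\<omega> \<in> space M. W {v\<in>V - {i}. X v \<omega> \<ge> 0}}" by auto
    moreover have "{\<omega> \<in> space M. - p - \<eta> \<le> X i \<omega> \<and> X i \<omega> < - p + \<eta>} \<in> sets M" by measurable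
    ultimately show ?thesis by auto
  qed
  have sti: "is_step \<eta> (U i) (U' i)" using st i by auto
  have U01: "0 \<le> U j y \<and> U j y \<le> 1" if "j \<in> V" for j y using st[OF that] by (auto simp: is_step_def)
  have t: "tlim V (sD V U U' ?c A i)" by (rule glim_tlim_grad[OF sF_glim[where \<eta>="\<lambda>_. \<eta>"] i]) (use V st h in auto)
  have ptw: "sD V U U' ?c A i (\<lambda>i. X i \<omega>) \<le> 1 / \<eta> * indicator ?E \<omega>" if w: "\<omega> \<in> space M" for \<omega>
  proof -
    let ?u = "\<lambda>j. U j (X j \<omega> - - p)"
    let ?R = "{v\<in>V - {i}. X v \<omega> \<ge> 0}"
    have d0: "0 \<le> mextd V (\<lambda>S. of_bool (A S) :: real) i ?u"
      by (rule mextd_01(1)[where \<eta>="\<lambda>_. \<eta>", OF V _ _ A i]) (use st h in auto)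
    have d1: "mextd V (\<lambda>S. of_bool (A S) :: real) i ?u \<le> of_bool (W ?R)"
    proof -
      have "0 \<le> mext (V - {i}) (\<lambda>R. of_bool (W ?R) - (of_bool (A (insert i R)) - of_bool (A R) :: real)) ?u"
      proof (rule mext_nonneg[OF _ _ Vi])
        show "0 \<le> ?u j \<and> ?u j \<le> 1" if "j \<in> V - {i}" for j using U01 that by auto
        fix R assume R: "R \<subseteq> V - {i}" "{j\<in>V - {i}. ?u j = 1} \<subseteq> R"
        have "?R \<subseteq> {j\<in>V - {i}. ?u j = 1}"
        proof
          fix j assume j: "j \<in> ?R"
          then have "X j \<omega> - - p \<ge> \<eta>" using p by auto
          then have "?u j = 1" using st[of j] j unfolding is_step_def by blast
          then show "j \<in> {j\<in>V - {i}. ?u j = 1}" using j by blast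
        qed
        then have "?R \<subseteq> R" using R(2) by (rule order_trans)
        have "W ?R" if "A (insert i R)" "\<not> A R"
          using piv[OF R(1) that] incrD[OF W \<open>?R \<subseteq> R\<close> R(1)] by blast
        then show "0 \<le> of_bool (W ?R) - (of_bool (A (insert i R)) - of_bool (A R) :: real)" by (auto simp: of_bool_def)
      qed
      then show ?thesis unfolding mext_diff using Vi by (simp add: mext_const mext_diff)
    qed
    show ?thesis
    proof (cases "- p - \<eta> \<le> X i \<omega> \<and> X i \<omega> < - p + \<eta>")
      case True
      have "sD V U U' ?c A i (\<lambda>i. X i \<omega>) \<le> (1 / \<eta>) * of_bool (W ?R)"
        unfolding sD_def using sti d0 d1 h by (intro mult_mono) (auto simp: is_step_def)
      also have "\<dots> = 1 / \<eta> * indicator ?E \<omega>" using True w by (simp add: indicator_def)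
      finally show ?thesis .
    next
      case False
      then have "\<bar>X i \<omega> - - p\<bar> \<ge> \<eta>" by auto
      then have "U' i (X i \<omega> - - p) = 0" using sti unfolding is_step_def by blast
      then have "sD V U U' ?c A i (\<lambda>i. X i \<omega>) = 0" unfolding sD_def by simp
      then show ?thesis using h by (simp add: indicator_def)
    qed
  qed
  have "EE (sD V U U' ?c A i) \<le> (LINT \<omega>|M. 1 / \<eta> * indicator ?E \<omega>)" unfolding EE_def
    by (rule integral_mono[OF tlim_integrable0[OF t]]) (use m ptw in \<open>auto simp: emeasure_eq_measure intro!: integrable_mult_right integrable_real_indicator\<close>)
  also have "\<dots> = 1 / \<eta> * prob ?E" using m by simp
  also have "\<dots> \<le> 1 / \<eta> * (2 * \<eta> * (\<delta> / q))"
  proof (intro mult_left_mono)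
    have "prob ?E * prob {\<omega> \<in> space M. X i \<omega> \<le> - p - \<eta>} \<le> (- p + \<eta> - (- p - \<eta>)) * prob (sev (V - {i}) (\<lambda>_. 0) W)"
      by (rule conditional_decreasing[OF Vi W]) (use h in auto)
    also have "\<dots> \<le> 2 * \<eta> * \<delta>" using h d by (auto intro!: mult_mono)
    finally have 1: "prob ?E * prob {\<omega> \<in> space M. X i \<omega> \<le> - p - \<eta>} \<le> 2 * \<eta> * \<delta>" .
    have "q \<le> prob {\<omega> \<in> space M. X i \<omega> \<le> - p - \<eta>}"
      by (rule order_trans[OF q(2)], rule finite_measure_mono) (use p in auto)
    then have "prob ?E * q \<le> prob ?E * prob {\<omega> \<in> space M. X i \<omega> \<le> - p - \<eta>}" by (intro mult_left_mono) auto
    then have "prob ?E * q \<le> 2 * \<eta> * \<delta>" using 1 by simp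
    then show "prob ?E \<le> 2 * \<eta> * (\<delta> / q)" using q(1) by (simp add: pos_le_divide_eq)
  qed (use h in auto)
  also have "\<dots> = 2 * \<delta> / q" using h by simp
  finally show ?thesis .
qed

text \<open>\<open>W i\<close> is a decreasing event that does not depend on \<open>i\<close> and that occurs whenever \<open>i\<close> is pivotal for
  \<open>A\<close>.\<close>

theorem sharp_threshold:
  assumes K: "\<And>V i. finite V ==> (\<Sum>j\<in>V. S i j) \<le> K" and K0: "K > 0"
    and p0: "p0 > 0" and c0: "c0 > 0" and xi: "\<xi> > 0"
  obtains \<delta> where "\<delta> > 0"
    "\<And>V A W. finite V ==> incr V A ==> (\<And>i R. i \<in> V ==> R \<subseteq> V - {i} ==> A (insert i R) ==> \<not> A R ==> W i R) ==>
      (\<And>i. i \<in> V ==> incr (V - {i}) (\<lambda>R. \<not> W i R)) ==>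
      (\<And>i. i \<in> V ==> prob (sev (V - {i}) (\<lambda>_. 0) (W i)) \<le> \<delta>) ==>
      c0 \<le> prob (sev V (\<lambda>_. 0) A) ==> 1 - \<xi> \<le> prob (sev V (\<lambda>_. - p0) A)"
proof -
  \<comment> \<open>Chosen so that \<open>2 * \<zeta> * K = p0 * c0 * \<xi>\<close>. Up to
    smoothing, the derivative in the level is at least
    \<open>c0 * (1 - P) / (2 * \<zeta> * K)\<close> on an interval of length almost
    \<open>p0\<close>, while the total increase is at most 1.\<close>
  define \<zeta> where "\<zeta> = p0 * c0 * \<xi> / (2 * K)"
  have z: "\<zeta> > 0" unfolding \<zeta>_def using p0 c0 xi K0 by simp
  obtain \<tau> \<delta>1 where tau: "0 \<le> \<tau>" "\<tau> < 1" "4 * sqrt (1 - \<tau>) \<le> \<zeta>" and d1: "\<delta>1 > 0"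
    and small: "\<And>V \<psi> t. finite V ==> tlim V \<psi> ==> (\<And>x. 0 \<le> \<psi> x) ==> (\<And>s x. 0 \<le> s ==> s < 1 ==> PP s \<psi> x \<le> tdens s) ==>
      EE \<psi> \<le> \<delta>1 ==> 0 \<le> t ==> t \<le> \<tau> ==> EE (\<lambda>x. \<psi> x * PP t \<psi> x) \<le> \<zeta> * EE \<psi>"
    by (rule small_energy[OF z]) blast
  obtain q where q: "q > 0" "\<And>i. q \<le> prob {\<omega> \<in> space M. X i \<omega> \<le> - p0}" using tail by blast
  show ?thesis
  proof (rule that[of "\<delta>1 * q / 2"])
    show "\<delta>1 * q / 2 > 0" using d1 q by simp
    fix V :: "'i set" and A and W :: "'i => 'i set => bool"
    assume V: "finite V" and A: "incr V A"
      and piv: "\<And>i R. i \<in> V ==> R \<subseteq> V - {i} ==> A (insert i R) ==> \<not> A R ==> W i R"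
      and W: "\<And>i. i \<in> V ==> incr (V - {i}) (\<lambda>R. \<not> W i R)"
      and dl: "\<And>i. i \<in> V ==> prob (sev (V - {i}) (\<lambda>_. 0) (W i)) \<le> \<delta>1 * q / 2"
      and c: "c0 \<le> prob (sev V (\<lambda>_. 0) A)"
    define P where "P = prob (sev V (\<lambda>_. - p0) A)"
    show "1 - \<xi> \<le> prob (sev V (\<lambda>_. - p0) A)"
    proof (cases "V = {}")
      case True
      have "A {}" using c c0 unfolding True sev_def by (cases "A {}") auto
      then have "sev V (\<lambda>_. - p0) A = space M" unfolding True sev_def by simp
      then show ?thesis using xi prob_space by simp
    next
      case ne: False
      have main: "p0 * (c0 * (1 - P)) \<le> p0 * c0 * \<xi> + e" if e: "e > 0" for e
      proof -
        define n where "n = real (card V)"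
        define a where "a = c0 * (1 - P)"
        have a0: "a \<ge> 0" unfolding a_def P_def using c0 by simp
        \<comment> \<open>The width \<eta> contributes at most \<open>L * \<eta>\<close> to the
          final inequality, so \<open>\<eta> \<le> e / L\<close> keeps this below
          \<open>e\<close>.\<close>
        define L where "L = 2 * a + 2 * n * p0 + 1"
        have L: "L > 0" unfolding L_def n_def using a0 p0 by (intro add_nonneg_pos add_nonneg_nonneg) auto
        define \<eta> where "\<eta> = min (p0 / 4) (e / L)"
        have h: "\<eta> > 0" "\<eta> \<le> p0 / 4" "\<eta> \<le> e / L"
          using p0 e L min.cobounded1[of "p0 / 4" "e / L"] min.cobounded2[of "p0 / 4" "e / L"] unfolding \<eta>_def by simp_all
        obtain U U' where U: "\<And>i::'i. is_step \<eta> (U i) (U' i)" using step_family[of "\<lambda>_. \<eta>"] h by metis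
        note st = V U h(1)
        let ?F = "\<lambda>p. sF V U (\<lambda>_. - p) A" and ?D = "\<lambda>p i. sD V U U' (\<lambda>_. - p) A i"
        have gl: "glim V (?F p) (?D p)" for p by (rule sF_glim[where \<eta>="\<lambda>_. \<eta>", OF st])
        have Fsh: "(\<lambda>x. ?F 0 (\<lambda>j. x j + p)) = ?F p" and Dsh: "(\<lambda>x. ?D 0 i (\<lambda>j. x j + p)) = ?D p i" for p i
          by (simp_all add: sF_def sD_def fun_eq_iff)
        \<comment> \<open>The levels stay \<eta> away from 0 and \<open>p0\<close>, because
          smoothing blurs the level by \<eta>.\<close>
        have lb: "\<eta> \<le> p0 - \<eta>" using h p0 by simp
        have int: "((\<lambda>p. \<Sum>i\<in>V. EE (?D p i)) has_integral (EE (?F (p0 - \<eta>)) - EE (?F \<eta>))) {\<eta>..p0 - \<eta>}"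
          using shift_formula[OF V gl[of 0] lb] unfolding Fsh Dsh .
        have low: "(a - 2 * n * \<eta>) / (2 * \<zeta> * K) \<le> (\<Sum>i\<in>V. EE (?D p i))" if p: "p \<in> {\<eta>..p0 - \<eta>}" for p
        proof -
          have D0: "0 \<le> ?D p i x" if "i \<in> V" for i x by (rule sD_nonneg[where \<eta>="\<lambda>_. \<eta>", OF st A that])
          have DB: "PP s (?D p i) x \<le> tdens s" if "i \<in> V" "0 \<le> s" "s < 1" for i s x
            by (rule PP_sD_le[where \<eta>="\<lambda>_. \<eta>", OF st A that])
          have I: "EE (?D p i) \<le> \<delta>1" if i: "i \<in> V" for i
          proof -
            have "EE (?D p i) \<le> 2 * (\<delta>1 * q / 2) / q"
              by (rule influence_bound[OF V i U h(1) W[OF i] piv[OF i] A _ _ q dl[OF i]]) (use p in auto)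
            then show ?thesis using q(1) by simp
          qed
          have v1: "EE (\<lambda>x. (?F p x)\<^sup>2) - (EE (?F p))\<^sup>2 \<le> 2 * \<zeta> * K * (\<Sum>i\<in>V. EE (?D p i))"
          proof (rule variance_energy[OF V ne gl D0 DB _ tau])
            show "(\<Sum>j\<in>V. \<bar>S i j\<bar>) \<le> K" for i using K[OF V, of i] S_nonneg by simp
            fix i t assume it: "i \<in> V" "0 \<le> t" "t \<le> \<tau>"
            show "EE (\<lambda>x. ?D p i x * PP t (?D p i) x) \<le> \<zeta> * EE (?D p i)"
              by (rule small[OF V glim_tlim_grad[OF gl it(1)] D0[OF it(1)] DB[OF it(1)] I[OF it(1)] it(2,3)])
          qed
          have v2: "EE (?F p) - 2 * n * \<eta> \<le> EE (\<lambda>x. (?F p x)\<^sup>2)"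
          proof -
            have tF: "tlim V (?F p)" by (rule glim_tlim[OF gl])
            have t2: "tlim V (\<lambda>x. (?F p x)\<^sup>2)" using tlim_mult[OF tF tF] by (simp add: power2_eq_square)
            note F01 = sF_01[where U=U and U'=U' and \<eta>="\<lambda>_. \<eta>", OF st, where c="\<lambda>_. - p" and E=A]
            have "\<bar>EE (\<lambda>x. ?F p x - (?F p x)\<^sup>2) - prob (sev V (\<lambda>_. - p) (\<lambda>_. False))\<bar> \<le> 2 * (\<Sum>i\<in>V. \<eta>)"
            proof (rule EE_approx[where \<eta>="\<lambda>_. \<eta>", OF st tlim_diff[OF tF t2]])
              show "0 \<le> ?F p x - (?F p x)\<^sup>2" for x using F01[where x=x] by (simp add: power2_eq_square mult_left_le)
              show "?F p x - (?F p x)\<^sup>2 \<le> 1" for x using F01[where x=x] by (simp add: diff_le_eq add_increasing2)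
              fix \<omega> assume w: "\<omega> \<in> space M" "\<omega> \<notin> bad V (\<lambda>_. \<eta>) (\<lambda>_. - p)"
              have "?F p (\<lambda>i. X i \<omega>) = of_bool (A {v\<in>V. X v \<omega> \<ge> - p})"
                by (rule sF_good[where \<eta>="\<lambda>_. \<eta>", OF st w])
              then show "?F p (\<lambda>i. X i \<omega>) - (?F p (\<lambda>i. X i \<omega>))\<^sup>2 = of_bool False" by simp
            qed
            moreover have "sev V (\<lambda>_. - p) (\<lambda>_. False) = {}" by (simp add: sev_def)
            ultimately have "EE (\<lambda>x. ?F p x - (?F p x)\<^sup>2) \<le> 2 * n * \<eta>" by (simp add: n_def)
            then show ?thesis using EE_diff[OF tF t2] by simp
          qed
          have v3: "c0 \<le> EE (?F p)"
          proof -
            have "prob (sev V (\<lambda>_. 0) A) \<le> prob (sev V (\<lambda>_. - p + \<eta>) A)"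
            proof (rule finite_measure_mono[OF _ sev_meas[OF V]])
              show "sev V (\<lambda>_. 0) A \<subseteq> sev V (\<lambda>_. - p + \<eta>) A"
              proof
                fix \<omega> assume "\<omega> \<in> sev V (\<lambda>_. 0) A"
                then show "\<omega> \<in> sev V (\<lambda>_. - p + \<eta>) A" unfolding sev_def
                  using incrD[OF A, of "{v\<in>V. X v \<omega> \<ge> 0}" "{v\<in>V. X v \<omega> \<ge> - p + \<eta>}"] p by fastforce
              qed
            qed
            also have "\<dots> \<le> EE (?F p)" by (rule sF_sandwich(1)[where \<eta>="\<lambda>_. \<eta>", OF st A])
            finally show ?thesis using c by simp
          qed
          have v4: "EE (?F p) \<le> P"
          proof -
            have "EE (?F p) \<le> prob (sev V (\<lambda>_. - p - \<eta>) A)" by (rule sF_sandwich(2)[where \<eta>="\<lambda>_. \<eta>", OF st A])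
            also have "\<dots> \<le> P" unfolding P_def
            proof (rule finite_measure_mono[OF _ sev_meas[OF V]])
              show "sev V (\<lambda>_. - p - \<eta>) A \<subseteq> sev V (\<lambda>_. - p0) A"
              proof
                fix \<omega> assume "\<omega> \<in> sev V (\<lambda>_. - p - \<eta>) A"
                then show "\<omega> \<in> sev V (\<lambda>_. - p0) A" unfolding sev_def
                  using incrD[OF A, of "{v\<in>V. X v \<omega> \<ge> - p - \<eta>}" "{v\<in>V. X v \<omega> \<ge> - p0}"] p by fastforce
              qed
            qed
            finally show ?thesis .
          qed
          have "P \<le> 1" unfolding P_def by simp
          then have "c0 * (1 - P) \<le> EE (?F p) * (1 - EE (?F p))"
            using c0 v3 v4 by (intro mult_mono) auto
          moreover have "EE (?F p) * (1 - EE (?F p)) - 2 * n * \<eta> \<le> 2 * \<zeta> * K * (\<Sum>i\<in>V. EE (?D p i))"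
            using v1 v2 by (simp add: right_diff_distrib power2_eq_square)
          ultimately have "a - 2 * n * \<eta> \<le> 2 * \<zeta> * K * (\<Sum>i\<in>V. EE (?D p i))" unfolding a_def by linarith
          then show ?thesis using z K0 by (simp add: pos_divide_le_eq mult.commute)
        qed
        have "((\<lambda>p. (a - 2 * n * \<eta>) / (2 * \<zeta> * K)) has_integral (p0 - \<eta> - \<eta>) *\<^sub>R ((a - 2 * n * \<eta>) / (2 * \<zeta> * K))) {\<eta>..p0 - \<eta>}"
          using has_integral_const_real[of "(a - 2 * n * \<eta>) / (2 * \<zeta> * K)" \<eta> "p0 - \<eta>"] lb by simp
        from has_integral_le[OF this int low] have "(p0 - 2 * \<eta>) * ((a - 2 * n * \<eta>) / (2 * \<zeta> * K)) \<le> EE (?F (p0 - \<eta>)) - EE (?F \<eta>)" by simp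
        also have "\<dots> \<le> 1"
          using EE_sF_bounds[where U=U and U'=U' and \<eta>="\<lambda>_. \<eta>", OF st, where c="\<lambda>_. - (p0 - \<eta>)" and A=A]
            EE_sF_bounds[where U=U and U'=U' and \<eta>="\<lambda>_. \<eta>", OF st, where c="\<lambda>_. - \<eta>" and A=A] by linarith
        finally have "(p0 - 2 * \<eta>) * (a - 2 * n * \<eta>) \<le> 2 * \<zeta> * K" using z K0 by (simp add: pos_divide_le_eq)
        moreover have "2 * \<zeta> * K = p0 * c0 * \<xi>" unfolding \<zeta>_def using K0 by simp
        moreover have "p0 * a - (p0 - 2 * \<eta>) * (a - 2 * n * \<eta>) \<le> L * \<eta>"
        proof -
          have "p0 * a - (p0 - 2 * \<eta>) * (a - 2 * n * \<eta>) = 2 * a * \<eta> + 2 * n * p0 * \<eta> - 4 * n * (\<eta> * \<eta>)" by (simp add: algebra_simps)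
          also have "\<dots> \<le> 2 * a * \<eta> + 2 * n * p0 * \<eta> + \<eta>"
          proof -
            have "0 \<le> 4 * n * (\<eta> * \<eta>)" unfolding n_def by simp
            then show ?thesis using h(1) by linarith
          qed
          finally show ?thesis unfolding L_def by (simp add: algebra_simps)
        qed
        moreover have "L * \<eta> \<le> e" using h(3) L by (simp add: pos_le_divide_eq mult.commute)
        ultimately show ?thesis unfolding a_def by linarith
      qed
      then have "p0 * (c0 * (1 - P)) \<le> p0 * c0 * \<xi>" by (rule field_le_epsilon)
      then have "1 - P \<le> \<xi>" using p0 c0 by (simp add: mult.assoc)
      then show ?thesis unfolding P_def by simp
    qed
  qed
qed

end

section \<open>Planar topology of the lattice\<close>

type_synonym vtx = "int \<times> int"

text \<open>The points with even coordinate sum are those of the integer lattice, the others are the centers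
  of its squares; see \<open>pos\<close> below.\<close>

definition adj :: "vtx => vtx => bool" where
  "adj p q \<longleftrightarrow> p \<noteq> q \<and> \<bar>fst p - fst q\<bar> \<le> 1 \<and> \<bar>snd p - snd q\<bar> \<le> 1 \<and>
     (fst p = fst q \<or> snd p = snd q \<or> even (fst p + snd p))"

lemma adj_sym: "adj p q ==> adj q p"
proof -
  assume a: "adj p q"
  have "even (fst q + snd q)" if "fst p \<noteq> fst q" "snd p \<noteq> snd q" "even (fst p + snd p)"
  proof -
    have "fst p - fst q \<in> {-1, 1}" "snd p - snd q \<in> {-1, 1}" using a that unfolding adj_def by auto
    then show ?thesis using that(3) by (auto simp: algebra_simps) presburger+
  qed
  then show ?thesis using a unfolding adj_def by auto
qed

lemma adj_fst: "adj p q ==> \<bar>fst p - fst q\<bar> \<le> 1" and adj_snd: "adj p q ==> \<bar>snd p - snd q\<bar> \<le> 1"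
  by (auto simp: adj_def)

definition conn :: "vtx set => vtx => vtx => bool" where
  "conn S x y \<longleftrightarrow> x \<in> S \<and> (\<lambda>a b. b \<in> S \<and> adj a b)\<^sup>*\<^sup>* x y"

lemma conn_refl: "x \<in> S ==> conn S x x" by (simp add: conn_def)
lemma conn_in1: "conn S x y ==> x \<in> S" by (simp add: conn_def)
lemma conn_step: "conn S x y ==> adj y z ==> z \<in> S ==> conn S x z"
  unfolding conn_def by (auto intro: rtranclp.rtrancl_into_rtrancl)
lemma conn_trans: "conn S x y ==> conn S y z ==> conn S x z" unfolding conn_def by auto

lemma conn_induct [consumes 1, case_names base step]:
  assumes "conn S x y" "P x" "\<And>y z. conn S x y ==> adj y z ==> z \<in> S ==> P y ==> P z"
  shows "P y"
proof -
  have "x \<in> S" "(\<lambda>a b. b \<in> S \<and> adj a b)\<^sup>*\<^sup>* x y" using assms(1) by (auto simp: conn_def)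
  from this(2) show ?thesis
    by (induction rule: rtranclp_induct) (use assms \<open>x \<in> S\<close> in \<open>auto simp: conn_def\<close>)
qed

lemma conn_in2: assumes "conn S x y" shows "y \<in> S"
  using assms by (induction rule: conn_induct) (use conn_in1[OF assms] in auto)

lemma conn_adj: "x \<in> S ==> y \<in> S ==> adj x y ==> conn S x y"
  by (meson conn_refl conn_step)

lemma conn_sym: assumes "conn S x y" shows "conn S y x"
  using assms
proof (induction rule: conn_induct)
  case base
  show ?case by (rule conn_refl[OF conn_in1[OF assms]])
next
  case (step y z)
  then show ?case by (meson conn_adj conn_in2 adj_sym conn_trans)
qed

lemma conn_mono: assumes "conn S x y" "S \<subseteq> T" shows "conn T x y"
  using assms(1) by (induction rule: conn_induct) (use assms conn_in1[OF assms(1)] in \<open>auto intro: conn_refl conn_step\<close>)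

lemma conn_map:
  assumes "conn S x y" "\<And>a b. adj a b ==> adj (\<sigma> a) (\<sigma> b)" "\<And>a. a \<in> S ==> \<sigma> a \<in> T"
  shows "conn T (\<sigma> x) (\<sigma> y)"
  using assms(1)
proof (induction rule: conn_induct)
  case base
  show ?case by (rule conn_refl[OF assms(3)[OF conn_in1[OF assms(1)]]])
next
  case (step y z)
  show ?case by (rule conn_step[OF step(4) assms(2)[OF step(2)] assms(3)[OF step(3)]])
qed

lemma conn_comp: assumes "conn S x y" shows "conn {w. conn S x w} x y"
  using assms by (induction rule: conn_induct) (use conn_in1[OF assms] in \<open>auto intro: conn_refl conn_step\<close>)

lemma conn_exit:
  assumes "conn T p z" "p \<in> A" "z \<notin> A"
  obtains a e where "conn (T \<inter> A) p a" "adj a e" "e \<in> T" "e \<notin> A"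
proof -
  have "(\<exists>a e. conn (T \<inter> A) p a \<and> adj a e \<and> e \<in> T \<and> e \<notin> A) \<or> conn (T \<inter> A) p z"
    using assms(1)
  proof (induction rule: conn_induct)
    case base
    show ?case using assms(2) conn_in1[OF assms(1)] by (auto intro: conn_refl)
  next
    case (step y z)
    show ?case
    proof (cases "z \<in> A")
      case True
      then show ?thesis using step conn_step[of "T \<inter> A" p y z] by blast
    next
      case False
      then show ?thesis using step by blast
    qed
  qed
  then show ?thesis using that assms(3) conn_in2 by blast
qed

text \<open>A discrete intermediate value argument: \<open>Y\<close> changes by at most 1 along
  edges, so the strip is entered at level \<open>m\<close> exactly. The induction remembers the last
  entry into the strip until level \<open>k\<close> is reached.\<close>

lemma conn_extract:
  fixes Y :: "vtx => int"
  assumes c: "conn T a b" and Y: "\<And>p q. adj p q ==> \<bar>Y p - Y q\<bar> \<le> 1" and m: "Y a \<le> m" "m \<le> k" "k \<le> Y b"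
  obtains a' b' where "Y a' = m" "Y b' = k" "conn T a a'" "conn (T \<inter> {v. m \<le> Y v \<and> Y v \<le> k}) a' b'"
proof -
  let ?T = "T \<inter> {v. m \<le> Y v \<and> Y v \<le> k}"
  let ?X = "\<exists>a' b'. Y a' = m \<and> Y b' = k \<and> conn T a a' \<and> conn ?T a' b'"
  have aT: "a \<in> T" using c by (rule conn_in1)
  have "?X \<or> (Y b < k \<and> (m \<le> Y b --> (\<exists>a'. Y a' = m \<and> conn T a a' \<and> conn ?T a' b)))"
    using c
  proof (induction rule: conn_induct)
    case base
    have *: "conn T a a" "Y a = m ==> conn ?T a a" using aT m by (auto intro: conn_refl)
    show ?case
    proof (cases "Y a = k")
      case True
      then have "Y a = m" using m by simp
      then show ?thesis using True * by blast
    next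
      case False
      then have "Y a < k" using m by simp
      moreover have "Y a = m" if "m \<le> Y a" using that m by simp
      ultimately show ?thesis using * by blast
    qed
  next
    case (step y z)
    show ?case
    proof (cases ?X)
      case False
      then have y: "Y y < k" "m \<le> Y y ==> \<exists>a'. Y a' = m \<and> conn T a a' \<and> conn ?T a' y" using step by auto
      have yz: "Y z \<le> Y y + 1" using Y[OF step(2)] by linarith
      have az: "conn T a z" using step by (auto intro: conn_step)
      show ?thesis
      proof (cases "m \<le> Y z")
        case False
        then show ?thesis using m by auto
      next
        case mz: True
        have zT: "z \<in> ?T" using step mz y yz by auto
        obtain a' where a': "Y a' = m" "conn T a a'" "conn ?T a' z"
        proof (cases "m \<le> Y y")
          case True
          then obtain a' where "Y a' = m" "conn T a a'" "conn ?T a' y" using y by blast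
          then show ?thesis using that conn_step[OF _ step(2) zT] by blast
        next
          case False
          then have "Y z = m" using mz yz by linarith
          then show ?thesis using that az conn_refl[OF zT] by blast
        qed
        show ?thesis
        proof (cases "Y z = k")
          case True
          then show ?thesis using a' by blast
        next
          case False
          then have "Y z < k" using yz y by linarith
          then show ?thesis using a' by blast
        qed
      qed
    qed simp
  qed
  then show ?thesis using that m by auto
qed

lemma conn_row: assumes "a \<le> b" "\<And>x. a \<le> x ==> x \<le> b ==> (x, y) \<in> S" shows "conn S (a, y) (b, y)"
  using assms
proof (induction b rule: int_ge_induct)
  case base then show ?case by (auto intro: conn_refl)
next
  case (step i)
  then have "conn S (a, y) (i, y)" by auto
  then show ?case by (rule conn_step) (use step in \<open>auto simp: adj_def\<close>)
qed

lemma conn_col: assumes "a \<le> b" "\<And>y. a \<le> y ==> y \<le> b ==> (x, y) \<in> S" shows "conn S (x, a) (x, b)"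
  using assms
proof (induction b rule: int_ge_induct)
  case base then show ?case by (auto intro: conn_refl)
next
  case (step i)
  then have "conn S (x, a) (x, i)" by auto
  then show ?case by (rule conn_step) (use step in \<open>auto simp: adj_def\<close>)
qed

section \<open>Crossings of rectangles and the Hex lemma\<close>

definition rect :: "int => int => int => int => vtx set" where
  "rect a b c d = {a..b} \<times> {c..d}"

definition crossH :: "int => int => int => int => vtx set => bool" where
  "crossH a b c d S \<longleftrightarrow> (\<exists>x y. fst x = a \<and> fst y = b \<and> conn (S \<inter> rect a b c d) x y)"

definition crossV :: "int => int => int => int => vtx set => bool" where
  "crossV a b c d S \<longleftrightarrow> (\<exists>x y. snd x = c \<and> snd y = d \<and> conn (S \<inter> rect a b c d) x y)"

abbreviation qbox :: "int => vtx set" where "qbox s \<equiv> rect (- s) s (- s) s"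
abbreviation lng :: "int => vtx set => bool" where "lng s \<equiv> crossH (-(3 * s)) (3 * s) (- s) s"

lemma finite_rect [simp]: "finite (rect a b c d)" by (simp add: rect_def)

lemma in_rect: "v \<in> rect a b c d \<longleftrightarrow> a \<le> fst v \<and> fst v \<le> b \<and> c \<le> snd v \<and> snd v \<le> d"
  by (cases v) (auto simp: rect_def)

text \<open>A Sperner-type parity argument: an edge is counted by \<open>edge12\<close> if its labels are 1 and 2.\<close>

definition edge12 :: "(vtx => nat) => vtx => vtx => nat" where
  "edge12 l p q = (if l p = 1 \<and> l q = 2 \<or> l p = 2 \<and> l q = 1 then 1 else 0)"

lemma edge12_sym: "edge12 l p q = edge12 l q p" by (auto simp: edge12_def)

lemma edge12_triangle:
  assumes "l p \<in> {1,2,3}" "l q \<in> {1,2,3}" "l r \<in> {1,2,3}" "{l p, l q, l r} \<noteq> {1,2,3}"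
  shows "even (edge12 l p q + edge12 l q r + edge12 l r p)"
  using assms by (auto simp: edge12_def insert_commute)

text \<open>One diagonal, chosen by the parity of \<open>i + j\<close>, cuts the square into two
  triangles of the graph. It is counted twice and drops out modulo 2.\<close>

lemma sperner_cell:
  assumes lab: "\<And>p. l p \<in> {1,2,3}"
    and nr: "\<And>p q r. adj p q ==> adj q r ==> adj r p ==> p \<in> C ==> q \<in> C ==> r \<in> C ==> {l p, l q, l r} \<noteq> {1,2,3}"
    and C: "{(i,j), (i+1,j), (i,j+1), (i+1,j+1)} \<subseteq> C"
  shows "even (edge12 l (i,j) (i+1,j) + edge12 l (i,j+1) (i+1,j+1) + edge12 l (i,j) (i,j+1) + edge12 l (i+1,j) (i+1,j+1))"
proof (cases "even (i + j)")
  case True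
  have 1: "even (edge12 l (i,j) (i+1,j) + edge12 l (i+1,j) (i+1,j+1) + edge12 l (i+1,j+1) (i,j))"
    by (rule edge12_triangle[OF lab lab lab nr]) (use True C in \<open>auto simp: adj_def\<close>)
  have 2: "even (edge12 l (i,j) (i,j+1) + edge12 l (i,j+1) (i+1,j+1) + edge12 l (i+1,j+1) (i,j))"
    by (rule edge12_triangle[OF lab lab lab nr]) (use True C in \<open>auto simp: adj_def\<close>)
  show ?thesis using 1 2 by presburger
next
  case False
  have 1: "even (edge12 l (i,j) (i+1,j) + edge12 l (i+1,j) (i,j+1) + edge12 l (i,j+1) (i,j))"
    by (rule edge12_triangle[OF lab lab lab nr]) (use False C in \<open>auto simp: adj_def\<close>)
  have 2: "even (edge12 l (i+1,j) (i,j+1) + edge12 l (i,j+1) (i+1,j+1) + edge12 l (i+1,j+1) (i+1,j))"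
    by (rule edge12_triangle[OF lab lab lab nr]) (use False C in \<open>auto simp: adj_def\<close>)
  show ?thesis using 1 2 unfolding edge12_sym[of l "(i,j+1)" "(i,j)"] edge12_sym[of l "(i+1,j+1)" "(i+1,j)"] by presburger
qed

text \<open>Adding up \<open>sperner_cell\<close> over all cells counts every inner edge twice, so
  only the boundary remains modulo 2.\<close>

lemma sperner_boundary:
  fixes m n :: nat
  assumes lab: "\<And>p. l p \<in> {1,2,3}"
    and nr: "\<And>p q r. adj p q ==> adj q r ==> adj r p ==> p \<in> C ==> q \<in> C ==> r \<in> C ==> {l p, l q, l r} \<noteq> {1,2,3}"
    and C: "rect a (a + int m) c (c + int n) \<subseteq> C"
  defines "h \<equiv> \<lambda>i j. edge12 l (a + int i, c + int j) (a + int i + 1, c + int j)"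
    and "v \<equiv> \<lambda>i j. edge12 l (a + int i, c + int j) (a + int i, c + int j + 1)"
  shows "even ((\<Sum>i<m. h i 0) + (\<Sum>i<m. h i n) + (\<Sum>j<n. v 0 j) + (\<Sum>j<n. v m j))"
proof -
  have cell: "even (h i j + h i (Suc j) + v i j + v (Suc i) j)" if "i < m" "j < n" for i j
  proof -
    have "even (edge12 l (a + int i, c + int j) (a + int i + 1, c + int j) + edge12 l (a + int i, c + int j + 1) (a + int i + 1, c + int j + 1)
      + edge12 l (a + int i, c + int j) (a + int i, c + int j + 1) + edge12 l (a + int i + 1, c + int j) (a + int i + 1, c + int j + 1))"
      by (rule sperner_cell[OF lab nr]) (use C that in \<open>auto simp: in_rect subset_iff\<close>)
    then show ?thesis unfolding h_def v_def by (simp add: algebra_simps)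
  qed
  have row: "even ((\<Sum>i<k. h i j) + (\<Sum>i<k. h i (Suc j)) + v 0 j + v k j)" if "k \<le> m" "j < n" for k j
    using that(1)
  proof (induction k)
    case (Suc k)
    then have "even ((\<Sum>i<k. h i j) + (\<Sum>i<k. h i (Suc j)) + v 0 j + v k j)" by simp
    moreover have "even (h k j + h k (Suc j) + v k j + v (Suc k) j)" using Suc that by (intro cell) auto
    ultimately show ?case by (simp only: sum.lessThan_Suc) presburger
  qed simp
  have "even ((\<Sum>i<m. h i 0) + (\<Sum>i<m. h i k) + (\<Sum>j<k. v 0 j) + (\<Sum>j<k. v m j))" if "k \<le> n" for k
    using that
  proof (induction k)
    case (Suc k)
    then have "even ((\<Sum>i<m. h i 0) + (\<Sum>i<m. h i k) + (\<Sum>j<k. v 0 j) + (\<Sum>j<k. v m j))" by simp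
    moreover have "even ((\<Sum>i<m. h i k) + (\<Sum>i<m. h i (Suc k)) + v 0 k + v m k)" using Suc by (intro row) auto
    ultimately show ?case by (simp only: sum.lessThan_Suc) presburger
  qed simp
  then show ?thesis by simp
qed

text \<open>The rectangle is enlarged by a column on the left, labelled 1, and a row at the bottom,
  labelled 2. Vertices of \<open>S\<close> joined to the left side get 1, other vertices joined in
  the complement to the bottom get 2, all the rest 3. No triangle carries all three labels: its
  vertex with label 3 would be joined to the left side if it is in \<open>S\<close>, and to the
  bottom if not. Without crossings the boundary has exactly one edge with labels 1 and 2, at the
  lower left corner, against \<open>sperner_boundary\<close>.\<close>

theorem hex:
  assumes ab: "a \<le> b" and cd: "c \<le> d"
  shows "crossH a b c d S \<or> crossV a b c d (- S)"
proof (rule ccontr)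
  assume no: "\<not> ?thesis"
  let ?R = "rect a b c d"
  define L where "L p \<longleftrightarrow> (\<exists>x. fst x = a \<and> conn (S \<inter> ?R) x p)" for p
  define B where "B p \<longleftrightarrow> (\<exists>x. snd x = c \<and> conn (- S \<inter> ?R) x p)" for p
  define l :: "vtx => nat" where "l p = (if fst p = a - 1 then 1 else if snd p = c - 1 then 2 else if L p then 1 else if B p then 2 else 3)" for p
  let ?C = "rect (a - 1) b (c - 1) d"
  have Lin: "p \<in> S" if "L p" for p using that conn_in2 unfolding L_def by blast
  have Bin: "p \<notin> S" if "B p" for p using that conn_in2 unfolding B_def by blast
  have key: False if pr: "adj p r" and qr: "adj q r" and l: "l p = 1" "l q = 2" "l r = 3" and C: "p \<in> ?C" "q \<in> ?C" "r \<in> ?C" for p q r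
  proof -
    have r: "r \<in> ?R" "\<not> L r" "\<not> B r" using l(3) C(3) unfolding l_def by (auto simp: in_rect split: if_splits)
    have rS: "r \<notin> S"
    proof
      assume rS: "r \<in> S"
      show False
      proof (cases "fst p = a - 1")
        case True
        then have "fst r = a" using r(1) adj_fst[OF pr] by (auto simp: in_rect)
        then have "L r" unfolding L_def using rS r(1) by (intro exI[of _ r]) (auto intro: conn_refl)
        then show False using r by simp
      next
        case False
        then have "L p" using l(1) unfolding l_def by (auto split: if_splits)
        then have "L r" unfolding L_def using conn_step[OF _ pr] rS r(1) by blast
        then show False using r by simp
      qed
    qed
    show False
    proof (cases "snd q = c - 1")
      case True
      then have "snd r = c" using r(1) adj_snd[OF qr] by (auto simp: in_rect)
      then have "B r" unfolding B_def using rS r(1) by (intro exI[of _ r]) (auto intro: conn_refl)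
      then show False using r by simp
    next
      case False
      then have "B q" using l(2) unfolding l_def by (auto split: if_splits)
      then have "B r" unfolding B_def using conn_step[OF _ qr] rS r(1) by blast
      then show False using r by simp
    qed
  qed
  define m n where "m = nat (b - a + 1)" and "n = nat (d - c + 1)"
  have mn: "a - 1 + int m = b" "c - 1 + int n = d" "m > 0" "n > 0" using ab cd by (auto simp: m_def n_def)
  have l3: "l p \<in> {1,2,3}" for p by (simp add: l_def)
  have nr: "{l p, l q, l r} \<noteq> {1,2,3}" if pq: "adj p q" and qr: "adj q r" and rp: "adj r p" and C: "p \<in> ?C" "q \<in> ?C" "r \<in> ?C" for p q r
  proof
    assume *: "{l p, l q, l r} = {1,2,3}"
    have "1 \<in> {l p, l q, l r}" "2 \<in> {l p, l q, l r}" "3 \<in> {l p, l q, l r}" by (simp_all add: *)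
    then have "(l p = 1 \<or> l q = 1 \<or> l r = 1) \<and> (l p = 2 \<or> l q = 2 \<or> l r = 2) \<and> (l p = 3 \<or> l q = 3 \<or> l r = 3)" by auto
    then have d: "l p = 1 \<and> l q = 2 \<and> l r = 3 \<or> l p = 1 \<and> l q = 3 \<and> l r = 2 \<or> l p = 2 \<and> l q = 1 \<and> l r = 3 \<or>
      l p = 2 \<and> l q = 3 \<and> l r = 1 \<or> l p = 3 \<and> l q = 1 \<and> l r = 2 \<or> l p = 3 \<and> l q = 2 \<and> l r = 1" by (elim conjE disjE) simp_all
    consider "l p = 1" "l q = 2" "l r = 3" | "l p = 1" "l q = 3" "l r = 2" | "l p = 2" "l q = 1" "l r = 3"
      | "l p = 2" "l q = 3" "l r = 1" | "l p = 3" "l q = 1" "l r = 2" | "l p = 3" "l q = 2" "l r = 1"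
      using d by blast
    then show False
    proof cases
      case 1 then show False using key[OF adj_sym[OF rp] qr] C by blast
    next
      case 2 then show False using key[OF pq adj_sym[OF qr]] C by blast
    next
      case 3 then show False using key[OF qr adj_sym[OF rp]] C by blast
    next
      case 4 then show False using key[OF adj_sym[OF qr] pq] C by blast
    next
      case 5 then show False using key[OF adj_sym[OF pq] rp] C by blast
    next
      case 6 then show False using key[OF rp adj_sym[OF pq]] C by blast
    qed
  qed
  have "even ((\<Sum>i<m. edge12 l (a - 1 + int i, c - 1 + int 0) (a - 1 + int i + 1, c - 1 + int 0))
     + (\<Sum>i<m. edge12 l (a - 1 + int i, c - 1 + int n) (a - 1 + int i + 1, c - 1 + int n))
     + (\<Sum>j<n. edge12 l (a - 1 + int 0, c - 1 + int j) (a - 1 + int 0, c - 1 + int j + 1))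
     + (\<Sum>j<n. edge12 l (a - 1 + int m, c - 1 + int j) (a - 1 + int m, c - 1 + int j + 1)))"
    by (rule sperner_boundary[where C="?C", OF l3 nr]) (use mn in auto)
  moreover have "(\<Sum>i<m. edge12 l (a - 1 + int i, c - 1 + int 0) (a - 1 + int i + 1, c - 1 + int 0)) = 1"
  proof -
    have "(\<Sum>i<m. edge12 l (a - 1 + int i, c - 1 + int 0) (a - 1 + int i + 1, c - 1 + int 0)) = (\<Sum>i<m. if i = 0 then 1 else 0)"
      by (intro sum.cong refl) (auto simp: edge12_def l_def)
    then show ?thesis using mn by simp
  qed
  moreover have "l (i, d) \<noteq> 2" if "i \<le> b" "a - 1 \<le> i" for i
  proof
    assume "l (i, d) = 2"
    then have "B (i, d)" using cd unfolding l_def by (auto split: if_splits)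
    then show False using no unfolding B_def crossV_def by (metis snd_conv)
  qed
  then have "(\<Sum>i<m. edge12 l (a - 1 + int i, c - 1 + int n) (a - 1 + int i + 1, c - 1 + int n)) = 0"
    unfolding mn(2) using mn(1) by (intro sum.neutral ballI) (auto simp: edge12_def)
  moreover have "(\<Sum>j<n. edge12 l (a - 1 + int 0, c - 1 + int j) (a - 1 + int 0, c - 1 + int j + 1)) = 0"
    by (intro sum.neutral ballI) (simp add: edge12_def l_def)
  moreover have "l (b, j) \<noteq> 1" for j
  proof
    assume "l (b, j) = 1"
    then have "L (b, j)" using ab unfolding l_def by (auto split: if_splits)
    then show False using no unfolding L_def crossH_def by (metis fst_conv)
  qed
  then have "(\<Sum>j<n. edge12 l (a - 1 + int m, c - 1 + int j) (a - 1 + int m, c - 1 + int j + 1)) = 0"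
    unfolding mn(1) by (intro sum.neutral ballI) (auto simp: edge12_def)
  ultimately show False by simp
qed

section \<open>Crossing paths share a vertex\<close>

definition ptv :: "vtx => real^2" where "ptv p = vector [real_of_int (fst p), real_of_int (snd p)]"

lemma ptv_nth [simp]: "ptv p $ 1 = real_of_int (fst p)" "ptv p $ 2 = real_of_int (snd p)"
  by (simp_all add: ptv_def)

lemma ptv_inj: "ptv p = ptv q \<longleftrightarrow> p = q"
proof
  assume "ptv p = ptv q"
  then have "ptv p $ 1 = ptv q $ 1" "ptv p $ 2 = ptv q $ 2" by simp_all
  then show "p = q" by (simp add: prod_eq_iff)
qed simp

text \<open>The only edge that can contain the point \<open>(x, y)\<close> in its interior.\<close>

definition edge_at :: "real => real => vtx set" where
  "edge_at x y = (if of_int \<lfloor>x\<rfloor> = x then {(\<lfloor>x\<rfloor>, \<lfloor>y\<rfloor>), (\<lfloor>x\<rfloor>, \<lfloor>y\<rfloor> + 1)}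
     else if of_int \<lfloor>y\<rfloor> = y then {(\<lfloor>x\<rfloor>, \<lfloor>y\<rfloor>), (\<lfloor>x\<rfloor> + 1, \<lfloor>y\<rfloor>)}
     else if even (\<lfloor>x\<rfloor> + \<lfloor>y\<rfloor>) then {(\<lfloor>x\<rfloor>, \<lfloor>y\<rfloor>), (\<lfloor>x\<rfloor> + 1, \<lfloor>y\<rfloor> + 1)}
     else {(\<lfloor>x\<rfloor> + 1, \<lfloor>y\<rfloor>), (\<lfloor>x\<rfloor>, \<lfloor>y\<rfloor> + 1)})"

text \<open>In the interior of an edge a coordinate is either a constant integer or lies strictly
  between two neighbouring integers; its floor then recovers the edge.\<close>

lemma coord_cases:
  fixes a b :: int and t :: real
  assumes "\<bar>a - b\<bar> \<le> 1" "0 < t" "t < 1"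
  defines "x \<equiv> (1 - t) * real_of_int a + t * real_of_int b"
  obtains "a = b" "x = real_of_int a" "\<lfloor>x\<rfloor> = a"
  | "b = a + 1" "\<lfloor>x\<rfloor> = a" "of_int \<lfloor>x\<rfloor> \<noteq> x"
  | "a = b + 1" "\<lfloor>x\<rfloor> = b" "of_int \<lfloor>x\<rfloor> \<noteq> x"
proof -
  consider "a = b" | "b = a + 1" | "a = b + 1" using assms(1) by linarith
  then show ?thesis
  proof cases
    case 1 then show ?thesis using that(1) by (simp add: x_def algebra_simps)
  next
    case 2
    then have x: "x = real_of_int a + t" by (simp add: x_def algebra_simps)
    have f: "\<lfloor>x\<rfloor> = a" unfolding floor_eq_iff x using assms(2,3) by simp
    have "of_int \<lfloor>x\<rfloor> \<noteq> x" unfolding f unfolding x using assms(2) by simp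
    then show ?thesis using that(2) 2 f by simp
  next
    case 3
    then have x: "x = real_of_int b + (1 - t)" by (simp add: x_def algebra_simps)
    have f: "\<lfloor>x\<rfloor> = b" unfolding floor_eq_iff x using assms(2,3) by simp
    have "of_int \<lfloor>x\<rfloor> \<noteq> x" unfolding f unfolding x using assms(3) by simp
    then show ?thesis using that(3) 3 f by simp
  qed
qed

lemma edge_interior:
  assumes ab: "adj a b" and t: "0 < t" "t < 1"
  defines "x \<equiv> (1 - t) * real_of_int (fst a) + t * real_of_int (fst b)"
    and "y \<equiv> (1 - t) * real_of_int (snd a) + t * real_of_int (snd b)"
  shows "{a, b} = edge_at x y \<and> \<not> (of_int \<lfloor>x\<rfloor> = x \<and> of_int \<lfloor>y\<rfloor> = y)"
proof -
  obtain a1 a2 b1 b2 where [simp]: "a = (a1, a2)" "b = (b1, b2)" by (cases a, cases b) auto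
  have A: "(a1, a2) \<noteq> (b1, b2)" "\<bar>a1 - b1\<bar> \<le> 1" "\<bar>a2 - b2\<bar> \<le> 1" "a1 = b1 \<or> a2 = b2 \<or> even (a1 + a2)"
    using ab by (auto simp: adj_def)
  have x: "x = (1 - t) * real_of_int a1 + t * real_of_int b1" and y: "y = (1 - t) * real_of_int a2 + t * real_of_int b2"
    by (auto simp: x_def y_def)
  from coord_cases[OF A(2) t] show ?thesis unfolding x[symmetric]
  proof cases
    case 1
    from coord_cases[OF A(3) t] show ?thesis unfolding y[symmetric]
      using 1 A by cases (auto simp: edge_at_def)
  next
    case 2
    from coord_cases[OF A(3) t] show ?thesis unfolding y[symmetric]
      using 2 A by cases (auto simp: edge_at_def)
  next
    case 3
    from coord_cases[OF A(3) t] show ?thesis unfolding y[symmetric]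
      using 3 A by cases (auto simp: edge_at_def)
  qed
qed

lemma edge_point:
  assumes ab: "a = b \<or> adj a b" and z: "z \<in> closed_segment (ptv a) (ptv b)"
  shows "z = ptv a \<or> z = ptv b \<or> {a, b} = edge_at (z $ 1) (z $ 2) \<and> \<not> (of_int \<lfloor>z $ 1\<rfloor> = z $ 1 \<and> of_int \<lfloor>z $ 2\<rfloor> = z $ 2)"
proof -
  obtain t where t: "0 \<le> t" "t \<le> 1" "z = (1 - t) *\<^sub>R ptv a + t *\<^sub>R ptv b"
    using z by (auto simp: closed_segment_def)
  consider "t = 0" | "t = 1" | "0 < t \<and> t < 1" "a = b" | "0 < t" "t < 1" "adj a b" using t ab by linarith
  then show ?thesis
  proof cases
    case 3 then show ?thesis using t by (simp add: algebra_simps)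
  next
    case 4
    have "z $ 1 = (1 - t) * real_of_int (fst a) + t * real_of_int (fst b)" "z $ 2 = (1 - t) * real_of_int (snd a) + t * real_of_int (snd b)"
      using t by simp_all
    then show ?thesis using edge_interior[OF 4(3,1,2)] by simp
  qed (use t in auto)
qed

text \<open>The drawing is planar: by \<open>edge_point\<close>, a point of an edge other than its
  end points determines the edge.\<close>

lemma edges_meet:
  assumes "a = b \<or> adj a b" "c = d \<or> adj c d" "z \<in> closed_segment (ptv a) (ptv b)" "z \<in> closed_segment (ptv c) (ptv d)"
  shows "{a, b} \<inter> {c, d} \<noteq> {}"
proof -
  have i: "of_int \<lfloor>ptv p $ 1\<rfloor> = ptv p $ 1 \<and> of_int \<lfloor>ptv p $ 2\<rfloor> = ptv p $ 2" for p by simp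
  note 1 = edge_point[OF assms(1,3)] and 2 = edge_point[OF assms(2,4)]
  show ?thesis
  proof (cases "of_int \<lfloor>z $ 1\<rfloor> = z $ 1 \<and> of_int \<lfloor>z $ 2\<rfloor> = z $ 2")
    case True
    then have "z = ptv a \<or> z = ptv b" "z = ptv c \<or> z = ptv d" using 1 2 by auto
    then have "a = c \<or> a = d \<or> b = c \<or> b = d" using ptv_inj by metis
    then show ?thesis by blast
  next
    case False
    then have "z \<noteq> ptv p" for p using i[of p] by auto
    then have "{a, b} = {c, d}" using 1 2 by auto
    then show ?thesis by auto
  qed
qed

lemma conn_path:
  assumes "conn S x y"
  shows "\<exists>g. path g \<and> pathstart g = ptv x \<and> pathfinish g = ptv y \<and>
    (\<forall>z\<in>path_image g. \<exists>a b. conn S x a \<and> conn S x b \<and> (a = b \<or> adj a b) \<and> z \<in> closed_segment (ptv a) (ptv b))"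
  using assms
proof (induction rule: conn_induct)
  case base
  have "conn S x x" by (rule conn_refl[OF conn_in1[OF assms]])
  have "\<exists>a b. conn S x a \<and> conn S x b \<and> (a = b \<or> adj a b) \<and> z \<in> closed_segment (ptv a) (ptv b)"
    if "z \<in> path_image (linepath (ptv x) (ptv x))" for z
    by (rule exI[of _ x], rule exI[of _ x]) (use that \<open>conn S x x\<close> in simp)
  then show ?case by (metis path_linepath pathstart_linepath pathfinish_linepath)
next
  case (step y z)
  then obtain g where g: "path g" "pathstart g = ptv x" "pathfinish g = ptv y"
    "\<forall>z\<in>path_image g. \<exists>a b. conn S x a \<and> conn S x b \<and> (a = b \<or> adj a b) \<and> z \<in> closed_segment (ptv a) (ptv b)" by blast
  have cz: "conn S x z" using conn_step[OF step(1-3)] .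
  show ?case
  proof (intro exI[of _ "g +++ linepath (ptv y) (ptv z)"] conjI ballI)
    fix w assume "w \<in> path_image (g +++ linepath (ptv y) (ptv z))"
    then have "w \<in> path_image g \<or> w \<in> closed_segment (ptv y) (ptv z)" using g by (auto simp: path_image_join)
    then show "\<exists>a b. conn S x a \<and> conn S x b \<and> (a = b \<or> adj a b) \<and> w \<in> closed_segment (ptv a) (ptv b)"
      using g(4) step(1,2) cz by blast
  qed (use g in auto)
qed

text \<open>The Fashoda theorem gives a common point of the two polygonal paths, and
  \<open>edges_meet\<close> turns it into a common vertex.\<close>

theorem planar:
  assumes S: "conn S x y" "S \<subseteq> rect a b c d" "fst x = a" "fst y = b"
    and T: "conn T z w" "T \<subseteq> rect a b c d" "snd z = c" "snd w = d"
  obtains v where "conn S x v" "conn T z v"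
proof -
  obtain g where g: "path g" "pathstart g = ptv x" "pathfinish g = ptv y"
    "\<And>z. z \<in> path_image g ==> \<exists>a b. conn S x a \<and> conn S x b \<and> (a = b \<or> adj a b) \<and> z \<in> closed_segment (ptv a) (ptv b)"
    using conn_path[OF S(1)] by blast
  obtain h where h: "path h" "pathstart h = ptv z" "pathfinish h = ptv w"
    "\<And>x. x \<in> path_image h ==> \<exists>a b. conn T z a \<and> conn T z b \<and> (a = b \<or> adj a b) \<and> x \<in> closed_segment (ptv a) (ptv b)"
    using conn_path[OF T(1)] by blast
  let ?l = "vector [real_of_int a, real_of_int c] :: real^2" and ?u = "vector [real_of_int b, real_of_int d] :: real^2"
  have box: "closed_segment (ptv p) (ptv q) \<subseteq> cbox ?l ?u" if "p \<in> rect a b c d" "q \<in> rect a b c d" for p q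
    using that by (intro closed_segment_subset) (auto simp: mem_box_cart forall_2 in_rect)
  have gb: "path_image g \<subseteq> cbox ?l ?u"
  proof
    fix z assume "z \<in> path_image g"
    then obtain p q where "conn S x p" "conn S x q" "z \<in> closed_segment (ptv p) (ptv q)" using g(4) by blast
    then show "z \<in> cbox ?l ?u" using box[of p q] S(2) conn_in2 by blast
  qed
  have hb: "path_image h \<subseteq> cbox ?l ?u"
  proof
    fix v assume "v \<in> path_image h"
    then obtain p q where "conn T z p" "conn T z q" "v \<in> closed_segment (ptv p) (ptv q)" using h(4) by blast
    then show "v \<in> cbox ?l ?u" using box[of p q] T(2) conn_in2 by blast
  qed
  obtain u where "u \<in> path_image g" "u \<in> path_image h"
    by (rule fashoda[OF g(1) h(1) gb hb]) (use g h S T in auto)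
  then obtain p q p' q' where pq: "conn S x p" "conn S x q" "p = q \<or> adj p q" "u \<in> closed_segment (ptv p) (ptv q)"
    "conn T z p'" "conn T z q'" "p' = q' \<or> adj p' q'" "u \<in> closed_segment (ptv p') (ptv q')" using g(4) h(4) by blast
  from edges_meet[OF pq(3,7,4,8)] have "p = p' \<or> p = q' \<or> q = p' \<or> q = q'" by blast
  then show ?thesis using that pq by metis
qed

text \<open>Both paths are prolonged to crossings of a larger rectangle; the prolongations do not meet.\<close>

lemma capture:
  assumes S: "conn S (r, y1) (r, y2)" "S \<subseteq> rect l r c d"
    and T: "conn T (r, w) z" "T \<subseteq> {v. fst v \<le> r}" "z \<notin> rect l r c d" and w: "y1 \<le> w" "w \<le> y2"
  obtains v where "conn S (r, y1) v" "conn T (r, w) v"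
proof (cases "w = y1 \<or> w = y2")
  case True
  have "conn T (r, w) (r, w)" "conn S (r, y1) (r, y1)" using conn_refl conn_in1 S(1) T(1) by blast+
  then show ?thesis using True that S(1) by auto
next
  case False
  then have w: "y1 < w" "w < y2" using w by auto
  let ?R = "rect l r c d"
  have p: "(r, y1) \<in> ?R" "(r, y2) \<in> ?R" using S conn_in1 conn_in2 by blast+
  then have b: "l \<le> r" "c \<le> y1" "y2 \<le> d" by (auto simp: in_rect)
  have u: "(r, w) \<in> ?R" using b w by (auto simp: in_rect)
  obtain a e where ae: "conn (T \<inter> ?R) (r, w) a" "adj a e" "e \<in> T" "e \<notin> ?R" using conn_exit[OF T(1) u T(3)] by blast
  have a: "a \<in> ?R" using conn_in2[OF ae(1)] by auto
  have e1: "fst e \<le> r" using ae T by auto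
  have e2: "l - 1 \<le> fst e" "c - 1 \<le> snd e" "snd e \<le> d + 1" using a adj_fst[OF ae(2)] adj_snd[OF ae(2)] by (auto simp: in_rect)
  let ?R' = "rect (l - 1) (r + 2) (c - 1) (d + 1)"
  \<comment> \<open>\<open>S'\<close> leaves along the column \<open>r + 1\<close>, downwards from
    \<open>y1\<close> and upwards from \<open>y2\<close>. The gap between them lets
    \<open>T'\<close> leave to the right along the row \<open>w\<close>.\<close>
  define S' where "S' = {v. conn S (r, y1) v} \<union> {v. fst v = r + 1 \<and> c - 1 \<le> snd v \<and> snd v \<le> y1} \<union> {v. fst v = r + 1 \<and> y2 \<le> snd v \<and> snd v \<le> d + 1}"
  \<comment> \<open>Unless \<open>e\<close> is to the left of the rectangle, it lies above or below
    it, so that its row leads to the left without entering the rectangle.\<close>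
  define F where "F = (if fst e = l - 1 then {} else {v. snd v = snd e \<and> l - 1 \<le> fst v \<and> fst v \<le> fst e})"
  define T' where "T' = {v. conn (T \<inter> ?R) (r, w) v} \<union> {e} \<union> F \<union> {v. snd v = w \<and> r + 1 \<le> fst v \<and> fst v \<le> r + 2}"
  have Fout: "v \<notin> ?R" if "v \<in> F" for v
    using that ae(4) e1 e2 unfolding F_def by (auto simp: in_rect split: if_splits)
  have cS: "conn S' (r + 1, c - 1) (r + 1, d + 1)"
  proof -
    have "conn S' (r + 1, c - 1) (r + 1, y1)" by (rule conn_col) (use b in \<open>auto simp: S'_def\<close>)
    moreover have "conn S' (r + 1, y1) (r, y1)"
      by (rule conn_adj) (use b conn_refl[OF conn_in1[OF S(1)]] in \<open>auto simp: S'_def adj_def\<close>)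
    moreover have "conn S' (r, y1) (r, y2)" by (rule conn_mono[OF conn_comp[OF S(1)]]) (auto simp: S'_def)
    moreover have "conn S' (r, y2) (r + 1, y2)"
      by (rule conn_adj) (use b S(1) in \<open>auto simp: S'_def adj_def\<close>)
    moreover have "conn S' (r + 1, y2) (r + 1, d + 1)" by (rule conn_col) (use b in \<open>auto simp: S'_def\<close>)
    ultimately show ?thesis by (meson conn_trans)
  qed
  have cT: "conn T' (l - 1, snd e) (r + 2, w)"
  proof -
    have "conn T' (l - 1, snd e) e"
    proof (cases "fst e = l - 1")
      case True
      then have "(l - 1, snd e) = e" by (auto simp: prod_eq_iff)
      then show ?thesis by (auto intro!: conn_refl simp: T'_def)
    next
      case False
      have "conn T' (l - 1, snd e) (fst e, snd e)" by (rule conn_row) (use e2 False in \<open>auto simp: T'_def F_def\<close>)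
      then show ?thesis by simp
    qed
    moreover have "conn T' e a" by (rule conn_adj) (use ae adj_sym in \<open>auto simp: T'_def\<close>)
    moreover have "conn T' a (r, w)" by (rule conn_mono[OF conn_sym[OF conn_comp[OF ae(1)]]]) (auto simp: T'_def)
    moreover have "conn T' (r, w) (r + 1, w)"
      by (rule conn_adj) (use conn_refl[OF conn_in1[OF ae(1)]] in \<open>auto simp: T'_def adj_def\<close>)
    moreover have "conn T' (r + 1, w) (r + 2, w)" by (rule conn_row) (auto simp: T'_def)
    ultimately show ?thesis by (meson conn_trans)
  qed
  have S'R: "S' \<subseteq> ?R'"
  proof -
    have "v \<in> ?R'" if "conn S (r, y1) v" for v
    proof -
      have "v \<in> ?R" using S(2) conn_in2[OF that] by blast
      then show ?thesis unfolding in_rect by linarith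
    qed
    moreover have "v \<in> ?R'" if "fst v = r + 1 \<and> c - 1 \<le> snd v \<and> snd v \<le> y1" for v
      using that b w unfolding in_rect by linarith
    moreover have "v \<in> ?R'" if "fst v = r + 1 \<and> y2 \<le> snd v \<and> snd v \<le> d + 1" for v
      using that b w unfolding in_rect by linarith
    ultimately show ?thesis unfolding S'_def by blast
  qed
  have T'R: "T' \<subseteq> ?R'"
  proof -
    have "v \<in> ?R" if "conn (T \<inter> ?R) (r, w) v" for v using conn_in2[OF that] by auto
    then have "v \<in> ?R'" if "conn (T \<inter> ?R) (r, w) v" for v using that unfolding in_rect by fastforce
    moreover have "F \<subseteq> ?R'" using e1 e2 b unfolding F_def by (auto simp: in_rect)
    moreover have "e \<in> ?R'" using e1 e2 b by (auto simp: in_rect)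
    ultimately show ?thesis using b w unfolding T'_def by (auto simp: in_rect)
  qed
  obtain v where v: "conn T' (l - 1, snd e) v" "conn S' (r + 1, c - 1) v"
    by (rule planar[OF cT T'R _ _ cS S'R]) auto
  have vT: "v \<in> T'" and vS: "v \<in> S'" using v conn_in2 by blast+
  show ?thesis
  proof (cases "conn S (r, y1) v")
    case True
    then have vR: "v \<in> ?R" using S(2) conn_in2 by blast
    have "v \<noteq> e" using vR ae(4) by blast
    moreover have "v \<notin> F" using vR Fout by blast
    moreover have "fst v \<le> r" using vR unfolding in_rect by simp
    ultimately have "conn (T \<inter> ?R) (r, w) v" using vT unfolding T'_def by auto
    then show ?thesis using that True conn_mono Int_lower1 by blast
  next
    case False
    then have v1: "fst v = r + 1" "snd v \<le> y1 \<or> y2 \<le> snd v" using vS unfolding S'_def by auto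
    have "\<not> conn (T \<inter> ?R) (r, w) v" using conn_in2[of "T \<inter> ?R" "(r, w)" v] v1 by (auto simp: in_rect)
    moreover have "v \<noteq> e" using v1 e1 by auto
    moreover have "v \<notin> F" using v1 e1 unfolding F_def by auto
    ultimately have "snd v = w" using vT unfolding T'_def by auto
    then show ?thesis using v1 w by auto
  qed
qed

text \<open>The vertical crossing spans a part common to both rectangles, so it meets both
  horizontal crossings and joins them.\<close>

lemma crossH_chain:
  assumes H1: "crossH a b c d B" and H2: "crossH a' b' c d B" and V: "crossV e f c d B"
    and le: "a \<le> a'" "a' \<le> e" "e \<le> f" "f \<le> b" "b \<le> b'"
  shows "crossH a b' c d B"
proof -
  obtain x y where xy: "fst x = a" "fst y = b" "conn (B \<inter> rect a b c d) x y" using H1 by (auto simp: crossH_def)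
  obtain x' y' where xy': "fst x' = a'" "fst y' = b'" "conn (B \<inter> rect a' b' c d) x' y'" using H2 by (auto simp: crossH_def)
  obtain z w where zw: "snd z = c" "snd w = d" "conn (B \<inter> rect e f c d) z w" using V by (auto simp: crossV_def)
  let ?T = "B \<inter> rect a b' c d"
  have m: "conn ?T p q" if "conn (B \<inter> rect a b c d) p q \<or> conn (B \<inter> rect a' b' c d) p q \<or> conn (B \<inter> rect e f c d) p q" for p q
    using that by (elim disjE; elim conn_mono) (use le in \<open>auto simp: in_rect\<close>)
  have meet: "\<exists>v. conn ?T p v \<and> conn ?T z v"
    if pq: "conn (B \<inter> rect a1 b1 c d) p q" "fst p \<le> e" "f \<le> fst q" "a \<le> a1" "b1 \<le> b'" for p q a1 b1
  proof -
    obtain p' q' where p': "fst p' = e" "fst q' = f" "conn (B \<inter> rect a1 b1 c d) p p'"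
      "conn (B \<inter> rect a1 b1 c d \<inter> {v. e \<le> fst v \<and> fst v \<le> f}) p' q'"
      by (rule conn_extract[OF pq(1), of fst e f]) (use pq le adj_fst in auto)
    obtain v where v: "conn (B \<inter> rect a1 b1 c d \<inter> {v. e \<le> fst v \<and> fst v \<le> f}) p' v" "conn (B \<inter> rect e f c d) z v"
      by (rule planar[OF p'(4) _ p'(1,2) zw(3) _ zw(1,2)]) (auto simp: in_rect)
    have mm: "conn ?T s t" if "conn (B \<inter> rect a1 b1 c d) s t" for s t
      using that by (rule conn_mono) (use pq in \<open>auto simp: in_rect\<close>)
    have "conn ?T p p'" using mm p'(3) by simp
    moreover have "conn ?T p' v" using mm conn_mono[OF v(1), of "B \<inter> rect a1 b1 c d"] by blast
    ultimately show ?thesis using m v(2) conn_trans by blast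
  qed
  obtain v where v: "conn ?T x v" "conn ?T z v" using meet[OF xy(3)] xy le by auto
  obtain v' where v': "conn ?T x' v'" "conn ?T z v'" using meet[OF xy'(3)] xy' le by auto
  have "conn ?T x y'" using v v' m[of x' y'] xy'(3) by (meson conn_sym conn_trans)
  then show ?thesis unfolding crossH_def using xy xy' by blast
qed

lemma no_both: assumes "crossH a b c d S" "crossV a b c d (- S)" shows False
proof -
  obtain x y where xy: "fst x = a" "fst y = b" "conn (S \<inter> rect a b c d) x y" using assms by (auto simp: crossH_def)
  obtain z w where zw: "snd z = c" "snd w = d" "conn (- S \<inter> rect a b c d) z w" using assms by (auto simp: crossV_def)
  obtain v where "conn (S \<inter> rect a b c d) x v" "conn (- S \<inter> rect a b c d) z v"
    by (rule planar[OF xy(3) _ xy(1,2) zw(3) _ zw(1,2)]) auto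
  then show False using conn_in2 by blast
qed

section \<open>Symmetries of the lattice\<close>

definition tr :: "vtx => vtx => vtx" where "tr s v = (fst v + fst s, snd v + snd s)"
definition mir :: "vtx => vtx" where "mir v = (- fst v, snd v)"
definition flp :: "vtx => vtx" where "flp v = (fst v, - snd v)"
definition swp :: "vtx => vtx" where "swp v = (snd v, fst v)"

lemma adj_tr: "even (fst s + snd s) ==> adj a b ==> adj (tr s a) (tr s b)"
  unfolding adj_def tr_def by (auto simp: prod_eq_iff)

lemma adj_mir: "adj a b ==> adj (mir a) (mir b)"
  unfolding adj_def mir_def by (auto simp: prod_eq_iff)

lemma adj_flp: "adj a b ==> adj (flp a) (flp b)"
  unfolding adj_def flp_def by (auto simp: prod_eq_iff)

lemma adj_swp: "adj a b ==> adj (swp a) (swp b)"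
  unfolding adj_def swp_def by (auto simp: prod_eq_iff algebra_simps)

lemma conn_vimage:
  assumes "\<And>a b. adj a b ==> adj (\<sigma> a) (\<sigma> b)" "\<And>a b. adj a b ==> adj (\<tau> a) (\<tau> b)"
    and "\<And>v. \<tau> (\<sigma> v) = v" "\<And>v. \<sigma> (\<tau> v) = v"
  shows "conn (\<sigma> -` S) x y \<longleftrightarrow> conn S (\<sigma> x) (\<sigma> y)"
proof
  assume "conn (\<sigma> -` S) x y"
  then show "conn S (\<sigma> x) (\<sigma> y)" by (rule conn_map[OF _ assms(1)]) auto
next
  assume "conn S (\<sigma> x) (\<sigma> y)"
  then have "conn (\<sigma> -` S) (\<tau> (\<sigma> x)) (\<tau> (\<sigma> y))" by (rule conn_map[OF _ assms(2)]) (auto simp: assms)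
  then show "conn (\<sigma> -` S) x y" by (simp add: assms)
qed

lemma tr_tr [simp]: "tr (- fst s, - snd s) (tr s v) = v" "tr s (tr (- fst s, - snd s) v) = v"
  by (simp_all add: tr_def)
lemma mir_mir [simp]: "mir (mir v) = v" and flp_flp [simp]: "flp (flp v) = v" and swp_swp [simp]: "swp (swp v) = v"
  by (simp_all add: mir_def flp_def swp_def)

lemma conn_vimage_tr: "even (fst s + snd s) ==> conn (tr s -` S) x y \<longleftrightarrow> conn S (tr s x) (tr s y)"
  by (rule conn_vimage[where \<tau>="tr (- fst s, - snd s)"], erule (1) adj_tr, rule adj_tr) simp_all
lemma conn_vimage_mir: "conn (mir -` S) x y \<longleftrightarrow> conn S (mir x) (mir y)"
  by (rule conn_vimage[where \<tau>=mir, OF adj_mir adj_mir]) simp_all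
lemma conn_vimage_swp: "conn (swp -` S) x y \<longleftrightarrow> conn S (swp x) (swp y)"
  by (rule conn_vimage[where \<tau>=swp, OF adj_swp adj_swp]) simp_all

lemma ex_tr: "(\<exists>x. P (tr s x)) \<longleftrightarrow> (\<exists>x. P x)" by (metis tr_tr(2))
lemma ex_swp: "(\<exists>x. P (swp x)) \<longleftrightarrow> (\<exists>x. P x)" by (metis swp_swp)

lemma crossH_tr: assumes "even (s + t)"
  shows "crossH a b c d (tr (s, t) -` B) \<longleftrightarrow> crossH (a + s) (b + s) (c + t) (d + t) B"
proof -
  have r: "tr (s, t) -` B \<inter> rect a b c d = tr (s, t) -` (B \<inter> rect (a + s) (b + s) (c + t) (d + t))"
    by (auto simp: tr_def in_rect)
  have e: "conn (tr (s, t) -` B \<inter> rect a b c d) x y \<longleftrightarrow> conn (B \<inter> rect (a + s) (b + s) (c + t) (d + t)) (tr (s, t) x) (tr (s, t) y)" for x y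
    unfolding r by (rule conn_vimage_tr) (use assms in simp)
  have f: "fst x = a \<longleftrightarrow> fst (tr (s, t) x) = a + s" "fst x = b \<longleftrightarrow> fst (tr (s, t) x) = b + s" for x by (auto simp: tr_def)
  show ?thesis unfolding crossH_def e f
    by (subst ex_tr, rule ex_cong1) (rule ex_tr)
qed

lemma crossV_swp: "crossV a b c d (swp -` B) \<longleftrightarrow> crossH c d a b B"
proof -
  have r: "swp -` B \<inter> rect a b c d = swp -` (B \<inter> rect c d a b)" by (auto simp: swp_def in_rect)
  have e: "conn (swp -` B \<inter> rect a b c d) x y \<longleftrightarrow> conn (B \<inter> rect c d a b) (swp x) (swp y)" for x y
    unfolding r by (rule conn_vimage_swp)
  have f: "snd x = z \<longleftrightarrow> fst (swp x) = z" for x z by (auto simp: swp_def)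
  show ?thesis unfolding crossH_def crossV_def e f
    by (subst ex_swp, rule ex_cong1) (rule ex_swp)
qed

lemma crossH_mono: assumes "crossH a b c d S" "S \<subseteq> T" shows "crossH a b c d T"
proof -
  have "S \<inter> rect a b c d \<subseteq> T \<inter> rect a b c d" using assms(2) by blast
  then show ?thesis using assms(1) conn_mono unfolding crossH_def by blast
qed

lemma crossV_mono: assumes "crossV a b c d S" "S \<subseteq> T" shows "crossV a b c d T"
proof -
  have "S \<inter> rect a b c d \<subseteq> T \<inter> rect a b c d" using assms(2) by blast
  then show ?thesis using assms(1) conn_mono unfolding crossV_def by blast
qed

lemma crossH_sub: assumes "crossH a b c d S" "a \<le> a'" "a' \<le> b'" "b' \<le> b" "c' \<le> c" "d \<le> d'" shows "crossH a' b' c' d' S"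
proof -
  obtain x y where xy: "fst x = a" "fst y = b" "conn (S \<inter> rect a b c d) x y" using assms by (auto simp: crossH_def)
  obtain p q where p: "fst p = a'" "fst q = b'" "conn (S \<inter> rect a b c d \<inter> {v. a' \<le> fst v \<and> fst v \<le> b'}) p q"
    by (rule conn_extract[OF xy(3), of fst a' b']) (use xy assms adj_fst in auto)
  have "conn (S \<inter> rect a' b' c' d') p q" by (rule conn_mono[OF p(3)]) (use assms in \<open>auto simp: in_rect\<close>)
  then show ?thesis unfolding crossH_def using p by blast
qed

text \<open>\<open>P\<close> lies in a horizontal strip and \<open>Q\<close> in a vertical one.
  After \<open>conn_extract\<close> both are crossings of the rectangle where the strips meet, and
  \<open>planar\<close> applies.\<close>

lemma cross_meet:
  assumes P: "conn P x y" "\<And>v. v \<in> P ==> c \<le> snd v \<and> snd v \<le> d" and f: "fst x \<le> a" "a \<le> b" "b \<le> fst y"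
    and Q: "conn Q z w" "\<And>v. v \<in> Q ==> a \<le> fst v \<and> fst v \<le> b" and g: "snd z \<le> c" "c \<le> d" "d \<le> snd w"
  shows "\<exists>v. conn P x v \<and> conn Q z v"
proof -
  obtain x' y' where x': "fst x' = a" "fst y' = b" "conn P x x'" "conn (P \<inter> {v. a \<le> fst v \<and> fst v \<le> b}) x' y'"
    by (rule conn_extract[OF P(1), of fst a b]) (use f adj_fst in auto)
  obtain z' w' where z': "snd z' = c" "snd w' = d" "conn Q z z'" "conn (Q \<inter> {v. c \<le> snd v \<and> snd v \<le> d}) z' w'"
    by (rule conn_extract[OF Q(1), of snd c d]) (use g adj_snd in auto)
  obtain v where v: "conn (P \<inter> {v. a \<le> fst v \<and> fst v \<le> b}) x' v" "conn (Q \<inter> {v. c \<le> snd v \<and> snd v \<le> d}) z' v"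
    by (rule planar[OF x'(4) _ x'(1,2) z'(4) _ z'(1,2)]) (use P(2) Q(2) in \<open>auto simp: in_rect\<close>)
  have "conn P x' v" "conn Q z' v" using v conn_mono Int_lower1 by blast+
  then show ?thesis using x'(3) z'(3) conn_trans by blast
qed

section \<open>Annuli, arms and circuits\<close>

definition nrm :: "vtx => int" where "nrm v = max \<bar>fst v\<bar> \<bar>snd v\<bar>"

lemma nrm_adj: "adj p q ==> \<bar>nrm p - nrm q\<bar> \<le> 1"
  using adj_fst[of p q] adj_snd[of p q] unfolding nrm_def by linarith

lemma nrm_rect: "nrm v \<le> s \<longleftrightarrow> v \<in> qbox s"
  unfolding nrm_def in_rect by linarith

definition ann :: "int => vtx set" where "ann s = {v. s \<le> nrm v \<and> nrm v \<le> 3 * s}"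

lemma finite_ann: "finite (ann s)"
  by (rule finite_subset[OF _ finite_rect[of "-(3 * s)" "3 * s" "-(3 * s)" "3 * s"]]) (auto simp: ann_def nrm_rect)

definition arm :: "int => vtx set => bool" where
  "arm s B \<longleftrightarrow> (\<exists>x y. nrm x = s \<and> nrm y = 3 * s \<and> conn (B \<inter> ann s) x y)"

lemma conn_arm:
  assumes "conn B u w" "nrm u \<le> s" "3 * s \<le> nrm w" "0 \<le> s"
  obtains x y where "nrm x = s" "nrm y = 3 * s" "conn B u x" "conn (B \<inter> ann s) x y"
proof -
  obtain x y where "nrm x = s" "nrm y = 3 * s" "conn B u x" "conn (B \<inter> {v. s \<le> nrm v \<and> nrm v \<le> 3 * s}) x y"
    by (rule conn_extract[OF assms(1) nrm_adj assms(2) _ assms(3)]) (use assms(4) in auto)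
  then show ?thesis using that unfolding ann_def by blast
qed

text \<open>In place of a closed path, the long rectangles along the four sides of the annulus are
  crossed: crossings of rectangles are the events to which positive association is applied.\<close>

definition circuit :: "int => vtx set => bool" where
  "circuit s B \<longleftrightarrow> crossH (-(3 * s)) (3 * s) s (3 * s) B \<and> crossH (-(3 * s)) (3 * s) (-(3 * s)) (-s) B \<and>
     crossV s (3 * s) (-(3 * s)) (3 * s) B \<and> crossV (-(3 * s)) (-s) (-(3 * s)) (3 * s) B"

text \<open>Crossings along adjacent sides meet in the corner square, so all four belong to one
  cluster, represented by \<open>z\<close>. A path across the annulus ends on one of the sides and
  meets the crossing there. With \<open>C\<close> the complement of \<open>B\<close> this excludes
  arms; with \<open>C = B\<close> it links infinite clusters.\<close>

lemma circuit_conn: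
  assumes c: "circuit s B" and s: "0 \<le> s"
  obtains z where "\<And>C x y. conn (C \<inter> ann s) x y ==> nrm x = s ==> nrm y = 3 * s ==> \<exists>v. conn (C \<inter> ann s) x v \<and> conn (B \<inter> ann s) z v"
proof -
  let ?R = "\<lambda>a b c d. B \<inter> rect a b c d"
  obtain t t' where t: "fst t = -(3 * s)" "fst t' = 3 * s" "conn (?R (-(3 * s)) (3 * s) s (3 * s)) t t'" using c unfolding circuit_def crossH_def by blast
  obtain b b' where b: "fst b = -(3 * s)" "fst b' = 3 * s" "conn (?R (-(3 * s)) (3 * s) (-(3 * s)) (-s)) b b'" using c unfolding circuit_def crossH_def by blast
  obtain r r' where r: "snd r = -(3 * s)" "snd r' = 3 * s" "conn (?R s (3 * s) (-(3 * s)) (3 * s)) r r'" using c unfolding circuit_def crossV_def by blast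
  obtain l l' where l: "snd l = -(3 * s)" "snd l' = 3 * s" "conn (?R (-(3 * s)) (-s) (-(3 * s)) (3 * s)) l l'" using c unfolding circuit_def crossV_def by blast
  have sub: "?R (-(3 * s)) (3 * s) s (3 * s) \<subseteq> B \<inter> ann s" "?R (-(3 * s)) (3 * s) (-(3 * s)) (-s) \<subseteq> B \<inter> ann s"
    "?R s (3 * s) (-(3 * s)) (3 * s) \<subseteq> B \<inter> ann s" "?R (-(3 * s)) (-s) (-(3 * s)) (3 * s) \<subseteq> B \<inter> ann s"
    using s by (auto simp: in_rect ann_def nrm_def)
  note mt = conn_mono[OF _ sub(1)] and mb = conn_mono[OF _ sub(2)] and mr = conn_mono[OF _ sub(3)] and ml = conn_mono[OF _ sub(4)]
  have "\<exists>v. conn (?R (-(3 * s)) (3 * s) s (3 * s)) t v \<and> conn (?R s (3 * s) (-(3 * s)) (3 * s)) r v"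
    by (rule cross_meet[OF t(3) _ _ _ _ r(3), where a=s and b="3 * s" and c=s and d="3 * s"]) (use t r s in \<open>auto simp: in_rect\<close>)
  then have tr: "conn (B \<inter> ann s) t r" using mt mr conn_trans conn_sym by meson
  have "\<exists>v. conn (?R (-(3 * s)) (3 * s) s (3 * s)) t v \<and> conn (?R (-(3 * s)) (-s) (-(3 * s)) (3 * s)) l v"
    by (rule cross_meet[OF t(3) _ _ _ _ l(3), where a="-(3 * s)" and b="-s" and c=s and d="3 * s"]) (use t l s in \<open>auto simp: in_rect\<close>)
  then have tl: "conn (B \<inter> ann s) t l" using mt ml conn_trans conn_sym by meson
  have "\<exists>v. conn (?R (-(3 * s)) (3 * s) (-(3 * s)) (-s)) b v \<and> conn (?R s (3 * s) (-(3 * s)) (3 * s)) r v"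
    by (rule cross_meet[OF b(3) _ _ _ _ r(3), where a=s and b="3 * s" and c="-(3 * s)" and d="-s"]) (use b r s in \<open>auto simp: in_rect\<close>)
  then have tb: "conn (B \<inter> ann s) t b" using mb mr tr conn_trans conn_sym by meson
  show ?thesis
  proof (rule that[of t])
    fix C x y assume xy: "conn (C \<inter> ann s) x y" and x: "nrm x = s" and y: "nrm y = 3 * s"
    have A: "\<bar>fst v\<bar> \<le> 3 * s \<and> \<bar>snd v\<bar> \<le> 3 * s" if "v \<in> C \<inter> ann s" for v using that by (auto simp: ann_def nrm_def)
    have fx: "\<bar>fst x\<bar> \<le> s" "\<bar>snd x\<bar> \<le> s" using x unfolding nrm_def by linarith+
    consider "fst y = 3 * s" | "fst y = -(3 * s)" | "snd y = 3 * s" | "snd y = -(3 * s)" using y unfolding nrm_def by linarith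
    then show "\<exists>v. conn (C \<inter> ann s) x v \<and> conn (B \<inter> ann s) t v"
    proof cases
      case 1
      have "\<exists>v. conn (C \<inter> ann s) x v \<and> conn (?R s (3 * s) (-(3 * s)) (3 * s)) r v"
        by (rule cross_meet[OF xy _ _ _ _ r(3), where a=s and b="3 * s" and c="-(3 * s)" and d="3 * s"]) (use 1 A fx r s in \<open>fastforce simp: in_rect\<close>)+
      then show ?thesis using mr tr conn_trans by meson
    next
      case 2
      have "\<exists>v. conn (C \<inter> ann s) y v \<and> conn (?R (-(3 * s)) (-s) (-(3 * s)) (3 * s)) l v"
        by (rule cross_meet[OF conn_sym[OF xy] _ _ _ _ l(3), where a="-(3 * s)" and b="-s" and c="-(3 * s)" and d="3 * s"]) (use 2 A fx l s in \<open>fastforce simp: in_rect\<close>)+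
      then show ?thesis using ml tl xy conn_trans by meson
    next
      case 3
      have "\<exists>v. conn (?R (-(3 * s)) (3 * s) s (3 * s)) t v \<and> conn (C \<inter> ann s) x v"
        by (rule cross_meet[OF t(3) _ _ _ _ xy, where a="-(3 * s)" and b="3 * s" and c=s and d="3 * s"]) (use 3 A fx t s in \<open>fastforce simp: in_rect\<close>)+
      then show ?thesis using mt conn_trans by meson
    next
      case 4
      have "\<exists>v. conn (?R (-(3 * s)) (3 * s) (-(3 * s)) (-s)) b v \<and> conn (C \<inter> ann s) y v"
        by (rule cross_meet[OF b(3) _ _ _ _ conn_sym[OF xy], where a="-(3 * s)" and b="3 * s" and c="-(3 * s)" and d="-s"]) (use 4 A fx b s in \<open>fastforce simp: in_rect\<close>)+
      then show ?thesis using mb tb xy conn_trans by meson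
    qed
  qed
qed

lemma circuit_no_arm: assumes "circuit s (- B)" "0 \<le> s" shows "\<not> arm s B"
proof
  assume "arm s B"
  then obtain x y where xy: "nrm x = s" "nrm y = 3 * s" "conn (B \<inter> ann s) x y" by (auto simp: arm_def)
  obtain z v where "conn (B \<inter> ann s) x v" "conn (- B \<inter> ann s) z v" using circuit_conn[OF assms] xy by metis
  then show False using conn_in2 by blast
qed

text \<open>The crossings and the X-shaped clusters of Tassion's argument.\<close>

definition HR :: "int => int => int => vtx set => bool" where
  "HR s \<alpha> \<beta> B \<longleftrightarrow> (\<exists>x w. fst x = - s \<and> \<alpha> \<le> w \<and> w \<le> \<beta> \<and> conn (B \<inter> qbox s) x (s, w))"

definition XX :: "int => int => vtx set => bool" where
  "XX s \<alpha> B \<longleftrightarrow> (\<exists>y1 y2 z1 z2. y1 \<le> -\<alpha> \<and> \<alpha> \<le> y2 \<and> z1 \<le> -\<alpha> \<and> \<alpha> \<le> z2 \<and> conn (B \<inter> qbox s) (s, y1) (s, y2) \<and>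
     conn (B \<inter> qbox s) (s, y1) (-s, z1) \<and> conn (B \<inter> qbox s) (s, y1) (-s, z2))"

lemma HR_mir: assumes "HR s \<alpha> \<beta> (mir -` B)" obtains x w where "fst x = s" "\<alpha> \<le> w" "w \<le> \<beta>" "conn (B \<inter> qbox s) (-s, w) x"
proof -
  obtain x w where x: "fst x = - s" "\<alpha> \<le> w" "w \<le> \<beta>" "conn (mir -` B \<inter> qbox s) x (s, w)" using assms by (auto simp: HR_def)
  have "conn (B \<inter> qbox s) (mir x) (mir (s, w))"
    by (rule conn_map[OF x(4) adj_mir]) (auto simp: mir_def in_rect)
  then show ?thesis using that[of "mir x" w] x conn_sym by (simp add: mir_def)
qed

lemma HR_flp: assumes "HR s \<alpha> \<beta> (flp -` B)" shows "HR s (-\<beta>) (-\<alpha>) B"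
proof -
  obtain x w where x: "fst x = - s" "\<alpha> \<le> w" "w \<le> \<beta>" "conn (flp -` B \<inter> qbox s) x (s, w)" using assms by (auto simp: HR_def)
  have "conn (B \<inter> qbox s) (flp x) (flp (s, w))"
    by (rule conn_map[OF x(4) adj_flp]) (auto simp: flp_def in_rect)
  then show ?thesis using x unfolding HR_def by (intro exI[of _ "flp x"] exI[of _ "-w"]) (simp add: flp_def)
qed

text \<open>A vertical crossing of the box meets each of the four horizontal crossings, which are
  obtained by reflections, and joins them to one cluster.\<close>

lemma XX_intro:
  assumes "HR s \<alpha> s B" "HR s \<alpha> s (flp -` B)" "HR s \<alpha> s (mir -` B)" "HR s \<alpha> s (flp -` (mir -` B))" "crossV (-s) s (-s) s B" and s: "0 \<le> s"
  shows "XX s \<alpha> B"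
proof -
  let ?T = "B \<inter> qbox s"
  obtain z z' where z: "snd z = -s" "snd z' = s" "conn ?T z z'" using assms(5) by (auto simp: crossV_def)
  have m: "conn ?T p z \<and> conn ?T q z" if "conn ?T p q" "fst p = -s" "fst q = s" for p q
  proof -
    have "\<exists>v. conn ?T p v \<and> conn ?T z v"
      by (rule cross_meet[OF that(1) _ _ _ _ z(3), where a="-s" and b=s and c="-s" and d=s]) (use that z s in \<open>auto simp: in_rect\<close>)
    then show ?thesis using that conn_sym conn_trans by meson
  qed
  obtain x1 y2 where 1: "fst x1 = - s" "\<alpha> \<le> y2" "conn ?T x1 (s, y2)" using assms(1) by (auto simp: HR_def)
  obtain x2 y1 where 2: "fst x2 = - s" "y1 \<le> -\<alpha>" "conn ?T x2 (s, y1)" using HR_flp[OF assms(2)] by (auto simp: HR_def)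
  obtain x3 z2 where 3: "fst x3 = s" "\<alpha> \<le> z2" "conn ?T (-s, z2) x3" by (rule HR_mir[OF assms(3)])
  obtain x4 z1 where 4: "fst x4 = s" "-s \<le> z1" "z1 \<le> -\<alpha>" "conn ?T (-s, z1) x4" by (rule HR_mir[OF HR_flp[OF assms(4)]])
  have "conn ?T (s, y2) z" "conn ?T (s, y1) z" "conn ?T (-s, z2) z" "conn ?T (-s, z1) z"
    using m[OF 1(3)] m[OF 2(3)] m[OF 3(3)] m[OF 4(4)] 1(1) 2(1) 3(1) 4(1) by simp_all
  then have "conn ?T (s, y1) (s, y2)" "conn ?T (s, y1) (-s, z1)" "conn ?T (s, y1) (-s, z2)"
    using conn_sym conn_trans by blast+
  then show ?thesis using 1 2 3 4 unfolding XX_def by blast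
qed

text \<open>The ends of one cluster on the side \<open>s\<close> enclose the lower end of the next:
  \<open>s - \<alpha> \<le> t\<close> and \<open>t \<le> 2 * \<alpha>\<close> say that it is neither
  too low nor too high. By \<open>s < t + \<alpha>\<close> the upper end of the next cluster lies
  outside the box of the previous one, so that \<open>capture\<close> applies.\<close>

lemma XX_stack:
  assumes X: "\<And>k. k \<le> n ==> XX s \<alpha> (tr (0, int k * t) -` B)" and t: "s - \<alpha> \<le> t" "t \<le> 2 * \<alpha>" "s < t + \<alpha>" "even t"
  shows "\<exists>y1 a b. y1 \<le> -\<alpha> \<and> conn (B \<inter> rect (-s) s (-s) (s + int n * t)) (s, y1) (s, a) \<and>
    conn (B \<inter> rect (-s) s (int n * t - s) (int n * t + s)) (s, a) (s, b) \<and> a \<le> int n * t - \<alpha> \<and> int n * t + \<alpha> \<le> b"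
  using X
proof (induction n)
  case 0
  then have "XX s \<alpha> (tr (0, 0) -` B)" by force
  moreover have "tr (0, 0) -` B = B" by (auto simp: tr_def)
  ultimately obtain y1 y2 where y: "y1 \<le> -\<alpha>" "\<alpha> \<le> y2" "conn (B \<inter> qbox s) (s, y1) (s, y2)" unfolding XX_def by auto
  then have "conn (B \<inter> qbox s) (s, y1) (s, y1)" using conn_refl conn_in1 by blast
  then show ?case using y by (intro exI[of _ y1] exI[of _ y1] exI[of _ y2]) simp
next
  case (Suc n)
  let ?N = "int (Suc n) * t"
  obtain y1 a b where y: "y1 \<le> -\<alpha>" "conn (B \<inter> rect (-s) s (-s) (s + int n * t)) (s, y1) (s, a)"
    "conn (B \<inter> rect (-s) s (int n * t - s) (int n * t + s)) (s, a) (s, b)" "a \<le> int n * t - \<alpha>" "int n * t + \<alpha> \<le> b"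
    using Suc.IH[OF Suc.prems] by (meson le_SucI)
  obtain u w where u: "u \<le> -\<alpha>" "\<alpha> \<le> w" "conn (tr (0, ?N) -` B \<inter> qbox s) (s, u) (s, w)" using Suc.prems[of "Suc n"] unfolding XX_def by auto
  have u0: "-s \<le> u" using conn_in1[OF u(3)] by (auto simp: in_rect)
  have t0: "0 \<le> t" using t u0 u(1) by linarith
  have cc: "conn (B \<inter> rect (-s) s (?N - s) (?N + s)) (tr (0, ?N) (s, u)) (tr (0, ?N) (s, w))"
    by (rule conn_map[OF u(3) adj_tr]) (use t in \<open>auto simp: tr_def in_rect\<close>)
  then have c: "conn (B \<inter> rect (-s) s (?N - s) (?N + s)) (s, u + ?N) (s, w + ?N)" by (simp add: tr_def)
  have N: "?N = int n * t + t" by (simp add: algebra_simps)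
  obtain v where v: "conn (B \<inter> rect (-s) s (int n * t - s) (int n * t + s)) (s, a) v" "conn (B \<inter> rect (-s) s (?N - s) (?N + s)) (s, u + ?N) v"
    by (rule capture[OF y(3) _ c]) (use y u u0 t N in \<open>auto simp: in_rect\<close>)
  have nt: "0 \<le> int n * t" using t0 by simp
  let ?R = "B \<inter> rect (-s) s (-s) (s + ?N)"
  have m: "conn ?R p q" if "conn (B \<inter> rect (-s) s (-s) (s + int n * t)) p q \<or> conn (B \<inter> rect (-s) s (int n * t - s) (int n * t + s)) p q
     \<or> conn (B \<inter> rect (-s) s (?N - s) (?N + s)) p q" for p q
    using that by (elim disjE; elim conn_mono; intro subsetI; elim IntE; intro IntI; (assumption | (use nt t0 N in \<open>unfold in_rect; linarith\<close>)))
  have "conn ?R (s, y1) (s, u + ?N)" using m y(2) v conn_sym conn_trans by meson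
  then show ?case using c y(1) u by (intro exI[of _ y1] exI[of _ "u + ?N"] exI[of _ "w + ?N"]) simp
qed

text \<open>The small cluster is placed with its right side on the line \<open>s\<close>. Its ends
  there enclose the window from 0 to \<beta> in which the large crossing ends. Its ends on the left
  side enclose the window in which a second large crossing, mirrored and translated, begins.
  \<open>capture\<close> joins both crossings to the cluster.\<close>

lemma glue:
  assumes H: "HR s 0 \<beta> B" and X: "XX s' \<alpha> (tr (s - s', c) -` B)" and H': "HR s 0 \<beta> (mir -` (tr (2 * s - 2 * s', 0) -` B))"
    and e: "even (s - s' + c)" and b: "0 \<le> s'" "s' < s" "c \<le> \<alpha>" "\<beta> \<le> c + \<alpha>" "c + s' \<le> s" "0 \<le> c"
  shows "crossH (-s) (3 * s - 2 * s') (-s) s B"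
proof -
  let ?N = "B \<inter> rect (s - 2 * s') s (c - s') (c + s')"
  obtain y1 y2 z1 z2 where y: "y1 \<le> -\<alpha>" "\<alpha> \<le> y2" "z1 \<le> -\<alpha>" "\<alpha> \<le> z2"
     and y': "conn (tr (s - s', c) -` B \<inter> qbox s') (s', y1) (s', y2)"
     "conn (tr (s - s', c) -` B \<inter> qbox s') (s', y1) (-s', z1)" "conn (tr (s - s', c) -` B \<inter> qbox s') (s', y1) (-s', z2)"
    using X unfolding XX_def by auto
  have m: "conn ?N (tr (s - s', c) p) (tr (s - s', c) q)" if "conn (tr (s - s', c) -` B \<inter> qbox s') p q" for p q
    by (rule conn_map[OF that adj_tr]) (use e in \<open>auto simp: tr_def in_rect\<close>)
  have n: "conn ?N (s, y1 + c) (s, y2 + c)" "conn ?N (s, y1 + c) (s - 2 * s', z1 + c)" "conn ?N (s, y1 + c) (s - 2 * s', z2 + c)"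
    using y'[THEN m] by (simp_all add: tr_def)
  obtain x w where x: "fst x = - s" "0 \<le> w" "w \<le> \<beta>" "conn (B \<inter> qbox s) x (s, w)" using H by (auto simp: HR_def)
  obtain v where v: "conn ?N (s, y1 + c) v" "conn (B \<inter> qbox s) (s, w) v"
    by (rule capture[OF n(1) _ conn_sym[OF x(4)]]) (use x b y in \<open>auto simp: in_rect\<close>)
  have H'': "HR s 0 \<beta> (mir -` (tr (2 * s - 2 * s', 0) -` B))" using H' .
  obtain x' w' where x': "fst x' = s" "0 \<le> w'" "w' \<le> \<beta>" "conn (tr (2 * s - 2 * s', 0) -` B \<inter> qbox s) (-s, w') x'"
    by (rule HR_mir[OF H''])
  have "conn (B \<inter> rect (s - 2 * s') (3 * s - 2 * s') (-s) s) (tr (2 * s - 2 * s', 0) (-s, w')) (tr (2 * s - 2 * s', 0) x')"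
    by (rule conn_map[OF x'(4) adj_tr]) (auto simp: tr_def in_rect)
  then have k: "conn (B \<inter> rect (s - 2 * s') (3 * s - 2 * s') (-s) s) (s - 2 * s', w') (tr (2 * s - 2 * s', 0) x')" by (simp add: tr_def)
  have f: "fst (tr (2 * s - 2 * s', 0) x') = 3 * s - 2 * s'" using x' by (simp add: tr_def)
  \<comment> \<open>\<open>capture\<close> is stated for the right side, so the left side of the
    small cluster is treated in the mirror image.\<close>
  let ?M = "mir -` ?N" and ?K = "mir -` (B \<inter> rect (s - 2 * s') (3 * s - 2 * s') (-s) s)"
  have n': "conn ?M (2 * s' - s, z1 + c) (2 * s' - s, z2 + c)"
    using conn_trans[OF conn_sym[OF n(2)] n(3)] unfolding conn_vimage_mir by (simp add: mir_def)
  have k': "conn ?K (2 * s' - s, w') (mir (tr (2 * s - 2 * s', 0) x'))" using k unfolding conn_vimage_mir by (simp add: mir_def)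
  obtain v' where v': "conn ?M (2 * s' - s, z1 + c) v'" "conn ?K (2 * s' - s, w') v'"
    by (rule capture[where l="-s", OF n' _ k']) (use x' b y f in \<open>auto simp: in_rect mir_def\<close>)
  have v'': "conn ?N (s - 2 * s', z1 + c) (mir v')" "conn (B \<inter> rect (s - 2 * s') (3 * s - 2 * s') (-s) s) (s - 2 * s', w') (mir v')"
    using v' unfolding conn_vimage_mir by (simp_all add: mir_def)
  let ?R = "B \<inter> rect (-s) (3 * s - 2 * s') (-s) s"
  have m: "conn ?R p q" if "conn (B \<inter> qbox s) p q \<or> conn ?N p q \<or> conn (B \<inter> rect (s - 2 * s') (3 * s - 2 * s') (-s) s) p q" for p q
    using that by (elim disjE; elim conn_mono) (use b in \<open>auto simp: in_rect\<close>)
  have "conn ?R x (s, y1 + c)" using m x(4) v conn_sym conn_trans by meson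
  moreover have "conn ?R (s, y1 + c) (s - 2 * s', w')" using m n(2) v'' conn_sym conn_trans by meson
  ultimately have "conn ?R x (tr (2 * s - 2 * s', 0) x')" using m k conn_trans by meson
  then show ?thesis using x f unfolding crossH_def by blast
qed

text \<open>For a window of three vertices no smaller cluster is needed: if these are black, they
  join the end points of the two crossings directly.\<close>

lemma glue_window:
  assumes H: "HR s 0 2 B" and H': "HR s 0 2 (mir -` (tr (2 * s, 0) -` B))" and w: "(s, 0) \<in> B" "(s, 1) \<in> B" "(s, 2) \<in> B" and s: "2 \<le> s"
  shows "crossH (-s) (3 * s) (-s) s B"
proof -
  obtain x w where x: "fst x = - s" "0 \<le> w" "w \<le> 2" "conn (B \<inter> qbox s) x (s, w)" using H by (auto simp: HR_def)
  obtain x' w' where x': "fst x' = s" "0 \<le> w'" "w' \<le> 2" "conn (tr (2 * s, 0) -` B \<inter> qbox s) (-s, w') x'"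
    by (rule HR_mir[OF H'])
  have "conn (B \<inter> rect s (3 * s) (-s) s) (tr (2 * s, 0) (-s, w')) (tr (2 * s, 0) x')"
    by (rule conn_map[OF x'(4) adj_tr]) (auto simp: tr_def in_rect)
  then have k: "conn (B \<inter> rect s (3 * s) (-s) s) (s, w') (tr (2 * s, 0) x')" by (simp add: tr_def)
  let ?R = "B \<inter> rect (-s) (3 * s) (-s) s"
  have m: "conn ?R p q" if "conn (B \<inter> qbox s) p q \<or> conn (B \<inter> rect s (3 * s) (-s) s) p q" for p q
    using that by (elim disjE; elim conn_mono) (use s in \<open>auto simp: in_rect\<close>)
  have i: "(s, j) \<in> ?R" if "0 \<le> j" "j \<le> 2" for j
  proof -
    have "j = 0 \<or> j = 1 \<or> j = 2" using that by linarith
    then show ?thesis using w s by (auto simp: in_rect)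
  qed
  have "conn ?R (s, 0) (s, j)" if "0 \<le> j" "j \<le> 2" for j
    by (rule conn_col) (use that i in auto)
  then have "conn ?R (s, w) (s, w')" using x x' conn_sym conn_trans by meson
  then have "conn ?R x (tr (2 * s, 0) x')" using m x(4) k conn_trans by meson
  then show ?thesis using x x' unfolding crossH_def by (intro exI[of _ x] exI[of _ "tr (2 * s, 0) x'"]) (simp add: tr_def)
qed

section \<open>Crossing probabilities\<close>

definition loc :: "vtx set => (vtx set => bool) => bool" where
  "loc V E \<longleftrightarrow> finite V \<and> (\<forall>R. E R = E (R \<inter> V))"

definition up :: "(vtx set => bool) => bool" where
  "up E \<longleftrightarrow> (\<forall>R T. R \<subseteq> T --> E R --> E T)"

lemma locD: "loc V E ==> finite V" "loc V E ==> E (R \<inter> V) = E R" by (auto simp: loc_def)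

lemma loc_mono: assumes "loc V E" "V \<subseteq> W" "finite W" shows "loc W E"
proof -
  have "E R = E (R \<inter> W)" for R
  proof -
    have "R \<inter> W \<inter> V = R \<inter> V" using assms(2) by blast
    then show ?thesis using locD(2)[OF assms(1), of R] locD(2)[OF assms(1), of "R \<inter> W"] by simp
  qed
  then show ?thesis using assms(3) unfolding loc_def by blast
qed

lemma loc_join: assumes "loc V E" "loc W F" shows "loc (V \<union> W) E" "loc (V \<union> W) F"
  using assms loc_mono locD(1) by (metis Un_upper1 Un_upper2 finite_UnI)+

lemma loc_conj: "loc V E ==> loc V F ==> loc V (\<lambda>R. E R \<and> F R)" unfolding loc_def by blast
lemma loc_not: "loc V E ==> loc V (\<lambda>R. \<not> E R)" unfolding loc_def by blast

lemma loc_vimage: assumes "loc V E" shows "loc (\<sigma> ` V) (\<lambda>R. E (\<sigma> -` R))"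
proof -
  have "E (\<sigma> -` R) = E (\<sigma> -` (R \<inter> \<sigma> ` V))" for R
  proof -
    have "\<sigma> -` (R \<inter> \<sigma> ` V) \<inter> V = \<sigma> -` R \<inter> V" by blast
    then show ?thesis using locD(2)[OF assms] by metis
  qed
  then show ?thesis using locD(1)[OF assms] unfolding loc_def by blast
qed

lemma loc_compl: assumes "loc V E" shows "loc V (\<lambda>R. E (- R))"
proof -
  have "E (- R) = E (- (R \<inter> V))" for R
  proof -
    have "- (R \<inter> V) \<inter> V = - R \<inter> V" by blast
    then show ?thesis using locD(2)[OF assms] by metis
  qed
  then show ?thesis using locD(1)[OF assms] unfolding loc_def by blast
qed

lemma upD: "up E ==> R \<subseteq> T ==> E R ==> E T" unfolding up_def by blast
lemma up_conj: "up E ==> up F ==> up (\<lambda>R. E R \<and> F R)" unfolding up_def by blast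
lemma up_vimage: "up E ==> up (\<lambda>R. E (\<sigma> -` R))" unfolding up_def by (meson vimage_mono)

lemma loc_crossH: "loc (rect a b c d) (crossH a b c d)" and loc_crossV: "loc (rect a b c d) (crossV a b c d)"
  unfolding loc_def crossH_def crossV_def by (simp_all add: Int_assoc)
lemma up_crossH: "up (crossH a b c d)" and up_crossV: "up (crossV a b c d)"
  unfolding up_def using crossH_mono crossV_mono by blast+
lemma loc_HR: "loc (qbox s) (HR s \<alpha> \<beta>)" and loc_XX: "loc (qbox s) (XX s \<alpha>)"
  unfolding loc_def HR_def XX_def by (simp_all add: Int_assoc)
lemma up_HR: "up (HR s \<alpha> \<beta>)" and up_XX: "up (XX s \<alpha>)"
proof -
  have *: "conn (R \<inter> qbox s) x y ==> R \<subseteq> T ==> conn (T \<inter> qbox s) x y" for R T x y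
    by (elim conn_mono) blast
  show "up (HR s \<alpha> \<beta>)" unfolding up_def HR_def using * by blast
  show "up (XX s \<alpha>)" unfolding up_def XX_def using * by meson
qed
lemma loc_circuit: "0 \<le> s ==> loc (qbox (3 * s)) (circuit s)"
  unfolding circuit_def
  by (intro loc_conj loc_mono[OF loc_crossH] loc_mono[OF loc_crossV]) (auto simp: in_rect)
lemma loc_mem: "loc {v} (\<lambda>R. v \<in> R)" and up_mem: "up (\<lambda>R. v \<in> R)" by (auto simp: loc_def up_def)

text \<open>The covariance is invariant under all translations, the graph only under those with even
  coordinate sum. Hence the parity conditions whenever an event is translated.\<close>

locale perc = gauss2 M X S for M :: "'w measure" and X :: "vtx => 'w => real" and S +
  fixes D :: real
  assumes decay: "\<And>v w. S v w \<le> D / (1 + real_of_int (nrm (fst v - fst w, snd v - snd w))) ^ 5"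
    and S_tr: "\<And>s v w. S (tr s v) (tr s w) = S v w"
    and S_mir: "\<And>v w. S (mir v) (mir w) = S v w"
    and S_swp: "\<And>v w. S (swp v) (swp w) = S v w"
begin

section \<open>Probabilities of local events\<close>

definition blk :: "real => 'w => vtx set" where "blk p \<omega> = {v. X v \<omega> \<ge> - p}"
definition pev :: "real => (vtx set => bool) => 'w set" where "pev p E = {\<omega> \<in> space M. E (blk p \<omega>)}"
definition pr :: "real => (vtx set => bool) => real" where "pr p E = prob (pev p E)"

lemma pev_sev: assumes "loc V E" shows "pev p E = sev V (\<lambda>_. - p) E"
proof -
  have "blk p \<omega> \<inter> V = {v \<in> V. - p \<le> X v \<omega>}" for \<omega> by (auto simp: blk_def)
  then show ?thesis using locD(2)[OF assms] unfolding pev_def sev_def by metis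
qed

lemma pev_meas: "loc V E ==> pev p E \<in> sets M" using pev_sev sev_meas locD(1) by metis

lemma pr_mono: assumes "loc V F" "\<And>R. E R ==> F R" shows "pr p E \<le> pr p F"
  unfolding pr_def by (rule finite_measure_mono[OF _ pev_meas[OF assms(1)]]) (auto simp: pev_def assms(2))

lemma pr_le1: "pr p E \<le> 1" and pr_ge0: "0 \<le> pr p E" by (simp_all add: pr_def)

lemma pr_not: assumes "loc V E" shows "pr p (\<lambda>R. \<not> E R) = 1 - pr p E"
proof -
  have "pev p (\<lambda>R. \<not> E R) = space M - pev p E" by (auto simp: pev_def)
  then show ?thesis using prob_compl[OF pev_meas[OF assms]] by (simp add: pr_def)
qed

lemma pr_disj: assumes "loc V E" "loc W F" shows "pr p (\<lambda>R. E R \<or> F R) \<le> pr p E + pr p F"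
proof -
  have "pev p (\<lambda>R. E R \<or> F R) = pev p E \<union> pev p F" by (auto simp: pev_def)
  then show ?thesis using measure_Un_le[OF pev_meas[OF assms(1)] pev_meas[OF assms(2)]] by (simp add: pr_def)
qed

lemma up_incr: "up E ==> incr V E" by (auto simp: up_def incr_def)

lemma pr_fkg: assumes "loc V E" "up E" "loc W F" "up F" shows "pr p E * pr p F \<le> pr p (\<lambda>R. E R \<and> F R)"
proof -
  note l = loc_join[OF assms(1,3)]
  show ?thesis unfolding pr_def pev_sev[OF l(1)] pev_sev[OF l(2)] pev_sev[OF loc_conj[OF l]]
    by (rule fkg[OF locD(1)[OF l(1)] up_incr[OF assms(2)] up_incr[OF assms(4)]])
qed

lemma pr_mono_level: assumes "p \<le> q" "loc V E" "up E" shows "pr p E \<le> pr q E"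
proof -
  have "blk p \<omega> \<subseteq> blk q \<omega>" for \<omega> using assms(1) unfolding blk_def by fastforce
  then have "pev p E \<subseteq> pev q E" using upD[OF assms(3)] unfolding pev_def by blast
  then show ?thesis unfolding pr_def by (rule finite_measure_mono[OF _ pev_meas[OF assms(2)]])
qed

lemma pr_vimage: assumes "loc V E" "\<And>v w. S (\<sigma> v) (\<sigma> w) = S v w" shows "pr p (\<lambda>R. E (\<sigma> -` R)) = pr p E"
proof -
  have g: "gauss M X S" ..
  have g': "gauss M (\<lambda>i. X (\<sigma> i)) S" using gauss_reindex[OF g, of \<sigma>] assms(2) by simp
  have "blk p \<omega> \<inter> V = {v \<in> V. - p \<le> X v \<omega>}" "\<sigma> -` blk p \<omega> \<inter> V = {v \<in> V. - p \<le> X (\<sigma> v) \<omega>}" for \<omega> by (auto simp: blk_def)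
  then have "pev p (\<lambda>R. E (\<sigma> -` R)) = gauss.sev M (\<lambda>i. X (\<sigma> i)) V (\<lambda>_. - p) E"
    unfolding gauss.sev_def[OF g'] pev_def using locD(2)[OF assms(1)] by metis
  then show ?thesis unfolding pr_def pev_sev[OF assms(1)]
    using sev_law[OF g g' locD(1)[OF assms(1)], of "\<lambda>_. - p" E] by simp
qed

lemma no_ties: "AE \<omega> in M. X v \<omega> \<noteq> a"
proof (rule AE_I)
  show "{\<omega> \<in> space M. \<not> X v \<omega> \<noteq> a} \<subseteq> {\<omega> \<in> space M. a \<le> X v \<omega> \<and> X v \<omega> \<le> a}" by auto
  have "prob {\<omega> \<in> space M. a \<le> X v \<omega> \<and> X v \<omega> \<le> a} = 0" using dens[of a a v] measure_nonneg[of M] by (simp add: antisym)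
  then show "emeasure M {\<omega> \<in> space M. a \<le> X v \<omega> \<and> X v \<omega> \<le> a} = 0" by (simp add: emeasure_eq_measure)
qed measurable

text \<open>Changing the sign of \<open>X\<close> preserves the law and turns white into black at
  the opposite level. The two sides differ only by ties, which are null sets.\<close>

lemma pr_white: assumes "loc V E" shows "pr p (\<lambda>R. E (- R)) = pr (- p) E"
proof -
  have g: "gauss M X S" ..
  note g' = gauss_uminus[OF g]
  have m: "pev p (\<lambda>R. E (- R)) \<in> sets M" by (rule pev_meas[OF loc_compl[OF assms]])
  have "AE \<omega> in M. \<forall>v\<in>V. X v \<omega> \<noteq> - p" by (rule AE_finite_allI[OF locD(1)[OF assms] no_ties])
  then have "pr p (\<lambda>R. E (- R)) = prob (gauss.sev M (\<lambda>i \<omega>. - X i \<omega>) V (\<lambda>_. p) E)" unfolding pr_def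
  proof (intro finite_measure_eq_AE m gauss.sev_meas[OF g' locD(1)[OF assms]], eventually_elim)
    fix \<omega> assume "\<forall>v\<in>V. X v \<omega> \<noteq> - p"
    then have "- blk p \<omega> \<inter> V = {v \<in> V. p \<le> - X v \<omega>}" by (fastforce simp: blk_def)
    then show "(\<omega> \<in> pev p (\<lambda>R. E (- R))) = (\<omega> \<in> gauss.sev M (\<lambda>i \<omega>. - X i \<omega>) V (\<lambda>_. p) E)"
      unfolding gauss.sev_def[OF g'] pev_def using locD(2)[OF assms, of "- blk p \<omega>"] by simp
  qed
  also have "\<dots> = pr (- p) E" unfolding pr_def pev_sev[OF assms] minus_minus
    by (rule sev_law[OF g' g locD(1)[OF assms]]) simp
  finally show ?thesis .
qed

text \<open>Keeps with a lower bound what is needed to combine it with others: monotonicity for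
  positive association, and dependence on finitely many vertices for measurability.\<close>

definition good :: "real => real => (vtx set => bool) => bool" where
  "good p c E \<longleftrightarrow> up E \<and> (\<exists>V. loc V E) \<and> c \<le> pr p E"

lemma good_weaken: "good p c E ==> c' \<le> c ==> good p c' E" by (auto simp: good_def)

lemma good_mono: assumes "good p c E" "\<And>R. E R ==> F R" "loc V F" "up F" shows "good p c F"
proof -
  have "pr p E \<le> pr p F" by (rule pr_mono[OF assms(3,2)])
  then show ?thesis using assms(1,3,4) unfolding good_def by force
qed

lemma good_conj: assumes "good p a E" "good p b F" "0 \<le> a" "0 \<le> b" shows "good p (a * b) (\<lambda>R. E R \<and> F R)"
proof -
  obtain V W where l: "loc V E" "loc W F" using assms by (auto simp: good_def)
  have "a * b \<le> pr p E * pr p F" using assms by (intro mult_mono) (auto simp: good_def pr_ge0)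
  then have "a * b \<le> pr p (\<lambda>R. E R \<and> F R)" using pr_fkg[OF l(1) _ l(2), of p] assms unfolding good_def by linarith
  then show ?thesis using assms up_conj loc_conj[OF loc_join[OF l]] unfolding good_def by blast
qed

lemma good_all: assumes "\<And>E. E \<in> set Es ==> good p c E" "0 \<le> c" shows "good p (c ^ length Es) (\<lambda>R. \<forall>E\<in>set Es. E R)"
  using assms(1)
proof (induction Es)
  case Nil
  have "pev p (\<lambda>R. True) = space M" by (simp add: pev_def)
  then show ?case by (auto simp: good_def up_def loc_def pr_def prob_space intro!: exI[of _ "{}"])
next
  case (Cons E Es)
  have "good p (c * c ^ length Es) (\<lambda>R. E R \<and> (\<forall>E\<in>set Es. E R))"
    by (rule good_conj) (use Cons assms(2) in auto)
  then show ?case by simp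
qed

lemma good_vimage: assumes "good p c E" "\<And>v w. S (\<sigma> v) (\<sigma> w) = S v w" shows "good p c (\<lambda>R. E (\<sigma> -` R))"
proof -
  obtain V where "loc V E" using assms by (auto simp: good_def)
  then show ?thesis using assms(1) pr_vimage[OF _ assms(2)] loc_vimage up_vimage unfolding good_def by metis
qed

lemma S_flp: "S (flp v) (flp w) = S v w"
proof -
  have "flp v = swp (mir (swp v))" for v by (simp add: flp_def swp_def mir_def)
  then show ?thesis by (simp add: S_swp S_mir)
qed

lemmas good_tr = good_vimage[OF _ S_tr] and good_mir = good_vimage[OF _ S_mir] and good_swp = good_vimage[OF _ S_swp]
  and good_flp = good_vimage[OF _ S_flp]

lemma good_crossV: assumes "good p c (crossH a b a' b')" shows "good p c (crossV a' b' a b)"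
proof -
  have "crossH a b a' b' (swp -` R) ==> crossV a' b' a b R" for R
    using crossV_swp[of a' b' a b "swp -` R"] by (simp add: vimage_def)
  then show ?thesis by (rule good_mono[OF good_swp[OF assms] _ loc_crossV up_crossV])
qed

lemma good_crossH_tr: assumes "good p c (crossH a b a' b')" "even (s + t)" shows "good p c (crossH (a + s) (b + s) (a' + t) (b' + t))"
  by (rule good_mono[OF good_tr[OF assms(1), of "(s, t)"] _ loc_crossH up_crossH]) (use crossH_tr[OF assms(2)] in blast)

text \<open>By \<open>hex\<close> the square is crossed horizontally in black or vertically in
  white. At level 0 both have the same probability, by the change of sign and the swap of the
  coordinates.\<close>

lemma good_square: assumes "0 \<le> s" shows "good 0 (1/2) (crossH (-s) s (-s) s)"
proof -
  let ?H = "crossH (-s) s (-s) s" and ?V = "crossV (-s) s (-s) s"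
  have "?V = (\<lambda>R. ?H (swp -` R))"
  proof
    fix R show "?V R = ?H (swp -` R)" using crossV_swp[of "-s" s "-s" s "swp -` R"] by (simp add: vimage_def)
  qed
  then have V: "pr 0 ?V = pr 0 ?H" using pr_vimage[OF loc_crossH S_swp] by simp
  have "\<not> ?H R ==> ?V (- R)" for R using hex[of "-s" s "-s" s R] assms by auto
  then have "1 - pr 0 ?H \<le> pr 0 (\<lambda>R. ?V (- R))"
    using pr_mono[OF loc_compl[OF loc_crossV], of "\<lambda>R. \<not> ?H R"] pr_not[OF loc_crossH] by metis
  also have "\<dots> = pr 0 ?H" using pr_white[OF loc_crossV, of 0] V by simp
  finally show ?thesis unfolding good_def using up_crossH loc_crossH by fastforce
qed

end

section \<open>Crossings of long rectangles\<close>

context perc begin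

lemma HR_half: assumes "0 \<le> s" shows "1/4 \<le> pr 0 (HR s 0 s)"
proof -
  have "HR s 0 s R \<or> HR s 0 s (flp -` R)" if h: "crossH (-s) s (-s) s R" for R
  proof -
    obtain x y where xy: "fst x = -s" "fst y = s" "conn (R \<inter> qbox s) x y" using h by (auto simp: crossH_def)
    have y: "y = (s, snd y)" "-s \<le> snd y" "snd y \<le> s" using xy conn_in2[OF xy(3)] by (auto simp: prod_eq_iff in_rect)
    show ?thesis
    proof (cases "0 \<le> snd y")
      case True
      then show ?thesis using xy y unfolding HR_def by metis
    next
      case False
      have "conn (flp -` R \<inter> qbox s) (flp x) (flp y)"
        by (rule conn_map[OF xy(3) adj_flp]) (auto simp: flp_def in_rect)
      then have "conn (flp -` R \<inter> qbox s) (flp x) (s, - snd y)" using xy(2) by (simp add: flp_def)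
      then have "HR s 0 s (flp -` R)" unfolding HR_def
        by (intro exI[of _ "flp x"] exI[of _ "- snd y"]) (use False xy y in \<open>simp add: flp_def\<close>)
      then show ?thesis ..
    qed
  qed
  then have *: "\<not> (HR s 0 s R \<or> HR s 0 s (flp -` R)) ==> \<not> crossH (-s) s (-s) s R" for R by blast
  note l = loc_join[OF loc_HR[of s 0 s] loc_vimage[OF loc_HR[of s 0 s], of flp]]
  have "pr 0 (crossH (-s) s (-s) s) \<le> pr 0 (\<lambda>R. HR s 0 s R \<or> HR s 0 s (flp -` R))"
  proof (rule pr_mono)
    show "loc (qbox s \<union> flp ` qbox s) (\<lambda>R. HR s 0 s R \<or> HR s 0 s (flp -` R))"
      using l unfolding loc_def by blast
  qed (use * in blast)
  also have "\<dots> \<le> pr 0 (HR s 0 s) + pr 0 (\<lambda>R. HR s 0 s (flp -` R))" by (rule pr_disj[OF loc_HR loc_vimage[OF loc_HR]])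
  also have "pr 0 (\<lambda>R. HR s 0 s (flp -` R)) = pr 0 (HR s 0 s)" by (rule pr_vimage[OF loc_HR S_flp])
  finally show ?thesis using good_square[OF assms] by (simp add: good_def)
qed

lemma HR_good: "c \<le> pr p (HR s \<alpha> \<beta>) ==> good p c (HR s \<alpha> \<beta>)" unfolding good_def using up_HR loc_HR by blast

text \<open>One of the two parts of the window carries half of the 1/4 in
  \<open>HR_half\<close>.\<close>

lemma HR_split: assumes "0 \<le> s" shows "1/8 \<le> pr 0 (HR s 0 \<alpha>) \<or> 1/8 \<le> pr 0 (HR s \<alpha> s)"
proof -
  have "loc (qbox s) (\<lambda>R. HR s 0 \<alpha> R \<or> HR s \<alpha> s R)" using loc_HR unfolding loc_def by blast
  moreover have "HR s 0 \<alpha> R \<or> HR s \<alpha> s R" if "HR s 0 s R" for R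
    using that unfolding HR_def by (meson linear)
  ultimately have "pr 0 (HR s 0 s) \<le> pr 0 (\<lambda>R. HR s 0 \<alpha> R \<or> HR s \<alpha> s R)" by (rule pr_mono)
  also have "\<dots> \<le> pr 0 (HR s 0 \<alpha>) + pr 0 (HR s \<alpha> s)" by (rule pr_disj[OF loc_HR loc_HR])
  finally show ?thesis using HR_half[OF assms] by linarith
qed

text \<open>The height \<alpha> is raised from 0, where \<open>HR_half\<close> applies, as long as
  the window from 0 to \<open>\<alpha> + 1\<close> is too unlikely; by \<open>HR_split\<close>,
  crossings then still end above \<open>\<alpha> + 1\<close> with probability at least 1/8.\<close>

lemma alpha_exists: assumes "0 \<le> s"
  shows "\<exists>\<alpha>. 0 \<le> \<alpha> \<and> \<alpha> \<le> s div 2 \<and> good 0 (1/8) (HR s \<alpha> s) \<and> (\<alpha> = s div 2 \<or> good 0 (1/8) (HR s 0 (\<alpha> + 1)))"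
proof (rule ccontr)
  assume c: "\<not> ?thesis"
  have "int n \<le> s div 2 --> good 0 (1/8) (HR s (int n) s)" for n
  proof (induction n)
    case 0
    show ?case using HR_half[OF assms] HR_good[of "1/8" 0 s 0 s] by simp
  next
    case (Suc n)
    show ?case
    proof
      assume n: "int (Suc n) \<le> s div 2"
      then have "good 0 (1/8) (HR s (int n) s)" using Suc by simp
      then have "\<not> good 0 (1/8) (HR s 0 (int n + 1))" using c n by force
      then have "\<not> 1/8 \<le> pr 0 (HR s 0 (int n + 1))" using HR_good by blast
      then show "good 0 (1/8) (HR s (int (Suc n)) s)" using HR_split[OF assms, of "int n + 1"] HR_good by (simp add: add.commute)
    qed
  qed
  from this[of "nat (s div 2)"] show False using c assms by auto
qed

lemma good_XX: assumes g: "good 0 (1/8) (HR s \<alpha> s)" and s: "0 \<le> s" shows "good 0 ((1/8) ^ 5) (XX s \<alpha>)"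
proof -
  let ?L = "[HR s \<alpha> s, \<lambda>R. HR s \<alpha> s (flp -` R), \<lambda>R. HR s \<alpha> s (mir -` R), \<lambda>R. HR s \<alpha> s (flp -` (mir -` R)), crossV (-s) s (-s) s]"
  have "good 0 (1/8) E" if "E \<in> set ?L" for E
    using that g good_flp[OF g] good_mir[OF g] good_mir[OF good_flp[OF g]] good_weaken[OF good_crossV[OF good_square[OF s]], of "1/8"] by auto
  then have "good 0 ((1/8) ^ length ?L) (\<lambda>R. \<forall>E\<in>set ?L. E R)" by (rule good_all) simp_all
  then have "good 0 ((1/8) ^ 5) (\<lambda>R. \<forall>E\<in>set ?L. E R)" by (simp add: eval_nat_numeral)
  then show ?thesis by (rule good_mono[OF _ XX_intro loc_XX up_XX]) (use s in auto)
qed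

text \<open>Only even translations are symmetries, so the rectangle is first shortened on the left
  by \<open>e\<close>. The extra unit in \<open>6 * s + 1\<close> pays for this.\<close>

lemma good_long: assumes g: "good p c (crossH a b (-s) s)" and ab: "6 * s + 1 \<le> b - a" and s: "0 \<le> s"
  shows "good p c (lng s)"
proof -
  define e where "e = (a + 3 * s) mod 2"
  have e: "0 \<le> e" "e \<le> 1" "even (a + e + 3 * s)" unfolding e_def by presburger+
  have "good p c (crossH (a + e) (a + e + 6 * s) (-s) s)"
  proof (rule good_mono[OF g _ loc_crossH up_crossH])
    fix R assume "crossH a b (-s) s R"
    then show "crossH (a + e) (a + e + 6 * s) (-s) s R" by (rule crossH_sub) (use e ab s in auto)
  qed
  then have "good p c (crossH (a + e + -(a + e + 3 * s)) (a + e + 6 * s + -(a + e + 3 * s)) (-s + 0) (s + 0))"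
    by (rule good_crossH_tr) (use e(3) in presburger)
  then show ?thesis by (simp add: algebra_simps)
qed

text \<open>Each step forward by \<open>t\<close> costs a translated crossing, of probability at
  least \<open>c\<close>, and a vertical crossing of a square, of probability at least 1/2, which
  joins it to the previous ones.\<close>

lemma good_chain: assumes g: "good 0 c (crossH (-s) (s + t) (-s) s)" and s: "0 \<le> s" "0 \<le> t" "even t" "0 \<le> c"
  shows "good 0 (1/2 * (c / 2) ^ n) (crossH (-s) (s + int n * t) (-s) s)"
proof (induction n)
  case 0 show ?case using good_square[OF s(1)] by simp
next
  case (Suc n)
  let ?a = "int n * t"
  have a: "0 \<le> ?a" "even ?a" using s by auto
  have H: "good 0 c (crossH (-s + ?a) (s + t + ?a) (-s) s)" using good_crossH_tr[OF g, of ?a 0] a by simp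
  have V: "good 0 (1/2) (crossV (-s + ?a) (s + ?a) (-s) s)"
    by (rule good_crossV) (use good_crossH_tr[OF good_square[OF s(1)], of 0 ?a] a in simp)
  have "good 0 (1/2 * (c / 2) ^ n * (c * (1/2))) (\<lambda>R. crossH (-s) (s + ?a) (-s) s R \<and> crossH (-s + ?a) (s + t + ?a) (-s) s R \<and> crossV (-s + ?a) (s + ?a) (-s) s R)"
    by (intro good_conj Suc.IH H V) (use s in auto)
  moreover have "1/2 * (c / 2) ^ n * (c * (1/2)) = 1/2 * (c / 2) ^ Suc n" by simp
  moreover have "s + t + ?a = s + int (Suc n) * t" by (simp add: algebra_simps)
  ultimately have "good 0 (1/2 * (c / 2) ^ Suc n) (\<lambda>R. crossH (-s) (s + ?a) (-s) s R \<and> crossH (-s + ?a) (s + int (Suc n) * t) (-s) s R \<and> crossV (-s + ?a) (s + ?a) (-s) s R)" by metis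
  then show ?case
  proof (rule good_mono[OF _ _ loc_crossH up_crossH])
    fix R assume h: "crossH (-s) (s + ?a) (-s) s R \<and> crossH (-s + ?a) (s + int (Suc n) * t) (-s) s R \<and> crossV (-s + ?a) (s + ?a) (-s) s R"
    show "crossH (-s) (s + int (Suc n) * t) (-s) s R"
      by (rule crossH_chain[OF h[THEN conjunct1] h[THEN conjunct2, THEN conjunct1] h[THEN conjunct2, THEN conjunct2]])
        (use a s in \<open>auto simp: algebra_simps\<close>)
  qed
qed

text \<open>With ends beyond half the height, copies shifted by \<open>2 * (s div 2)\<close>
  interlock in \<open>XX_stack\<close>. Eight of them span a height of \<open>6 * s + 1\<close> for
  \<open>s \<ge> 7\<close>.\<close>

lemma rsw_stack: assumes g: "good 0 (1/8) (HR s (s div 2) s)" and s: "7 \<le> s"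
  shows "good 0 (((1/8) ^ 5) ^ 8) (lng s)"
proof -
  define \<alpha> where "\<alpha> = s div 2"
  have al: "2 * \<alpha> \<le> s" "s \<le> 2 * \<alpha> + 1" unfolding \<alpha>_def by presburger+
  define t where "t = 2 * \<alpha>"
  let ?E = "\<lambda>k R. XX s \<alpha> (tr (0, int k * t) -` R)"
  have X: "good 0 ((1/8) ^ 5) (XX s \<alpha>)" using good_XX[OF g] s by (simp add: \<alpha>_def)
  have "good 0 (((1/8) ^ 5) ^ length (map ?E [0..<8])) (\<lambda>R. \<forall>E\<in>set (map ?E [0..<8]). E R)"
    by (rule good_all) (use good_tr[OF X] in auto)
  then have "good 0 (((1/8) ^ 5) ^ 8) (\<lambda>R. \<forall>E\<in>set (map ?E [0..<8]). E R)" by simp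
  then have "good 0 (((1/8) ^ 5) ^ 8) (crossV (-s) s 0 (6 * s + 1))"
  proof (rule good_mono[OF _ _ loc_crossV up_crossV])
    fix R assume "\<forall>E\<in>set (map ?E [0..<8]). E R"
    then have "XX s \<alpha> (tr (0, int k * t) -` R)" if "k \<le> 7" for k using that by simp
    from XX_stack[of 7, OF this] obtain y1 a b where y: "y1 \<le> - \<alpha>" "conn (R \<inter> rect (-s) s (-s) (s + int 7 * t)) (s, y1) (s, a)"
      "conn (R \<inter> rect (-s) s (int 7 * t - s) (int 7 * t + s)) (s, a) (s, b)" "int 7 * t + \<alpha> \<le> b"
      using s al unfolding t_def by force
    have t0: "0 \<le> t" using s al unfolding t_def by linarith
    have "conn (R \<inter> rect (-s) s (-s) (s + int 7 * t)) (s, a) (s, b)"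
      by (rule conn_mono[OF y(3)]) (use t0 in \<open>auto simp: in_rect\<close>)
    with y(2) have c: "conn (R \<inter> rect (-s) s (-s) (s + int 7 * t)) (s, y1) (s, b)" by (rule conn_trans)
    obtain p q where pq: "snd p = 0" "snd q = 6 * s + 1" "conn (R \<inter> rect (-s) s (-s) (s + int 7 * t) \<inter> {v. 0 \<le> snd v \<and> snd v \<le> 6 * s + 1}) p q"
      by (rule conn_extract[OF c, of snd 0 "6 * s + 1"]) (use y s al adj_snd t_def in auto)
    have "conn (R \<inter> rect (-s) s 0 (6 * s + 1)) p q" by (rule conn_mono[OF pq(3)]) (auto simp: in_rect)
    then show "crossV (-s) s 0 (6 * s + 1) R" unfolding crossV_def using pq by blast
  qed
  from good_swp[OF this] have "good 0 (((1/8) ^ 5) ^ 8) (crossH 0 (6 * s + 1) (-s) s)"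
    by (rule good_mono[OF _ _ loc_crossH up_crossH]) (simp add: crossV_swp)
  then show ?thesis by (rule good_long) (use s in auto)
qed

text \<open>Ten extensions by \<open>2 * (s div 3)\<close> make the rectangle at least
  \<open>6 * s + 1\<close> long for \<open>s \<ge> 7\<close>.\<close>

lemma rsw_extend: assumes g: "good 0 c (crossH (-s) (s + 2 * (s div 3)) (-s) s)" and s: "7 \<le> s" and c: "0 \<le> c"
  shows "good 0 (1/2 * (c / 2) ^ 10) (lng s)"
proof -
  have "good 0 (1/2 * (c / 2) ^ 10) (crossH (-s) (s + int 10 * (2 * (s div 3))) (-s) s)"
    by (rule good_chain[OF g]) (use s c in auto)
  moreover have "6 * s + 1 \<le> s + int 10 * (2 * (s div 3)) - -s" using s by (simp; presburger)
  ultimately show ?thesis by (rule good_long) (use s in simp)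
qed

text \<open>For \<open>s\<close> equal to \<open>3/2 * s'\<close> rounded up, the glued crossing
  extends to \<open>3 * s - 2 * s' \<ge> s + 2 * (s div 3)\<close>, and the raised small box stays
  below the top of the large one because \<open>\<alpha>' + s' \<le> s\<close>.\<close>

lemma rsw_glue:
  assumes "good 0 (1/8) (HR s' \<alpha>' s')" "good 0 (1/8) (HR s 0 (\<alpha> + 1))" "0 \<le> \<alpha>" "\<alpha> + 2 \<le> 2 * \<alpha>'" "\<alpha>' \<le> s' div 2"
    and s: "s = (3 * s' + 1) div 2" "1 \<le> s'"
  shows "good 0 ((1/8) ^ 7) (crossH (-s) (s + 2 * (s div 3)) (-s) s)"
proof -
  \<comment> \<open>Lowering \<alpha>' by a parity makes the translation even. The loss of at most
    one unit is covered by \<open>\<alpha> + 2 \<le> 2 * \<alpha>'\<close>, which leaves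
    \<open>\<alpha> + 1 \<le> c + \<alpha>'\<close>.\<close>
  define c where "c = \<alpha>' - (s - s' + \<alpha>') mod 2"
  have c: "even (s - s' + c)" "c \<le> \<alpha>'" "\<alpha>' - 1 \<le> c" unfolding c_def by presburger+
  have ss: "s' < s" "\<alpha>' + s' \<le> s" "s' \<le> s - s div 3" and d: "0 \<le> s div 3" "0 \<le> s" using s assms(5) by presburger+
  note X = good_XX[OF assms(1)]
  have "good 0 (1/8 * ((1/8) ^ 5 * (1/8))) (\<lambda>R. HR s 0 (\<alpha> + 1) R \<and> XX s' \<alpha>' (tr (s - s', c) -` R) \<and> HR s 0 (\<alpha> + 1) (mir -` (tr (2 * s - 2 * s', 0) -` R)))"
    by (intro good_conj assms(2) good_tr[OF X] good_tr[OF good_mir[OF assms(2)]]) (use s in auto)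
  then have "good 0 (1/8 * ((1/8) ^ 5 * (1/8))) (crossH (-s) (s + 2 * (s div 3)) (-s) s)"
  proof (rule good_mono[OF _ _ loc_crossH up_crossH])
    fix R assume h: "HR s 0 (\<alpha> + 1) R \<and> XX s' \<alpha>' (tr (s - s', c) -` R) \<and> HR s 0 (\<alpha> + 1) (mir -` (tr (2 * s - 2 * s', 0) -` R))"
    have "crossH (-s) (3 * s - 2 * s') (-s) s R"
      by (rule glue[OF h[THEN conjunct1] h[THEN conjunct2, THEN conjunct1] h[THEN conjunct2, THEN conjunct2] c(1)]) (use c ss assms(3,4) s in auto)
    then show "crossH (-s) (s + 2 * (s div 3)) (-s) s R"
      by (rule crossH_sub) (use ss d in auto)
  qed
  then show ?thesis by (simp add: eval_nat_numeral)
qed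

lemma good_mem: "good 0 (1/2) (\<lambda>R. v \<in> R)"
proof -
  have "good 0 (1/2) (\<lambda>R. (0, 0) \<in> R)"
    by (rule good_mono[OF good_square[of 0] _ loc_mem up_mem]) (auto simp: crossH_def dest!: conn_in1 simp: rect_def)
  from good_tr[OF this, of v] show ?thesis by (simp add: tr_def)
qed

lemma rsw_window:
  assumes g: "good 0 (1/8) (HR s 0 (\<alpha> + 1))" and "\<alpha> \<le> 1" and s: "2 \<le> s"
  shows "good 0 ((1/8) ^ 7) (crossH (-s) (s + 2 * (s div 3)) (-s) s)"
proof -
  have d: "0 \<le> s div 3" "s div 3 \<le> s" using s by presburger+
  have H: "good 0 (1/8) (HR s 0 2)"
    by (rule good_mono[OF g _ loc_HR up_HR]) (use assms(2) in \<open>force simp: HR_def\<close>)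
  have "good 0 (1/8 * (1/8 * (1/2 * (1/2 * (1/2))))) (\<lambda>R. HR s 0 2 R \<and> HR s 0 2 (mir -` (tr (2 * s, 0) -` R)) \<and> (s, 0) \<in> R \<and> (s, 1) \<in> R \<and> (s, 2) \<in> R)"
    by (intro good_conj H good_tr[OF good_mir[OF H]] good_mem) auto
  then have "good 0 (1/8 * (1/8 * (1/2 * (1/2 * (1/2))))) (crossH (-s) (s + 2 * (s div 3)) (-s) s)"
  proof (rule good_mono[OF _ _ loc_crossH up_crossH])
    fix R assume "HR s 0 2 R \<and> HR s 0 2 (mir -` (tr (2 * s, 0) -` R)) \<and> (s, 0) \<in> R \<and> (s, 1) \<in> R \<and> (s, 2) \<in> R"
    then have "crossH (-s) (3 * s) (-s) s R" using glue_window s by blast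
    then show "crossH (-s) (s + 2 * (s div 3)) (-s) s R"
      by (rule crossH_sub) (use d s in auto)
  qed
  then show ?thesis by (rule good_weaken) (simp add: eval_nat_numeral)
qed

primrec scale :: "nat => nat => int" where
  "scale N 0 = int N" | "scale N (Suc k) = (3 * scale N k + 1) div 2"

text \<open>The height \<open>al s\<close>, above which a crossing of the box still ends with probability at least \<open>1/8\<close>,
  is at most half of \<open>s\<close>. Hence it cannot double at each step of a sequence of scales that grow by the
  factor \<open>3/2\<close>, and at arbitrarily large scales one of the three constructions above applies.\<close>

theorem rsw: "\<exists>c>0. \<forall>N. \<exists>s\<ge>N. good 0 c (lng s)"
proof -
  obtain al where al: "\<And>s. 0 \<le> s ==> 0 \<le> al s \<and> al s \<le> s div 2 \<and> good 0 (1/8) (HR s (al s) s) \<and> (al s = s div 2 \<or> good 0 (1/8) (HR s 0 (al s + 1)))"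
    using alpha_exists by metis
  define c where "c = min (((1/8) ^ 5) ^ 8) (1/2 * ((1/8) ^ 7 / 2) ^ 10 :: real)"
  have c: "c > 0" unfolding c_def by simp
  have "\<exists>s\<ge>N. good 0 c (lng s)" for N
  proof (rule ccontr)
    assume no: "\<not> ?thesis"
    define n where "n = nat (max N 7)"
    define s where "s = scale n"
    have s0: "s 0 = int n" and sS: "s (Suc k) = (3 * s k + 1) div 2" for k by (simp_all add: s_def)
    have n: "N \<le> int n" "7 \<le> int n" by (auto simp: n_def)
    have sn: "int n \<le> s k" for k
    proof (induction k)
      case (Suc k) then show ?case unfolding sS by presburger
    qed (simp add: s0)
    have s7: "7 \<le> s k" "N \<le> s k" for k using sn[of k] n by simp_all
    have no1: "\<not> good 0 (((1/8) ^ 5) ^ 8) (lng (s k))" for k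
      using no s7 good_weaken[where c'=c] unfolding c_def by (meson min.cobounded1)
    have no2: "\<not> good 0 ((1/8) ^ 7) (crossH (-s k) (s k + 2 * (s k div 3)) (-s k) (s k))" for k
      using no s7[of k] good_weaken[where c'=c] rsw_extend[of "(1/8)^7" "s k"] unfolding c_def
      by (meson min.cobounded2 zero_le_power divide_nonneg_nonneg zero_le_one zero_le_numeral)
    have A: "0 \<le> al (s k)" "al (s k) \<le> s k div 2" "good 0 (1/8) (HR (s k) (al (s k)) (s k))"
      "al (s k) = s k div 2 \<or> good 0 (1/8) (HR (s k) 0 (al (s k) + 1))" for k using al[of "s k"] s7[of k] by auto
    have HL: "good 0 (1/8) (HR (s k) 0 (al (s k) + 1))" for k
      using A(3,4)[of k] rsw_stack[OF _ s7(1)] no1[of k] by metis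
    have a2: "2 \<le> al (s k)" for k
      using rsw_window[OF HL[of k]] s7[of k] no2[of k] by linarith
    \<comment> \<open>Otherwise \<open>rsw_glue\<close>, with a small cluster of scale
      \<open>s k\<close> and crossings of scale \<open>s (Suc k)\<close>, would contradict
      \<open>no2\<close>.\<close>
    have gr: "2 * (al (s k) - 1) \<le> al (s (Suc k)) - 1" for k
    proof (rule ccontr)
      assume n: "\<not> ?thesis"
      have "al (s (Suc k)) + 2 \<le> 2 * al (s k)" using n by presburger
      from rsw_glue[OF A(3)[of k] HL[of "Suc k"] A(1)[of "Suc k"] this A(2)[of k] sS] show False using no2 s7[of k] by auto
    qed
    \<comment> \<open>The quotient of \<open>al (s k) - 1\<close> by \<open>s k + 1\<close> gains at
      least the factor 4/3, that is, 2 divided by 3/2, in each step. It is at most 1, so this cannot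
      go on.\<close>
    have r: "(4/3) ^ k * real_of_int (s k + 1) \<le> real_of_int (al (s k) - 1) * real_of_int (s 0 + 1)" for k
    proof (induction k)
      case 0 then show ?case using a2[of 0] s7[of 0] by (simp add: mult_le_cancel_right1)
    next
      case (Suc k)
      have "real_of_int (s (Suc k) + 1) \<le> 3/2 * real_of_int (s k + 1)"
      proof -
        have "2 * (s (Suc k) + 1) \<le> 3 * (s k + 1)" unfolding sS by presburger
        then have "real_of_int (2 * (s (Suc k) + 1)) \<le> real_of_int (3 * (s k + 1))" by (rule of_int_le_iff[THEN iffD2])
        then show ?thesis by (simp add: field_simps)
      qed
      then have "(4/3) ^ Suc k * real_of_int (s (Suc k) + 1) \<le> (4/3) ^ Suc k * (3/2 * real_of_int (s k + 1))" by (intro mult_left_mono) auto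
      also have "\<dots> = 2 * ((4/3) ^ k * real_of_int (s k + 1))" by simp
      also have "\<dots> \<le> 2 * (real_of_int (al (s k) - 1) * real_of_int (s 0 + 1))" using Suc by simp
      also have "\<dots> = real_of_int (2 * (al (s k) - 1)) * real_of_int (s 0 + 1)" by simp
      also have "\<dots> \<le> real_of_int (al (s (Suc k)) - 1) * real_of_int (s 0 + 1)"
        by (intro mult_right_mono) (use gr[of k] s7[of 0] in linarith)+
      finally show ?case .
    qed
    have "(4/3) ^ k \<le> real_of_int (s 0 + 1)" for k
    proof -
      have "al (s k) - 1 \<le> s k + 1" using A(2)[of k] s7[of k] by linarith
      then have "real_of_int (al (s k) - 1) * real_of_int (s 0 + 1) \<le> real_of_int (s k + 1) * real_of_int (s 0 + 1)"
        by (intro mult_right_mono) (use s7[of 0] in linarith)+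
      with r[of k] have "(4/3) ^ k * real_of_int (s k + 1) \<le> real_of_int (s 0 + 1) * real_of_int (s k + 1)" by (simp add: mult.commute)
      then show ?thesis by (rule mult_right_le_imp_le) (use s7[of k] in linarith)
    qed
    moreover obtain k where "real_of_int (s 0 + 1) < (4/3) ^ k" using real_arch_pow[of "4/3" "real_of_int (s 0 + 1)"] by auto
    ultimately show False by (meson not_le)
  qed
  then show ?thesis using c by blast
qed

end

section \<open>Percolation on the lattice\<close>

lemma conn_reach_aux:
  assumes "conn B x y" "nrm x \<le> m" "m \<le> N" "N \<le> nrm y"
  shows "\<exists>a b. nrm a \<le> m \<and> nrm b = N \<and> conn B x a \<and> conn (B \<inter> qbox N) a b"
proof -
  obtain a b where ab: "nrm a = m" "nrm b = N" "conn B x a" "conn (B \<inter> {v. m \<le> nrm v \<and> nrm v \<le> N}) a b"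
    by (rule conn_extract[OF assms(1) nrm_adj assms(2,3,4)])
  have "conn (B \<inter> qbox N) a b" by (rule conn_mono[OF ab(4)]) (auto simp: nrm_rect)
  moreover have "nrm a \<le> m" using ab(1) by simp
  ultimately show ?thesis using ab(2,3) by blast
qed

definition reach :: "int => int => vtx set => bool" where
  "reach m N B \<longleftrightarrow> (\<exists>x y. nrm x \<le> m \<and> nrm y = N \<and> conn (B \<inter> qbox N) x y)"

lemma conn_reach: "conn B x y ==> nrm x \<le> m ==> m \<le> N ==> N \<le> nrm y ==> reach m N B"
  unfolding reach_def using conn_reach_aux by blast

lemma reach_conn: assumes "reach m N B" obtains x y where "nrm x \<le> m" "nrm y = N" "conn B x y"
  using assms conn_mono[OF _ Int_lower1] unfolding reach_def by blast

lemma loc_reach: "loc (qbox N) (reach m N)" unfolding loc_def reach_def by (simp add: Int_assoc)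
lemma up_reach: "up (reach m N)"
proof -
  have "conn (R \<inter> qbox N) x y ==> R \<subseteq> T ==> conn (T \<inter> qbox N) x y" for R T x y
    by (elim conn_mono) blast
  then show ?thesis unfolding up_def reach_def by blast
qed
lemma loc_arm: "loc (ann s) (arm s)" unfolding loc_def arm_def by (simp add: Int_assoc finite_ann)
lemma up_arm: "up (arm s)"
proof -
  have "conn (R \<inter> ann s) x y ==> R \<subseteq> T ==> conn (T \<inter> ann s) x y" for R T x y by (elim conn_mono) blast
  then show ?thesis unfolding up_def arm_def by blast
qed

lemma card_rect: "a \<le> b + 1 ==> c \<le> d + 1 ==> real (card (rect a b c d)) = real_of_int (b - a + 1) * real_of_int (d - c + 1)"
  by (simp add: rect_def)

text \<open>On each side of \<open>y\<close> the sum is bounded by the Basel series, and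
  \<open>pi\<^sup>2 / 6 \<le> 2\<close>.\<close>

lemma sum_inverse_square:
  fixes A :: "int set"
  assumes "finite A"
  shows "(\<Sum>x\<in>A. 1 / (1 + \<bar>real_of_int x - real_of_int y\<bar>)\<^sup>2) \<le> 4"
proof -
  define g where "g x = 1 / (1 + \<bar>real_of_int x - real_of_int y\<bar>)\<^sup>2" for x :: int
  have T: "(\<lambda>n. 1 / (1 + real n)\<^sup>2) sums (pi\<^sup>2 / 6)" using inverse_squares_sums by (simp add: add.commute)
  have P: "pi\<^sup>2 / 6 \<le> 2"
  proof -
    have "pi\<^sup>2 \<le> (3.2)\<^sup>2" using pi_approx by (intro power_mono) auto
    then show ?thesis by (simp add: power2_eq_square)
  qed
  have half: "sum g B \<le> 2" if f: "finite B" and s: "(\<forall>x\<in>B. y \<le> x) \<or> (\<forall>x\<in>B. x \<le> y)" for B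
  proof -
    have i: "inj_on (\<lambda>x. nat \<bar>x - y\<bar>) B" using s unfolding inj_on_def by (smt (verit) nat_eq_iff2)
    have "sum g B = (\<Sum>n\<in>(\<lambda>x. nat \<bar>x - y\<bar>) ` B. 1 / (1 + real n)\<^sup>2)" by (subst sum.reindex[OF i]) (simp add: g_def)
    also have "\<dots> \<le> pi\<^sup>2 / 6" using sum_le_suminf[OF sums_summable[OF T]] sums_unique[OF T] f by simp
    finally show ?thesis using P by simp
  qed
  have A: "A = (A \<inter> {y..}) \<union> (A \<inter> {..<y})" by auto
  have "sum g A = sum g (A \<inter> {y..}) + sum g (A \<inter> {..<y})"
    by (subst A, rule sum.union_disjoint) (use assms in auto)
  also have "\<dots> \<le> 2 + 2" using assms by (intro add_mono half) auto
  finally show ?thesis by (simp add: g_def)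
qed

section \<open>Arm probabilities at level zero\<close>

context perc begin

lemma D1: "1 \<le> D" using decay[of "(0, 0)" "(0, 0)"] S_diag by (simp add: nrm_def)

text \<open>With \<open>n\<close> the larger of the two coordinate distances,
  \<open>(1 + n) ^ 5\<close> dominates the product of the squares of 1 plus each distance. The
  double sum then factorizes into two sums that are at most 4.\<close>

lemma S_summable: assumes "finite V" shows "(\<Sum>j\<in>V. S i j) \<le> 16 * D"
proof -
  let ?g = "\<lambda>x y. 1 / (1 + \<bar>real_of_int x - real_of_int y\<bar>)\<^sup>2"
  have "S i j \<le> D * (?g (fst j) (fst i) * ?g (snd j) (snd i))" for j
  proof -
    define n where "n = real_of_int (nrm (fst i - fst j, snd i - snd j))"
    have n: "\<bar>real_of_int (fst j) - real_of_int (fst i)\<bar> \<le> n" "\<bar>real_of_int (snd j) - real_of_int (snd i)\<bar> \<le> n" "0 \<le> n"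
      unfolding n_def nrm_def by (auto simp: max_def)
    have "(1 + \<bar>real_of_int (fst j) - real_of_int (fst i)\<bar>)\<^sup>2 * (1 + \<bar>real_of_int (snd j) - real_of_int (snd i)\<bar>)\<^sup>2 \<le> (1 + n)\<^sup>2 * (1 + n)\<^sup>2"
      using n by (intro mult_mono power_mono) auto
    also have "\<dots> = (1 + n) ^ 4" by (simp flip: power_add)
    also have "\<dots> \<le> (1 + n) ^ 5" using n by (intro power_increasing) auto
    finally have "D / (1 + n) ^ 5 \<le> D / ((1 + \<bar>real_of_int (fst j) - real_of_int (fst i)\<bar>)\<^sup>2 * (1 + \<bar>real_of_int (snd j) - real_of_int (snd i)\<bar>)\<^sup>2)"
      using D1 n by (intro divide_left_mono) (auto intro!: mult_pos_pos zero_less_power add_pos_nonneg)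
    then show ?thesis using decay[of i j] by (simp add: n_def)
  qed
  then have "(\<Sum>j\<in>V. S i j) \<le> (\<Sum>j\<in>V. D * (?g (fst j) (fst i) * ?g (snd j) (snd i)))" by (rule sum_mono)
  also have "\<dots> \<le> (\<Sum>j\<in>fst ` V \<times> snd ` V. D * (?g (fst j) (fst i) * ?g (snd j) (snd i)))"
  proof (rule sum_mono2)
    show "V \<subseteq> fst ` V \<times> snd ` V" by force
  qed (use assms D1 in simp_all)
  also have "\<dots> = D * ((\<Sum>x\<in>fst ` V. ?g x (fst i)) * (\<Sum>x\<in>snd ` V. ?g x (snd i)))"
    unfolding sum_product by (simp only: sum.cartesian_product case_prod_beta sum_distrib_left)
  also have "\<dots> \<le> D * (4 * 4)" using assms D1 by (intro mult_left_mono mult_mono sum_inverse_square) (auto intro!: sum_nonneg)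
  finally show ?thesis by simp
qed

lemma S_sum_far:
  assumes "\<And>v w. v \<in> A ==> w \<in> B ==> d \<le> real_of_int (nrm (fst v - fst w, snd v - snd w))" "0 < d"
  shows "(\<Sum>v\<in>A. \<Sum>w\<in>B. S v w) \<le> real (card A) * real (card B) * (D / d ^ 5)"
proof -
  have "S v w \<le> D / d ^ 5" if "v \<in> A" "w \<in> B" for v w
  proof -
    have "S v w \<le> D / (1 + real_of_int (nrm (fst v - fst w, snd v - snd w))) ^ 5" by (rule decay)
    also have "\<dots> \<le> D / d ^ 5" using assms(1)[OF that] assms(2) D1
      by (intro divide_left_mono power_mono) (auto intro!: mult_pos_pos zero_less_power)
    finally show ?thesis .
  qed
  then have "(\<Sum>v\<in>A. \<Sum>w\<in>B. S v w) \<le> (\<Sum>v\<in>A. \<Sum>w\<in>B. D / d ^ 5)" by (intro sum_mono)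
  then show ?thesis by simp
qed

lemma pr_mixing:
  assumes "loc VA A" "loc VB B" "up A" "up B" "VA \<inter> VB = {}" "h > 0"
  shows "pr p (\<lambda>R. A R \<and> B R) \<le> pr p A * pr p B + 2 / h * (\<Sum>i\<in>VA. \<Sum>j\<in>VB. S i j) + 6 * (real (card VA) * h)"
proof -
  note l = loc_join[OF assms(1,2)]
  have "sev (VA \<union> VB) c (\<lambda>R. A R \<and> B R) = sev (VA \<union> VB) c (\<lambda>R. A (R \<inter> VA) \<and> B (R \<inter> VB))" for c
    using locD(2)[OF assms(1)] locD(2)[OF assms(2)] by (simp add: sev_def)
  then show ?thesis unfolding pr_def pev_sev[OF loc_conj[OF l]] pev_sev[OF assms(1)] pev_sev[OF assms(2)]
    using mixing[OF locD(1)[OF assms(1)] locD(1)[OF assms(2)] assms(5) up_incr[OF assms(3)] up_incr[OF assms(4)] assms(6)] by simp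
qed

lemma good_circuit: assumes g: "good p c (lng s)" and "0 \<le> c" "0 \<le> s"
  shows "good p (c ^ 4) (circuit s)"
proof -
  have 1: "good p c (crossH (-(3 * s)) (3 * s) s (3 * s))" using good_crossH_tr[OF g, of 0 "2 * s"] by simp
  have 2: "good p c (crossH (-(3 * s)) (3 * s) (-(3 * s)) (-s))" using good_crossH_tr[OF g, of 0 "- (2 * s)"] by simp
  have "good p (c * (c * (c * c))) (\<lambda>R. crossH (-(3 * s)) (3 * s) s (3 * s) R \<and> crossH (-(3 * s)) (3 * s) (-(3 * s)) (-s) R \<and>
     crossV s (3 * s) (-(3 * s)) (3 * s) R \<and> crossV (-(3 * s)) (-s) (-(3 * s)) (3 * s) R)"
    by (intro good_conj good_crossV 1 2) (use assms in auto)
  then show ?thesis unfolding circuit_def[abs_def] by (simp add: eval_nat_numeral)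
qed

text \<open>A white circuit blocks black arms. At level 0 white has the law of black, so four long
  crossings give the circuit a probability of at least \<open>c ^ 4\<close>.\<close>

lemma pr_arm: assumes g: "good 0 c (lng s)" and "0 \<le> c" "0 \<le> s"
  shows "pr 0 (arm s) \<le> 1 - c ^ 4"
proof -
  have l: "loc (qbox (3 * s)) (\<lambda>R. circuit s (- R))" by (rule loc_compl[OF loc_circuit[OF assms(3)]])
  have "arm s R ==> \<not> circuit s (- R)" for R using circuit_no_arm assms(3) by blast
  then have "pr 0 (arm s) \<le> pr 0 (\<lambda>R. \<not> circuit s (- R))" by (rule pr_mono[OF loc_not[OF l]])
  also have "\<dots> = 1 - pr 0 (circuit s)" using pr_not[OF l] pr_white[OF loc_circuit[OF assms(3)], of 0] by simp
  finally show ?thesis using good_circuit[OF assms] by (simp add: good_def)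
qed

text \<open>Each inductive step adds an annulus so far out that, by \<open>pr_mixing\<close>, its
  arm event is almost independent of reaching \<open>N\<close>. The arm fails with probability at
  least \<open>q\<close>; half of this pays for the mixing error, which leaves the factor
  \<open>1 - q / 2\<close>.\<close>

theorem pr_reach: assumes "0 \<le> m" "\<epsilon> > 0" shows "\<exists>N\<ge>m. pr 0 (reach m N) \<le> \<epsilon>"
proof -
  obtain c where c: "c > 0" "\<And>N. \<exists>s\<ge>N. good 0 c (lng s)" using rsw by blast
  have c1: "c \<le> 1" using c(2)[of 0] pr_le1 unfolding good_def by (meson order_trans)
  define q where "q = c ^ 4"
  have q: "0 < q" "q \<le> 1" using c c1 by (auto simp: q_def power_le_one)
  have "\<exists>N\<ge>m. pr 0 (reach m N) \<le> (1 - q / 2) ^ n" for n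
  proof (induction n)
    case 0 show ?case using pr_le1 by auto
  next
    case (Suc n)
    then obtain N where N: "m \<le> N" "pr 0 (reach m N) \<le> (1 - q / 2) ^ n" by blast
    let ?V = "qbox N"
    define v where "v = real (card ?V)"
    have v: "0 < v" using N(1) assms(1) by (simp add: v_def card_rect)
    define d where "d = q / 2 * (1 - q / 2) ^ n"
    have d: "0 < d" using q by (simp add: d_def)
    define h where "h = d / (12 * v)"
    have h: "0 < h" using d v by (simp add: h_def)
    \<comment> \<open>The covariance term will be at most \<open>K / s ^ 3\<close>: the annulus has
      at most \<open>49 * s\<^sup>2\<close> vertices, at distance at least \<open>s / 2\<close> from
      the box, whence the factor 32.\<close>
    define K where "K = 2 / h * (v * 49 * (D * 32))"
    have K: "0 < K" using h v D1 by (simp add: K_def)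
    obtain s where s: "max (2 * N + 1) (\<lceil>2 * K / d\<rceil>) \<le> s" and g: "good 0 c (lng s)" using c(2) by blast
    have s1: "2 * N + 1 \<le> s" "2 * K / d \<le> real_of_int s" using s by (auto simp: ceiling_le_iff)
    then have s0: "1 \<le> s" "N \<le> s" using N(1) assms(1) by auto
    have far: "real_of_int s / 2 \<le> real_of_int (nrm (fst u - fst w, snd u - snd w))" if "u \<in> ?V" "w \<in> ann s" for u w
    proof -
      have "nrm u \<le> N" "s \<le> nrm w" using that by (auto simp: nrm_rect ann_def)
      then have "s - N \<le> nrm (fst u - fst w, snd u - snd w)" unfolding nrm_def by auto
      then show ?thesis using s1 by linarith
    qed
    have ca: "real (card (ann s)) \<le> 49 * (real_of_int s)\<^sup>2"
    proof -
      have "card (ann s) \<le> card (qbox (3 * s))" by (rule card_mono) (auto simp: ann_def nrm_rect)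
      then have "real (card (ann s)) \<le> real_of_int (6 * s + 1) * real_of_int (6 * s + 1)"
        using s0 card_rect[of "-(3 * s)" "3 * s" "-(3 * s)" "3 * s"] by (simp; linarith)
      also have "\<dots> \<le> (7 * real_of_int s) * (7 * real_of_int s)" using s0 by (intro mult_mono) auto
      finally show ?thesis by (simp add: power2_eq_square)
    qed
    have "2 / h * (\<Sum>i\<in>?V. \<Sum>j\<in>ann s. S i j) \<le> 2 / h * (v * real (card (ann s)) * (D / (real_of_int s / 2) ^ 5))"
      using h S_sum_far[OF far] s0 unfolding v_def by (intro mult_left_mono) auto
    also have "\<dots> \<le> 2 / h * (v * (49 * (real_of_int s)\<^sup>2) * (D / (real_of_int s / 2) ^ 5))"
      using h v ca D1 s0 by (intro mult_left_mono mult_right_mono) auto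
    also have "\<dots> = K / (real_of_int s) ^ 3" using s0 by (simp add: K_def field_simps power2_eq_square eval_nat_numeral)
    also have "\<dots> \<le> K / real_of_int s"
    proof -
      have "real_of_int s ^ 1 \<le> real_of_int s ^ 3" using s0 by (intro power_increasing) auto
      then show ?thesis using K s0 by (intro divide_left_mono) auto
    qed
    also have "\<dots> \<le> d / 2" using s1(2) s0 d by (simp add: field_simps)
    finally have e1: "2 / h * (\<Sum>i\<in>?V. \<Sum>j\<in>ann s. S i j) \<le> d / 2" .
    have e2: "6 * (real (card ?V) * h) = d / 2" using v by (simp add: h_def v_def[symmetric])
    have "reach m N R \<and> arm s R" if r: "reach m (3 * s) R" for R
    proof -
      obtain x y where xy: "nrm x \<le> m" "nrm y = 3 * s" "conn R x y" by (rule reach_conn[OF r])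
      have "arm s R"
        by (rule conn_arm[OF xy(3), of s]) (use xy s0 N in \<open>auto simp: arm_def\<close>)
      moreover have "reach m N R" by (rule conn_reach[OF xy(3,1)]) (use xy s0 N in auto)
      ultimately show ?thesis by simp
    qed
    then have "pr 0 (reach m (3 * s)) \<le> pr 0 (\<lambda>R. reach m N R \<and> arm s R)"
      by (intro pr_mono[OF loc_conj[OF loc_join[OF loc_reach[of N m] loc_arm[of s]]]])
    also have "\<dots> \<le> pr 0 (reach m N) * pr 0 (arm s) + d / 2 + d / 2"
    proof -
      have "?V \<inter> ann s = {}" using s1 N(1) assms(1) by (auto simp: ann_def simp flip: nrm_rect)
      from pr_mixing[OF loc_reach loc_arm up_reach up_arm this h, of 0 m] e1 e2 show ?thesis by linarith
    qed
    also have "\<dots> \<le> (1 - q / 2) ^ n * (1 - q) + d"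
      using N(2) pr_arm[OF g] c(1) s0 q mult_mono[of "pr 0 (reach m N)" "(1 - q / 2) ^ n" "pr 0 (arm s)" "1 - q"] pr_ge0
      by (simp add: q_def)
    also have "\<dots> = (1 - q / 2) ^ Suc n" by (simp add: d_def algebra_simps)
    finally show ?case using s0 N(1) by (intro exI[of _ "3 * s"]) auto
  qed
  moreover obtain n where "(1 - q / 2) ^ n < \<epsilon>" using real_arch_pow_inv[of \<epsilon> "1 - q / 2"] assms q by auto
  ultimately show ?thesis by (meson less_imp_le order_trans)
qed

end

section \<open>Long crossings above level zero\<close>

context perc begin

text \<open>By \<open>hex\<close> there is a white vertical crossing for \<open>R\<close>, and by
  \<open>no_both\<close> it cannot survive when \<open>i\<close> turns black, so its cluster
  contains \<open>i\<close>. Its ends have heights \<open>- s\<close> and \<open>s\<close>, hence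
  one of them is at distance at least \<open>s\<close> from \<open>i\<close>.\<close>

lemma white_arm:
  fixes V :: "vtx set"
  assumes "i \<in> rect a b (-s) s" "crossH a b (-s) s (insert i R)" "\<not> crossH a b (-s) s R" "1 \<le> s"
  shows "\<exists>y x. adj y i \<and> conn ((rect a b (-s) s - {i}) - R) x y \<and> s \<le> nrm (fst x - fst i, snd x - snd i)"
proof -
  let ?V = "rect a b (-s) s"
  have "a \<le> b" using assms(1) by (auto simp: in_rect)
  then have "crossV a b (-s) s (- R)" using hex[of a b "-s" s R] assms by auto
  then obtain x y where xy: "snd x = -s" "snd y = s" "conn (- R \<inter> ?V) x y" by (auto simp: crossV_def)
  have c: "conn (- R \<inter> ?V) x i"
  proof (rule ccontr)
    assume n: "\<not> conn (- R \<inter> ?V) x i"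
    have "w \<in> - insert i R \<inter> ?V" if "conn (- R \<inter> ?V) x w" for w using conn_in2[OF that] n that by blast
    then have "conn (- insert i R \<inter> ?V) x y" by (intro conn_mono[OF conn_comp[OF xy(3)]]) blast
    then have "crossV a b (-s) s (- insert i R)" using xy unfolding crossV_def by blast
    then show False using no_both assms(2) by blast
  qed
  have key: ?thesis if z: "conn (- R \<inter> ?V) z i" "s \<le> nrm (fst z - fst i, snd z - snd i)" for z
  proof -
    have "z \<in> - {i}" using z(2) assms(4) by (auto simp: nrm_def)
    then obtain y e where e: "conn (- R \<inter> ?V \<inter> - {i}) z y" "adj y e" "e \<notin> - {i}" using conn_exit[OF z(1), of "- {i}"] by blast
    have "- R \<inter> ?V \<inter> - {i} = (?V - {i}) - R" by blast
    moreover have "e = i" using e(3) by blast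
    ultimately show ?thesis using e(1,2) z(2) by metis
  qed
  show ?thesis
  proof (cases "s \<le> nrm (fst x - fst i, snd x - snd i)")
    case True then show ?thesis using key c by blast
  next
    case False
    then have "s \<le> nrm (fst y - fst i, snd y - snd i)" using xy unfolding nrm_def by auto
    then show ?thesis using key conn_trans[OF conn_sym[OF xy(3)] c] by blast
  qed
qed

text \<open>Only even translations preserve the graph, so the arm is recentered at \<open>i\<close>
  or at its right neighbour. A vertex adjacent to \<open>i\<close> then comes within distance 2 of
  the origin, and the other end loses at most one unit, hence \<open>N < s\<close>.\<close>

lemma white_arm_reach:
  assumes "adj y i" "conn B x y" "s \<le> nrm (fst x - fst i, snd x - snd i)" "N < s" "2 \<le> N"
    and e: "e = (fst i + (fst i + snd i) mod 2, snd i)"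
  shows "reach 2 N (tr e -` B)"
proof -
  have ev: "even (fst e + snd e)" unfolding e by (simp; presburger)
  let ?f = "tr (- fst e, - snd e)"
  have c: "conn (tr e -` B) (?f x) (?f y)"
    by (rule conn_map[OF assms(2) adj_tr]) (use ev in auto)
  have m: "0 \<le> (fst i + snd i) mod 2" "(fst i + snd i) mod 2 \<le> 1" by presburger+
  have "nrm (?f y) \<le> 2" using m adj_fst[OF assms(1)] adj_snd[OF assms(1)] unfolding e tr_def nrm_def by auto
  moreover have "N \<le> nrm (?f x)" using m assms(3,4) unfolding e tr_def nrm_def by auto
  ultimately show ?thesis using conn_reach[OF conn_sym[OF c]] assms(5) by blast
qed

text \<open>The bound \<delta> of \<open>sharp_threshold\<close> is uniform over all events, so it
  is fixed before the scale: \<open>N\<close> makes white arms of length \<open>N\<close> at most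
  \<delta> likely, and only then a scale \<open>s > N\<close> with a likely crossing at level 0 is
  chosen.\<close>

theorem supercritical:
  assumes p0: "p0 > 0" and xi: "\<xi> > 0"
  shows "\<exists>s\<ge>N0. 1 - \<xi> \<le> pr p0 (lng s)"
proof -
  obtain c where c: "c > 0" "\<And>N. \<exists>s\<ge>N. good 0 c (lng s)" using rsw by blast
  have K: "16 * D > 0" using D1 by simp
  obtain \<delta> where d: "\<delta> > 0" "\<And>V A W. finite V ==> incr V A ==> (\<And>i R. i \<in> V ==> R \<subseteq> V - {i} ==> A (insert i R) ==> \<not> A R ==> W i R) ==>
      (\<And>i. i \<in> V ==> incr (V - {i}) (\<lambda>R. \<not> W i R)) ==>
      (\<And>i. i \<in> V ==> prob (sev (V - {i}) (\<lambda>_. 0) (W i)) \<le> \<delta>) ==>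
      c \<le> prob (sev V (\<lambda>_. 0) A) ==> 1 - \<xi> \<le> prob (sev V (\<lambda>_. - p0) A)"
    by (rule sharp_threshold[OF S_summable K p0 c(1) xi]) auto
  obtain N where N: "2 \<le> N" "pr 0 (reach 2 N) \<le> \<delta>" using pr_reach[of 2 \<delta>] d(1) by auto
  obtain s where s: "max N0 (N + 1) \<le> s" and g: "good 0 c (lng s)" using c(2) by blast
  let ?V = "rect (-(3 * s)) (3 * s) (-s) s" and ?A = "lng s"
  define W where "W i R \<longleftrightarrow> (\<exists>y x. adj y i \<and> conn ((?V - {i}) - R) x y \<and> s \<le> nrm (fst x - fst i, snd x - snd i))" for i R
  have "1 - \<xi> \<le> prob (sev ?V (\<lambda>_. - p0) ?A)"
  proof (rule d(2)[of ?V ?A W])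
    show "incr ?V ?A" by (rule up_incr[OF up_crossH])
    show "W i R" if "i \<in> ?V" "R \<subseteq> ?V - {i}" "?A (insert i R)" "\<not> ?A R" for i R
      unfolding W_def by (rule white_arm) (use that s N in auto)
    show "incr (?V - {i}) (\<lambda>R. \<not> W i R)" for i unfolding incr_def
    proof (intro allI impI notI)
      fix Q T assume "Q \<subseteq> T" "\<not> W i Q" "W i T"
      then show False unfolding W_def using conn_mono[of "(?V - {i}) - T" _ _ "(?V - {i}) - Q"] by (meson Diff_mono order_refl)
    qed
    show "c \<le> prob (sev ?V (\<lambda>_. 0) ?A)" using g pev_sev[OF loc_crossH, of 0] by (simp add: good_def pr_def)
    fix i :: vtx
    let ?e = "(fst i + (fst i + snd i) mod 2, snd i)"
    have l: "loc (?V - {i}) (W i)"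
    proof -
      have "(?V - {i}) - R = (?V - {i}) - (R \<inter> (?V - {i}))" for R by blast
      then show ?thesis unfolding loc_def W_def by (metis finite_Diff finite_rect)
    qed
    have lr: "loc (tr ?e ` qbox N) (\<lambda>R. reach 2 N (tr ?e -` R))" by (rule loc_vimage[OF loc_reach])
    have "reach 2 N (tr ?e -` (- R))" if "W i R" for R
    proof -
      obtain y x where yx: "adj y i" "conn ((?V - {i}) - R) x y" "s \<le> nrm (fst x - fst i, snd x - snd i)" using \<open>W i R\<close> by (auto simp: W_def)
      have "conn (- R) x y" by (rule conn_mono[OF yx(2)]) blast
      from white_arm_reach[OF yx(1) this yx(3) _ N(1) refl] s show ?thesis by simp
    qed
    then have "pr 0 (W i) \<le> pr 0 (\<lambda>R. reach 2 N (tr ?e -` (- R)))" by (rule pr_mono[OF loc_compl[OF lr]])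
    also have "\<dots> = pr 0 (\<lambda>R. reach 2 N (tr ?e -` R))" using pr_white[OF lr, of 0] by simp
    also have "\<dots> = pr 0 (reach 2 N)" by (rule pr_vimage[OF loc_reach S_tr])
    finally show "prob (sev (?V - {i}) (\<lambda>_. 0) (W i)) \<le> \<delta>" using N(2) pev_sev[OF l, of 0] by (simp add: pr_def)
  qed simp
  then show ?thesis using s pev_sev[OF loc_crossH, of p0] by (auto simp: pr_def)
qed

end

section \<open>Existence and uniqueness of the infinite cluster\<close>

definition inf_cl :: "vtx set => vtx => bool" where
  "inf_cl B v \<longleftrightarrow> (\<forall>N. \<exists>w. conn B v w \<and> N \<le> nrm w)"

text \<open>The horizontal crossings at two consecutive scales both meet the vertical crossing at
  the smaller scale, so all of them lie in one cluster.\<close>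

lemma inf_cl_exists:
  assumes H: "\<And>k. k0 \<le> k ==> lng (s k) B" and V: "\<And>k. k0 \<le> k ==> crossV (- s k) (s k) (-(3 * s k)) (3 * s k) B"
    and s: "\<And>k. s (Suc k) = 3 * s k" "\<And>k. 0 < s k" "\<And>k. int k \<le> s k"
  shows "\<exists>v. inf_cl B v"
proof -
  have "\<forall>k. \<exists>x y. k0 \<le> k --> fst x = -(3 * s k) \<and> fst y = 3 * s k \<and> conn (B \<inter> rect (-(3 * s k)) (3 * s k) (- s k) (s k)) x y"
    using H unfolding crossH_def by blast
  then obtain x y where x: "\<And>k. k0 \<le> k ==> fst (x k) = -(3 * s k) \<and> fst (y k) = 3 * s k \<and> conn (B \<inter> rect (-(3 * s k)) (3 * s k) (- s k) (s k)) (x k) (y k)"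
    by metis
  have step: "conn B (x k) (x (Suc k))" if k: "k0 \<le> k" for k
  proof -
    obtain z w where z: "snd z = -(3 * s k)" "snd w = 3 * s k" "conn (B \<inter> rect (- s k) (s k) (-(3 * s k)) (3 * s k)) z w"
      using V[OF k] unfolding crossV_def by blast
    note m = conn_mono[OF _ Int_lower1]
    have s0: "0 < s k" using s by simp
    note xk = x[OF k] and xk' = x[OF le_SucI[OF k]]
    have "\<exists>v. conn (B \<inter> rect (-(3 * s k)) (3 * s k) (- s k) (s k)) (x k) v \<and> conn (B \<inter> rect (- s k) (s k) (-(3 * s k)) (3 * s k)) z v"
      by (rule cross_meet[OF _ _ _ _ _ z(3), where a="- s k" and b="s k" and c="- s k" and d="s k"]) (use xk z s0 in \<open>auto simp: in_rect\<close>)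
    then have 1: "conn B (x k) z" using m conn_trans conn_sym by meson
    have "\<exists>v. conn (B \<inter> rect (-(3 * s (Suc k))) (3 * s (Suc k)) (- s (Suc k)) (s (Suc k))) (x (Suc k)) v \<and> conn (B \<inter> rect (- s k) (s k) (-(3 * s k)) (3 * s k)) z v"
      by (rule cross_meet[OF _ _ _ _ _ z(3), where a="- s k" and b="s k" and c="-(3 * s k)" and d="3 * s k" and y="y (Suc k)"])
        (use xk' z s0 s(1) in \<open>auto simp: in_rect\<close>)
    then have "conn B (x (Suc k)) z" using m conn_trans conn_sym by meson
    then show ?thesis using 1 conn_trans conn_sym by blast
  qed
  have c: "conn B (x k0) (x (k0 + n))" for n
  proof (induction n)
    case 0
    have "x k0 \<in> B" using x[of k0] conn_in1 by blast
    then show ?case by (simp add: conn_refl)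
  next
    case (Suc n) then show ?case using step[of "k0 + n"] conn_trans by simp
  qed
  have "N \<le> nrm (x (k0 + nat N))" for N
  proof -
    have "int (k0 + nat N) \<le> s (k0 + nat N)" by (rule s)
    then have "N \<le> 3 * s (k0 + nat N)" using s(2)[of "k0 + nat N"] by linarith
    then have "N \<le> \<bar>fst (x (k0 + nat N))\<bar>" using x[of "k0 + nat N"] by simp
    then show ?thesis unfolding nrm_def by simp
  qed
  then show ?thesis using c unfolding inf_cl_def by blast
qed

text \<open>Both clusters cross every large annulus, where \<open>circuit_conn\<close> provides one
  vertex \<open>z\<close> to which each of them is joined.\<close>

lemma inf_cl_unique:
  assumes C: "\<And>k. k0 \<le> k ==> circuit (s k) B" and s: "\<And>k. int k \<le> s k" and v: "inf_cl B v" "inf_cl B w"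
  shows "conn B v w"
proof -
  define k where "k = max k0 (nat (max (nrm v) (nrm w)))"
  have k: "k0 \<le> k" "nrm v \<le> s k" "nrm w \<le> s k" using s[of k] unfolding k_def by auto
  have s0: "0 \<le> s k" using s[of k] by simp
  obtain z where z: "\<And>x y. conn (B \<inter> ann (s k)) x y ==> nrm x = s k ==> nrm y = 3 * s k ==> \<exists>v. conn (B \<inter> ann (s k)) x v \<and> conn (B \<inter> ann (s k)) z v"
    using circuit_conn[OF C[OF k(1)] s0] by metis
  have "conn B u z" if u: "inf_cl B u" "nrm u \<le> s k" for u
  proof -
    obtain t where t: "conn B u t" "3 * s k \<le> nrm t" using u unfolding inf_cl_def by blast
    obtain x y where "nrm x = s k" "nrm y = 3 * s k" "conn B u x" "conn (B \<inter> ann (s k)) x y" by (rule conn_arm[OF t(1) u(2) t(2) s0])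
    then obtain a where "conn B u x" "conn (B \<inter> ann (s k)) x a" "conn (B \<inter> ann (s k)) z a" using z by blast
    then show ?thesis using conn_mono[OF _ Int_lower1] conn_trans conn_sym by meson
  qed
  then show ?thesis using v k conn_trans conn_sym by meson
qed

context perc begin

lemma good_union: assumes "good p (1 - a) E" "good p (1 - b) F" shows "good p (1 - (a + b)) (\<lambda>R. E R \<and> F R)"
proof -
  obtain V W where l: "loc V E" "loc W F" using assms by (auto simp: good_def)
  note lc = loc_conj[OF loc_join[OF l]]
  have "pr p (\<lambda>R. \<not> (E R \<and> F R)) \<le> pr p (\<lambda>R. \<not> E R \<or> \<not> F R)"
    by (rule pr_mono[of "V \<union> W"]) (use loc_not[OF lc] in simp_all)
  also have "\<dots> \<le> pr p (\<lambda>R. \<not> E R) + pr p (\<lambda>R. \<not> F R)" by (rule pr_disj[OF loc_not[OF l(1)] loc_not[OF l(2)]])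
  finally have "1 - (a + b) \<le> pr p (\<lambda>R. E R \<and> F R)" using pr_not[OF lc] pr_not[OF l(1)] pr_not[OF l(2)] assms by (simp add: good_def)
  then show ?thesis using assms up_conj lc unfolding good_def by blast
qed

text \<open>Each extension by \<open>2 * s\<close> adds a translated long crossing and a vertical
  crossing of a square. Both fail with probability at most \<open>w\<close>, hence the coefficient
  \<open>2 * n + 1\<close>.\<close>

lemma long_chain: assumes g: "good p (1 - w) (lng s)" and s: "0 \<le> s"
  shows "good p (1 - (2 * real n + 1) * w) (crossH (-(3 * s)) (3 * s + 2 * s * int n) (-s) s)"
proof (induction n)
  case 0 show ?case using g by simp
next
  case (Suc n)
  let ?t = "2 * s * int n"
  have t: "0 \<le> ?t" using s by simp
  have 2: "good p (1 - w) (crossH (-(3 * s) + (?t + 2 * s)) (3 * s + (?t + 2 * s)) (-s) s)" using good_crossH_tr[OF g, of "?t + 2 * s" 0] by simp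
  have "good p (1 - w) (crossH (-s) s (-s) s)"
  proof (rule good_mono[OF g _ loc_crossH up_crossH])
    fix R assume "lng s R" then show "crossH (-s) s (-s) s R" by (rule crossH_sub) (use s in auto)
  qed
  from good_crossH_tr[OF this, of 0 ?t] have 3: "good p (1 - w) (crossV (-s + ?t) (s + ?t) (-s) s)" by (intro good_crossV) simp
  have e: "3 * s + (?t + 2 * s) = 3 * s + 2 * s * int (Suc n)" by (simp add: algebra_simps)
  have "good p (1 - ((2 * real n + 1) * w + (w + w))) (crossH (-(3 * s)) (3 * s + 2 * s * int (Suc n)) (-s) s)"
  proof (rule good_mono[OF good_union[OF Suc good_union[OF 2 3]] _ loc_crossH up_crossH])
    fix R assume h: "crossH (- (3 * s)) (3 * s + ?t) (- s) s R \<and> crossH (- (3 * s) + (?t + 2 * s)) (3 * s + (?t + 2 * s)) (- s) s R \<and> crossV (- s + ?t) (s + ?t) (- s) s R"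
    show "crossH (-(3 * s)) (3 * s + 2 * s * int (Suc n)) (-s) s R" unfolding e[symmetric]
      by (rule crossH_chain[OF h[THEN conjunct1] h[THEN conjunct2, THEN conjunct1] h[THEN conjunct2, THEN conjunct2]]) (use s t in auto)
  qed
  then show ?case by (simp add: algebra_simps)
qed

lemma pr_decouple:
  assumes l: "loc VA A" "loc VB B" and u: "up A" "up B" and h: "h > 0"
  shows "pr (p + 2 * h) (\<lambda>R. \<not> A R \<and> \<not> B R) \<le> (1 - pr p A) * (1 - pr p B) + 2 / h * (\<Sum>i\<in>VA. \<Sum>j\<in>VB. S i j)"
proof -
  note lj = loc_join[OF l]
  have "sev (VA \<union> VB) c (\<lambda>R. \<not> A R \<and> \<not> B R) = sev (VA \<union> VB) c (\<lambda>R. \<not> A (R \<inter> VA) \<and> \<not> B (R \<inter> VB))" for c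
    using locD(2)[OF l(1)] locD(2)[OF l(2)] by (simp add: sev_def)
  \<comment> \<open>The thresholds \<open>- p - 2 * h\<close> and \<open>- p\<close> are
    \<open>a - h\<close> and \<open>a + h\<close> for \<open>a = - p - h\<close>.\<close>
  then have "pr (p + 2 * h) (\<lambda>R. \<not> A R \<and> \<not> B R) = prob (sev (VA \<union> VB) (\<lambda>_. (-p - h) - h) (\<lambda>R. \<not> A (R \<inter> VA) \<and> \<not> B (R \<inter> VB)))"
    unfolding pr_def pev_sev[OF loc_conj[OF loc_not[OF lj(1)] loc_not[OF lj(2)]]] by (simp add: algebra_simps)
  also have "\<dots> \<le> prob (sev VA (\<lambda>_. (-p - h) + h) (\<lambda>R. \<not> A R)) * prob (sev VB (\<lambda>_. (-p - h) + h) (\<lambda>R. \<not> B R)) + 2 / h * (\<Sum>i\<in>VA. \<Sum>j\<in>VB. S i j)"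
    by (rule sprinkled_decoupling[OF locD(1)[OF l(1)] locD(1)[OF l(2)] up_incr[OF u(1)] up_incr[OF u(2)] h])
  also have "prob (sev VA (\<lambda>_. (-p - h) + h) (\<lambda>R. \<not> A R)) = 1 - pr p A"
    using pr_not[OF l(1), of p] pev_sev[OF loc_not[OF l(1)], of p] by (simp add: pr_def)
  also have "prob (sev VB (\<lambda>_. (-p - h) + h) (\<lambda>R. \<not> B R)) = 1 - pr p B"
    using pr_not[OF l(2), of p] pev_sev[OF loc_not[OF l(2)], of p] by (simp add: pr_def)
  finally show ?thesis .
qed

text \<open>The rectangle of scale \<open>3 * s\<close> contains two strips of height
  \<open>2 * s\<close>, at distance \<open>2 * s\<close>, that run along its whole length
  \<open>18 * s\<close>. Six extensions of a crossing of length \<open>6 * s\<close> cross a strip,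
  with failure probability at most 13 times that at scale \<open>s\<close>. If the large rectangle
  is not crossed, both strips fail, whence the square.\<close>

lemma renormalization:
  assumes s: "1 \<le> s" and h: "h > 0"
  shows "1 - pr (p + 2 * h) (lng (3 * s)) \<le> (14 * (1 - pr p (lng s)))\<^sup>2 + 204 * D / (h * real_of_int s)"
proof -
  define w where "w = 1 - pr p (lng s)"
  have w: "0 \<le> w" using pr_le1 by (simp add: w_def)
  have "good p (1 - w) (lng s)" unfolding w_def good_def using up_crossH loc_crossH by simp blast
  from long_chain[OF this, of 6] s have "good p (1 - 13 * w) (crossH (-(3 * s)) (15 * s) (-s) s)" by simp
  from good_crossH_tr[OF this, of "-6 * s" "2 * s"] good_crossH_tr[OF this, of "-6 * s" "-2 * s"]
  have g: "good p (1 - 13 * w) (crossH (-9 * s) (9 * s) s (3 * s))" "good p (1 - 13 * w) (crossH (-9 * s) (9 * s) (-3 * s) (-s))" by simp_all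
  let ?A = "rect (-9 * s) (9 * s) s (3 * s)" and ?B = "rect (-9 * s) (9 * s) (-3 * s) (-s)"
  have far: "2 * real_of_int s \<le> real_of_int (nrm (fst u - fst v, snd u - snd v))" if "u \<in> ?A" "v \<in> ?B" for u v
  proof -
    have "2 * s \<le> nrm (fst u - fst v, snd u - snd v)" using that unfolding nrm_def in_rect by auto
    then show ?thesis by linarith
  qed
  have c: "real (card ?A) \<le> 57 * (real_of_int s)\<^sup>2" "real (card ?B) \<le> 57 * (real_of_int s)\<^sup>2"
  proof -
    have "(18 * real_of_int s + 1) * (2 * real_of_int s + 1) \<le> (19 * real_of_int s) * (3 * real_of_int s)" using s by (intro mult_mono) auto
    then show "real (card ?A) \<le> 57 * (real_of_int s)\<^sup>2" "real (card ?B) \<le> 57 * (real_of_int s)\<^sup>2" using s by (simp_all add: card_rect power2_eq_square)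
  qed
  have "2 / h * (\<Sum>i\<in>?A. \<Sum>j\<in>?B. S i j) \<le> 2 / h * (real (card ?A) * real (card ?B) * (D / (2 * real_of_int s) ^ 5))"
    using h s by (intro mult_left_mono S_sum_far[OF far]) auto
  also have "\<dots> \<le> 2 / h * ((57 * (real_of_int s)\<^sup>2) * (57 * (real_of_int s)\<^sup>2) * (D / (2 * real_of_int s) ^ 5))"
    using h s c D1 by (intro mult_left_mono mult_right_mono mult_mono) auto
  \<comment> \<open>Here 3249 is the square of 57, and 1/16 is 2 divided by the fifth power of 2
    that comes from the distance \<open>2 * s\<close>.\<close>
  also have "\<dots> = (3249 / 16) * D / (h * real_of_int s)" using h s by (simp add: field_simps power2_eq_square eval_nat_numeral)
  also have "\<dots> \<le> 204 * D / (h * real_of_int s)" using h s D1 by (intro divide_right_mono mult_right_mono) auto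
  finally have e: "2 / h * (\<Sum>i\<in>?A. \<Sum>j\<in>?B. S i j) \<le> 204 * D / (h * real_of_int s)" .
  note lA = loc_crossH[of "-9 * s" "9 * s" s "3 * s"] and lB = loc_crossH[of "-9 * s" "9 * s" "-3 * s" "-s"]
  have "1 - pr (p + 2 * h) (lng (3 * s)) = pr (p + 2 * h) (\<lambda>R. \<not> lng (3 * s) R)" using pr_not[OF loc_crossH] by simp
  also have "\<dots> \<le> pr (p + 2 * h) (\<lambda>R. \<not> crossH (-9 * s) (9 * s) s (3 * s) R \<and> \<not> crossH (-9 * s) (9 * s) (-3 * s) (-s) R)"
  proof (rule pr_mono[OF loc_conj[OF loc_join[OF loc_not[OF lA] loc_not[OF lB]]]])
    fix R assume n: "\<not> lng (3 * s) R"
    have "crossH (-9 * s) (9 * s) a b R ==> -(3 * s) \<le> a ==> b \<le> 3 * s ==> lng (3 * s) R" for a b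
      by (erule crossH_sub) (use s in auto)
    then show "\<not> crossH (-9 * s) (9 * s) s (3 * s) R \<and> \<not> crossH (-9 * s) (9 * s) (-3 * s) (-s) R" using n s by force
  qed
  also have "\<dots> \<le> (1 - pr p (crossH (-9 * s) (9 * s) s (3 * s))) * (1 - pr p (crossH (-9 * s) (9 * s) (-3 * s) (-s))) + 2 / h * (\<Sum>i\<in>?A. \<Sum>j\<in>?B. S i j)"
    by (rule pr_decouple[OF lA lB up_crossH up_crossH h])
  also have "\<dots> \<le> (14 * w) * (14 * w) + 204 * D / (h * real_of_int s)"
    using g w pr_le1 unfolding good_def by (intro add_mono e mult_mono) auto
  finally show ?thesis by (simp add: w_def power2_eq_square)
qed

text \<open>The levels increase from \<open>p / 2\<close> towards \<open>p\<close> with increments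
  that halve, while the scales triple, so the decoupling error decays like
  \<open>(2/3) ^ k\<close>.\<close>

lemma fast_decay:
  assumes p: "p > 0"
  obtains s0 where "1 \<le> s0" "\<And>k. good p (1 - (2/3) ^ k) (lng (3 ^ k * s0))"
proof -
  \<comment> \<open>The solution of \<open>(14 * \<xi>)\<^sup>2 = \<xi> / 3\<close>: in each step
    the squared term and the decoupling error contribute one third of \<xi> each, which gives the
    factor 2/3.\<close>
  define \<xi> :: real where "\<xi> = 1 / 588"
  define E where "E = 204 * D * 8 / p"
  have E: "0 < E" using D1 p by (simp add: E_def)
  obtain s0 where s0: "max 1 \<lceil>3 * E / \<xi>\<rceil> \<le> s0" "1 - \<xi> \<le> pr (p / 2) (lng s0)"
    using supercritical[of "p / 2" \<xi> "max 1 \<lceil>3 * E / \<xi>\<rceil>"] p by (auto simp: \<xi>_def)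
  have s1: "1 \<le> s0" "3 * E / \<xi> \<le> real_of_int s0" using s0(1) by (auto simp: ceiling_le_iff)
  then have s2: "E / real_of_int s0 \<le> \<xi> / 3" using E by (simp add: \<xi>_def field_simps)
  define P where "P k = p - (p / 2) / 2 ^ k" for k :: nat
  have u: "1 - pr (P k) (lng (3 ^ k * s0)) \<le> \<xi> * (2/3) ^ k" for k
  proof (induction k)
    case 0 show ?case using s0(2) by (simp add: P_def)
  next
    case (Suc k)
    define h where "h = (p / 8) / 2 ^ k"
    have h: "h > 0" using p by (simp add: h_def)
    have s3: "1 \<le> 3 ^ k * s0" using s1 mult_mono[of 1 "3 ^ k" 1 s0] by simp
    have PS: "P (Suc k) = P k + 2 * h" by (simp add: P_def h_def field_simps)
    have "1 - pr (P (Suc k)) (lng (3 ^ Suc k * s0)) \<le> (14 * (1 - pr (P k) (lng (3 ^ k * s0))))\<^sup>2 + 204 * D / (h * real_of_int (3 ^ k * s0))"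
      using renormalization[OF s3 h, of "P k"] unfolding PS by (simp add: mult.assoc)
    also have "\<dots> \<le> (14 * (\<xi> * (2/3) ^ k))\<^sup>2 + 204 * D / (h * real_of_int (3 ^ k * s0))"
      using Suc pr_le1 by (intro add_right_mono power_mono mult_left_mono) auto
    also have "204 * D / (h * real_of_int (3 ^ k * s0)) = E / real_of_int s0 * (2/3) ^ k"
      using p s1 by (simp add: h_def E_def field_simps power_divide)
    also have "(14 * (\<xi> * (2/3) ^ k))\<^sup>2 \<le> \<xi> / 3 * (2/3) ^ k"
    proof -
      have "(14 * (\<xi> * (2/3) ^ k))\<^sup>2 = \<xi> / 3 * ((2/3) ^ k * (2/3) ^ k)" by (simp add: \<xi>_def power2_eq_square)
      also have "\<dots> \<le> \<xi> / 3 * ((2/3) ^ k * 1)" by (intro mult_left_mono power_le_one) (auto simp: \<xi>_def)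
      finally show ?thesis by simp
    qed
    also have "\<xi> / 3 * (2/3) ^ k + E / real_of_int s0 * (2/3) ^ k \<le> \<xi> / 3 * (2/3) ^ k + \<xi> / 3 * (2/3) ^ k"
      using s2 by (intro add_left_mono mult_right_mono) auto
    finally show ?case by simp
  qed
  show ?thesis
  proof (rule that[OF s1(1)])
    fix k
    have "pr (P k) (lng (3 ^ k * s0)) \<le> pr p (lng (3 ^ k * s0))" by (rule pr_mono_level[OF _ loc_crossH up_crossH]) (use p in \<open>simp add: P_def\<close>)
    moreover have "\<xi> * (2/3) ^ k \<le> 1 * (2/3) ^ k" by (intro mult_right_mono) (auto simp: \<xi>_def)
    ultimately have "1 - (2/3) ^ k \<le> pr p (lng (3 ^ k * s0))" using u[of k] by linarith
    then show "good p (1 - (2/3) ^ k) (lng (3 ^ k * s0))" unfolding good_def using up_crossH loc_crossH by blast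
  qed
qed

theorem unique_infinite_cluster:
  assumes p: "p > 0"
  shows "AE \<omega> in M. (\<exists>v. inf_cl (blk p \<omega>) v) \<and> (\<forall>v w. inf_cl (blk p \<omega>) v --> inf_cl (blk p \<omega>) w --> conn (blk p \<omega>) v w)"
proof -
  obtain s0 where s0: "1 \<le> s0" "\<And>k. good p (1 - (2/3) ^ k) (lng (3 ^ k * s0))" using fast_decay[OF p] by metis
  define s where "s k = 3 ^ k * s0" for k :: nat
  have s: "s (Suc k) = 3 * s k" "0 < s k" "int k \<le> s k" for k
  proof -
    show "s (Suc k) = 3 * s k" by (simp add: s_def)
    show "0 < s k" using s0 by (simp add: s_def)
    have "k \<le> 3 ^ k" by (rule less_imp_le[OF power_gt_expt]) simp
    then have "int k \<le> 3 ^ k" by (metis of_nat_le_iff of_nat_numeral of_nat_power)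
    also have "\<dots> \<le> s k" using s0 by (simp add: s_def)
    finally show "int k \<le> s k" .
  qed
  \<comment> \<open>The first two crossings are those of \<open>inf_cl_exists\<close>, the other
    four form a circuit.\<close>
  define G where "G k R \<longleftrightarrow> lng (s k) R \<and> crossV (- s k) (s k) (-(3 * s k)) (3 * s k) R \<and> crossH (-(3 * s k)) (3 * s k) (s k) (3 * s k) R \<and>
    crossH (-(3 * s k)) (3 * s k) (-(3 * s k)) (- s k) R \<and> crossV (s k) (3 * s k) (-(3 * s k)) (3 * s k) R \<and> crossV (-(3 * s k)) (- s k) (-(3 * s k)) (3 * s k) R" for k R
  have g: "good p (1 - (2/3) ^ k) (lng (s k))" for k unfolding s_def by (rule s0(2))
  have "good p (1 - ((2/3) ^ k + ((2/3) ^ k + ((2/3) ^ k + ((2/3) ^ k + ((2/3) ^ k + (2/3) ^ k)))))) (G k)" for k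
  proof -
    have 1: "good p (1 - (2/3) ^ k) (crossH (-(3 * s k)) (3 * s k) (s k) (3 * s k))" using good_crossH_tr[OF g, of 0 "2 * s k" k] by simp
    have 2: "good p (1 - (2/3) ^ k) (crossH (-(3 * s k)) (3 * s k) (-(3 * s k)) (- s k))" using good_crossH_tr[OF g, of 0 "- (2 * s k)" k] by simp
    show ?thesis unfolding G_def[abs_def] by (rule good_union[OF g good_union[OF good_crossV[OF g] good_union[OF 1 good_union[OF 2 good_union[OF good_crossV[OF 1] good_crossV[OF 2]]]]]])
  qed
  then have G: "good p (1 - 6 * (2/3) ^ k) (G k)" for k by (simp add: algebra_simps)
  have m: "pev p (\<lambda>R. \<not> G k R) \<in> sets M" and pk: "prob (pev p (\<lambda>R. \<not> G k R)) \<le> 6 * (2/3) ^ k" for k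
  proof -
    obtain V where "loc V (G k)" using G by (auto simp: good_def)
    then show "pev p (\<lambda>R. \<not> G k R) \<in> sets M" "prob (pev p (\<lambda>R. \<not> G k R)) \<le> 6 * (2/3) ^ k"
      using pev_meas[OF loc_not] pr_not[of V "G k" p] G[of k] by (auto simp: good_def pr_def)
  qed
  have "summable (\<lambda>k. 6 * (2/3::real) ^ k)" by (intro summable_mult summable_geometric) simp
  then have "summable (\<lambda>k. prob (pev p (\<lambda>R. \<not> G k R)))" by (rule summable_comparison_test'[where N=0]) (use pk in simp)
  then have "AE \<omega> in M. eventually (\<lambda>k. \<omega> \<in> space M - pev p (\<lambda>R. \<not> G k R)) sequentially"
    by (rule borel_cantelli_AE1[OF m, rotated]) (simp add: emeasure_eq_measure)
  then show ?thesis
  proof eventually_elim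
    fix \<omega> assume "eventually (\<lambda>k. \<omega> \<in> space M - pev p (\<lambda>R. \<not> G k R)) sequentially"
    then obtain k0 where k0: "\<And>k. k0 \<le> k ==> G k (blk p \<omega>)" unfolding eventually_sequentially pev_def by blast
    have "\<exists>v. inf_cl (blk p \<omega>) v" by (rule inf_cl_exists[OF _ _ s]) (use k0 in \<open>auto simp: G_def\<close>)
    moreover have "circuit (s k) (blk p \<omega>)" if "k0 \<le> k" for k using k0[OF that] by (simp add: G_def circuit_def)
    ultimately show "(\<exists>v. inf_cl (blk p \<omega>) v) \<and> (\<forall>v w. inf_cl (blk p \<omega>) v --> inf_cl (blk p \<omega>) w --> conn (blk p \<omega>) v w)"
      using inf_cl_unique[of k0 s "blk p \<omega>"] s(3) by blast
  qed
qed

text \<open>An infinite cluster through a vertex of norm at most \<open>m\<close> joins the box of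
  radius \<open>m\<close> to every larger distance. By \<open>pr_reach\<close> this is arbitrarily
  unlikely at level 0, hence at lower levels.\<close>

theorem no_infinite_cluster:
  assumes p: "p \<le> 0"
  shows "AE \<omega> in M. \<forall>v. \<not> inf_cl (blk p \<omega>) v"
proof -
  have "AE \<omega> in M. \<not> (\<forall>N\<ge>int m. reach (int m) N (blk p \<omega>))" for m
  proof -
    let ?F = "{\<omega> \<in> space M. \<forall>N\<ge>int m. reach (int m) N (blk p \<omega>)}"
    have "?F = (\<Inter>N\<in>{int m..}. pev p (reach (int m) N))" by (auto simp: pev_def)
    moreover have "(\<Inter>N\<in>{int m..}. pev p (reach (int m) N)) \<in> sets M"
    proof (rule sets.countable_INT')
      show "(\<lambda>N. pev p (reach (int m) N)) ` {int m..} \<subseteq> sets M" using pev_meas[OF loc_reach] by blast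
    qed auto
    ultimately have F: "?F \<in> sets M" by simp
    have "prob ?F \<le> \<epsilon>" if e: "\<epsilon> > 0" for \<epsilon>
    proof -
      obtain N where N: "int m \<le> N" "pr 0 (reach (int m) N) \<le> \<epsilon>" using pr_reach[of "int m" \<epsilon>] e by auto
      have "prob ?F \<le> pr p (reach (int m) N)" unfolding pr_def
        by (rule finite_measure_mono[OF _ pev_meas[OF loc_reach]]) (use N in \<open>auto simp: pev_def\<close>)
      also have "\<dots> \<le> pr 0 (reach (int m) N)" by (rule pr_mono_level[OF p loc_reach up_reach])
      finally show ?thesis using N by simp
    qed
    then have "prob ?F \<le> 0" by (rule field_le_epsilon) simp
    then have "prob ?F = 0" using measure_nonneg[of M ?F] by linarith
    then show ?thesis using F by (intro AE_I[of _ _ ?F]) (auto simp: emeasure_eq_measure)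
  qed
  then have "AE \<omega> in M. \<forall>m. \<not> (\<forall>N\<ge>int m. reach (int m) N (blk p \<omega>))" by (simp add: AE_all_countable)
  then show ?thesis
  proof eventually_elim
    fix \<omega> assume a: "\<forall>m. \<not> (\<forall>N\<ge>int m. reach (int m) N (blk p \<omega>))"
    show "\<forall>v. \<not> inf_cl (blk p \<omega>) v"
    proof (intro allI notI)
      fix v assume v: "inf_cl (blk p \<omega>) v"
      have n: "nrm v \<le> int (nat (nrm v))" by simp
      have "reach (int (nat (nrm v))) N (blk p \<omega>)" if "int (nat (nrm v)) \<le> N" for N
        using v conn_reach[OF _ n that] unfolding inf_cl_def by blast
      then show False using a by blast
    qed
  qed
qed

end

section \<open>From the lattice to the plane\<close>

lemma real2_eq_iff: "x = y \<longleftrightarrow> x $ 1 = y $ 1 \<and> x $ 2 = y $ 2" for x y :: "real^2"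
  by (simp add: Finite_Cartesian_Product.vec_eq_iff forall_2)

text \<open>A rotation by 45 degrees combined with a scaling by \<open>\<epsilon> / sqrt 2\<close>:
  the diagonal steps (1,-1) and (1,1) become the steps of length \<epsilon> along the axes.\<close>

definition lat_map :: "real => real^2 => real^2" where
  "lat_map \<epsilon> z = \<epsilon> *\<^sub>R vector [(z $ 1 - z $ 2) / 2, (z $ 1 + z $ 2) / 2]"

definition pos :: "real => vtx => real^2" where "pos \<epsilon> v = lat_map \<epsilon> (ptv v)"

lemma lat_map_nth [simp]: "lat_map \<epsilon> z $ 1 = \<epsilon> * (z $ 1 - z $ 2) / 2" "lat_map \<epsilon> z $ 2 = \<epsilon> * (z $ 1 + z $ 2) / 2"
  by (simp_all add: lat_map_def)

lemma linear_lat_map: "linear (lat_map \<epsilon>)"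
  by (rule linearI) (simp_all add: real2_eq_iff field_simps)

lemma inj_lat_map: assumes "\<epsilon> > 0" shows "inj (lat_map \<epsilon>)"
proof (rule injI)
  fix x y assume "lat_map \<epsilon> x = lat_map \<epsilon> y"
  then have "lat_map \<epsilon> x $ 1 = lat_map \<epsilon> y $ 1" "lat_map \<epsilon> x $ 2 = lat_map \<epsilon> y $ 2" by simp_all
  then have "x $ 1 - x $ 2 = y $ 1 - y $ 2" "x $ 1 + x $ 2 = y $ 1 + y $ 2" using assms by simp_all
  then have "x $ 1 = y $ 1" "x $ 2 = y $ 2" by linarith+
  then show "x = y" by (simp add: real2_eq_iff)
qed

lemma pos_nth: "pos \<epsilon> v $ 1 = \<epsilon> * (real_of_int (fst v) - real_of_int (snd v)) / 2"
  "pos \<epsilon> v $ 2 = \<epsilon> * (real_of_int (fst v) + real_of_int (snd v)) / 2"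
  by (simp_all add: pos_def)

lemma inj_pos: assumes "\<epsilon> > 0" shows "inj (pos \<epsilon>)"
  unfolding pos_def by (rule injI) (metis inj_lat_map[OF assms] injD ptv_inj)

lemma norm_pos_diff: assumes "\<epsilon> > 0" shows "\<epsilon> * real_of_int (nrm (fst v - fst w, snd v - snd w)) / 2 \<le> norm (pos \<epsilon> v - pos \<epsilon> w)"
proof -
  let ?x = "pos \<epsilon> v - pos \<epsilon> w"
  have c: "\<bar>?x $ 1\<bar> \<le> norm ?x" "\<bar>?x $ 2\<bar> \<le> norm ?x" by (rule component_le_norm_cart)+
  have "?x $ 1 + ?x $ 2 = \<epsilon> * real_of_int (fst v - fst w)" "?x $ 2 - ?x $ 1 = \<epsilon> * real_of_int (snd v - snd w)"
    by (simp_all add: pos_nth field_simps)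
  then have "\<bar>\<epsilon> * real_of_int (fst v - fst w)\<bar> \<le> 2 * norm ?x" "\<bar>\<epsilon> * real_of_int (snd v - snd w)\<bar> \<le> 2 * norm ?x" using c by linarith+
  then have "\<epsilon> * \<bar>real_of_int (fst v - fst w)\<bar> \<le> 2 * norm ?x" "\<epsilon> * \<bar>real_of_int (snd v - snd w)\<bar> \<le> 2 * norm ?x"
    using assms by (simp_all add: abs_mult)
  then show ?thesis unfolding nrm_def by (cases "\<bar>fst v - fst w\<bar> \<le> \<bar>snd v - snd w\<bar>") (auto simp: max_def)
qed

lemma norm_pos: assumes "\<epsilon> > 0" shows "\<epsilon> * real_of_int (nrm v) / 2 \<le> norm (pos \<epsilon> v)"
proof -
  have "pos \<epsilon> (0, 0) = 0" by (simp add: real2_eq_iff pos_nth)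
  then show ?thesis using norm_pos_diff[OF assms, of v "(0, 0)"] by simp
qed

lemma pos_even: assumes "even (fst v + snd v)"
  shows "\<exists>a b. pos 1 v = vector [real_of_int a, real_of_int b] \<and> fst v = a + b \<and> snd v = b - a"
proof -
  obtain b where b: "fst v + snd v = 2 * b" using assms by (rule evenE)
  have w: "snd v = 2 * b - fst v" using b by simp
  show ?thesis by (intro exI[of _ "fst v - b"] exI[of _ b]) (simp add: w real2_eq_iff pos_nth field_simps)
qed

lemma dist_vector2: "dist (vector [a, b] :: real^2) (vector [c, d]) = sqrt ((a - c)\<^sup>2 + (b - d)\<^sup>2)"
  unfolding dist_norm norm_vec_def L2_set_def by (simp add: sum_2)

lemma pos_ab: "pos 1 (a + b, b - a) = vector [real_of_int a, real_of_int b]"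
  and pos_ab1: "pos 1 (a + b + 1, b - a) = vector [real_of_int a, real_of_int b] + vector [1/2, 1/2]"
  by (simp_all add: real2_eq_iff pos_nth field_simps)

lemma integer_points_ab: assumes "x \<in> integer_points" obtains a b :: int where "x = vector [real_of_int a, real_of_int b]"
proof -
  obtain a b :: int where "x $ 1 = real_of_int a" "x $ 2 = real_of_int b" using assms by (auto simp: integer_points_def elim!: Ints_cases)
  then have "x = vector [real_of_int a, real_of_int b]" by (simp add: real2_eq_iff)
  then show ?thesis by (rule that)
qed

lemma ab_integer_points: "vector [real_of_int a, real_of_int b] \<in> integer_points" by (simp add: integer_points_def)

lemma lattice_vertices_pos: "lattice_vertices = range (pos 1)"
proof (intro equalityI subsetI)
  fix x assume "x \<in> lattice_vertices"
  then obtain z where z: "z \<in> integer_points" "x = z \<or> x = z + vector [1/2, 1/2]" unfolding lattice_vertices_def by blast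
  obtain a b where "z = vector [real_of_int a, real_of_int b]" by (rule integer_points_ab[OF z(1)])
  then have "x = pos 1 (a + b, b - a) \<or> x = pos 1 (a + b + 1, b - a)" using z(2) by (simp only: pos_ab pos_ab1)
  then show "x \<in> range (pos 1)" by blast
next
  fix x assume "x \<in> range (pos 1)"
  then obtain u w where x: "x = pos 1 (u, w)" by auto
  show "x \<in> lattice_vertices"
  proof (cases "even (u + w)")
    case True
    then show ?thesis using pos_even[of "(u, w)"] ab_integer_points x unfolding lattice_vertices_def by fastforce
  next
    case False
    then have "even (u - 1 + w)" by simp
    then obtain b where "u - 1 + w = 2 * b" by (rule evenE)
    then have e: "u = (u - 1 - b) + b + 1" "w = b - (u - 1 - b)" by simp_all
    have "x = vector [real_of_int (u - 1 - b), real_of_int b] + vector [1/2, 1/2]" unfolding x using pos_ab1[of "u - 1 - b" b] e by metis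
    then show ?thesis using ab_integer_points unfolding lattice_vertices_def by blast
  qed
qed

lemma edge_adj: assumes "(x, y) \<in> lattice_edges" obtains a b where "adj a b" "x = pos 1 a" "y = pos 1 b"
proof -
  consider "x \<in> integer_points" "y \<in> integer_points" "dist x y = 1"
    | z w where "z \<in> integer_points" "x = z + vector [1/2, 1/2]" "y = z + w" "w \<in> {vector [0, 0], vector [1, 0], vector [0, 1], vector [1, 1]}"
    using assms by (auto simp: lattice_edges_def)
  then show ?thesis
  proof cases
    case 1
    obtain a b c d where xy: "x = vector [real_of_int a, real_of_int b]" "y = vector [real_of_int c, real_of_int d]"
      using 1 by (metis integer_points_ab)
    have "real_of_int ((a - c)\<^sup>2 + (b - d)\<^sup>2) = real_of_int 1" using 1(3) unfolding xy dist_vector2 by simp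
    then have e: "(a - c)\<^sup>2 + (b - d)\<^sup>2 = 1" by (simp only: of_int_eq_iff)
    have "(a - c)\<^sup>2 \<le> 1" "(b - d)\<^sup>2 \<le> 1" using e zero_le_power2[of "a - c"] zero_le_power2[of "b - d"] by linarith+
    then have r: "\<bar>a - c\<bar> \<le> 1" "\<bar>b - d\<bar> \<le> 1" by (simp_all add: abs_square_le_1)
    have "a = c \<or> b = d"
    proof (rule ccontr)
      assume "\<not> ?thesis"
      then have "0 < (a - c)\<^sup>2" "0 < (b - d)\<^sup>2" by simp_all
      then show False using e by linarith
    qed
    moreover have "\<not> (a = c \<and> b = d)" using e by auto
    ultimately have "adj (a + b, b - a) (c + d, d - c)" using r unfolding adj_def by auto
    then show ?thesis by (rule that) (simp_all add: pos_ab xy)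
  next
    case 2
    obtain a b where z: "z = vector [real_of_int a, real_of_int b]" using 2 by (metis integer_points_ab)
    have x: "x = pos 1 (a + b + 1, b - a)" using 2 z by (simp add: pos_ab1)
    from 2(4) consider "y = pos 1 (a + b, b - a)" | "y = pos 1 (a + b + 1, b - a - 1)" | "y = pos 1 (a + b + 1, b - a + 1)" | "y = pos 1 (a + b + 2, b - a)"
      unfolding 2(3) z by (auto simp: real2_eq_iff pos_nth field_simps)
    then show ?thesis by cases (rule that[OF _ x]; simp add: adj_def)+
  qed
qed

lemma adj_edge: assumes "adj a b" shows "(pos 1 a, pos 1 b) \<in> lattice_edges \<or> (pos 1 b, pos 1 a) \<in> lattice_edges"
proof -
  have odd: "(pos 1 a, pos 1 b) \<in> lattice_edges" if ab: "adj a b" "odd (fst a + snd a)" for a b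
  proof -
    obtain k where k: "fst a + snd a = 2 * k + 1" using ab(2) by (rule oddE)
    define z where "z = (vector [real_of_int (fst a - 1 - k), real_of_int k] :: real^2)"
    have A: "\<bar>fst a - fst b\<bar> \<le> 1" "\<bar>snd a - snd b\<bar> \<le> 1" "fst a = fst b \<or> snd a = snd b" "a \<noteq> b" using ab by (auto simp: adj_def)
    have s: "snd a = 2 * k + 1 - fst a" using k by simp
    have 1: "pos 1 a = z + vector [1/2, 1/2]" by (simp add: z_def real2_eq_iff pos_nth s field_simps)
    have "fst b = fst a - 1 \<and> snd b = snd a \<or> fst b = fst a + 1 \<and> snd b = snd a \<or> fst b = fst a \<and> snd b = snd a - 1 \<or> fst b = fst a \<and> snd b = snd a + 1"
      using A(1-3) A(4)[unfolded prod_eq_iff] by presburger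
    then consider "fst b = fst a - 1" "snd b = snd a" | "fst b = fst a + 1" "snd b = snd a" | "fst b = fst a" "snd b = snd a - 1" | "fst b = fst a" "snd b = snd a + 1"
      by blast
    then have "pos 1 b - z \<in> {vector [0, 0], vector [1, 0], vector [0, 1], vector [1, 1]}"
      by cases (simp_all add: z_def real2_eq_iff pos_nth s field_simps)
    then have "\<exists>w. pos 1 b = z + w \<and> w \<in> {vector [0, 0], vector [1, 0], vector [0, 1], vector [1, 1]}" by (intro exI[of _ "pos 1 b - z"]) simp
    moreover have "z \<in> integer_points" unfolding z_def by (rule ab_integer_points)
    ultimately show ?thesis unfolding lattice_edges_def 1 by blast
  qed
  show ?thesis
  proof (cases "odd (fst a + snd a) \<or> odd (fst b + snd b)")
    case True then show ?thesis using odd[OF assms] odd[OF adj_sym[OF assms]] by blast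
  next
    case False
    obtain x y where x: "pos 1 a = vector [real_of_int x, real_of_int y]" "fst a = x + y" "snd a = y - x" using False pos_even by blast
    obtain x' y' where y: "pos 1 b = vector [real_of_int x', real_of_int y']" "fst b = x' + y'" "snd b = y' - x'" using False pos_even by blast
    have A: "\<bar>x + y - (x' + y')\<bar> \<le> 1" "\<bar>y - x - (y' - x')\<bar> \<le> 1" "\<not> (x = x' \<and> y = y')"
      using assms unfolding adj_def prod_eq_iff x(2,3) y(2,3) by auto
    have "x' = x \<and> y' = y + 1 \<or> x' = x \<and> y' = y - 1 \<or> x' = x + 1 \<and> y' = y \<or> x' = x - 1 \<and> y' = y"
      using A by presburger
    then consider "x' = x" "y' = y + 1" | "x' = x" "y' = y - 1" | "x' = x + 1" "y' = y" | "x' = x - 1" "y' = y" by blast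
    then have "dist (pos 1 a) (pos 1 b) = 1" unfolding x(1) y(1) dist_vector2 by cases simp_all
    moreover have "pos 1 a \<in> integer_points" "pos 1 b \<in> integer_points" unfolding x(1) y(1) by (rule ab_integer_points)+
    ultimately show ?thesis unfolding lattice_edges_def by blast
  qed
qed

lemma pos_scale: "\<epsilon> *\<^sub>R pos 1 v = pos \<epsilon> v" by (simp add: real2_eq_iff pos_nth)

lemma pos_scaled_vertices: "pos \<epsilon> v \<in> scaled_vertices \<epsilon>"
  unfolding scaled_vertices_def lattice_vertices_pos by (rule image_eqI[of _ _ "pos 1 v"]) (simp_all add: pos_scale)

lemma pos_scaled_edges: "(pos 1 a, pos 1 b) \<in> lattice_edges ==> (pos \<epsilon> a, pos \<epsilon> b) \<in> scaled_edges \<epsilon>"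
  unfolding scaled_edges_def by (rule image_eqI[of _ _ "(pos 1 a, pos 1 b)"]) (simp_all add: pos_scale)

section \<open>The planar set carried by a set of vertices and its components\<close>

definition body :: "real => vtx set => (real^2) set" where
  "body \<epsilon> B = {x. \<exists>a b. a \<in> B \<and> b \<in> B \<and> (a = b \<or> adj a b) \<and> x \<in> closed_segment (pos \<epsilon> a) (pos \<epsilon> b)}"

lemma bodyI: "a \<in> B ==> b \<in> B ==> a = b \<or> adj a b ==> x \<in> closed_segment (pos \<epsilon> a) (pos \<epsilon> b) ==> x \<in> body \<epsilon> B"
  unfolding body_def mem_Collect_eq by (rule exI[of _ a], rule exI[of _ b]) simp

lemma bodyE: assumes "x \<in> body \<epsilon> B"
  obtains a b where "a \<in> B" "b \<in> B" "a = b \<or> adj a b" "x \<in> closed_segment (pos \<epsilon> a) (pos \<epsilon> b)"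
  using assms unfolding body_def by blast

lemma black_points_body: "black_points \<epsilon> p g = body \<epsilon> {v. g (pos \<epsilon> v) \<ge> - p}" (is "?L = ?R")
proof (intro equalityI subsetI)
  fix x assume "x \<in> ?L"
  then consider "x \<in> scaled_vertices \<epsilon>" "g x \<ge> - p"
    | y1 y2 where "(y1, y2) \<in> scaled_edges \<epsilon>" "x \<in> closed_segment y1 y2" "g y1 \<ge> - p" "g y2 \<ge> - p" unfolding black_points_def by blast
  then show "x \<in> ?R"
  proof cases
    case 1
    then obtain v where "x = pos \<epsilon> v" by (auto simp: scaled_vertices_def lattice_vertices_pos pos_scale)
    then show ?thesis using 1 unfolding body_def by (intro CollectI exI[of _ v]) simp
  next
    case 2
    then obtain y1' y2' where y: "(y1', y2') \<in> lattice_edges" "y1 = \<epsilon> *\<^sub>R y1'" "y2 = \<epsilon> *\<^sub>R y2'" by (auto simp: scaled_edges_def)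
    obtain a b where ab: "adj a b" "y1' = pos 1 a" "y2' = pos 1 b" by (rule edge_adj[OF y(1)])
    have "y1 = pos \<epsilon> a" "y2 = pos \<epsilon> b" using y ab by (simp_all add: pos_scale)
    then show ?thesis using 2 ab(1) unfolding body_def by blast
  qed
next
  fix x assume "x \<in> ?R"
  then obtain a b where ab: "g (pos \<epsilon> a) \<ge> - p" "g (pos \<epsilon> b) \<ge> - p" "a = b \<or> adj a b" "x \<in> closed_segment (pos \<epsilon> a) (pos \<epsilon> b)"
    unfolding body_def by auto
  show "x \<in> ?L"
  proof (cases "a = b")
    case True
    then have "x = pos \<epsilon> a" using ab by simp
    then show ?thesis using ab(1) pos_scaled_vertices unfolding black_points_def by blast
  next
    case False
    then have "(pos 1 a, pos 1 b) \<in> lattice_edges \<or> (pos 1 b, pos 1 a) \<in> lattice_edges" using ab adj_edge by blast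
    then have "(pos \<epsilon> a, pos \<epsilon> b) \<in> scaled_edges \<epsilon> \<or> (pos \<epsilon> b, pos \<epsilon> a) \<in> scaled_edges \<epsilon>"
      using pos_scaled_edges by blast
    then show ?thesis
    proof
      assume "(pos \<epsilon> a, pos \<epsilon> b) \<in> scaled_edges \<epsilon>"
      then show ?thesis using ab unfolding black_points_def by blast
    next
      assume "(pos \<epsilon> b, pos \<epsilon> a) \<in> scaled_edges \<epsilon>"
      moreover have "x \<in> closed_segment (pos \<epsilon> b) (pos \<epsilon> a)" using ab(4) by (simp add: closed_segment_commute)
      ultimately show ?thesis using ab unfolding black_points_def by blast
    qed
  qed
qed

context fixes \<epsilon> :: real assumes eps: "\<epsilon> > 0" begin

lemma segments_meet:
  assumes "a = b \<or> adj a b" "c = d \<or> adj c d" "z \<in> closed_segment (pos \<epsilon> a) (pos \<epsilon> b)" "z \<in> closed_segment (pos \<epsilon> c) (pos \<epsilon> d)"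
  shows "{a, b} \<inter> {c, d} \<noteq> {}"
proof -
  obtain x y where "z = lat_map \<epsilon> x" "x \<in> closed_segment (ptv a) (ptv b)" "z = lat_map \<epsilon> y" "y \<in> closed_segment (ptv c) (ptv d)"
    using assms(3,4) unfolding pos_def closed_segment_linear_image[OF linear_lat_map] by blast
  then show ?thesis using inj_lat_map[OF eps] edges_meet[OF assms(1,2)] by (metis injD)
qed

lemma finite_nrm: "finite {v. nrm v \<le> N}" unfolding nrm_rect by simp

text \<open>The segments form a locally finite family of closed sets: a ball of radius 1 meets only
  segments whose end points have bounded norm.\<close>

lemma closed_body: "closed (body \<epsilon> B)"
proof -
  define P where "P = {p. fst p \<in> B \<and> snd p \<in> B \<and> (fst p = snd p \<or> adj (fst p) (snd p))}"
  let ?sg = "\<lambda>p. closed_segment (pos \<epsilon> (fst p)) (pos \<epsilon> (snd p))"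
  let ?A = "?sg ` P"
  have "closedin euclidean (\<Union> ?A)"
  proof (rule closedin_locally_finite_Union)
    show "closedin euclidean U" if "U \<in> ?A" for U using that by auto
    show "locally_finite_in euclidean ?A" unfolding locally_finite_in_def
    proof (intro conjI ballI)
      fix x :: "real^2"
      define N where "N = \<lceil>2 * (norm x + 1 + 2 * \<epsilon>) / \<epsilon>\<rceil>"
      have fin: "finite (?sg ` ({v. nrm v \<le> N} \<times> {v. nrm v \<le> N}))" by (rule finite_imageI[OF finite_cartesian_product[OF finite_nrm finite_nrm]])
      have near: "nrm a \<le> N" if "a = b \<or> adj a b" "closed_segment (pos \<epsilon> a) (pos \<epsilon> b) \<inter> ball x 1 \<noteq> {}" for a b
      proof -
        from that(2) obtain y where "y \<in> closed_segment (pos \<epsilon> a) (pos \<epsilon> b) \<inter> ball x 1" unfolding ex_in_conv[symmetric] by (rule exE)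
        then have y: "y \<in> closed_segment (pos \<epsilon> a) (pos \<epsilon> b)" "y \<in> ball x 1" by simp_all
        have "norm (pos \<epsilon> a - y) \<le> norm (pos \<epsilon> a - pos \<epsilon> b)" using segment_bound(1)[of y "pos \<epsilon> a" "pos \<epsilon> b"] y(1) by (simp add: norm_minus_commute)
        also have "\<dots> \<le> 2 * \<epsilon>"
        proof -
          have A: "\<bar>fst a - fst b\<bar> \<le> 1" "\<bar>snd a - snd b\<bar> \<le> 1" using that(1) by (auto dest: adj_fst adj_snd)
          then have B: "\<bar>real_of_int (fst a) - real_of_int (fst b)\<bar> \<le> 1" "\<bar>real_of_int (snd a) - real_of_int (snd b)\<bar> \<le> 1" by linarith+
          have c: "(pos \<epsilon> a - pos \<epsilon> b) $ 1 = \<epsilon> * (((real_of_int (fst a) - real_of_int (fst b)) - (real_of_int (snd a) - real_of_int (snd b))) / 2)"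
            "(pos \<epsilon> a - pos \<epsilon> b) $ 2 = \<epsilon> * (((real_of_int (fst a) - real_of_int (fst b)) + (real_of_int (snd a) - real_of_int (snd b))) / 2)"
            by (simp_all add: pos_nth field_simps)
          have "norm (pos \<epsilon> a - pos \<epsilon> b) \<le> (\<Sum>i\<in>UNIV. \<bar>(pos \<epsilon> a - pos \<epsilon> b) $ i\<bar>)" by (rule norm_le_l1_cart)
          also have "\<dots> = \<bar>(pos \<epsilon> a - pos \<epsilon> b) $ 1\<bar> + \<bar>(pos \<epsilon> a - pos \<epsilon> b) $ 2\<bar>" by (rule sum_2)
          also have "\<dots> \<le> \<epsilon> * 1 + \<epsilon> * 1" unfolding c abs_mult using eps B by (intro add_mono mult_mono) (auto simp: abs_le_iff)
          finally show ?thesis by simp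
        qed
        finally have "norm (pos \<epsilon> a) \<le> norm x + 1 + 2 * \<epsilon>" using y(2)[unfolded mem_ball] norm_triangle_ineq[of "pos \<epsilon> a - y" y] norm_triangle_ineq[of x "y - x"]
          by (simp add: dist_norm norm_minus_commute)
        then have "real_of_int (nrm a) \<le> 2 * (norm x + 1 + 2 * \<epsilon>) / \<epsilon>" using norm_pos[OF eps, of a] eps by (simp add: field_simps)
        then show ?thesis unfolding N_def by (simp add: le_ceiling_iff)
      qed
      have "{U \<in> ?A. U \<inter> ball x 1 \<noteq> {}} \<subseteq> ?sg ` ({v. nrm v \<le> N} \<times> {v. nrm v \<le> N})"
      proof
        fix U assume "U \<in> {U \<in> ?A. U \<inter> ball x 1 \<noteq> {}}"
        then obtain p where p: "U = ?sg p" "fst p = snd p \<or> adj (fst p) (snd p)" "?sg p \<inter> ball x 1 \<noteq> {}" unfolding P_def by blast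
        have "nrm (fst p) \<le> N" by (rule near[OF p(2,3)])
        moreover have "nrm (snd p) \<le> N"
        proof (rule near)
          show "snd p = fst p \<or> adj (snd p) (fst p)" using p(2) adj_sym by metis
        qed (use p(3) in \<open>simp add: closed_segment_commute\<close>)
        ultimately have "p \<in> {v. nrm v \<le> N} \<times> {v. nrm v \<le> N}" by (simp add: mem_Times_iff)
        then show "U \<in> ?sg ` ({v. nrm v \<le> N} \<times> {v. nrm v \<le> N})" using p(1) by blast
      qed
      then have "finite {U \<in> ?A. U \<inter> ball x 1 \<noteq> {}}" using fin finite_subset by blast
      then show "\<exists>V. openin euclidean V \<and> x \<in> V \<and> finite {U \<in> ?A. U \<inter> V \<noteq> {}}" by (intro exI[of _ "ball x 1"]) simp
    qed simp
  qed
  moreover have "\<Union> ?A = body \<epsilon> B"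
  proof (intro equalityI subsetI)
    fix x assume "x \<in> \<Union> ?A"
    then obtain p where "p \<in> P" "x \<in> ?sg p" by blast
    then show "x \<in> body \<epsilon> B" unfolding body_def P_def by blast
  next
    fix x assume "x \<in> body \<epsilon> B"
    then obtain a b where "a \<in> B" "b \<in> B" "a = b \<or> adj a b" "x \<in> closed_segment (pos \<epsilon> a) (pos \<epsilon> b)" unfolding body_def by blast
    then have "(a, b) \<in> P" "x \<in> ?sg (a, b)" unfolding P_def by simp_all
    then show "x \<in> \<Union> ?A" by blast
  qed
  ultimately show ?thesis by simp
qed

lemma pos_body: "v \<in> B ==> pos \<epsilon> v \<in> body \<epsilon> B" by (rule bodyI[of v _ v]) simp_all

text \<open>The bodies of the cluster of \<open>v\<close> and of the remaining vertices are closed,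
  disjoint and cover everything, so a connected subset that contains \<open>pos \<epsilon> v\<close>
  stays in the former.\<close>

lemma component_body: assumes v: "v \<in> B" shows "connected_component_set (body \<epsilon> B) (pos \<epsilon> v) = body \<epsilon> {w. conn B v w}" (is "?L = ?R")
proof (rule equalityI)
  have c: "connected_component (body \<epsilon> B) (pos \<epsilon> a) x" if "a \<in> B" "b \<in> B" "a = b \<or> adj a b" "x \<in> closed_segment (pos \<epsilon> a) (pos \<epsilon> b)" for a b x
  proof -
    have "closed_segment (pos \<epsilon> a) (pos \<epsilon> b) \<subseteq> body \<epsilon> B" by (rule subsetI) (rule bodyI[OF that(1-3)])
    then show ?thesis unfolding connected_component_def by (intro exI[of _ "closed_segment (pos \<epsilon> a) (pos \<epsilon> b)"]) (simp add: that(4))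
  qed
  have w: "connected_component (body \<epsilon> B) (pos \<epsilon> v) (pos \<epsilon> w)" if "conn B v w" for w
    using that
  proof (induction rule: conn_induct)
    case base show ?case using pos_body[OF v] by simp
  next
    case (step y z)
    have "connected_component (body \<epsilon> B) (pos \<epsilon> y) (pos \<epsilon> z)" by (rule c[OF conn_in2[OF step(1)] step(3)]) (simp_all add: step(2))
    then show ?case using step(4) connected_component_trans by metis
  qed
  show "?R \<subseteq> ?L"
  proof
    fix x assume "x \<in> ?R"
    then obtain a b where ab: "conn B v a" "conn B v b" "a = b \<or> adj a b" "x \<in> closed_segment (pos \<epsilon> a) (pos \<epsilon> b)" by (elim bodyE) simp
    have "connected_component (body \<epsilon> B) (pos \<epsilon> a) x" by (rule c[OF conn_in2[OF ab(1)] conn_in2[OF ab(2)] ab(3,4)])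
    then have "connected_component (body \<epsilon> B) (pos \<epsilon> v) x" by (rule connected_component_trans[OF w[OF ab(1)]])
    then show "x \<in> ?L" by simp
  qed
  let ?Q = "body \<epsilon> (B - {w. conn B v w})"
  have cover: "body \<epsilon> B \<subseteq> ?R \<union> ?Q"
  proof
    fix x assume "x \<in> body \<epsilon> B"
    then obtain a b where ab: "a \<in> B" "b \<in> B" "a = b \<or> adj a b" "x \<in> closed_segment (pos \<epsilon> a) (pos \<epsilon> b)" by (rule bodyE)
    show "x \<in> ?R \<union> ?Q"
    proof (cases "conn B v a")
      case True
      then have "conn B v b" using ab conn_step by metis
      then show ?thesis using True bodyI[of a _ b x] ab(3,4) by simp
    next
      case False
      then have "\<not> conn B v b" using ab conn_step adj_sym by metis
      then show ?thesis using False bodyI[of a _ b x] ab by simp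
    qed
  qed
  have disj: "?R \<inter> ?Q = {}"
  proof (rule ccontr)
    assume "?R \<inter> ?Q \<noteq> {}"
    then obtain x where x: "x \<in> ?R" "x \<in> ?Q" by blast
    from x(1) obtain a b where 1: "a \<in> {w. conn B v w}" "b \<in> {w. conn B v w}" "a = b \<or> adj a b" "x \<in> closed_segment (pos \<epsilon> a) (pos \<epsilon> b)" by (rule bodyE)
    from x(2) obtain c d where 2: "c \<in> B - {w. conn B v w}" "d \<in> B - {w. conn B v w}" "c = d \<or> adj c d" "x \<in> closed_segment (pos \<epsilon> c) (pos \<epsilon> d)" by (rule bodyE)
    from segments_meet[OF 1(3) 2(3) 1(4) 2(4)] show False using 1(1,2) 2(1,2) by blast
  qed
  have "?L \<inter> ?Q = {}"
  proof (rule ccontr)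
    assume n: "?L \<inter> ?Q \<noteq> {}"
    have "?L \<subseteq> ?R \<union> ?Q" using connected_component_subset cover by blast
    moreover have "pos \<epsilon> v \<in> ?R \<inter> ?L" using pos_body[of v "{w. conn B v w}"] conn_refl[OF v] pos_body[OF v] by auto
    ultimately show False using connected_connected_component[of "body \<epsilon> B" "pos \<epsilon> v"] closed_body n disj unfolding connected_closed by blast
  qed
  then show "?L \<subseteq> ?R" using connected_component_subset cover by blast
qed

lemma unbounded_body: assumes "v \<in> B" shows "bounded (body \<epsilon> {w. conn B v w}) \<longleftrightarrow> \<not> inf_cl B v"
proof
  assume "bounded (body \<epsilon> {w. conn B v w})"
  then obtain K where K: "\<And>x. x \<in> body \<epsilon> {w. conn B v w} ==> norm x \<le> K" unfolding bounded_iff by blast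
  show "\<not> inf_cl B v"
  proof
    assume "inf_cl B v"
    then obtain w where w: "conn B v w" "\<lceil>2 * K / \<epsilon>\<rceil> + 1 \<le> nrm w" unfolding inf_cl_def by blast
    have "2 * K / \<epsilon> < real_of_int (nrm w)" using w(2) by linarith
    then have "K < \<epsilon> * real_of_int (nrm w) / 2" using eps by (simp add: field_simps)
    also have "\<dots> \<le> K" using norm_pos[OF eps, of w] K[OF pos_body[of w]] w(1) by simp
    finally show False by simp
  qed
next
  assume "\<not> inf_cl B v"
  then obtain N where "\<And>w. conn B v w ==> nrm w < N" unfolding inf_cl_def by (meson not_le)
  then have "{w. conn B v w} \<subseteq> {w. nrm w \<le> N}" by force
  then have f: "finite {w. conn B v w}" using finite_nrm finite_subset by blast
  have "body \<epsilon> {w. conn B v w} \<subseteq> (\<Union>a\<in>{w. conn B v w}. \<Union>b\<in>{w. conn B v w}. closed_segment (pos \<epsilon> a) (pos \<epsilon> b))"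
    by (rule subsetI, elim bodyE) (intro UN_I)
  then show "bounded (body \<epsilon> {w. conn B v w})" using f by (elim bounded_subset[rotated]) (intro bounded_UN ballI bounded_closed_segment; simp)
qed

lemma unbounded_components:
  "{C \<in> components (body \<epsilon> B). \<not> bounded C} = {body \<epsilon> {w. conn B v w} | v. inf_cl B v}"
proof (intro equalityI subsetI)
  fix C assume "C \<in> {C \<in> components (body \<epsilon> B). \<not> bounded C}"
  then obtain x where x: "x \<in> body \<epsilon> B" "C = connected_component_set (body \<epsilon> B) x" "\<not> bounded C" unfolding components_def by blast
  obtain a b where ab: "a \<in> B" "b \<in> B" "a = b \<or> adj a b" "x \<in> closed_segment (pos \<epsilon> a) (pos \<epsilon> b)" using x(1) by (rule bodyE)
  have "x \<in> body \<epsilon> {w. conn B a w}" by (rule bodyI[OF _ _ ab(3,4)]) (use ab conn_refl[of a B] conn_adj[of a B b] in auto)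
  then have "x \<in> connected_component_set (body \<epsilon> B) (pos \<epsilon> a)" using component_body[OF ab(1)] by simp
  then have "C = connected_component_set (body \<epsilon> B) (pos \<epsilon> a)" unfolding x(2) by (metis connected_component_eq)
  then have "C = body \<epsilon> {w. conn B a w}" using component_body[OF ab(1)] by simp
  then show "C \<in> {body \<epsilon> {w. conn B v w} | v. inf_cl B v}" using x(3) unbounded_body[OF ab(1)] by blast
next
  fix C assume "C \<in> {body \<epsilon> {w. conn B v w} | v. inf_cl B v}"
  then obtain v where v: "C = body \<epsilon> {w. conn B v w}" "inf_cl B v" by blast
  have vB: "v \<in> B" using v(2) conn_in1 unfolding inf_cl_def by blast
  then show "C \<in> {C \<in> components (body \<epsilon> B). \<not> bounded C}"
    using v unbounded_body[OF vB] component_body[OF vB] pos_body[OF vB] unfolding components_def by blast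
qed

end

section \<open>Gaussian fields\<close>

context prob_space begin

lemma gaussian_variable_cases:
  assumes "gaussian_variable M Y" "expectation Y = 0"
  obtains "AE \<omega> in M. Y \<omega> = 0" | \<sigma> where "\<sigma> > 0" "distributed M lborel Y (normal_density 0 \<sigma>)"
proof -
  have Ym: "Y \<in> borel_measurable M" using assms(1) by (simp add: gaussian_variable_def)
  consider \<mu> where "AE \<omega> in M. Y \<omega> = \<mu>" | \<mu> \<sigma> where "\<sigma> > 0" "distributed M lborel Y (normal_density \<mu> \<sigma>)"
    using assms(1) unfolding gaussian_variable_def by blast
  then show ?thesis
  proof cases
    case 1
    have "expectation Y = expectation (\<lambda>_. \<mu>)" by (rule integral_cong_AE) (use 1 Ym in auto)
    then have "\<mu> = 0" using assms(2) by (simp add: prob_space)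
    then show ?thesis using 1 that(1) by simp
  next
    case 2
    then have "\<mu> = 0" using normal_distributed_expectation[OF 2] assms(2) by simp
    then show ?thesis using 2 that(2) by blast
  qed
qed

lemma gaussian_variable_integrable:
  assumes "gaussian_variable M Y"
  shows "integrable M Y" "integrable M (\<lambda>\<omega>. (Y \<omega>)\<^sup>2)"
proof -
  have Ym: "Y \<in> borel_measurable M" using assms(1) by (simp add: gaussian_variable_def)
  consider \<mu> where "AE \<omega> in M. Y \<omega> = \<mu>" | \<mu> \<sigma> where "\<sigma> > 0" "distributed M lborel Y (normal_density \<mu> \<sigma>)"
    using assms(1) unfolding gaussian_variable_def by blast
  then have "integrable M Y \<and> integrable M (\<lambda>\<omega>. (Y \<omega>)\<^sup>2)"
  proof cases
    case 1
    have "integrable M Y \<longleftrightarrow> integrable M (\<lambda>_. \<mu>)" by (rule integrable_cong_AE) (use 1 Ym in auto)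
    moreover have "integrable M (\<lambda>\<omega>. (Y \<omega>)\<^sup>2) \<longleftrightarrow> integrable M (\<lambda>_. \<mu>\<^sup>2)" by (rule integrable_cong_AE) (use 1 Ym in auto)
    ultimately show ?thesis by simp
  next
    case 2
    have i: "integrable M Y"
      by (rule distributed_integrable_var[OF 2(2)]) (use integrable_normal_moment_nz_1[OF 2(1)] in auto)
    have "integrable lborel (\<lambda>x. normal_density \<mu> \<sigma> x * (x - \<mu>)\<^sup>2)" by (rule integrable_normal_moment[OF 2(1)])
    then have "integrable M (\<lambda>\<omega>. (Y \<omega> - \<mu>)\<^sup>2)" using distributed_integrable[OF 2(2), of "\<lambda>x. (x - \<mu>)\<^sup>2"] by simp
    then have "integrable M (\<lambda>\<omega>. (Y \<omega> - \<mu>)\<^sup>2 + 2 * \<mu> * Y \<omega> - \<mu>\<^sup>2)" using i by simp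
    moreover have "(Y \<omega> - \<mu>)\<^sup>2 + 2 * \<mu> * Y \<omega> - \<mu>\<^sup>2 = (Y \<omega>)\<^sup>2" for \<omega> by (simp add: power2_eq_square algebra_simps)
    ultimately show ?thesis using i by simp
  qed
  then show "integrable M Y" "integrable M (\<lambda>\<omega>. (Y \<omega>)\<^sup>2)" by auto
qed

lemma centered_gaussian_char:
  assumes "gaussian_variable M Y" "expectation Y = 0"
  shows "(LINT \<omega>|M. cis (Y \<omega>)) = of_real (exp (- expectation (\<lambda>\<omega>. (Y \<omega>)\<^sup>2) / 2))"
proof -
  have Ym [measurable]: "Y \<in> borel_measurable M" using assms(1) by (simp add: gaussian_variable_def)
  have cm: "cis \<in> borel_measurable borel" unfolding cis_conv_exp[abs_def] by measurable
  show ?thesis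
  proof (rule gaussian_variable_cases[OF assms])
    assume z: "AE \<omega> in M. Y \<omega> = 0"
    have "(LINT \<omega>|M. cis (Y \<omega>)) = (LINT \<omega>|M. 1)"
      by (rule integral_cong_AE) (use z cm in \<open>auto elim!: eventually_mono\<close>)
    moreover have "expectation (\<lambda>\<omega>. (Y \<omega>)\<^sup>2) = expectation (\<lambda>\<omega>. 0)" by (rule integral_cong_AE) (use z in auto)
    ultimately show ?thesis by (simp add: prob_space)
  next
    fix \<sigma> :: real assume s: "\<sigma> > 0" and d: "distributed M lborel Y (normal_density 0 \<sigma>)"
    have v: "expectation (\<lambda>\<omega>. (Y \<omega>)\<^sup>2) = \<sigma>\<^sup>2" using normal_distributed_variance[OF s d] assms(2) by simp
    have "distributed M lborel (\<lambda>\<omega>. Y \<omega> / \<sigma>) std_normal_density" using d normal_standard_normal_convert[OF s, of Y 0] by simp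
    then have e: "distr M lborel (\<lambda>\<omega>. Y \<omega> / \<sigma>) = std_normal_distribution" by (rule distributed_distr_eq_density)
    have "(LINT \<omega>|M. cis (Y \<omega>)) = (LINT \<omega>|M. cis (\<sigma> * (Y \<omega> / \<sigma>)))" using s by simp
    also have "\<dots> = (LINT x|distr M lborel (\<lambda>\<omega>. Y \<omega> / \<sigma>). cis (\<sigma> * x))"
    proof (rule integral_distr[symmetric])
      show "(\<lambda>x. cis (\<sigma> * x)) \<in> borel_measurable lborel" unfolding cis_conv_exp by measurable
    qed measurable
    also have "\<dots> = char std_normal_distribution \<sigma>" unfolding e char_def by (simp add: cis_conv_exp)
    also have "\<dots> = of_real (exp (- \<sigma>\<^sup>2 / 2))" by (simp add: char_std_normal_distribution)
    finally show ?thesis by (simp add: v)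
  qed
qed

lemma std_normal_interval:
  assumes d: "distributed M lborel X std_normal_density" and A: "A \<in> sets borel"
  shows "prob {\<omega> \<in> space M. X \<omega> \<in> A} = (LINT x|lborel. std_normal_density x * indicator A x)"
proof -
  have Xm: "X \<in> measurable M borel" using distributed_measurable[OF d] by simp
  have m: "{\<omega> \<in> space M. X \<omega> \<in> A} \<in> sets M" using measurable_sets[OF Xm A] by (simp add: vimage_def Int_def conj_commute)
  have "(LINT x|lborel. std_normal_density x * indicator A x) = (LINT \<omega>|M. indicator A (X \<omega>))"
    by (rule distributed_integral[OF d]) (use A in auto)
  also have "\<dots> = (LINT \<omega>|M. indicator {\<omega> \<in> space M. X \<omega> \<in> A} \<omega>)" by (rule Bochner_Integration.integral_cong) (auto simp: indicator_def)
  also have "\<dots> = prob {\<omega> \<in> space M. X \<omega> \<in> A}" using m by simp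
  finally show ?thesis by simp
qed

end

lemma std_normal_density_le_1: "std_normal_density x \<le> 1"
proof -
  have "1 * 1 \<le> 2 * pi" using pi_gt3 by linarith
  then have "1 \<le> sqrt (2 * pi)" by simp
  then have "1 / sqrt (2 * pi) \<le> 1" by simp
  moreover have "exp (- x\<^sup>2 / 2) \<le> 1" by simp
  ultimately have "1 / sqrt (2 * pi) * exp (- x\<^sup>2 / 2) \<le> 1 * 1" by (intro mult_mono) auto
  then show ?thesis by (simp add: std_normal_density_def)
qed

lemma integrable_std_indicator: "A \<in> sets borel ==> integrable lborel (\<lambda>x. std_normal_density x * indicator A x)"
  by (rule integrable_real_mult_indicator) (auto intro: integrable_normal_moment[of 1 0 0, simplified])

text \<open>Distinct lattice points have distance at least \<open>\<epsilon> / 2\<close>, so the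
  bound is asked for away from the origin only, with a constant that may depend on
  \<open>r\<close>.\<close>

definition decays :: "(real^2 => real) => bool" where
  "decays \<kappa> \<longleftrightarrow> (\<forall>r>0. \<exists>C. \<forall>x. r \<le> norm x --> \<kappa> x \<le> C / norm x ^ 5)"

section \<open>From the field to the lattice model\<close>

context gaussian_field begin

lemma f_gaussian: "gaussian_variable M (f x)"
  using gaussian_combination[of "{x}" "\<lambda>_. 1"] by simp

lemma f_meas [measurable]: "f x \<in> borel_measurable M"
  using f_gaussian[of x] by (simp add: gaussian_variable_def)

lemma f_prod_integrable: "integrable M (\<lambda>\<omega>. f x \<omega> * f y \<omega>)"
proof (rule Bochner_Integration.integrable_bound[of M "\<lambda>\<omega>. (f x \<omega>)\<^sup>2 + (f y \<omega>)\<^sup>2"])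
  show "integrable M (\<lambda>\<omega>. (f x \<omega>)\<^sup>2 + (f y \<omega>)\<^sup>2)" by (intro Bochner_Integration.integrable_add gaussian_variable_integrable f_gaussian)
  have "\<bar>a * b\<bar> \<le> a\<^sup>2 + b\<^sup>2" for a b :: real
  proof -
    have "0 \<le> \<bar>a\<bar> * \<bar>b\<bar>" by simp
    then show ?thesis using sum_squares_bound[of "\<bar>a\<bar>" "\<bar>b\<bar>"] unfolding abs_mult power2_abs by linarith
  qed
  then show "AE \<omega> in M. norm (f x \<omega> * f y \<omega>) \<le> norm ((f x \<omega>)\<^sup>2 + (f y \<omega>)\<^sup>2)" by simp
qed measurable

lemma field_perc:
  assumes c: "centered M f" and eps: "\<epsilon> > 0" and cov: "covariance_function M f \<kappa>" and nn: "\<And>x. \<kappa> x \<ge> 0" and one: "\<kappa> 0 = 1"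
    and dec: "decays \<kappa>" and sym: "\<And>x. \<kappa> (vector [- (x $ 1), x $ 2]) = \<kappa> x" "\<And>x. \<kappa> (vector [- (x $ 2), - (x $ 1)]) = \<kappa> x"
  shows "\<exists>D. perc M (\<lambda>v. f (pos \<epsilon> v)) (\<lambda>v w. \<kappa> (pos \<epsilon> v - pos \<epsilon> w)) D"
proof -
  have E: "(LINT \<omega>|M. f x \<omega> * f y \<omega>) = \<kappa> (x - y)" for x y using cov by (simp add: covariance_function_def)
  have mean0: "expectation (f x) = 0" for x using c by (simp add: centered_def)
  have int: "integrable M (f x)" for x by (rule gaussian_variable_integrable[OF f_gaussian])
  have std: "distributed M lborel (f x) std_normal_density" for x
  proof (rule gaussian_variable_cases[OF f_gaussian mean0[of x]])
    assume "AE \<omega> in M. f x \<omega> = 0"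
    then have "(LINT \<omega>|M. f x \<omega> * f x \<omega>) = (LINT \<omega>|M. 0)" by (intro integral_cong_AE) auto
    then show ?thesis using E[of x x] one by simp
  next
    fix \<sigma> :: real assume s: "\<sigma> > 0" and d: "distributed M lborel (f x) (normal_density 0 \<sigma>)"
    have "\<sigma>\<^sup>2 = 1" using normal_distributed_variance[OF s d] E[of x x] one mean0 by (simp add: power2_eq_square)
    then have "\<sigma> = 1" using s by (simp add: power2_eq_1_iff)
    then show ?thesis using d by simp
  qed
  have char: "(LINT \<omega>|M. cis (lin V a (\<lambda>i. f (pos \<epsilon> i) \<omega>))) = of_real (exp (- bil (\<lambda>v w. \<kappa> (pos \<epsilon> v - pos \<epsilon> w)) V a a / 2))"
    if V: "finite V" for V a
  proof -
    let ?Y = "\<lambda>\<omega>. \<Sum>i\<in>V. a i * f (pos \<epsilon> i) \<omega>"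
    have i: "inj_on (pos \<epsilon>) V" using inj_pos[OF eps] inj_on_subset by blast
    \<comment> \<open>\<open>gaussian_combination\<close> takes coefficients indexed by points of
      the plane, hence the inverse of \<open>pos \<epsilon>\<close>.\<close>
    have "(\<Sum>x\<in>pos \<epsilon> ` V. a (the_inv_into V (pos \<epsilon>) x) * f x \<omega>) = ?Y \<omega>" for \<omega>
      by (subst sum.reindex[OF i]) (simp add: the_inv_into_f_f[OF i])
    then have g: "gaussian_variable M ?Y" using gaussian_combination[of "pos \<epsilon> ` V" "\<lambda>x. a (the_inv_into V (pos \<epsilon>) x)"] V by simp
    have m: "expectation ?Y = 0" using int mean0 by simp
    have "expectation (\<lambda>\<omega>. (?Y \<omega>)\<^sup>2) = (LINT \<omega>|M. (\<Sum>i\<in>V. \<Sum>j\<in>V. a i * a j * (f (pos \<epsilon> i) \<omega> * f (pos \<epsilon> j) \<omega>)))"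
      by (simp add: power2_eq_square sum_product mult_ac)
    also have "\<dots> = bil (\<lambda>v w. \<kappa> (pos \<epsilon> v - pos \<epsilon> w)) V a a"
      by (simp add: bil_def Bochner_Integration.integral_sum f_prod_integrable E)
    finally show ?thesis using centered_gaussian_char[OF g m] by (simp add: lin_def)
  qed
  obtain C0 where C0: "\<And>x. \<epsilon> / 2 \<le> norm x ==> \<kappa> x \<le> C0 / norm x ^ 5" using dec eps unfolding decays_def by (meson half_gt_zero)
  define C where "C = max C0 0"
  \<comment> \<open>The value 1 covers \<open>v = w\<close>. Otherwise the lattice distance
    \<open>n\<close> is at least 1, so the distance in the plane is at least
    \<open>\<epsilon> * n / 2 \<ge> \<epsilon> / 4 * (1 + n)\<close>, which gives the factor
    \<open>(4 / \<epsilon>) ^ 5\<close>.\<close>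
  define D where "D = max 1 (C * (4 / \<epsilon>) ^ 5)"
  have decay: "\<kappa> (pos \<epsilon> v - pos \<epsilon> w) \<le> D / (1 + real_of_int (nrm (fst v - fst w, snd v - snd w))) ^ 5" for v w
  proof (cases "v = w")
    case True
    then show ?thesis using one by (simp add: nrm_def D_def)
  next
    case False
    let ?n = "nrm (fst v - fst w, snd v - snd w)" and ?x = "norm (pos \<epsilon> v - pos \<epsilon> w)"
    have n: "1 \<le> ?n" using False unfolding nrm_def by (auto simp: prod_eq_iff)
    have x: "\<epsilon> * real_of_int ?n / 2 \<le> ?x" by (rule norm_pos_diff[OF eps])
    have "\<epsilon> * 1 \<le> \<epsilon> * real_of_int ?n" using n eps by (intro mult_left_mono) auto
    then have x2: "\<epsilon> / 2 \<le> ?x" using x by simp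
    have "\<epsilon> / 4 * (1 + real_of_int ?n) \<le> \<epsilon> / 4 * (2 * real_of_int ?n)" using n eps by (intro mult_left_mono) auto
    then have x3: "\<epsilon> / 4 * (1 + real_of_int ?n) \<le> ?x" using x by simp
    have p: "0 < \<epsilon> / 4 * (1 + real_of_int ?n)" using n eps by simp
    have "\<kappa> (pos \<epsilon> v - pos \<epsilon> w) \<le> C0 / ?x ^ 5" by (rule C0[OF x2])
    also have "\<dots> \<le> C / ?x ^ 5" by (intro divide_right_mono) (auto simp: C_def)
    also have "\<dots> \<le> C / (\<epsilon> / 4 * (1 + real_of_int ?n)) ^ 5"
    proof (rule divide_left_mono)
      show "(\<epsilon> / 4 * (1 + real_of_int ?n)) ^ 5 \<le> ?x ^ 5" by (rule power_mono[OF x3]) (use p in simp)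
      show "0 < ?x ^ 5 * (\<epsilon> / 4 * (1 + real_of_int ?n)) ^ 5"
        by (rule mult_pos_pos[OF zero_less_power[OF less_le_trans[OF p x3]] zero_less_power[OF p]])
    qed (simp add: C_def)
    also have "\<dots> = C * (4 / \<epsilon>) ^ 5 / (1 + real_of_int ?n) ^ 5" using eps by (simp add: power_mult_distrib power_divide)
    also have "\<dots> \<le> D / (1 + real_of_int ?n) ^ 5" using n by (intro divide_right_mono) (auto simp: D_def)
    finally show ?thesis .
  qed
  have "perc M (\<lambda>v. f (pos \<epsilon> v)) (\<lambda>v w. \<kappa> (pos \<epsilon> v - pos \<epsilon> w)) D"
  proof (unfold_locales)
    show "f (pos \<epsilon> i) \<in> borel_measurable M" for i by (rule f_meas)
    show "\<kappa> (pos \<epsilon> i - pos \<epsilon> j) = \<kappa> (pos \<epsilon> j - pos \<epsilon> i)" for i j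
      using E[of "pos \<epsilon> i" "pos \<epsilon> j"] E[of "pos \<epsilon> j" "pos \<epsilon> i"] by (simp add: mult.commute)
    show "\<kappa> (pos \<epsilon> i - pos \<epsilon> j) \<ge> 0" for i j by (rule nn)
    show "\<kappa> (pos \<epsilon> i - pos \<epsilon> i) = 1" for i using one by simp
    show "prob {\<omega> \<in> space M. a \<le> f (pos \<epsilon> i) \<omega> \<and> f (pos \<epsilon> i) \<omega> \<le> b} \<le> b - a" if "a \<le> b" for a b i
    proof -
      have "prob {\<omega> \<in> space M. a \<le> f (pos \<epsilon> i) \<omega> \<and> f (pos \<epsilon> i) \<omega> \<le> b} = (LINT x|lborel. std_normal_density x * indicator {a..b} x)"
        using std_normal_interval[OF std, of "{a..b}"] by simp
      also have "\<dots> \<le> (LINT x|lborel. indicator {a..b} x)"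
      proof (rule integral_mono[OF integrable_std_indicator])
        show "integrable lborel (indicator {a..b} :: real => real)" by (rule integrable_real_indicator) (use that in simp_all)
      qed (use std_normal_density_le_1 in \<open>auto simp: indicator_def\<close>)
      finally show ?thesis using that by simp
    qed
    show "\<exists>q>0. \<forall>i. q \<le> prob {\<omega> \<in> space M. f (pos \<epsilon> i) \<omega> \<le> a}" for a
    proof (intro exI conjI allI)
      \<comment> \<open>The mass of \<open>{a - 1..a}\<close> is at least this, since the density on
        that interval is at least its value at \<open>\<bar>a\<bar> + 1\<close>.\<close>
      let ?q = "std_normal_density (\<bar>a\<bar> + 1)"
      show "0 < ?q" by (rule normal_density_pos) simp
      fix i
      have "?q * indicator {a - 1..a} x \<le> std_normal_density x * indicator {..a} x" for x
      proof (cases "x \<in> {a - 1..a}")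
        case True
        then have "\<bar>x\<bar> \<le> \<bar>a\<bar> + 1" by auto
        then have "x\<^sup>2 \<le> (\<bar>a\<bar> + 1)\<^sup>2" by (simp add: abs_le_square_iff[symmetric])
        then have "?q \<le> std_normal_density x" unfolding std_normal_density_def by (intro mult_left_mono) auto
        then show ?thesis using True by simp
      qed simp
      then have "(LINT x|lborel. ?q * indicator {a - 1..a} x) \<le> (LINT x|lborel. std_normal_density x * indicator {..a} x)"
        by (intro integral_mono integrable_std_indicator) (auto intro!: integrable_mult_right integrable_real_indicator)
      then show "?q \<le> prob {\<omega> \<in> space M. f (pos \<epsilon> i) \<omega> \<le> a}" using std_normal_interval[OF std, of "{..a}" "pos \<epsilon> i"] by simp
    qed
    show "\<kappa> (pos \<epsilon> (tr s v) - pos \<epsilon> (tr s w)) = \<kappa> (pos \<epsilon> v - pos \<epsilon> w)" for s v w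
    proof -
      have "pos \<epsilon> (tr s v) - pos \<epsilon> (tr s w) = pos \<epsilon> v - pos \<epsilon> w" by (simp add: real2_eq_iff pos_nth tr_def field_simps)
      then show ?thesis by simp
    qed
    show "\<kappa> (pos \<epsilon> (mir v) - pos \<epsilon> (mir w)) = \<kappa> (pos \<epsilon> v - pos \<epsilon> w)" for v w
    proof -
      \<comment> \<open>As lattice coordinates are rotated by 45 degrees, \<open>mir\<close> is the
        reflection in the antidiagonal of the plane, and \<open>swp\<close> below is the reflection
        in the vertical axis.\<close>
      have "pos \<epsilon> (mir v) - pos \<epsilon> (mir w) = vector [- ((pos \<epsilon> v - pos \<epsilon> w) $ 2), - ((pos \<epsilon> v - pos \<epsilon> w) $ 1)]"
        by (simp add: real2_eq_iff pos_nth mir_def field_simps)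
      then show ?thesis using sym(2)[of "pos \<epsilon> v - pos \<epsilon> w"] by simp
    qed
    show "\<kappa> (pos \<epsilon> (swp v) - pos \<epsilon> (swp w)) = \<kappa> (pos \<epsilon> v - pos \<epsilon> w)" for v w
    proof -
      have "pos \<epsilon> (swp v) - pos \<epsilon> (swp w) = vector [- ((pos \<epsilon> v - pos \<epsilon> w) $ 1), (pos \<epsilon> v - pos \<epsilon> w) $ 2]"
        by (simp add: real2_eq_iff pos_nth swp_def field_simps)
      then show ?thesis using sym(1)[of "pos \<epsilon> v - pos \<epsilon> w"] by simp
    qed
  qed (fact char, fact decay)
  then show ?thesis ..
qed

end

text \<open>A path is finite and so stays in some box. This expresses the existence of an infinite
  cluster by countable operations on local events, which makes it measurable.\<close>

lemma conn_finite: "conn B v w \<longleftrightarrow> (\<exists>n::nat. conn (B \<inter> qbox (int n)) v w)"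
proof
  assume c: "conn B v w"
  then show "\<exists>n::nat. conn (B \<inter> qbox (int n)) v w"
  proof (induction rule: conn_induct)
    case base
    have "v \<in> B \<inter> qbox (int (nat (nrm v)))"
      using conn_in1[OF c] by (simp flip: nrm_rect)
    then show ?case using conn_refl by blast
  next
    case (step y z)
    then obtain n :: nat where n: "conn (B \<inter> qbox (int n)) v y" by blast
    define m where "m = max n (nat (nrm z))"
    have "conn (B \<inter> qbox (int m)) v y" by (rule conn_mono[OF n]) (auto simp: m_def in_rect)
    moreover have "z \<in> B \<inter> qbox (int m)" using step(3) by (simp add: m_def flip: nrm_rect)
    ultimately show ?case using conn_step[OF _ step(2)] by blast
  qed
next
  assume "\<exists>n::nat. conn (B \<inter> qbox (int n)) v w"
  then show "conn B v w" using conn_mono[OF _ Int_lower1] by blast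
qed

context perc begin

lemma inf_cl_meas: "{\<omega> \<in> space M. \<exists>v. inf_cl (blk p \<omega>) v} \<in> sets M"
proof -
  have c: "Measurable.pred M (\<lambda>\<omega>. conn (blk p \<omega> \<inter> qbox (int n)) v w)" for n v w
  proof -
    have "loc (qbox (int n)) (\<lambda>R. conn (R \<inter> qbox (int n)) v w)"
      unfolding loc_def by (simp add: Int_assoc)
    from pev_meas[OF this, of p] show ?thesis unfolding pev_def pred_def .
  qed
  have "Measurable.pred M (\<lambda>\<omega>. \<exists>v. \<forall>N. \<exists>w. (\<exists>n::nat. conn (blk p \<omega> \<inter> qbox (int n)) v w) \<and> N \<le> nrm w)"
    using c by measurable
  then show ?thesis unfolding inf_cl_def conn_finite[symmetric] pred_def .
qed

end

context gaussian_field begin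

lemma sharp_threshold_field:
  assumes c: "centered M f" and eps: "\<epsilon> > 0" and cov: "covariance_function M f \<kappa>" and nn: "\<And>x. \<kappa> x \<ge> 0" and one: "\<kappa> 0 = 1"
    and dec: "decays \<kappa>" and sym: "\<And>x. \<kappa> (vector [- (x $ 1), x $ 2]) = \<kappa> x" "\<And>x. \<kappa> (vector [- (x $ 2), - (x $ 1)]) = \<kappa> x"
  shows "sharp_threshold_at_zero M f \<epsilon>"
proof -
  obtain D where "perc M (\<lambda>v. f (pos \<epsilon> v)) (\<lambda>v w. \<kappa> (pos \<epsilon> v - pos \<epsilon> w)) D" by (rule exE[OF field_perc[where \<kappa>=\<kappa> and \<epsilon>=\<epsilon>, OF assms]])
  then interpret P: perc M "\<lambda>v. f (pos \<epsilon> v)" "\<lambda>v w. \<kappa> (pos \<epsilon> v - pos \<epsilon> w)" D .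
  have U: "unbounded_black_components \<epsilon> p (\<lambda>x. f x \<omega>) = {body \<epsilon> {w. conn (P.blk p \<omega>) v w} | v. inf_cl (P.blk p \<omega>) v}" for p \<omega>
    unfolding unbounded_black_components_def black_points_body P.blk_def by (rule unbounded_components[OF eps])
  have ev: "percolation_event M f \<epsilon> p = {\<omega> \<in> space M. \<exists>v. inf_cl (P.blk p \<omega>) v}" for p
  proof -
    have "unbounded_black_components \<epsilon> p (\<lambda>x. f x \<omega>) \<noteq> {} \<longleftrightarrow> (\<exists>v. inf_cl (P.blk p \<omega>) v)" for \<omega>
      unfolding U by blast
    then show ?thesis unfolding percolation_event_def by simp
  qed
  have m: "percolation_event M f \<epsilon> p \<in> sets M" for p unfolding ev by (rule P.inf_cl_meas)
  have 1: "measure M (percolation_event M f \<epsilon> p) = 1" if "p > 0" for p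
  proof -
    have "AE \<omega> in M. \<omega> \<in> percolation_event M f \<epsilon> p" unfolding ev using P.unique_infinite_cluster[OF that] AE_space by eventually_elim blast
    then show ?thesis using prob_eq_1[OF m] by blast
  qed
  have 0: "measure M (percolation_event M f \<epsilon> p) = 0" if "p \<le> 0" for p
  proof -
    have "AE \<omega> in M. \<omega> \<notin> percolation_event M f \<epsilon> p" unfolding ev using P.no_infinite_cluster[OF that] by eventually_elim blast
    then show ?thesis using prob_eq_0[OF m] by blast
  qed
  have "critical_threshold M f \<epsilon> = Sup {ereal p | p. p \<le> 0}"
  proof -
    have "measure M (percolation_event M f \<epsilon> p) = 0 \<longleftrightarrow> p \<le> 0" for p using 0[of p] 1[of p] by (cases "p \<le> 0") auto
    then show ?thesis unfolding critical_threshold_def by simp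
  qed
  also have "\<dots> = 0"
  proof (rule antisym)
    show "Sup {ereal p | p. p \<le> 0} \<le> 0" by (rule Sup_least) auto
    show "0 \<le> Sup {ereal p | p. p \<le> 0}" by (rule Sup_upper) (auto simp: zero_ereal_def)
  qed
  finally have ct: "critical_threshold M f \<epsilon> = 0" .
  have "AE \<omega> in M. \<forall>C \<in> unbounded_black_components \<epsilon> p (\<lambda>x. f x \<omega>). \<forall>C' \<in> unbounded_black_components \<epsilon> p (\<lambda>x. f x \<omega>). C = C'" for p
  proof -
    have "AE \<omega> in M. \<forall>v w. inf_cl (P.blk p \<omega>) v --> inf_cl (P.blk p \<omega>) w --> conn (P.blk p \<omega>) v w"
    proof (cases "p \<le> 0")
      case True
      from P.no_infinite_cluster[OF True] show ?thesis by (rule eventually_mono) blast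
    next
      case False
      then have "p > 0" by simp
      from P.unique_infinite_cluster[OF this] show ?thesis by (rule eventually_mono) blast
    qed
    then show ?thesis
    proof eventually_elim
      fix \<omega> assume a: "\<forall>v w. inf_cl (P.blk p \<omega>) v --> inf_cl (P.blk p \<omega>) w --> conn (P.blk p \<omega>) v w"
      have "{u. conn (P.blk p \<omega>) v u} = {u. conn (P.blk p \<omega>) w u}" if "inf_cl (P.blk p \<omega>) v" "inf_cl (P.blk p \<omega>) w" for v w
      proof -
        have vw: "conn (P.blk p \<omega>) v w" using a that by blast
        have "conn (P.blk p \<omega>) v u = conn (P.blk p \<omega>) w u" for u
          using conn_trans[OF vw] conn_trans[OF conn_sym[OF vw]] by blast
        then show ?thesis by simp
      qed
      note same = this
      show "\<forall>C \<in> unbounded_black_components \<epsilon> p (\<lambda>x. f x \<omega>). \<forall>C' \<in> unbounded_black_components \<epsilon> p (\<lambda>x. f x \<omega>). C = C'"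
      proof (intro ballI)
        fix C C' assume "C \<in> unbounded_black_components \<epsilon> p (\<lambda>x. f x \<omega>)" "C' \<in> unbounded_black_components \<epsilon> p (\<lambda>x. f x \<omega>)"
        then obtain v w where vw: "C = body \<epsilon> {u. conn (P.blk p \<omega>) v u}" "inf_cl (P.blk p \<omega>) v"
          "C' = body \<epsilon> {u. conn (P.blk p \<omega>) w u}" "inf_cl (P.blk p \<omega>) w" unfolding U mem_Collect_eq by (elim exE conjE)
        show "C = C'" unfolding vw(1,3) same[OF vw(2,4)] ..
      qed
    qed
  qed
  moreover have "percolation_event M f \<epsilon> p \<in> sets M \<and> measure M (percolation_event M f \<epsilon> p) = (if p > 0 then 1 else 0)" for p
    using m[of p] 0[of p] 1[of p] by simp
  ultimately show ?thesis unfolding sharp_threshold_at_zero_def using ct by blast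
qed

lemma law_invariant_covariance:
  assumes "law_invariant M f T" "covariance_function M f \<kappa>"
  shows "\<kappa> (T x - T y) = \<kappa> (x - y)"
proof -
  let ?P = "\<Pi>\<^sub>M x\<in>UNIV. (borel :: real measure)"
  have m: "(\<lambda>\<omega> x. f (T' x) \<omega>) \<in> measurable M ?P" for T' :: "real^2 => real^2" by (rule measurable_PiM_single') auto
  have h: "(\<lambda>\<phi>. \<phi> x * \<phi> y) \<in> borel_measurable ?P" by measurable
  have "(LINT \<omega>|M. f (T x) \<omega> * f (T y) \<omega>) = (LINT \<phi>|field_law M (\<lambda>x. f (T x)). \<phi> x * \<phi> y)"
    unfolding field_law_def by (rule integral_distr[OF m h, symmetric])
  also have "\<dots> = (LINT \<phi>|field_law M f. \<phi> x * \<phi> y)" using assms(1) by (simp add: law_invariant_def)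
  also have "\<dots> = (LINT \<omega>|M. f x \<omega> * f y \<omega>)" unfolding field_law_def by (rule integral_distr[OF m[of "\<lambda>x. x"] h])
  finally show ?thesis using assms(2) by (simp add: covariance_function_def)
qed

end

section \<open>Decay of the covariance functions, and the conclusion\<close>

lemma derivs_decay_decays: assumes "derivs_decay \<kappa>" shows "decays \<kappa>"
proof -
  obtain \<alpha> C where ac: "\<alpha> > 5" "\<And>\<beta>\<^sub>1 \<beta>\<^sub>2 x. \<beta>\<^sub>1 + \<beta>\<^sub>2 \<le> 3 ==> x \<noteq> 0 ==> \<bar>multi_deriv \<beta>\<^sub>1 \<beta>\<^sub>2 \<kappa> x\<bar> \<le> C * norm x powr (- \<alpha>)"
    using assms unfolding derivs_decay_def by blast
  have k: "\<bar>\<kappa> x\<bar> \<le> C * norm x powr (- \<alpha>)" if "x \<noteq> 0" for x using ac(2)[of 0 0 x] that by (simp add: multi_deriv_def)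
  have "\<exists>C'. \<forall>x. r \<le> norm x --> \<kappa> x \<le> C' / norm x ^ 5" if r: "r > 0" for r
  proof (intro exI allI impI)
    fix x :: "real^2" assume x: "r \<le> norm x"
    then have x0: "x \<noteq> 0" "0 < norm x" using r by auto
    \<comment> \<open>The excess \<open>\<alpha> - 5\<close> of the exponent goes into the constant,
      which may depend on \<open>r\<close>.\<close>
    have "norm x powr (- \<alpha>) = norm x powr (- (\<alpha> - 5)) * norm x powr (- 5)" by (simp flip: powr_add)
    also have "\<dots> \<le> r powr (- (\<alpha> - 5)) * norm x powr (- 5)" using x r ac(1) by (intro mult_right_mono powr_mono2') auto
    also have "norm x powr (- 5) = 1 / norm x ^ 5" using x0 by (simp add: powr_minus_divide powr_numeral)
    finally have p: "norm x powr (- \<alpha>) \<le> r powr (- (\<alpha> - 5)) * (1 / norm x ^ 5)" .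
    have "C * norm x powr (- \<alpha>) \<le> \<bar>C\<bar> * norm x powr (- \<alpha>)" by (rule mult_right_mono) simp_all
    then have "\<kappa> x \<le> \<bar>C\<bar> * norm x powr (- \<alpha>)" using k[OF x0(1)] by linarith
    also have "\<dots> \<le> \<bar>C\<bar> * (r powr (- (\<alpha> - 5)) * (1 / norm x ^ 5))" by (rule mult_left_mono[OF p]) simp
    finally show "\<kappa> x \<le> (\<bar>C\<bar> * r powr (- (\<alpha> - 5))) / norm x ^ 5" by simp
  qed
  then show ?thesis by (simp add: decays_def)
qed

text \<open>The sixth power of the norm is a polynomial in the coordinates, which suits both
  examples; the spare power goes into the constant.\<close>

lemma decays_power6: assumes "\<And>x. \<kappa> x * norm x ^ 6 \<le> C" "C \<ge> 0" shows "decays \<kappa>"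
  unfolding decays_def
proof (intro allI impI exI)
  fix r :: real and x :: "real^2" assume r: "r > 0" "r \<le> norm x"
  have p: "0 < norm x" using r by linarith
  have "\<kappa> x \<le> C / norm x ^ 6" using assms(1)[of x] p by (simp add: pos_le_divide_eq)
  also have "\<dots> = (C / norm x) / norm x ^ 5" by (simp add: eval_nat_numeral)
  also have "\<dots> \<le> (C / r) / norm x ^ 5" by (rule divide_right_mono[OF divide_left_mono[OF r(2) assms(2) mult_pos_pos[OF p r(1)]]]) simp
  finally show "\<kappa> x \<le> (C / r) / norm x ^ 5" .
qed

lemma norm2_sq: "(norm (x :: real^2))\<^sup>2 = (x $ 1)\<^sup>2 + (x $ 2)\<^sup>2"
  unfolding norm_vec_def L2_set_def by (simp add: sum_2)

lemma bargmann_fock_decays: "decays bargmann_fock_covariance"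
proof (rule decays_power6)
  fix x :: "real^2"
  \<comment> \<open>The cube of \<open>t \<le> exp t\<close> at
    \<open>t = (norm x)\<^sup>2 / 6\<close> compares \<open>norm x ^ 6 / 216\<close> with
    \<open>exp ((norm x)\<^sup>2 / 2)\<close>.\<close>
  let ?t = "(norm x)\<^sup>2 / 6"
  have "norm x ^ 6 = 216 * ?t ^ 3" by (simp add: power_divide flip: power_mult)
  also have "?t \<le> exp ?t" using exp_ge_add_one_self[of ?t] by linarith
  then have "216 * ?t ^ 3 \<le> 216 * exp ?t ^ 3" by (intro mult_left_mono power_mono) auto
  also have "exp ?t ^ 3 = exp ((norm x)\<^sup>2 / 2)" by (simp flip: exp_of_nat_mult)
  finally have "exp (- (norm x)\<^sup>2 / 2) * norm x ^ 6 \<le> exp (- (norm x)\<^sup>2 / 2) * (216 * exp ((norm x)\<^sup>2 / 2))" by (rule mult_left_mono) simp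
  also have "\<dots> = 216" by (simp flip: exp_add)
  finally show "bargmann_fock_covariance x * norm x ^ 6 \<le> 216" by (simp add: bargmann_fock_covariance_def)
qed simp

lemma rational_decays: assumes "n \<ge> 3" shows "decays (rational_covariance n)"
proof (rule decays_power6)
  fix x :: "real^2"
  let ?a = "(1 + (x $ 1)\<^sup>2) * (1 + (x $ 2)\<^sup>2)"
  have a: "1 + (norm x)\<^sup>2 \<le> ?a" unfolding norm2_sq by (simp add: algebra_simps)
  have a1: "1 \<le> ?a" "(norm x)\<^sup>2 \<le> ?a" using a zero_le_power2[of "norm x"] by linarith+
  have "norm x ^ 6 = ((norm x)\<^sup>2) ^ 3" by (simp flip: power_mult)
  also have "\<dots> \<le> ?a ^ 3" using a1 by (intro power_mono) auto
  \<comment> \<open>The third power of the denominator already dominates \<open>norm x ^ 6\<close>;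
    this is where \<open>n \<ge> 3\<close> enters.\<close>
  also have "\<dots> \<le> ?a ^ n" using a1 assms by (intro power_increasing) auto
  finally have "norm x ^ 6 / ?a ^ n \<le> 1" using a1 by simp
  then show "rational_covariance n x * norm x ^ 6 \<le> 1" by (simp add: rational_covariance_def power_one_over)
qed simp

theorem theorem2p11:
  fixes M :: "'w measure" and f :: "real^2 \<Rightarrow> 'w \<Rightarrow> real" and \<epsilon> :: real
  assumes "gaussian_field M f" and "centered M f" and "continuous_field M f"
    and "0 < \<epsilon>" and "\<epsilon> \<le> 1"
  shows
    "(\<forall>\<kappa>. nondegenerate M f \<and> normalized M f \<and> stationary M f \<and>
        covariance_function M f \<kappa> \<and> (\<forall>x. \<kappa> x \<ge> 0) \<and>
        law_invariant M f rotation_quarter \<and> law_invariant M f reflection_horizontal \<and>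
        fourier_positive \<kappa> \<and> C_k 3 \<kappa> \<and> derivs_decay \<kappa>
        \<longrightarrow> sharp_threshold_at_zero M f \<epsilon>) \<and>
     (covariance_function M f bargmann_fock_covariance \<longrightarrow> sharp_threshold_at_zero M f \<epsilon>) \<and>
     (\<forall>n\<ge>3. covariance_function M f (rational_covariance n) \<longrightarrow> sharp_threshold_at_zero M f \<epsilon>)"
proof -
  interpret gaussian_field M f by fact
  note sharp = sharp_threshold_field[OF assms(2,4)]
  show ?thesis
  proof (intro conjI allI impI)
    fix \<kappa>
    assume "nondegenerate M f \<and> normalized M f \<and> stationary M f \<and>
        covariance_function M f \<kappa> \<and> (\<forall>x. \<kappa> x \<ge> 0) \<and>
        law_invariant M f rotation_quarter \<and> law_invariant M f reflection_horizontal \<and>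
        fourier_positive \<kappa> \<and> C_k 3 \<kappa> \<and> derivs_decay \<kappa>"
    then have n: "normalized M f" and cov: "covariance_function M f \<kappa>" and nn: "\<And>x. \<kappa> x \<ge> 0"
      and rot: "law_invariant M f rotation_quarter" and ref: "law_invariant M f reflection_horizontal"
      and dec: "derivs_decay \<kappa>" by auto
    have E: "(LINT \<omega>|M. f x \<omega> * f y \<omega>) = \<kappa> (x - y)" for x y using cov by (simp add: covariance_function_def)
    have one: "\<kappa> 0 = 1" using n E[of 0 0] assms(2) by (simp add: normalized_def centered_def power2_eq_square)
    have ev: "\<kappa> (- x) = \<kappa> x" for x using E[of 0 x] E[of x 0] by (simp add: mult.commute)
    have r: "\<kappa> (rotation_quarter x) = \<kappa> x" for x
    proof -
      have "rotation_quarter 0 = 0" by (simp add: real2_eq_iff rotation_quarter_def)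
      then show ?thesis using law_invariant_covariance[OF rot cov, of x 0] by simp
    qed
    have h: "\<kappa> (reflection_horizontal x) = \<kappa> x" for x
    proof -
      have "reflection_horizontal 0 = 0" by (simp add: real2_eq_iff reflection_horizontal_def)
      then show ?thesis using law_invariant_covariance[OF ref cov, of x 0] by simp
    qed
    show "sharp_threshold_at_zero M f \<epsilon>"
    proof (rule sharp[where \<kappa>=\<kappa>, OF cov nn one derivs_decay_decays[OF dec]])
      fix x :: "real^2"
      \<comment> \<open>The reflection in the vertical axis is the negative of the horizontal one,
        and \<kappa> is even.\<close>
      have "- reflection_horizontal x = vector [- (x $ 1), x $ 2]" by (simp add: real2_eq_iff reflection_horizontal_def)
      then show "\<kappa> (vector [- (x $ 1), x $ 2]) = \<kappa> x" using ev[of "reflection_horizontal x"] h[of x] by simp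
      have "reflection_horizontal (rotation_quarter x) = vector [- (x $ 2), - (x $ 1)]"
        by (simp add: real2_eq_iff reflection_horizontal_def rotation_quarter_def)
      then show "\<kappa> (vector [- (x $ 2), - (x $ 1)]) = \<kappa> x" using h[of "rotation_quarter x"] r[of x] by simp
    qed
  next
    assume "covariance_function M f bargmann_fock_covariance"
    then show "sharp_threshold_at_zero M f \<epsilon>"
      by (rule sharp) (auto simp: bargmann_fock_decays bargmann_fock_covariance_def norm2_sq add.commute)
  next
    fix n :: nat assume "3 \<le> n" "covariance_function M f (rational_covariance n)"
    from this(2) show "sharp_threshold_at_zero M f \<epsilon>"
      by (rule sharp) (auto simp: rational_decays[OF \<open>3 \<le> n\<close>] rational_covariance_def mult.commute)
  qed
qed

end
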